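(* Let $A$ be a separable $C^*$-algebra and $B$ a stable $\sigma$-unital $C^*$-algebra. Then the map $\gamma:EN(A,B)\to EM(A,B)$, defined in the context by $\gamma([(\psi^+,\psi^-)])=[(\psi^+\circ s,\psi^-\circ s)]$, is an isomorphism.
   Context: Notation. $\mathbb R_+=[0,\infty)$; $MB$ is the multiplier algebra; $IB=C([0,1];B)$; $C_b(\mathbb R_+;B)$ is the algebra of bounded norm-continuous functions and $C_0(\mathbb R_+;B)$ its ideal of functions vanishing at infinity. For a pair of (not necessarily linear) continuous maps $\Phi^\pm:A\to C_b(\mathbb R_+;B)$ let $E$ be the $C^*$-algebra generated by all $\Phi^\pm(a)$, and $D\subset E$ the ideal of $E$ generated by $\Phi^+(a)-\Phi^-(a)$, $a\in A$. The pair is a compact asymptotic $KK$-cycle from $A$ to $B$ if $\Phi^\pm(\lambda a)=\lambda\Phi^\pm(a)$ for $\lambda\in\mathbb C$, $\Phi^\pm(a^* )-\Phi^\pm(a)^*\in C_0(\mathbb R_+;B)$, and $(\Phi^\pm(a+b)-\Phi^\pm(a)-\Phi^\pm(b))x\in C_0(\mathbb R_+;B)$, $(\Phi^\pm(ab)-\Phi^\pm(a)\Phi^\pm(b))x\in C_0(\mathbb R_+;B)$ for all $a,b\in A$, $x\in D$. Two are homotopic if there is a compact asymptotic $KK$-cycle from $A$ to $IB$ with these evaluations at $0$ and $1$. $EM(A,B)$ is the abelian group of homotopy classes, with addition $[(\Phi^+,\Phi^-)]+[(\Psi^+,\Psi^-)]=[(s_1\Phi^+s_1^*+s_2\Psi^+s_2^*,\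 s_1\Phi^-s_1^*+s_2\Psi^-s_2^* )]$, where $s_1,s_2\in MB$ are isometries with $s_1s_1^*+s_2s_2^*=1$ (regarded as constant functions). An asymptotic homomorphism from $C$ to $B$ is a continuous $\mathbb C$-homogeneous map $\psi:C\to C_b(\mathbb R_+;B)$ whose composition with $C_b(\mathbb R_+;B)\to C_b(\mathbb R_+;B)/C_0(\mathbb R_+;B)$ is a $*$-homomorphism. $\mathcal E_A$ is the set of surjective $*$-homomorphisms $p:C\to A$ with $C$ a separable $C^*$-algebra; $(C,p)\le(C',p')$ if there is a surjective $*$-homomorphism $\lambda:C'\to C$ with $p'=p\circ\lambda$. This is a directed set. For $(C,p)\in\mathcal E_A$ with $J=\operatorname{Ker}p$, $EN(C,J;B)$ is the semigroup of homotopy classes of pairs $(\psi^+,\psi^-)$ of asymptotic homomorphisms from $C$ to $B$ that agree on $J$, i.e. $\psi^+(j)-\psi^-(j)\in C_0(\mathbb R_+;B)$ for $j\in J$; a homotopy is such a pair from $C$ to $IB$ (agreeing on $J$), and addition is again defined using $s_1,s_2$. A surjection $\lambda:C'\to C$ over $A$ induces $EN(C,J;B)\to EN(C',J';B)$, $(\psi^+,\psi^-)\mapsto(\psi^+\circ\lambda,\psi^-\circ\lambda)$, and $EN(A,B)=\varinjlim_{C\in\mathcal E_A}EN(C,J;B)$ (so pairs are identified when they become homotopic after pulling back to some larger $C'\in\mathcal E_A$); it is a group. The map $\gamma$. For $(C,p)\in\mathcal E_A$ choose a continuous, $\mathbb C$-homogeneous, $*$-respecting map $s:A\to C$ with $p\circ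 s=\mathrm{id}_A$. For a pair $(\psi^+,\psi^-)$ representing an element of $EN(C,J;B)$, the pair $(\psi^+\circ s,\psi^-\circ s)$ is a compact asymptotic $KK$-cycle whose class depends only on the class of $(\psi^+,\psi^-)$ in $EN(A,B)$; this class is $\gamma([(\psi^+,\psi^-)])$. *)

theory Defs
  imports "HOL-Analysis.Analysis" "HOL-Algebra.Group"
begin

section \<open>C*-algebras with explicit carrier\<close>

text \<open>
  The statement involves algebras built from others (multiplier algebras, function algebras) and a
  direct limit over a family of algebras, so complex C*-algebras are records with an explicit
  carrier. They need not be unital.
\<close>

record 'a cstar = "'a partial_object" +
  czero :: 'a
  cadd :: "'a \<Rightarrow> 'a \<Rightarrow> 'a" (infixl \<open>\<boxplus>\<index>\<close> 65)
  cscale :: "complex \<Rightarrow> 'a \<Rightarrow> 'a" (infixr \<open>\<odot>\<index>\<close> 75)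
  cmult :: "'a \<Rightarrow> 'a \<Rightarrow> 'a" (infixl \<open>\<boxdot>\<index>\<close> 70)
  adj :: "'a \<Rightarrow> 'a"
  nrm :: "'a \<Rightarrow> real"

definition cdiff :: "('a, 'm) cstar_scheme \<Rightarrow> 'a \<Rightarrow> 'a \<Rightarrow> 'a" (infixl \<open>\<boxminus>\<index>\<close> 65)
  where "x \<boxminus>\<^bsub>A\<^esub> y = x \<boxplus>\<^bsub>A\<^esub> ((-1) \<odot>\<^bsub>A\<^esub> y)"

text \<open>
  The locale \<^locale>\<open>Metric_space\<close> wants nonnegativity and symmetry of the distance for all
  elements of the type, hence the value 0 outside the carrier.
\<close>

definition cdist :: "('a, 'm) cstar_scheme \<Rightarrow> 'a \<Rightarrow> 'a \<Rightarrow> real"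
  where "cdist A x y = (if x \<in> carrier A \<and> y \<in> carrier A then nrm A (x \<boxminus>\<^bsub>A\<^esub> y) else 0)"

definition ctop :: "('a, 'm) cstar_scheme \<Rightarrow> 'a topology"
  where "ctop A = Metric_space.mtopology (carrier A) (cdist A)"

locale cstar_algebra =
  fixes A :: "('a, 'm) cstar_scheme" (structure)
  assumes zero_closed: "czero A \<in> carrier A"
    and add_closed: "\<lbrakk>x \<in> carrier A; y \<in> carrier A\<rbrakk> \<Longrightarrow> x \<boxplus> y \<in> carrier A"
    and scale_closed: "x \<in> carrier A \<Longrightarrow> c \<odot> x \<in> carrier A"
    and mult_closed: "\<lbrakk>x \<in> carrier A; y \<in> carrier A\<rbrakk> \<Longrightarrow> x \<boxdot> y \<in> carrier A"
    and adj_closed: "x \<in> carrier A \<Longrightarrow> adj A x \<in> carrier A"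
    and add_assoc: "\<lbrakk>x \<in> carrier A; y \<in> carrier A; z \<in> carrier A\<rbrakk>
          \<Longrightarrow> (x \<boxplus> y) \<boxplus> z = x \<boxplus> (y \<boxplus> z)"
    and add_commute: "\<lbrakk>x \<in> carrier A; y \<in> carrier A\<rbrakk> \<Longrightarrow> x \<boxplus> y = y \<boxplus> x"
    and add_zero: "x \<in> carrier A \<Longrightarrow> x \<boxplus> czero A = x"
    and diff_self: "x \<in> carrier A \<Longrightarrow> x \<boxminus> x = czero A"
    and scale_one: "x \<in> carrier A \<Longrightarrow> 1 \<odot> x = x"
    and scale_scale: "x \<in> carrier A \<Longrightarrow> c \<odot> (d \<odot> x) = (c * d) \<odot> x"
    and scale_add_left: "x \<in> carrier A \<Longrightarrow> (c + d) \<odot> x = c \<odot> x \<boxplus> d \<odot> x"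
    and scale_add_right: "\<lbrakk>x \<in> carrier A; y \<in> carrier A\<rbrakk>
          \<Longrightarrow> c \<odot> (x \<boxplus> y) = c \<odot> x \<boxplus> c \<odot> y"
    and mult_assoc: "\<lbrakk>x \<in> carrier A; y \<in> carrier A; z \<in> carrier A\<rbrakk>
          \<Longrightarrow> (x \<boxdot> y) \<boxdot> z = x \<boxdot> (y \<boxdot> z)"
    and mult_add_left: "\<lbrakk>x \<in> carrier A; y \<in> carrier A; z \<in> carrier A\<rbrakk>
          \<Longrightarrow> (x \<boxplus> y) \<boxdot> z = x \<boxdot> z \<boxplus> y \<boxdot> z"
    and mult_add_right: "\<lbrakk>x \<in> carrier A; y \<in> carrier A; z \<in> carrier A\<rbrakk>
          \<Longrightarrow> x \<boxdot> (y \<boxplus> z) = x \<boxdot> y \<boxplus> x \<boxdot> z"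
    and mult_scale_left: "\<lbrakk>x \<in> carrier A; y \<in> carrier A\<rbrakk>
          \<Longrightarrow> (c \<odot> x) \<boxdot> y = c \<odot> (x \<boxdot> y)"
    and mult_scale_right: "\<lbrakk>x \<in> carrier A; y \<in> carrier A\<rbrakk>
          \<Longrightarrow> x \<boxdot> (c \<odot> y) = c \<odot> (x \<boxdot> y)"
    and adj_adj: "x \<in> carrier A \<Longrightarrow> adj A (adj A x) = x"
    and adj_add: "\<lbrakk>x \<in> carrier A; y \<in> carrier A\<rbrakk>
          \<Longrightarrow> adj A (x \<boxplus> y) = adj A x \<boxplus> adj A y"
    and adj_scale: "x \<in> carrier A \<Longrightarrow> adj A (c \<odot> x) = cnj c \<odot> adj A x"
    and adj_mult: "\<lbrakk>x \<in> carrier A; y \<in> carrier A\<rbrakk>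
          \<Longrightarrow> adj A (x \<boxdot> y) = adj A y \<boxdot> adj A x"
    and nrm_nonneg: "x \<in> carrier A \<Longrightarrow> 0 \<le> nrm A x"
    and nrm_eq_0: "x \<in> carrier A \<Longrightarrow> nrm A x = 0 \<longleftrightarrow> x = czero A"
    and nrm_scale: "x \<in> carrier A \<Longrightarrow> nrm A (c \<odot> x) = cmod c * nrm A x"
    and nrm_triangle: "\<lbrakk>x \<in> carrier A; y \<in> carrier A\<rbrakk>
          \<Longrightarrow> nrm A (x \<boxplus> y) \<le> nrm A x + nrm A y"
    and nrm_mult: "\<lbrakk>x \<in> carrier A; y \<in> carrier A\<rbrakk>
          \<Longrightarrow> nrm A (x \<boxdot> y) \<le> nrm A x * nrm A y"
    and cstar_identity: "x \<in> carrier A \<Longrightarrow> nrm A (adj A x \<boxdot> x) = (nrm A x)\<^sup>2"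
    and complete: "Metric_space.mcomplete (carrier A) (cdist A)"

abbreviation separable :: "('a, 'm) cstar_scheme \<Rightarrow> bool"
  where "separable A \<equiv> separable_space (ctop A)"

definition star_hom :: "('a, 'm) cstar_scheme \<Rightarrow> ('b, 'n) cstar_scheme \<Rightarrow> ('a \<Rightarrow> 'b) \<Rightarrow> bool"
  where "star_hom A B f \<longleftrightarrow> f \<in> carrier A \<rightarrow> carrier B \<and>
    (\<forall>x\<in>carrier A. \<forall>y\<in>carrier A. f (x \<boxplus>\<^bsub>A\<^esub> y) = f x \<boxplus>\<^bsub>B\<^esub> f y) \<and>
    (\<forall>c. \<forall>x\<in>carrier A. f (c \<odot>\<^bsub>A\<^esub> x) = c \<odot>\<^bsub>B\<^esub> f x) \<and>
    (\<forall>x\<in>carrier A. \<forall>y\<in>carrier A. f (x \<boxdot>\<^bsub>A\<^esub> y) = f x \<boxdot>\<^bsub>B\<^esub> f y) \<and>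
    (\<forall>x\<in>carrier A. f (adj A x) = adj B (f x))"

definition star_epi :: "('a, 'm) cstar_scheme \<Rightarrow> ('b, 'n) cstar_scheme \<Rightarrow> ('a \<Rightarrow> 'b) \<Rightarrow> bool"
  where "star_epi A B f \<longleftrightarrow> star_hom A B f \<and> f ` carrier A = carrier B"

definition star_ker :: "('a, 'm) cstar_scheme \<Rightarrow> ('b, 'n) cstar_scheme \<Rightarrow> ('a \<Rightarrow> 'b) \<Rightarrow> 'a set"
  where "star_ker A B f = {x \<in> carrier A. f x = czero B}"

definition cstar_subalgebra :: "('a, 'm) cstar_scheme \<Rightarrow> 'a set \<Rightarrow> bool"
  where "cstar_subalgebra A E \<longleftrightarrow> closedin (ctop A) E \<and> czero A \<in> E \<and>
    (\<forall>x\<in>E. \<forall>y\<in>E. x \<boxplus>\<^bsub>A\<^esub> y \<in> E) \<and> (\<forall>c. \<forall>x\<in>E. c \<odot>\<^bsub>A\<^esub> x \<in> E) \<and>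
    (\<forall>x\<in>E. \<forall>y\<in>E. x \<boxdot>\<^bsub>A\<^esub> y \<in> E) \<and> (\<forall>x\<in>E. adj A x \<in> E)"

definition cstar_generated :: "('a, 'm) cstar_scheme \<Rightarrow> 'a set \<Rightarrow> 'a set"
  where "cstar_generated A S = \<Inter>{E. cstar_subalgebra A E \<and> S \<subseteq> E}"

text \<open>Ideals are norm closed and two-sided; here they are ideals of a C*-subalgebra \<open>E\<close> of \<open>A\<close>.\<close>

definition closed_ideal :: "('a, 'm) cstar_scheme \<Rightarrow> 'a set \<Rightarrow> 'a set \<Rightarrow> bool"
  where "closed_ideal A E I \<longleftrightarrow> closedin (ctop A) I \<and> I \<subseteq> E \<and> czero A \<in> I \<and>
    (\<forall>x\<in>I. \<forall>y\<in>I. x \<boxplus>\<^bsub>A\<^esub> y \<in> I) \<and> (\<forall>c. \<forall>x\<in>I. c \<odot>\<^bsub>A\<^esub> x \<in> I) \<and>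
    (\<forall>e\<in>E. \<forall>x\<in>I. e \<boxdot>\<^bsub>A\<^esub> x \<in> I \<and> x \<boxdot>\<^bsub>A\<^esub> e \<in> I)"

definition ideal_generated :: "('a, 'm) cstar_scheme \<Rightarrow> 'a set \<Rightarrow> 'a set \<Rightarrow> 'a set"
  where "ideal_generated A E S = \<Inter>{I. closed_ideal A E I \<and> S \<subseteq> I}"


section \<open>\<open>\<sigma>\<close>-unital and stable C*-algebras\<close>

definition positive :: "('a, 'm) cstar_scheme \<Rightarrow> 'a \<Rightarrow> bool"
  where "positive A x \<longleftrightarrow> (\<exists>y\<in>carrier A. x = adj A y \<boxdot>\<^bsub>A\<^esub> y)"

definition sigma_unital :: "('a, 'm) cstar_scheme \<Rightarrow> bool"
  where "sigma_unital A \<longleftrightarrow> (\<exists>u :: nat \<Rightarrow> 'a.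
    (\<forall>n. positive A (u n) \<and> nrm A (u n) \<le> 1 \<and> positive A (u (Suc n) \<boxminus>\<^bsub>A\<^esub> u n)) \<and>
    (\<forall>x\<in>carrier A. (\<lambda>n. nrm A (u n \<boxdot>\<^bsub>A\<^esub> x \<boxminus>\<^bsub>A\<^esub> x)) \<longlonglongrightarrow> 0 \<and>
                   (\<lambda>n. nrm A (x \<boxdot>\<^bsub>A\<^esub> u n \<boxminus>\<^bsub>A\<^esub> x)) \<longlonglongrightarrow> 0))"

definition l2 :: "(nat \<Rightarrow> complex) set"
  where "l2 = {x. summable (\<lambda>n. (cmod (x n))\<^sup>2)}"

definition l2_inner :: "(nat \<Rightarrow> complex) \<Rightarrow> (nat \<Rightarrow> complex) \<Rightarrow> complex"
  where "l2_inner x y = (\<Sum>n. cnj (x n) * y n)"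

definition l2_norm :: "(nat \<Rightarrow> complex) \<Rightarrow> real"
  where "l2_norm x = sqrt (\<Sum>n. (cmod (x n))\<^sup>2)"

definition compact_operator :: "((nat \<Rightarrow> complex) \<Rightarrow> (nat \<Rightarrow> complex)) \<Rightarrow> bool"
  where "compact_operator T \<longleftrightarrow> T \<in> l2 \<rightarrow> l2 \<and>
    (\<forall>x\<in>l2. \<forall>y\<in>l2. T (\<lambda>n. x n + y n) = (\<lambda>n. T x n + T y n)) \<and>
    (\<forall>c. \<forall>x\<in>l2. T (\<lambda>n. c * x n) = (\<lambda>n. c * T x n)) \<and>
    (\<forall>x :: nat \<Rightarrow> nat \<Rightarrow> complex. (\<forall>k. x k \<in> l2 \<and> l2_norm (x k) \<le> 1) \<longrightarrow>
      (\<exists>r. \<exists>y\<in>l2. strict_mono r \<and> (\<lambda>k. l2_norm (\<lambda>n. T (x (r k)) n - y n)) \<longlonglongrightarrow> 0))"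

text \<open>The algebra of compact operators on \<open>\<ell>\<^sup>2(\<nat>)\<close>.\<close>

definition compacts :: "((nat \<Rightarrow> complex) \<Rightarrow> (nat \<Rightarrow> complex)) cstar"
  where "compacts = \<lparr>
    carrier = {T \<in> extensional l2. compact_operator T},
    czero = (\<lambda>x\<in>l2. \<lambda>n. 0),
    cadd = (\<lambda>S T. \<lambda>x\<in>l2. \<lambda>n. S x n + T x n),
    cscale = (\<lambda>c T. \<lambda>x\<in>l2. \<lambda>n. c * T x n),
    cmult = (\<lambda>S T. \<lambda>x\<in>l2. S (T x)),
    adj = (\<lambda>T. \<lambda>x\<in>l2. THE z. z \<in> l2 \<and> (\<forall>y\<in>l2. l2_inner z y = l2_inner x (T y))),
    nrm = (\<lambda>T. SUP x\<in>{x \<in> l2. l2_norm x \<le> 1}. l2_norm (T x))\<rparr>"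

primrec csum :: "('a, 'm) cstar_scheme \<Rightarrow> (nat \<Rightarrow> 'a) \<Rightarrow> nat \<Rightarrow> 'a"
  where "csum A f 0 = czero A"
  | "csum A f (Suc n) = csum A f n \<boxplus>\<^bsub>A\<^esub> f n"

text \<open>
  \<open>is_cstar_tensor X Y T \<tau>\<close>: the map \<open>x \<otimes> y \<mapsto> \<tau> x y\<close> is an injective *-homomorphism of the
  algebraic tensor product \<open>X \<odot> Y\<close> onto a *-subalgebra that is dense in \<open>T\<close>, i.e. \<open>T\<close> is a
  C*-completion of \<open>X \<odot> Y\<close>. The third-last conjunct is injectivity, expressed with linearly
  independent families in \<open>Y\<close>; the span of the range of \<open>\<tau>\<close> is already a *-algebra, so that the
  last conjunct is its density. For \<open>Y\<close> the compact operators, which are nuclear, \<open>X \<odot> Y\<close> has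
  only one C*-norm and such a \<open>T\<close> is the C*-tensor product.
\<close>

definition is_cstar_tensor ::
  "('x, 'm) cstar_scheme \<Rightarrow> ('y, 'n) cstar_scheme \<Rightarrow> ('t, 'k) cstar_scheme \<Rightarrow> ('x \<Rightarrow> 'y \<Rightarrow> 't) \<Rightarrow> bool"
  where "is_cstar_tensor X Y T \<tau> \<longleftrightarrow>
    (\<forall>x\<in>carrier X. \<forall>y\<in>carrier Y. \<tau> x y \<in> carrier T) \<and>
    (\<forall>x\<in>carrier X. \<forall>x'\<in>carrier X. \<forall>y\<in>carrier Y. \<tau> (x \<boxplus>\<^bsub>X\<^esub> x') y = \<tau> x y \<boxplus>\<^bsub>T\<^esub> \<tau> x' y) \<and>
    (\<forall>x\<in>carrier X. \<forall>y\<in>carrier Y. \<forall>y'\<in>carrier Y. \<tau> x (y \<boxplus>\<^bsub>Y\<^esub> y') = \<tau> x y \<boxplus>\<^bsub>T\<^esub> \<tau> x y') \<and>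
    (\<forall>c. \<forall>x\<in>carrier X. \<forall>y\<in>carrier Y.
      \<tau> (c \<odot>\<^bsub>X\<^esub> x) y = c \<odot>\<^bsub>T\<^esub> \<tau> x y \<and> \<tau> x (c \<odot>\<^bsub>Y\<^esub> y) = c \<odot>\<^bsub>T\<^esub> \<tau> x y) \<and>
    (\<forall>n x y. (\<forall>i<n. x i \<in> carrier X \<and> y i \<in> carrier Y) \<and>
       (\<forall>c. csum Y (\<lambda>i. c i \<odot>\<^bsub>Y\<^esub> y i) n = czero Y \<longrightarrow> (\<forall>i<n. c i = 0)) \<and>
       csum T (\<lambda>i. \<tau> (x i) (y i)) n = czero T \<longrightarrow> (\<forall>i<n. x i = czero X)) \<and>
    (\<forall>x\<in>carrier X. \<forall>x'\<in>carrier X. \<forall>y\<in>carrier Y. \<forall>y'\<in>carrier Y.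
      \<tau> x y \<boxdot>\<^bsub>T\<^esub> \<tau> x' y' = \<tau> (x \<boxdot>\<^bsub>X\<^esub> x') (y \<boxdot>\<^bsub>Y\<^esub> y') \<and> adj T (\<tau> x y) = \<tau> (adj X x) (adj Y y)) \<and>
    cstar_generated T {\<tau> x y |x y. x \<in> carrier X \<and> y \<in> carrier Y} = carrier T"

text \<open>\<open>B\<close> is isomorphic to its tensor product with the compact operators.\<close>

definition stable_cstar :: "('b, 'm) cstar_scheme \<Rightarrow> bool"
  where "stable_cstar B \<longleftrightarrow> (\<exists>\<tau>. is_cstar_tensor B compacts B \<tau>)"


section \<open>Multiplier algebras\<close>

text \<open>
  Multipliers are double centralizers \<open>(L, R)\<close>; \<open>L\<close> is left and \<open>R\<close> is right multiplication
  by the multiplier.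
\<close>

definition bounded_linear_op :: "('b, 'm) cstar_scheme \<Rightarrow> ('b \<Rightarrow> 'b) \<Rightarrow> bool"
  where "bounded_linear_op B L \<longleftrightarrow> L \<in> carrier B \<rightarrow> carrier B \<and>
    (\<forall>x\<in>carrier B. \<forall>y\<in>carrier B. L (x \<boxplus>\<^bsub>B\<^esub> y) = L x \<boxplus>\<^bsub>B\<^esub> L y) \<and>
    (\<forall>c. \<forall>x\<in>carrier B. L (c \<odot>\<^bsub>B\<^esub> x) = c \<odot>\<^bsub>B\<^esub> L x) \<and>
    (\<exists>K. \<forall>x\<in>carrier B. nrm B (L x) \<le> K * nrm B x)"

definition double_centralizer :: "('b, 'm) cstar_scheme \<Rightarrow> ('b \<Rightarrow> 'b) \<Rightarrow> ('b \<Rightarrow> 'b) \<Rightarrow> bool"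
  where "double_centralizer B L R \<longleftrightarrow> bounded_linear_op B L \<and> bounded_linear_op B R \<and>
    (\<forall>x\<in>carrier B. \<forall>y\<in>carrier B. L (x \<boxdot>\<^bsub>B\<^esub> y) = L x \<boxdot>\<^bsub>B\<^esub> y \<and>
      R (x \<boxdot>\<^bsub>B\<^esub> y) = x \<boxdot>\<^bsub>B\<^esub> R y \<and> R x \<boxdot>\<^bsub>B\<^esub> y = x \<boxdot>\<^bsub>B\<^esub> L y)"

definition multiplier_algebra :: "('b, 'm) cstar_scheme \<Rightarrow> (('b \<Rightarrow> 'b) \<times> ('b \<Rightarrow> 'b)) cstar"
  where "multiplier_algebra B = \<lparr>
    carrier = {(L, R). L \<in> extensional (carrier B) \<and> R \<in> extensional (carrier B) \<and>
      double_centralizer B L R},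
    czero = (\<lambda>x\<in>carrier B. czero B, \<lambda>x\<in>carrier B. czero B),
    cadd = (\<lambda>(L, R) (L', R'). (\<lambda>x\<in>carrier B. L x \<boxplus>\<^bsub>B\<^esub> L' x, \<lambda>x\<in>carrier B. R x \<boxplus>\<^bsub>B\<^esub> R' x)),
    cscale = (\<lambda>c (L, R). (\<lambda>x\<in>carrier B. c \<odot>\<^bsub>B\<^esub> L x, \<lambda>x\<in>carrier B. c \<odot>\<^bsub>B\<^esub> R x)),
    cmult = (\<lambda>(L, R) (L', R'). (\<lambda>x\<in>carrier B. L (L' x), \<lambda>x\<in>carrier B. R' (R x))),
    adj = (\<lambda>(L, R). (\<lambda>x\<in>carrier B. adj B (R (adj B x)), \<lambda>x\<in>carrier B. adj B (L (adj B x)))),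
    nrm = (\<lambda>(L, R). SUP x\<in>{x \<in> carrier B. nrm B x \<le> 1}. nrm B (L x))\<rparr>"

definition multiplier_one :: "('b, 'm) cstar_scheme \<Rightarrow> ('b \<Rightarrow> 'b) \<times> ('b \<Rightarrow> 'b)"
  where "multiplier_one B = (\<lambda>x\<in>carrier B. x, \<lambda>x\<in>carrier B. x)"

definition multiplier_isometry :: "('b, 'm) cstar_scheme \<Rightarrow> ('b \<Rightarrow> 'b) \<times> ('b \<Rightarrow> 'b) \<Rightarrow> bool"
  where "multiplier_isometry B s \<longleftrightarrow> s \<in> carrier (multiplier_algebra B) \<and>
    adj (multiplier_algebra B) s \<boxdot>\<^bsub>multiplier_algebra B\<^esub> s = multiplier_one B"

text \<open>The element \<open>s x s\<^sup>*\<close> of \<open>B\<close>, for a multiplier \<open>s\<close> and \<open>x\<close> in \<open>B\<close>.\<close>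

definition conjugate ::
  "('b, 'm) cstar_scheme \<Rightarrow> ('b \<Rightarrow> 'b) \<times> ('b \<Rightarrow> 'b) \<Rightarrow> 'b \<Rightarrow> 'b"
  where "conjugate B s x = fst s (snd (adj (multiplier_algebra B) s) x)"


section \<open>Algebras of functions\<close>

text \<open>Bounded norm-continuous functions \<open>X \<rightarrow> B\<close>.\<close>

definition Cb :: "real set \<Rightarrow> ('b, 'm) cstar_scheme \<Rightarrow> (real \<Rightarrow> 'b) cstar"
  where "Cb X B = \<lparr>
    carrier = {f \<in> extensional X. continuous_map (top_of_set X) (ctop B) f \<and>
      (\<exists>K. \<forall>t\<in>X. nrm B (f t) \<le> K)},
    czero = (\<lambda>t\<in>X. czero B),
    cadd = (\<lambda>f g. \<lambda>t\<in>X. f t \<boxplus>\<^bsub>B\<^esub> g t),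
    cscale = (\<lambda>c f. \<lambda>t\<in>X. c \<odot>\<^bsub>B\<^esub> f t),
    cmult = (\<lambda>f g. \<lambda>t\<in>X. f t \<boxdot>\<^bsub>B\<^esub> g t),
    adj = (\<lambda>f. \<lambda>t\<in>X. adj B (f t)),
    nrm = (\<lambda>f. SUP t\<in>X. nrm B (f t))\<rparr>"

abbreviation CbR :: "('b, 'm) cstar_scheme \<Rightarrow> (real \<Rightarrow> 'b) cstar"
  where "CbR B \<equiv> Cb {0..} B"

definition C0R :: "('b, 'm) cstar_scheme \<Rightarrow> (real \<Rightarrow> 'b) set"
  where "C0R B = {f \<in> carrier (CbR B). ((\<lambda>t. nrm B (f t)) \<longlongrightarrow> 0) at_top}"

text \<open>The algebra \<open>IB = C([0,1]; B)\<close>; boundedness is automatic on the compact interval.\<close>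

abbreviation IB :: "('b, 'm) cstar_scheme \<Rightarrow> (real \<Rightarrow> 'b) cstar"
  where "IB B \<equiv> Cb {0..1} B"

text \<open>The map \<open>C\<^sub>b(\<real>\<^sub>+; IB) \<rightarrow> C\<^sub>b(\<real>\<^sub>+; B)\<close> given by evaluation at \<open>r\<close> in \<open>[0,1]\<close>.\<close>

definition eval_at :: "real \<Rightarrow> (real \<Rightarrow> real \<Rightarrow> 'b) \<Rightarrow> real \<Rightarrow> 'b"
  where "eval_at r f = (\<lambda>t\<in>{0..}. f t r)"


section \<open>Pairs of maps into \<open>C\<^sub>b(\<real>\<^sub>+; B)\<close>\<close>

text \<open>Only the values on the carrier of the domain are relevant.\<close>

type_synonym ('a, 'b) fun_pair = "('a \<Rightarrow> real \<Rightarrow> 'b) \<times> ('a \<Rightarrow> real \<Rightarrow> 'b)"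

definition pair_comp :: "('c, 'b) fun_pair \<Rightarrow> ('a \<Rightarrow> 'c) \<Rightarrow> ('a, 'b) fun_pair"
  where "pair_comp \<Phi> f = (fst \<Phi> \<circ> f, snd \<Phi> \<circ> f)"

definition evaluates_to ::
  "('a, 'm) cstar_scheme \<Rightarrow> real \<Rightarrow> ('a, real \<Rightarrow> 'b) fun_pair \<Rightarrow> ('a, 'b) fun_pair \<Rightarrow> bool"
  where "evaluates_to A r \<Theta> \<Phi> \<longleftrightarrow> (\<forall>a\<in>carrier A.
    eval_at r (fst \<Theta> a) = fst \<Phi> a \<and> eval_at r (snd \<Theta> a) = snd \<Phi> a)"

definition orth_sum ::
  "('b, 'm) cstar_scheme \<Rightarrow> ('b \<Rightarrow> 'b) \<times> ('b \<Rightarrow> 'b) \<Rightarrow> ('b \<Rightarrow> 'b) \<times> ('b \<Rightarrow> 'b) \<Rightarrow>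
    ('a \<Rightarrow> real \<Rightarrow> 'b) \<Rightarrow> ('a \<Rightarrow> real \<Rightarrow> 'b) \<Rightarrow> 'a \<Rightarrow> real \<Rightarrow> 'b"
  where "orth_sum B s1 s2 \<phi> \<psi> a =
    (\<lambda>t\<in>{0..}. conjugate B s1 (\<phi> a t) \<boxplus>\<^bsub>B\<^esub> conjugate B s2 (\<psi> a t))"

definition pair_sum ::
  "('b, 'm) cstar_scheme \<Rightarrow> ('b \<Rightarrow> 'b) \<times> ('b \<Rightarrow> 'b) \<Rightarrow> ('b \<Rightarrow> 'b) \<times> ('b \<Rightarrow> 'b) \<Rightarrow>
    ('a, 'b) fun_pair \<Rightarrow> ('a, 'b) fun_pair \<Rightarrow> ('a, 'b) fun_pair"
  where "pair_sum B s1 s2 \<Phi> \<Psi> =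
    (orth_sum B s1 s2 (fst \<Phi>) (fst \<Psi>), orth_sum B s1 s2 (snd \<Phi>) (snd \<Psi>))"

definition pair_zero :: "('b, 'm) cstar_scheme \<Rightarrow> ('a, 'b) fun_pair"
  where "pair_zero B = (\<lambda>a. czero (CbR B), \<lambda>a. czero (CbR B))"

definition homogeneous ::
  "('a, 'm) cstar_scheme \<Rightarrow> ('b, 'n) cstar_scheme \<Rightarrow> ('a \<Rightarrow> 'b) \<Rightarrow> bool"
  where "homogeneous A B f \<longleftrightarrow> (\<forall>c. \<forall>a\<in>carrier A. f (c \<odot>\<^bsub>A\<^esub> a) = c \<odot>\<^bsub>B\<^esub> f a)"


section \<open>Compact asymptotic KK-cycles and \<open>EM(A,B)\<close>\<close>

definition kk_algebra ::
  "('a, 'm) cstar_scheme \<Rightarrow> ('b, 'n) cstar_scheme \<Rightarrow> ('a, 'b) fun_pair \<Rightarrow> (real \<Rightarrow> 'b) set"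
  where "kk_algebra A B \<Phi> =
    cstar_generated (CbR B) (fst \<Phi> ` carrier A \<union> snd \<Phi> ` carrier A)"

definition kk_ideal ::
  "('a, 'm) cstar_scheme \<Rightarrow> ('b, 'n) cstar_scheme \<Rightarrow> ('a, 'b) fun_pair \<Rightarrow> (real \<Rightarrow> 'b) set"
  where "kk_ideal A B \<Phi> = ideal_generated (CbR B) (kk_algebra A B \<Phi>)
    {fst \<Phi> a \<boxminus>\<^bsub>CbR B\<^esub> snd \<Phi> a |a. a \<in> carrier A}"

definition kk_cycle ::
  "('a, 'm) cstar_scheme \<Rightarrow> ('b, 'n) cstar_scheme \<Rightarrow> ('a, 'b) fun_pair \<Rightarrow> bool"
  where "kk_cycle A B \<Phi> \<longleftrightarrow> (\<forall>\<phi>\<in>{fst \<Phi>, snd \<Phi>}.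
    continuous_map (ctop A) (ctop (CbR B)) \<phi> \<and> homogeneous A (CbR B) \<phi> \<and>
    (\<forall>a\<in>carrier A. \<phi> (adj A a) \<boxminus>\<^bsub>CbR B\<^esub> adj (CbR B) (\<phi> a) \<in> C0R B) \<and>
    (\<forall>a\<in>carrier A. \<forall>b\<in>carrier A. \<forall>x\<in>kk_ideal A B \<Phi>.
      (\<phi> (a \<boxplus>\<^bsub>A\<^esub> b) \<boxminus>\<^bsub>CbR B\<^esub> \<phi> a \<boxminus>\<^bsub>CbR B\<^esub> \<phi> b) \<boxdot>\<^bsub>CbR B\<^esub> x \<in> C0R B \<and>
      (\<phi> (a \<boxdot>\<^bsub>A\<^esub> b) \<boxminus>\<^bsub>CbR B\<^esub> \<phi> a \<boxdot>\<^bsub>CbR B\<^esub> \<phi> b) \<boxdot>\<^bsub>CbR B\<^esub> x \<in> C0R B))"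

definition kk_homotopy ::
  "('a, 'm) cstar_scheme \<Rightarrow> ('b, 'n) cstar_scheme \<Rightarrow> (('a, 'b) fun_pair \<times> ('a, 'b) fun_pair) set"
  where "kk_homotopy A B = {(\<Phi>, \<Psi>). kk_cycle A B \<Phi> \<and> kk_cycle A B \<Psi> \<and>
    (\<exists>\<Theta>. kk_cycle A (IB B) \<Theta> \<and> evaluates_to A 0 \<Theta> \<Phi> \<and> evaluates_to A 1 \<Theta> \<Psi>)}"

text \<open>
  Here and below, operations on classes are defined on representatives and collected by a union,
  as in \<^theory>\<open>HOL.Equiv_Relations\<close>.
\<close>

definition EM ::
  "('a, 'm) cstar_scheme \<Rightarrow> ('b, 'n) cstar_scheme \<Rightarrow>
    ('b \<Rightarrow> 'b) \<times> ('b \<Rightarrow> 'b) \<Rightarrow> ('b \<Rightarrow> 'b) \<times> ('b \<Rightarrow> 'b) \<Rightarrow> ('a, 'b) fun_pair set monoid"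
  where "EM A B s1 s2 = \<lparr>
    carrier = {\<Phi>. kk_cycle A B \<Phi>} // kk_homotopy A B,
    mult = (\<lambda>X Y. \<Union>\<Phi>\<in>X. \<Union>\<Psi>\<in>Y. kk_homotopy A B `` {pair_sum B s1 s2 \<Phi> \<Psi>}),
    one = kk_homotopy A B `` {pair_zero B}\<rparr>"


section \<open>Asymptotic homomorphisms and \<open>EN(A,B)\<close>\<close>

text \<open>
  The last three conditions say that the composition with the quotient map from
  \<open>C\<^sub>b(\<real>\<^sub>+; B)\<close> to \<open>C\<^sub>b(\<real>\<^sub>+; B) / C\<^sub>0(\<real>\<^sub>+; B)\<close> is a *-homomorphism (it is homogeneous anyway).
\<close>

definition asymptotic_hom ::
  "('c, 'm) cstar_scheme \<Rightarrow> ('b, 'n) cstar_scheme \<Rightarrow> ('c \<Rightarrow> real \<Rightarrow> 'b) \<Rightarrow> bool"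
  where "asymptotic_hom C B \<psi> \<longleftrightarrow>
    continuous_map (ctop C) (ctop (CbR B)) \<psi> \<and> homogeneous C (CbR B) \<psi> \<and>
    (\<forall>a\<in>carrier C. \<forall>b\<in>carrier C. \<psi> (a \<boxplus>\<^bsub>C\<^esub> b) \<boxminus>\<^bsub>CbR B\<^esub> (\<psi> a \<boxplus>\<^bsub>CbR B\<^esub> \<psi> b) \<in> C0R B) \<and>
    (\<forall>a\<in>carrier C. \<forall>b\<in>carrier C. \<psi> (a \<boxdot>\<^bsub>C\<^esub> b) \<boxminus>\<^bsub>CbR B\<^esub> \<psi> a \<boxdot>\<^bsub>CbR B\<^esub> \<psi> b \<in> C0R B) \<and>
    (\<forall>a\<in>carrier C. \<psi> (adj C a) \<boxminus>\<^bsub>CbR B\<^esub> adj (CbR B) (\<psi> a) \<in> C0R B)"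

definition agreeing_pair ::
  "('c, 'm) cstar_scheme \<Rightarrow> 'c set \<Rightarrow> ('b, 'n) cstar_scheme \<Rightarrow> ('c, 'b) fun_pair \<Rightarrow> bool"
  where "agreeing_pair C J B \<psi> \<longleftrightarrow> asymptotic_hom C B (fst \<psi>) \<and> asymptotic_hom C B (snd \<psi>) \<and>
    (\<forall>j\<in>J. fst \<psi> j \<boxminus>\<^bsub>CbR B\<^esub> snd \<psi> j \<in> C0R B)"

definition en_homotopy ::
  "('c, 'm) cstar_scheme \<Rightarrow> 'c set \<Rightarrow> ('b, 'n) cstar_scheme \<Rightarrow>
    (('c, 'b) fun_pair \<times> ('c, 'b) fun_pair) set"
  where "en_homotopy C J B = {(\<phi>, \<psi>). agreeing_pair C J B \<phi> \<and> agreeing_pair C J B \<psi> \<and>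
    (\<exists>\<theta>. agreeing_pair C J (IB B) \<theta> \<and> evaluates_to C 0 \<theta> \<phi> \<and> evaluates_to C 1 \<theta> \<psi>)}"

text \<open>\<open>EN(C, J; B)\<close>.\<close>

definition EN_rel ::
  "('c, 'm) cstar_scheme \<Rightarrow> 'c set \<Rightarrow> ('b, 'n) cstar_scheme \<Rightarrow>
    ('b \<Rightarrow> 'b) \<times> ('b \<Rightarrow> 'b) \<Rightarrow> ('b \<Rightarrow> 'b) \<times> ('b \<Rightarrow> 'b) \<Rightarrow> ('c, 'b) fun_pair set monoid"
  where "EN_rel C J B s1 s2 = \<lparr>
    carrier = {\<psi>. agreeing_pair C J B \<psi>} // en_homotopy C J B,
    mult = (\<lambda>\<xi> \<eta>. \<Union>\<phi>\<in>\<xi>. \<Union>\<psi>\<in>\<eta>. en_homotopy C J B `` {pair_sum B s1 s2 \<phi> \<psi>}),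
    one = en_homotopy C J B `` {pair_zero B}\<rparr>"

text \<open>
  The family of all extensions of \<open>A\<close> by surjections from separable C*-algebras has to be a set of
  some type. A separable C*-algebra has at most the cardinality of the continuum, so up to
  isomorphism it is no restriction to take algebras whose elements are real numbers.
\<close>

type_synonym 'a extn = "real cstar \<times> (real \<Rightarrow> 'a)"

definition extensions :: "('a, 'm) cstar_scheme \<Rightarrow> 'a extn set"
  where "extensions A = {(C, p). cstar_algebra C \<and> separable C \<and> star_epi C A p}"

text \<open>
  \<open>over_map (C, p) (C', p') \<lambda>\<close>: the surjection \<open>\<lambda> : C' \<rightarrow> C\<close> witnesses that \<open>(C, p) \<le> (C', p')\<close>.
\<close>

definition over_map :: "'a extn \<Rightarrow> 'a extn \<Rightarrow> (real \<Rightarrow> real) \<Rightarrow> bool"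
  where "over_map X X' l \<longleftrightarrow> star_epi (fst X') (fst X) l \<and>
    (\<forall>c\<in>carrier (fst X'). snd X' c = snd X (l c))"

definition ext_ker :: "('a, 'm) cstar_scheme \<Rightarrow> 'a extn \<Rightarrow> real set"
  where "ext_ker A X = star_ker (fst X) A (snd X)"

text \<open>The map \<open>EN(C, J; B) \<rightarrow> EN(C', J'; B)\<close> induced by \<open>l\<close>, with \<open>X'\<close> standing for \<open>C' \<rightarrow> A\<close>.\<close>

definition EN_pullback ::
  "('a, 'm) cstar_scheme \<Rightarrow> ('b, 'n) cstar_scheme \<Rightarrow> 'a extn \<Rightarrow> (real \<Rightarrow> real) \<Rightarrow>
    (real, 'b) fun_pair set \<Rightarrow> (real, 'b) fun_pair set"
  where "EN_pullback A B X' l \<xi> =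
    (\<Union>\<psi>\<in>\<xi>. en_homotopy (fst X') (ext_ker A X') B `` {pair_comp \<psi> l})"

definition EN_pre ::
  "('a, 'm) cstar_scheme \<Rightarrow> ('b, 'n) cstar_scheme \<Rightarrow> ('a extn \<times> (real, 'b) fun_pair set) set"
  where "EN_pre A B = (SIGMA X:extensions A.
    {\<psi>. agreeing_pair (fst X) (ext_ker A X) B \<psi>} // en_homotopy (fst X) (ext_ker A X) B)"

definition EN_lim ::
  "('a, 'm) cstar_scheme \<Rightarrow> ('b, 'n) cstar_scheme \<Rightarrow>
    (('a extn \<times> (real, 'b) fun_pair set) \<times> ('a extn \<times> (real, 'b) fun_pair set)) set"
  where "EN_lim A B = {((X, \<xi>), (Y, \<eta>)). (X, \<xi>) \<in> EN_pre A B \<and> (Y, \<eta>) \<in> EN_pre A B \<and>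
    (\<exists>Z\<in>extensions A. \<exists>l m. over_map X Z l \<and> over_map Y Z m \<and>
      EN_pullback A B Z l \<xi> = EN_pullback A B Z m \<eta>)}"

text \<open>
  The direct limit of the \<open>EN(C, J; B)\<close>. As the index set is directed, two classes have
  representatives with the same index, and these are added there.
\<close>

definition EN ::
  "('a, 'm) cstar_scheme \<Rightarrow> ('b, 'n) cstar_scheme \<Rightarrow>
    ('b \<Rightarrow> 'b) \<times> ('b \<Rightarrow> 'b) \<Rightarrow> ('b \<Rightarrow> 'b) \<times> ('b \<Rightarrow> 'b) \<Rightarrow>
    ('a extn \<times> (real, 'b) fun_pair set) set monoid"
  where "EN A B s1 s2 = \<lparr>
    carrier = EN_pre A B // EN_lim A B,
    mult = (\<lambda>U V. \<Union>{EN_lim A B `` {(X, \<xi> \<otimes>\<^bsub>EN_rel (fst X) (ext_ker A X) B s1 s2\<^esub> \<eta>)} |X \<xi> \<eta>.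
      (X, \<xi>) \<in> U \<and> (X, \<eta>) \<in> V}),
    one = (\<Union>X\<in>extensions A. EN_lim A B `` {(X, \<one>\<^bsub>EN_rel (fst X) (ext_ker A X) B s1 s2\<^esub>)})\<rparr>"


section \<open>The map \<open>\<gamma>\<close>\<close>

definition sections :: "('a, 'm) cstar_scheme \<Rightarrow> 'a extn \<Rightarrow> ('a \<Rightarrow> real) set"
  where "sections A X = {s. continuous_map (ctop A) (ctop (fst X)) s \<and> homogeneous A (fst X) s \<and>
    (\<forall>a\<in>carrier A. s (adj A a) = adj (fst X) (s a)) \<and> (\<forall>a\<in>carrier A. snd X (s a) = a)}"

definition gamma_map ::
  "('a, 'm) cstar_scheme \<Rightarrow> ('b, 'n) cstar_scheme \<Rightarrow>
    ('a extn \<times> (real, 'b) fun_pair set) set \<Rightarrow> ('a, 'b) fun_pair set"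
  where "gamma_map A B U =
    (\<Union>(X, \<xi>)\<in>U. \<Union>\<psi>\<in>\<xi>. \<Union>s\<in>sections A X. kk_homotopy A B `` {pair_comp \<psi> s})"

end

theory Submission
  imports Defs
begin

text \<open>
  A cycle \<open>\<Phi>\<close> generates a C*-algebra \<open>E\<close> with an ideal \<open>D\<close>. Let \<open>N\<close> be the annihilator of \<open>D\<close> in
  \<open>E\<close> modulo \<open>C\<^sub>0\<close> and \<open>T\<close> the annihilator of \<open>N\<close>. The maps \<open>\<Phi>\<^sup>\<plusminus>\<close> are *-homomorphisms modulo \<open>N\<close>,
  they agree modulo \<open>T\<close>, and \<open>N \<inter> T\<close> is contained in \<open>C\<^sub>0\<close>. Hence the triples \<open>(a, e, e')\<close> with
  \<open>e - \<Phi>\<^sup>+ a\<close> and \<open>e' - \<Phi>\<^sup>- a\<close> in \<open>N\<close> and \<open>e - e'\<close> in \<open>T\<close> form a C*-algebra over \<open>A\<close> whose projections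
  \<open>e\<close>, \<open>e'\<close> agree modulo \<open>C\<^sub>0\<close> on the kernel. The separable subalgebra generated by the
  \<open>(a, \<Phi>\<^sup>+ a, \<Phi>\<^sup>- a)\<close> is an extension of \<open>A\<close>, and the projections are a pair that \<open>\<gamma>\<close> maps to \<open>[\<Phi>]\<close>.
  The same construction, applied to a homotopy of cycles and enlarged by the segments between
  elements and their images under the sections, gives an extension in which two pairs with
  homotopic images become homotopic. So \<open>\<gamma>\<close> is bijective; it is additive because composition with
  a section is. Sections exist by a Bartle-Graves argument in which the weights of a series of lifts
  are averaged over the circle to make them homogeneous.
\<close>

text \<open>The relations of a cycle hold only after multiplication by \<open>D\<close>, so its two
  maps are not asymptotic homomorphisms on \<open>A\<close>. An extension absorbs the defects into
  its kernel; the difficulty is to make the two lifted maps agree there, where each is only known to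
  annihilate \<open>D\<close>. This is the purpose of \<open>T\<close>: if \<open>y\<close> lies in
  \<open>N\<close> and in \<open>T\<close>, the product of \<open>y\<close> with its adjoint lies in
  \<open>C\<^sub>0\<close>, and then so does \<open>y\<close>, by the C*-identity. The tautological
  section, sending \<open>a\<close> to \<open>(a, \<Phi>\<^sup>+ a, \<Phi>\<^sup>- a)\<close>,
  returns the cycle exactly but respects adjoints only modulo \<open>C\<^sub>0\<close>. It is
  compared with the sections that define \<open>\<gamma>\<close> along straight segments inside the
  fibres. The same segments are needed for injectivity: a homotopy of cycles speaks only about
  values of sections, and a segment joins an arbitrary element of the extension to the section value
  over the same point. An index of the limit has to be separable, which is why the algebra of all
  triples is cut down to the part generated by a continuous image of separable algebras.\<close>

abbreviation cadd_in ("(_ +[_]/ _)" [65, 0, 66] 65) where "x +[A] y \<equiv> cadd A x y"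
abbreviation cdiff_in ("(_ -[_]/ _)" [65, 0, 66] 65) where "x -[A] y \<equiv> cdiff A x y"
abbreviation cmult_in ("(_ *[_]/ _)" [70, 0, 71] 70) where "x *[A] y \<equiv> cmult A x y"
abbreviation cscale_in ("(_ .[_]/ _)" [76, 0, 75] 75) where "c .[A] x \<equiv> cscale A c x"

section \<open>Calculus in C*-algebras with explicit carrier\<close>

text \<open>The C*-axioms without completeness. A newly constructed algebra first gets these axioms
  and is then shown to be complete with the calculus that they provide.\<close>

locale pre_cstar =
  fixes A :: "'a cstar" (structure)
  assumes zero_closed [simp]: "czero A \<in> carrier A"
    and add_closed [simp]: "\<lbrakk>x \<in> carrier A; y \<in> carrier A\<rbrakk> \<Longrightarrow> x \<boxplus> y \<in> carrier A"
    and scale_closed [simp]: "x \<in> carrier A \<Longrightarrow> c \<odot> x \<in> carrier A"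
    and mult_closed [simp]: "\<lbrakk>x \<in> carrier A; y \<in> carrier A\<rbrakk> \<Longrightarrow> x \<boxdot> y \<in> carrier A"
    and adj_closed [simp]: "x \<in> carrier A \<Longrightarrow> adj A x \<in> carrier A"
    and add_assoc: "\<lbrakk>x \<in> carrier A; y \<in> carrier A; z \<in> carrier A\<rbrakk>
          \<Longrightarrow> (x \<boxplus> y) \<boxplus> z = x \<boxplus> (y \<boxplus> z)"
    and add_commute: "\<lbrakk>x \<in> carrier A; y \<in> carrier A\<rbrakk> \<Longrightarrow> x \<boxplus> y = y \<boxplus> x"
    and add_zero [simp]: "x \<in> carrier A \<Longrightarrow> x \<boxplus> czero A = x"
    and diff_self [simp]: "x \<in> carrier A \<Longrightarrow> x \<boxminus> x = czero A"
    and scale_one [simp]: "x \<in> carrier A \<Longrightarrow> 1 \<odot> x = x"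
    and scale_scale [simp]: "x \<in> carrier A \<Longrightarrow> c \<odot> (d \<odot> x) = (c * d) \<odot> x"
    and scale_add_left: "x \<in> carrier A \<Longrightarrow> (c + d) \<odot> x = c \<odot> x \<boxplus> d \<odot> x"
    and scale_add_right: "\<lbrakk>x \<in> carrier A; y \<in> carrier A\<rbrakk>
          \<Longrightarrow> c \<odot> (x \<boxplus> y) = c \<odot> x \<boxplus> c \<odot> y"
    and mult_assoc: "\<lbrakk>x \<in> carrier A; y \<in> carrier A; z \<in> carrier A\<rbrakk>
          \<Longrightarrow> (x \<boxdot> y) \<boxdot> z = x \<boxdot> (y \<boxdot> z)"
    and mult_add_left: "\<lbrakk>x \<in> carrier A; y \<in> carrier A; z \<in> carrier A\<rbrakk>
          \<Longrightarrow> (x \<boxplus> y) \<boxdot> z = x \<boxdot> z \<boxplus> y \<boxdot> z"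
    and mult_add_right: "\<lbrakk>x \<in> carrier A; y \<in> carrier A; z \<in> carrier A\<rbrakk>
          \<Longrightarrow> x \<boxdot> (y \<boxplus> z) = x \<boxdot> y \<boxplus> x \<boxdot> z"
    and mult_scale_left [simp]: "\<lbrakk>x \<in> carrier A; y \<in> carrier A\<rbrakk>
          \<Longrightarrow> (c \<odot> x) \<boxdot> y = c \<odot> (x \<boxdot> y)"
    and mult_scale_right [simp]: "\<lbrakk>x \<in> carrier A; y \<in> carrier A\<rbrakk>
          \<Longrightarrow> x \<boxdot> (c \<odot> y) = c \<odot> (x \<boxdot> y)"
    and adj_adj [simp]: "x \<in> carrier A \<Longrightarrow> adj A (adj A x) = x"
    and adj_add: "\<lbrakk>x \<in> carrier A; y \<in> carrier A\<rbrakk>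
          \<Longrightarrow> adj A (x \<boxplus> y) = adj A x \<boxplus> adj A y"
    and adj_scale: "x \<in> carrier A \<Longrightarrow> adj A (c \<odot> x) = cnj c \<odot> adj A x"
    and adj_mult: "\<lbrakk>x \<in> carrier A; y \<in> carrier A\<rbrakk>
          \<Longrightarrow> adj A (x \<boxdot> y) = adj A y \<boxdot> adj A x"
    and nrm_nonneg [simp]: "x \<in> carrier A \<Longrightarrow> 0 \<le> nrm A x"
    and nrm_eq_0: "x \<in> carrier A \<Longrightarrow> nrm A x = 0 \<longleftrightarrow> x = czero A"
    and nrm_scale: "x \<in> carrier A \<Longrightarrow> nrm A (c \<odot> x) = cmod c * nrm A x"
    and nrm_triangle: "\<lbrakk>x \<in> carrier A; y \<in> carrier A\<rbrakk>
          \<Longrightarrow> nrm A (x \<boxplus> y) \<le> nrm A x + nrm A y"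
    and nrm_mult: "\<lbrakk>x \<in> carrier A; y \<in> carrier A\<rbrakk>
          \<Longrightarrow> nrm A (x \<boxdot> y) \<le> nrm A x * nrm A y"
    and cstar_identity: "x \<in> carrier A \<Longrightarrow> nrm A (adj A x \<boxdot> x) = (nrm A x)\<^sup>2"
begin

lemma diff_closed [simp]: "\<lbrakk>x \<in> carrier A; y \<in> carrier A\<rbrakk> \<Longrightarrow> x \<boxminus> y \<in> carrier A"
  by (simp add: cdiff_def)

lemma zero_add [simp]: "x \<in> carrier A \<Longrightarrow> czero A \<boxplus> x = x"
  using add_commute add_zero zero_closed by metis

lemma scale_zero_left [simp]: "x \<in> carrier A \<Longrightarrow> 0 \<odot> x = czero A"
  using scale_add_left[of x 1 "-1"] diff_self[of x] by (simp add: cdiff_def)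

lemma scale_zero_right [simp]: "c \<odot> czero A = czero A"
  using scale_scale[of "czero A" c 0] by simp

lemma mult_zero_left [simp]: "x \<in> carrier A \<Longrightarrow> czero A \<boxdot> x = czero A"
  using mult_scale_left[of x x 0] by simp

lemma mult_zero_right [simp]: "x \<in> carrier A \<Longrightarrow> x \<boxdot> czero A = czero A"
  using mult_scale_right[of x x 0] by simp

lemma adj_zero [simp]: "adj A (czero A) = czero A"
  using adj_scale[of "czero A" 0] by simp

lemma nrm_zero [simp]: "nrm A (czero A) = 0"
  by (simp add: nrm_eq_0)

lemma add_left_commute:
  "\<lbrakk>x \<in> carrier A; y \<in> carrier A; z \<in> carrier A\<rbrakk> \<Longrightarrow> x \<boxplus> (y \<boxplus> z) = y \<boxplus> (x \<boxplus> z)"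
  using add_assoc add_commute by metis

lemmas add_ac = add_assoc add_commute add_left_commute

lemma neg_add_cancel [simp]: "x \<in> carrier A \<Longrightarrow> (-1) \<odot> x \<boxplus> x = czero A"
  using diff_self[of x] add_commute[of x "(-1) \<odot> x"] by (simp add: cdiff_def)

lemma add_diff_cancel [simp]: "\<lbrakk>x \<in> carrier A; y \<in> carrier A\<rbrakk> \<Longrightarrow> x \<boxplus> y \<boxminus> y = x"
  using diff_self[of y] by (simp add: cdiff_def add_assoc)

lemma diff_add_cancel [simp]: "\<lbrakk>x \<in> carrier A; y \<in> carrier A\<rbrakk> \<Longrightarrow> x \<boxminus> y \<boxplus> y = x"
  by (simp add: cdiff_def add_assoc)

lemma diff_zero [simp]: "x \<in> carrier A \<Longrightarrow> x \<boxminus> czero A = x"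
  by (simp add: cdiff_def)

lemma diff_eq_eq: "\<lbrakk>x \<in> carrier A; y \<in> carrier A; z \<in> carrier A\<rbrakk> \<Longrightarrow> x \<boxminus> y = z \<longleftrightarrow> x = z \<boxplus> y"
  using add_diff_cancel diff_add_cancel by metis

lemma eq_diff_eq: "\<lbrakk>x \<in> carrier A; y \<in> carrier A; z \<in> carrier A\<rbrakk> \<Longrightarrow> z = x \<boxminus> y \<longleftrightarrow> z \<boxplus> y = x"
  using diff_eq_eq by metis

lemma add_left_cancel:
  "\<lbrakk>x \<in> carrier A; y \<in> carrier A; z \<in> carrier A\<rbrakk> \<Longrightarrow> x \<boxplus> y = x \<boxplus> z \<longleftrightarrow> y = z"
  using add_diff_cancel add_commute by metis

lemma diff_diff_left:
  "\<lbrakk>x \<in> carrier A; y \<in> carrier A; z \<in> carrier A\<rbrakk> \<Longrightarrow> x \<boxminus> y \<boxminus> z = x \<boxminus> (y \<boxplus> z)"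
  by (simp add: cdiff_def add_assoc scale_add_right)

lemma diff_diff_right:
  "\<lbrakk>x \<in> carrier A; y \<in> carrier A; z \<in> carrier A\<rbrakk> \<Longrightarrow> x \<boxminus> (y \<boxminus> z) = x \<boxplus> z \<boxminus> y"
  by (simp add: cdiff_def add_ac scale_add_right)

lemma add_diff_right:
  "\<lbrakk>x \<in> carrier A; y \<in> carrier A; z \<in> carrier A\<rbrakk> \<Longrightarrow> x \<boxplus> (y \<boxminus> z) = x \<boxplus> y \<boxminus> z"
  by (simp add: cdiff_def add_ac)

lemma add_diff_left:
  "\<lbrakk>x \<in> carrier A; y \<in> carrier A; z \<in> carrier A\<rbrakk> \<Longrightarrow> (x \<boxminus> y) \<boxplus> z = x \<boxplus> z \<boxminus> y"
  by (simp add: cdiff_def add_ac)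

lemma scale_diff_right:
  "\<lbrakk>x \<in> carrier A; y \<in> carrier A\<rbrakk> \<Longrightarrow> c \<odot> (x \<boxminus> y) = c \<odot> x \<boxminus> c \<odot> y"
  by (simp add: cdiff_def scale_add_right)

lemma scale_diff_left: "x \<in> carrier A \<Longrightarrow> (c - d) \<odot> x = c \<odot> x \<boxminus> d \<odot> x"
  using scale_add_left[of x c "-d"] by (simp add: cdiff_def)

lemma mult_diff_left:
  "\<lbrakk>x \<in> carrier A; y \<in> carrier A; z \<in> carrier A\<rbrakk> \<Longrightarrow> (x \<boxminus> y) \<boxdot> z = x \<boxdot> z \<boxminus> y \<boxdot> z"
  by (simp add: cdiff_def mult_add_left)

lemma mult_diff_right:
  "\<lbrakk>x \<in> carrier A; y \<in> carrier A; z \<in> carrier A\<rbrakk> \<Longrightarrow> x \<boxdot> (y \<boxminus> z) = x \<boxdot> y \<boxminus> x \<boxdot> z"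
  by (simp add: cdiff_def mult_add_right)

lemma adj_diff:
  "\<lbrakk>x \<in> carrier A; y \<in> carrier A\<rbrakk> \<Longrightarrow> adj A (x \<boxminus> y) = adj A x \<boxminus> adj A y"
  by (simp add: cdiff_def adj_add adj_scale)

text \<open>A normal form for the additive group: differences move outwards until one minuend and
  one subtrahend remain, then across the equation, and sums are sorted.\<close>

lemmas group_simps = add_ac diff_eq_eq eq_diff_eq diff_diff_left diff_diff_right
  add_diff_right add_diff_left

lemma diff_eq_0: "\<lbrakk>x \<in> carrier A; y \<in> carrier A\<rbrakk> \<Longrightarrow> x \<boxminus> y = czero A \<longleftrightarrow> x = y"
  by (simp add: diff_eq_eq)

lemma diff_diff_add:
  "\<lbrakk>x \<in> carrier A; y \<in> carrier A; z \<in> carrier A\<rbrakk> \<Longrightarrow> (x \<boxminus> y) \<boxplus> (y \<boxminus> z) = x \<boxminus> z"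
  by (simp add: group_simps)

lemma add_diff_add:
  "\<lbrakk>x \<in> carrier A; y \<in> carrier A; z \<in> carrier A; w \<in> carrier A\<rbrakk> \<Longrightarrow>
    (x \<boxplus> y) \<boxminus> (z \<boxplus> w) = (x \<boxminus> z) \<boxplus> (y \<boxminus> w)"
  by (simp add: group_simps)

lemma mult_diff_mult:
  "\<lbrakk>x \<in> carrier A; y \<in> carrier A; z \<in> carrier A; w \<in> carrier A\<rbrakk> \<Longrightarrow>
    x \<boxdot> y \<boxminus> z \<boxdot> w = (x \<boxminus> z) \<boxdot> y \<boxplus> z \<boxdot> (y \<boxminus> w)"
  by (simp add: mult_diff_left mult_diff_right diff_diff_add)

lemma nrm_neg [simp]: "x \<in> carrier A \<Longrightarrow> nrm A ((-1) \<odot> x) = nrm A x"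
  by (simp add: nrm_scale)

lemma nrm_diff_commute: "\<lbrakk>x \<in> carrier A; y \<in> carrier A\<rbrakk> \<Longrightarrow> nrm A (x \<boxminus> y) = nrm A (y \<boxminus> x)"
proof -
  assume "x \<in> carrier A" "y \<in> carrier A"
  then have "y \<boxminus> x = (-1) \<odot> (x \<boxminus> y)"
    by (simp add: cdiff_def scale_add_right add_commute)
  then show ?thesis
    using \<open>x \<in> carrier A\<close> \<open>y \<in> carrier A\<close> by simp
qed

lemma nrm_diff_triangle:
  "\<lbrakk>x \<in> carrier A; y \<in> carrier A; z \<in> carrier A\<rbrakk> \<Longrightarrow> nrm A (x \<boxminus> z) \<le> nrm A (x \<boxminus> y) + nrm A (y \<boxminus> z)"
  using nrm_triangle[of "x \<boxminus> y" "y \<boxminus> z"] by (simp add: diff_diff_add)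

lemma nrm_diff_le: "\<lbrakk>x \<in> carrier A; y \<in> carrier A\<rbrakk> \<Longrightarrow> nrm A (x \<boxminus> y) \<le> nrm A x + nrm A y"
  using nrm_triangle[of x "(-1) \<odot> y"] by (simp add: cdiff_def)

lemma nrm_le_add_diff: "\<lbrakk>x \<in> carrier A; y \<in> carrier A\<rbrakk> \<Longrightarrow> nrm A x \<le> nrm A y + nrm A (x \<boxminus> y)"
  using nrm_triangle[of "x \<boxminus> y" y] by simp

lemma nrm_diff_ineq: "\<lbrakk>x \<in> carrier A; y \<in> carrier A\<rbrakk> \<Longrightarrow> \<bar>nrm A x - nrm A y\<bar> \<le> nrm A (x \<boxminus> y)"
  using nrm_le_add_diff[of x y] nrm_le_add_diff[of y x] nrm_diff_commute[of x y] by linarith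

text \<open>By the C*-identity and submultiplicativity the square of the norm of \<open>y\<close> is
  at most the product of the norms of the adjoint and of \<open>y\<close>. Cancelling one factor
  gives one inequality, and applying it to the adjoint gives the other.\<close>

lemma nrm_adj [simp]: "x \<in> carrier A \<Longrightarrow> nrm A (adj A x) = nrm A x"
proof -
  have *: "nrm A y \<le> nrm A (adj A y)" if "y \<in> carrier A" for y
  proof (cases "nrm A y = 0")
    case False
    then have "0 < nrm A y" using that nrm_nonneg[of y] by linarith
    moreover have "nrm A y * nrm A y \<le> nrm A (adj A y) * nrm A y"
      using cstar_identity[OF that] nrm_mult[of "adj A y" y] that by (simp add: power2_eq_square)
    ultimately show ?thesis by simp
  qed (use that in simp)
  assume "x \<in> carrier A"
  then show ?thesis using *[of x] *[of "adj A x"] by simp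
qed

section \<open>Metric and topology of the norm\<close>

lemma Metric: "Metric_space (carrier A) (cdist A)"
proof
  show "0 \<le> cdist A x y" for x y by (simp add: cdist_def)
  show "cdist A x y = cdist A y x" for x y by (simp add: cdist_def nrm_diff_commute)
  show "cdist A x y = 0 \<longleftrightarrow> x = y" if "x \<in> carrier A" "y \<in> carrier A" for x y
    using that by (simp add: cdist_def nrm_eq_0 diff_eq_0)
  show "cdist A x z \<le> cdist A x y + cdist A y z"
    if "x \<in> carrier A" "y \<in> carrier A" "z \<in> carrier A" for x y z
    using that nrm_diff_triangle by (simp add: cdist_def)
qed

sublocale M: Metric_space "carrier A" "cdist A"
  by (rule Metric)

lemma topspace_ctop [simp]: "topspace (ctop A) = carrier A"
  by (simp add: ctop_def)

lemma closure_of_ctop: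
  assumes "S \<subseteq> carrier A"
  shows "ctop A closure_of S = {x \<in> carrier A. \<forall>e>0. \<exists>y\<in>S. nrm A (x \<boxminus> y) < e}"
proof -
  have "(\<exists>y\<in>S. y \<in> M.mball x e) \<longleftrightarrow> (\<exists>y\<in>S. nrm A (x \<boxminus> y) < e)" if "x \<in> carrier A" for x e
    using that assms by (intro bex_cong refl) (auto simp: cdist_def)
  then show ?thesis
    unfolding ctop_def M.metric_closure_of by (intro Collect_cong conj_cong) simp_all
qed

lemma closedin_ctop_iff:
  "closedin (ctop A) S \<longleftrightarrow> S \<subseteq> carrier A \<and>
    (\<forall>x\<in>carrier A. (\<forall>e>0. \<exists>y\<in>S. nrm A (x \<boxminus> y) < e) \<longrightarrow> x \<in> S)"
proof (cases "S \<subseteq> carrier A")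
  case True
  then have "closedin (ctop A) S \<longleftrightarrow> ctop A closure_of S \<subseteq> S"
    using closure_of_subset_eq[of S "ctop A"] by simp
  also have "\<dots> \<longleftrightarrow> (\<forall>x\<in>carrier A. (\<forall>e>0. \<exists>y\<in>S. nrm A (x \<boxminus> y) < e) \<longrightarrow> x \<in> S)"
    unfolding closure_of_ctop[OF True] by blast
  finally show ?thesis using True by simp
next
  case False
  then show ?thesis using closedin_subset[of "ctop A" S] by auto
qed

lemma separable_iff:
  "separable A \<longleftrightarrow> (\<exists>Q. countable Q \<and> Q \<subseteq> carrier A \<and>
    (\<forall>x\<in>carrier A. \<forall>e>0. \<exists>y\<in>Q. nrm A (x \<boxminus> y) < e))"
  unfolding separable_space_def topspace_ctop
  by (intro ex_cong1 conj_cong refl) (simp add: closure_of_ctop set_eq_iff, blast)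

definition conv_seq :: "(nat \<Rightarrow> 'a) \<Rightarrow> 'a \<Rightarrow> bool"
  where "conv_seq \<sigma> x \<longleftrightarrow> (\<forall>e>0. \<exists>N. \<forall>n\<ge>N. nrm A (\<sigma> n \<boxminus> x) < e)"

lemma mcomplete_iff:
  "M.mcomplete \<longleftrightarrow> (\<forall>\<sigma>. (\<forall>n. \<sigma> n \<in> carrier A) \<longrightarrow>
    (\<forall>e>0. \<exists>N. \<forall>m\<ge>N. \<forall>n\<ge>N. nrm A (\<sigma> m \<boxminus> \<sigma> n) < e) \<longrightarrow> (\<exists>x\<in>carrier A. conv_seq \<sigma> x))"
proof -
  have C: "M.MCauchy \<sigma> \<longleftrightarrow> (\<forall>n. \<sigma> n \<in> carrier A) \<and>
      (\<forall>e>0. \<exists>N. \<forall>m\<ge>N. \<forall>n\<ge>N. nrm A (\<sigma> m \<boxminus> \<sigma> n) < e)" for \<sigma>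
    unfolding M.MCauchy_def image_subset_iff
    by (rule conj_cong) (simp_all add: cdist_def)
  have L: "(\<exists>x. limitin M.mtopology \<sigma> x sequentially) \<longleftrightarrow> (\<exists>x\<in>carrier A. conv_seq \<sigma> x)"
    if "\<forall>n. \<sigma> n \<in> carrier A" for \<sigma>
    unfolding M.limit_metric_sequentially conv_seq_def Bex_def
    using that by (intro ex_cong1 conj_cong refl) (simp add: cdist_def)
  show ?thesis
    unfolding M.mcomplete_def C using L by metis
qed

lemma cstar_algebraI:
  assumes "\<And>\<sigma> :: nat \<Rightarrow> 'a. (\<And>n. \<sigma> n \<in> carrier A) \<Longrightarrow>
    (\<And>e. e > 0 \<Longrightarrow> \<exists>N. \<forall>m\<ge>N. \<forall>n\<ge>N. nrm A (\<sigma> m \<boxminus> \<sigma> n) < e) \<Longrightarrow>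
    \<exists>x\<in>carrier A. \<forall>e>0. \<exists>N. \<forall>n\<ge>N. nrm A (\<sigma> n \<boxminus> x) < e"
  shows "cstar_algebra A"
proof
  show "M.mcomplete"
    unfolding mcomplete_iff conv_seq_def
    by (intro allI impI) (rule assms; blast)
qed (fact zero_closed add_closed scale_closed mult_closed adj_closed add_assoc add_commute add_zero
    diff_self scale_one scale_scale scale_add_left scale_add_right mult_assoc mult_add_left
    mult_add_right mult_scale_left mult_scale_right adj_adj adj_add adj_scale adj_mult nrm_nonneg
    nrm_eq_0 nrm_scale nrm_triangle nrm_mult cstar_identity)+

end

section \<open>Epsilon forms of completeness and continuity\<close>

abbreviation csa :: "'a cstar \<Rightarrow> bool"
  where "csa \<equiv> cstar_algebra"

lemma cstar_imp_pre:
  shows "csa A \<Longrightarrow> pre_cstar A"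
  unfolding cstar_algebra_def pre_cstar_def by (elim conjE, intro conjI; assumption)

lemma cstar_complete:
  fixes A :: "'a cstar" and \<sigma> :: "nat \<Rightarrow> 'a"
  assumes "csa A" "\<And>n. \<sigma> n \<in> carrier A"
    "\<And>e. e > 0 \<Longrightarrow> \<exists>N. \<forall>m\<ge>N. \<forall>n\<ge>N. nrm A (\<sigma> m -[A] \<sigma> n) < e"
  shows "\<exists>x\<in>carrier A. \<forall>e>0. \<exists>N. \<forall>n\<ge>N. nrm A (\<sigma> n -[A] x) < e"
proof -
  interpret pre_cstar A using assms(1) by (rule cstar_imp_pre)
  show ?thesis
    using cstar_algebra.complete[OF assms(1)] assms(2,3)
    unfolding mcomplete_iff conv_seq_def image_subset_iff by blast
qed

lemma continuous_ctop_iff: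
  assumes "csa A" "csa B"
  shows "continuous_map (ctop A) (ctop B) f \<longleftrightarrow> f \<in> carrier A \<rightarrow> carrier B \<and>
    (\<forall>a\<in>carrier A. \<forall>e>0. \<exists>d>0. \<forall>b\<in>carrier A.
      nrm A (a -[A] b) < d \<longrightarrow> nrm B (f a -[B] f b) < e)"
proof -
  interpret A: pre_cstar A using assms(1) by (rule cstar_imp_pre)
  interpret B: pre_cstar B using assms(2) by (rule cstar_imp_pre)
  show ?thesis
  proof (cases "f \<in> carrier A \<rightarrow> carrier B")
    case True
    then have [simp]: "x \<in> carrier A \<Longrightarrow> f x \<in> carrier B" for x by auto
    show ?thesis unfolding ctop_def A.M.metric_continuous_map[OF B.Metric]
      using True by (simp add: cdist_def image_subset_iff Pi_iff imp_conjL Ball_def cong: conj_cong)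
  next
    case False
    then show ?thesis unfolding ctop_def A.M.metric_continuous_map[OF B.Metric]
      by (auto simp: Pi_iff)
  qed
qed

lemma continuous_real_ctop_iff:
  fixes X :: "real set" and B :: "'b cstar"
  assumes "csa B"
  shows "continuous_map (top_of_set X) (ctop B) f \<longleftrightarrow> f \<in> X \<rightarrow> carrier B \<and>
    (\<forall>t\<in>X. \<forall>e>0. \<exists>d>0. \<forall>t'\<in>X. \<bar>t' - t\<bar> < d \<longrightarrow> nrm B (f t -[B] f t') < e)"
proof -
  interpret B: pre_cstar B using assms by (rule cstar_imp_pre)
  interpret Xm: Submetric UNIV dist X
    by unfold_locales simp
  have top: "top_of_set X = Xm.sub.mtopology"
    using Xm.mtopology_submetric by simp
  show ?thesis
  proof (cases "f \<in> X \<rightarrow> carrier B")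
    case True
    then have [simp]: "x \<in> X \<Longrightarrow> f x \<in> carrier B" for x by auto
    show ?thesis unfolding ctop_def top Xm.sub.metric_continuous_map[OF B.Metric]
      using True by (simp add: cdist_def image_subset_iff Pi_iff dist_real_def abs_minus_commute imp_conjL Ball_def
          cong: conj_cong)
  next
    case False
    then show ?thesis unfolding ctop_def top Xm.sub.metric_continuous_map[OF B.Metric]
      by (auto simp: Pi_iff)
  qed
qed

section \<open>Constructions of C*-algebras\<close>

text \<open>Identities are pulled back from \<open>B\<close> by joint injectivity of the
  \<open>g i\<close>, inequalities by taking suprema. Point evaluations give the function algebras;
  a one-element index set gives algebras transported along a single isometric map.\<close>

lemma pre_cstar_jointly_isometric:
  fixes C :: "'c cstar" and B :: "'b cstar" and g :: "'i \<Rightarrow> 'c \<Rightarrow> 'b"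
  assumes "pre_cstar B"
    and [simp]: "czero C \<in> carrier C"
      "\<And>x y. \<lbrakk>x \<in> carrier C; y \<in> carrier C\<rbrakk> \<Longrightarrow> x +[C] y \<in> carrier C"
      "\<And>c x. x \<in> carrier C \<Longrightarrow> c .[C] x \<in> carrier C"
      "\<And>x y. \<lbrakk>x \<in> carrier C; y \<in> carrier C\<rbrakk> \<Longrightarrow> x *[C] y \<in> carrier C"
      "\<And>x. x \<in> carrier C \<Longrightarrow> adj C x \<in> carrier C"
    and g [simp]: "\<And>i x. \<lbrakk>i \<in> I; x \<in> carrier C\<rbrakk> \<Longrightarrow> g i x \<in> carrier B"
    and [simp]: "\<And>i. i \<in> I \<Longrightarrow> g i (czero C) = czero B"
      "\<And>i x y. \<lbrakk>i \<in> I; x \<in> carrier C; y \<in> carrier C\<rbrakk> \<Longrightarrow> g i (x +[C] y) = g i x +[B] g i y"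
      "\<And>i c x. \<lbrakk>i \<in> I; x \<in> carrier C\<rbrakk> \<Longrightarrow> g i (c .[C] x) = c .[B] g i x"
      "\<And>i x y. \<lbrakk>i \<in> I; x \<in> carrier C; y \<in> carrier C\<rbrakk> \<Longrightarrow> g i (x *[C] y) = g i x *[B] g i y"
      "\<And>i x. \<lbrakk>i \<in> I; x \<in> carrier C\<rbrakk> \<Longrightarrow> g i (adj C x) = adj B (g i x)"
    and inj: "\<And>x y. \<lbrakk>x \<in> carrier C; y \<in> carrier C; \<And>i. i \<in> I \<Longrightarrow> g i x = g i y\<rbrakk> \<Longrightarrow> x = y"
    and I: "I \<noteq> {}"
    and bdd: "\<And>x. x \<in> carrier C \<Longrightarrow> \<exists>K. \<forall>i\<in>I. nrm B (g i x) \<le> K"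
    and nrm: "\<And>x. x \<in> carrier C \<Longrightarrow> nrm C x = (SUP i\<in>I. nrm B (g i x))"
  shows "pre_cstar C"
proof -
  interpret B: pre_cstar B by fact
  have d [simp]: "x -[C] y \<in> carrier C" "\<And>i. i \<in> I \<Longrightarrow> g i (x -[C] y) = g i x -[B] g i y"
    if "x \<in> carrier C" "y \<in> carrier C" for x y
    using that by (simp_all add: cdiff_def)
  have bdd': "bdd_above ((\<lambda>i. nrm B (g i x)) ` I)" if "x \<in> carrier C" for x
    using bdd[OF that] by (auto intro: bdd_aboveI2)
  have le: "nrm B (g i x) \<le> nrm C x" if "i \<in> I" "x \<in> carrier C" for i x
    using that nrm bdd' by (auto intro: cSUP_upper)
  have leI: "nrm C x \<le> K" if "x \<in> carrier C" "\<And>i. i \<in> I \<Longrightarrow> nrm B (g i x) \<le> K" for x K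
    using that nrm I by (auto intro: cSUP_least)
  have nn: "0 \<le> nrm C x" if x: "x \<in> carrier C" for x
  proof -
    obtain i where "i \<in> I" using I by auto
    then show ?thesis using le[of i x] B.nrm_nonneg[of "g i x"] x by (meson g order_trans)
  qed
  show ?thesis
  proof
    fix x y z c d assume [simp]: "x \<in> carrier C" "y \<in> carrier C" "z \<in> carrier C"
    show "x +[C] y +[C] z = x +[C] (y +[C] z)" by (rule inj) (simp_all add: B.add_assoc)
    show "x +[C] y = y +[C] x" by (rule inj) (simp_all add: B.add_commute)
    show "x +[C] czero C = x" by (rule inj) simp_all
    show "x -[C] x = czero C" by (rule inj) simp_all
    show "1 .[C] x = x" by (rule inj) simp_all
    show "c .[C] (d .[C] x) = (c * d) .[C] x" by (rule inj) simp_all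
    show "(c + d) .[C] x = c .[C] x +[C] d .[C] x" by (rule inj) (simp_all add: B.scale_add_left)
    show "c .[C] (x +[C] y) = c .[C] x +[C] c .[C] y" by (rule inj) (simp_all add: B.scale_add_right)
    show "x *[C] y *[C] z = x *[C] (y *[C] z)" by (rule inj) (simp_all add: B.mult_assoc)
    show "(x +[C] y) *[C] z = x *[C] z +[C] y *[C] z" by (rule inj) (simp_all add: B.mult_add_left)
    show "x *[C] (y +[C] z) = x *[C] y +[C] x *[C] z" by (rule inj) (simp_all add: B.mult_add_right)
    show "(c .[C] x) *[C] y = c .[C] (x *[C] y)" by (rule inj) simp_all
    show "x *[C] (c .[C] y) = c .[C] (x *[C] y)" by (rule inj) simp_all
    show "adj C (adj C x) = x" by (rule inj) simp_all
    show "adj C (x +[C] y) = adj C x +[C] adj C y" by (rule inj) (simp_all add: B.adj_add)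
    show "adj C (c .[C] x) = cnj c .[C] adj C x" by (rule inj) (simp_all add: B.adj_scale)
    show "adj C (x *[C] y) = adj C y *[C] adj C x" by (rule inj) (simp_all add: B.adj_mult)
    show "0 \<le> nrm C x" by (rule nn) simp
    show "nrm C x = 0 \<longleftrightarrow> x = czero C"
    proof
      assume 0: "nrm C x = 0"
      show "x = czero C"
      proof (rule inj)
        fix i assume i: "i \<in> I"
        then have "nrm B (g i x) = 0" using le[OF i \<open>x \<in> carrier C\<close>] 0 B.nrm_nonneg[OF g[OF i \<open>x \<in> carrier C\<close>]] by linarith
        then show "g i x = g i (czero C)" using i by (simp add: B.nrm_eq_0)
      qed simp_all
    next
      assume "x = czero C"
      moreover have "nrm C (czero C) \<le> 0" by (rule leI) simp_all
      ultimately show "nrm C x = 0" using nn[of x] by simp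
    qed
    have *: "nrm C (c .[C] y) \<le> cmod c * nrm C y" if "y \<in> carrier C" for c y
      by (rule leI) (use that le in \<open>auto simp: B.nrm_scale intro: mult_left_mono\<close>)
    show "nrm C (c .[C] x) = cmod c * nrm C x"
    proof (cases "c = 0")
      case True
      then show ?thesis using *[of x c] nn[of "c .[C] x"] by simp
    next
      case False
      \<comment> \<open>The bound \<open>*\<close> for the inverse scalar, applied to the scaled
        element, is the missing reverse inequality.\<close>
      have "inverse c .[C] (c .[C] x) = x" using False by (intro inj) simp_all
      then have "nrm C x \<le> cmod (inverse c) * nrm C (c .[C] x)"
        using *[of "c .[C] x" "inverse c"] by simp
      then show ?thesis using *[of x c] False
        by (simp add: norm_divide divide_simps mult.commute split: if_splits)
    qed
    show "nrm C (x +[C] y) \<le> nrm C x + nrm C y"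
    proof (rule leI)
      fix i assume "i \<in> I"
      then show "nrm B (g i (x +[C] y)) \<le> nrm C x + nrm C y"
        using B.nrm_triangle[of "g i x" "g i y"] le[of i x] le[of i y] by simp
    qed simp
    show "nrm C (x *[C] y) \<le> nrm C x * nrm C y"
    proof (rule leI)
      fix i assume i: "i \<in> I"
      then have "nrm B (g i (x *[C] y)) \<le> nrm B (g i x) * nrm B (g i y)" by (simp add: B.nrm_mult)
      also have "\<dots> \<le> nrm C x * nrm C y" using i le[of i] nn by (intro mult_mono) simp_all
      finally show "nrm B (g i (x *[C] y)) \<le> nrm C x * nrm C y" .
    qed simp
    have sq: "nrm B (g i (adj C x *[C] x)) = (nrm B (g i x))\<^sup>2" if "i \<in> I" for i
      using that by (simp add: B.cstar_identity)
    have "nrm C (adj C x *[C] x) \<le> (nrm C x)\<^sup>2"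
      by (rule leI) (use le sq in \<open>auto intro: power_mono\<close>)
    moreover have "nrm C x \<le> sqrt (nrm C (adj C x *[C] x))"
      by (rule leI) (use le[of _ "adj C x *[C] x"] sq in \<open>auto intro: real_le_rsqrt\<close>)
    then have "(nrm C x)\<^sup>2 \<le> nrm C (adj C x *[C] x)"
      using nn[of x] nn[of "adj C x *[C] x"] by (simp add: real_le_lsqrt real_sqrt_le_iff)
        (metis power_mono real_sqrt_pow2)
    ultimately show "nrm C (adj C x *[C] x) = (nrm C x)\<^sup>2" by simp
  qed simp_all
qed

subsection \<open>Bounded continuous functions\<close>

lemma Cb_simps:
  "czero (Cb X B) = (\<lambda>t\<in>X. czero B)"
  "x +[Cb X B] y = (\<lambda>t\<in>X. x t +[B] y t)"
  "c .[Cb X B] x = (\<lambda>t\<in>X. c .[B] x t)"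
  "x *[Cb X B] y = (\<lambda>t\<in>X. x t *[B] y t)"
  "adj (Cb X B) x = (\<lambda>t\<in>X. adj B (x t))"
  by (simp_all add: Cb_def)

lemma Cb_diff: "x -[Cb X B] y = (\<lambda>t\<in>X. x t -[B] y t)"
  by (auto simp: cdiff_def Cb_simps)

lemma nrm_Cb: "nrm (Cb X B) x = (SUP t\<in>X. nrm B (x t))"
  by (simp add: Cb_def)

text \<open>Continuity as convergence of a real-valued function, so that closure of the function
  algebra under its operations becomes arithmetic of real limits.\<close>

definition cont_on :: "real set \<Rightarrow> 'b cstar \<Rightarrow> (real \<Rightarrow> 'b) \<Rightarrow> bool"
  where "cont_on X B f \<longleftrightarrow> (\<forall>t\<in>X. ((\<lambda>t'. nrm B (f t -[B] f t')) \<longlongrightarrow> 0) (at t within X))"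

lemma cont_on_iff:
  fixes B :: "'b cstar"
  assumes "pre_cstar B" "f \<in> X \<rightarrow> carrier B"
  shows "cont_on X B f \<longleftrightarrow> (\<forall>t\<in>X. \<forall>e>0. \<exists>d>0. \<forall>t'\<in>X. \<bar>t' - t\<bar> < d \<longrightarrow> nrm B (f t -[B] f t') < e)"
proof -
  interpret pre_cstar B by fact
  have "((\<lambda>t'. nrm B (f t -[B] f t')) \<longlongrightarrow> 0) (at t within X) \<longleftrightarrow>
     (\<forall>e>0. \<exists>d>0. \<forall>t'\<in>X. \<bar>t' - t\<bar> < d \<longrightarrow> nrm B (f t -[B] f t') < e)" if "t \<in> X" for t
    using that assms(2) unfolding tendsto_iff eventually_at
    by (intro all_cong ex_cong conj_cong refl ball_cong) (auto simp: dist_real_def Pi_iff)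
  then show ?thesis by (simp add: cont_on_def)
qed

lemma carrier_Cb:
  assumes "csa B"
  shows "f \<in> carrier (Cb X B) \<longleftrightarrow> f \<in> extensional X \<and> f \<in> X \<rightarrow> carrier B \<and> cont_on X B f \<and>
    (\<exists>K. \<forall>t\<in>X. nrm B (f t) \<le> K)"
  using cont_on_iff[OF cstar_imp_pre[OF assms], of f X]
  by (auto simp: Cb_def continuous_real_ctop_iff[OF assms])

lemma Cb_apply_closed:
  shows "\<lbrakk>csa B; f \<in> carrier (Cb X B); t \<in> X\<rbrakk> \<Longrightarrow> f t \<in> carrier B"
  by (auto simp: carrier_Cb)

lemma Cb_eqI:
  assumes "csa B" "f \<in> carrier (Cb X B)" "g \<in> carrier (Cb X B)" "\<And>t. t \<in> X \<Longrightarrow> f t = g t"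
  shows "f = g"
  using assms by (auto simp: carrier_Cb intro: extensionalityI)

lemma Cb_bdd:
  shows "\<lbrakk>csa B; f \<in> carrier (Cb X B)\<rbrakk> \<Longrightarrow> bdd_above ((\<lambda>t. nrm B (f t)) ` X)"
  by (auto simp: carrier_Cb intro: bdd_aboveI2)

lemma nrm_Cb_le:
  shows "\<lbrakk>csa B; f \<in> carrier (Cb X B); t \<in> X\<rbrakk> \<Longrightarrow> nrm B (f t) \<le> nrm (Cb X B) f"
  unfolding nrm_Cb by (intro cSUP_upper Cb_bdd)

lemma nrm_CbI: "\<lbrakk>X \<noteq> {}; \<And>t. t \<in> X \<Longrightarrow> nrm B (f t) \<le> K\<rbrakk> \<Longrightarrow> nrm (Cb X B) f \<le> K"
  unfolding nrm_Cb by (intro cSUP_least)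

lemma cstar_Cb:
  fixes B :: "'b cstar"
  assumes cB: "csa B" and X: "X \<noteq> {}"
  shows "csa (Cb X B)"
proof -
  interpret B: pre_cstar B using cB by (rule cstar_imp_pre)
  note c = carrier_Cb[OF cB]
  have cl [simp]: "f t \<in> carrier B" if "f \<in> carrier (Cb X B)" "t \<in> X" for f t
    using Cb_apply_closed[OF cB] that by blast
  have bounded: "\<exists>K\<ge>0. \<forall>t\<in>X. nrm B (f t) \<le> K" if f: "f \<in> carrier (Cb X B)" for f
  proof -
    obtain K where "\<forall>t\<in>X. nrm B (f t) \<le> K" using f unfolding c by auto
    then show ?thesis by (intro exI[of _ "max K 0"]) auto
  qed
  have tends: "((\<lambda>t'. nrm B (f t -[B] f t')) \<longlongrightarrow> 0) (at t within X)"
    if "f \<in> carrier (Cb X B)" "t \<in> X" for f t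
    using that unfolding c cont_on_def by auto
  \<comment> \<open>\<open>h\<close> is a modulus of continuity for \<open>f\<close>. For each
    operation it is assembled from the moduli of the arguments and their bounds.\<close>
  have closeI: "f \<in> carrier (Cb X B)"
    if h: "f \<in> extensional X" "\<And>t. t \<in> X \<Longrightarrow> f t \<in> carrier B" "\<And>t. t \<in> X \<Longrightarrow> nrm B (f t) \<le> K"
      "\<And>t t'. t \<in> X \<Longrightarrow> t' \<in> X \<Longrightarrow> nrm B (f t -[B] f t') \<le> h t t'"
      "\<And>t. t \<in> X \<Longrightarrow> (h t \<longlongrightarrow> 0) (at t within X)" for f K h
  proof -
    have "((\<lambda>t'. nrm B (f t -[B] f t')) \<longlongrightarrow> 0) (at t within X)" if t: "t \<in> X" for t
    proof (rule Lim_null_comparison[OF _ h(5)[OF t]])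
      show "\<forall>\<^sub>F t' in at t within X. norm (nrm B (f t -[B] f t')) \<le> h t t'"
        using h(2,4) t
        by (auto simp: eventually_at_filter)
    qed
    then show ?thesis unfolding c cont_on_def using h(1-3) by auto
  qed
  have pre: "pre_cstar (Cb X B)"
  proof (rule pre_cstar_jointly_isometric[where B = B and I = X and g = "\<lambda>t f. f t"])
    show "pre_cstar B" by (rule B.pre_cstar_axioms)
    show "czero (Cb X B) \<in> carrier (Cb X B)"
      by (rule closeI[of _ "0" "\<lambda>t t'. 0"]) (simp_all add: Cb_simps)
    fix x y c assume x: "x \<in> carrier (Cb X B)"
    obtain K where K: "K \<ge> 0" "\<forall>t\<in>X. nrm B (x t) \<le> K" using bounded[OF x] by auto
    show "c .[Cb X B] x \<in> carrier (Cb X B)"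
    proof (rule closeI[of _ "cmod c * K" "\<lambda>t t'. cmod c * nrm B (x t -[B] x t')"])
      show "((\<lambda>t'. cmod c * nrm B (x t -[B] x t')) \<longlongrightarrow> 0) (at t within X)" if "t \<in> X" for t
        using tends[OF x that] by (rule tendsto_mult_right_zero)
    qed (use x K in \<open>auto simp: Cb_simps B.nrm_scale B.scale_diff_right[symmetric] intro: mult_left_mono\<close>)
    show "adj (Cb X B) x \<in> carrier (Cb X B)"
    proof (rule closeI[of _ K "\<lambda>t t'. nrm B (x t -[B] x t')"])
      show "((\<lambda>t'. nrm B (x t -[B] x t')) \<longlongrightarrow> 0) (at t within X)" if "t \<in> X" for t
        using tends[OF x that] .
    qed (use x K in \<open>auto simp: Cb_simps B.adj_diff[symmetric]\<close>)
    show "\<exists>K. \<forall>t\<in>X. nrm B (x t) \<le> K" using K by auto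
    assume y: "y \<in> carrier (Cb X B)"
    obtain L where L: "L \<ge> 0" "\<forall>t\<in>X. nrm B (y t) \<le> L" using bounded[OF y] by auto
    show "x +[Cb X B] y \<in> carrier (Cb X B)"
    proof (rule closeI[of _ "K + L" "\<lambda>t t'. nrm B (x t -[B] x t') + nrm B (y t -[B] y t')"])
      show "((\<lambda>t'. nrm B (x t -[B] x t') + nrm B (y t -[B] y t')) \<longlongrightarrow> 0) (at t within X)" if "t \<in> X" for t
        using tendsto_add[OF tends[OF x that] tends[OF y that]] by simp
      show "nrm B ((x +[Cb X B] y) t) \<le> K + L" if t: "t \<in> X" for t
        using B.nrm_triangle[of "x t" "y t"] t x y K(2) L(2) by (fastforce simp: Cb_simps)
    qed (use x y in \<open>auto simp: Cb_simps B.add_diff_add intro: B.nrm_triangle\<close>)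
    show "x *[Cb X B] y \<in> carrier (Cb X B)"
    proof (rule closeI[of _ "K * L" "\<lambda>t t'. nrm B (x t -[B] x t') * L + K * nrm B (y t -[B] y t')"])
      show "((\<lambda>t'. nrm B (x t -[B] x t') * L + K * nrm B (y t -[B] y t')) \<longlongrightarrow> 0) (at t within X)"
        if "t \<in> X" for t
        using tendsto_add[OF tendsto_mult_left_zero[OF tends[OF x that]]
            tendsto_mult_right_zero[OF tends[OF y that]]] by simp
      show "nrm B ((x *[Cb X B] y) t) \<le> K * L" if t: "t \<in> X" for t
      proof -
        have "nrm B (x t *[B] y t) \<le> nrm B (x t) * nrm B (y t)" using t x y by (simp add: B.nrm_mult)
        also have "\<dots> \<le> K * L" using t x y K L by (intro mult_mono) auto
        finally show ?thesis using t by (simp add: Cb_simps)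
      qed
      show "nrm B ((x *[Cb X B] y) t -[B] (x *[Cb X B] y) t') \<le>
          nrm B (x t -[B] x t') * L + K * nrm B (y t -[B] y t')" if t: "t \<in> X" "t' \<in> X" for t t'
      proof -
        have "nrm B (x t *[B] y t -[B] x t' *[B] y t') \<le>
            nrm B ((x t -[B] x t') *[B] y t) + nrm B (x t' *[B] (y t -[B] y t'))"
          using t x y by (simp add: B.mult_diff_mult B.nrm_triangle)
        also have "\<dots> \<le> nrm B (x t -[B] x t') * nrm B (y t) + nrm B (x t') * nrm B (y t -[B] y t')"
          using t x y by (intro add_mono B.nrm_mult) auto
        also have "\<dots> \<le> nrm B (x t -[B] x t') * L + K * nrm B (y t -[B] y t')"
          using t x y K L by (intro add_mono mult_mono) auto
        finally show ?thesis using t by (simp add: Cb_simps)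
      qed
    qed (use x y in \<open>auto simp: Cb_simps\<close>)
    show "x = y" if "\<And>t. t \<in> X \<Longrightarrow> x t = y t" using Cb_eqI[OF cB x y that] .
  qed (use X in \<open>auto simp: Cb_simps nrm_Cb\<close>)
  interpret C: pre_cstar "Cb X B" by fact
  show ?thesis
  proof (rule C.cstar_algebraI)
    fix \<sigma> :: "nat \<Rightarrow> real \<Rightarrow> 'b"
    assume \<sigma>: "\<And>n. \<sigma> n \<in> carrier (Cb X B)"
      and cauchy: "\<And>e. e > 0 \<Longrightarrow> \<exists>N. \<forall>m\<ge>N. \<forall>n\<ge>N. nrm (Cb X B) (\<sigma> m -[Cb X B] \<sigma> n) < e"
    have d: "nrm B (\<sigma> m t -[B] \<sigma> n t) \<le> nrm (Cb X B) (\<sigma> m -[Cb X B] \<sigma> n)" if "t \<in> X" for m n t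
      using nrm_Cb_le[OF cB C.diff_closed[OF \<sigma> \<sigma>] that, of m n] that by (simp add: Cb_diff)
    have "\<exists>y\<in>carrier B. \<forall>e>0. \<exists>N. \<forall>n\<ge>N. nrm B (\<sigma> n t -[B] y) < e" if t: "t \<in> X" for t
    proof (rule cstar_complete[OF cB])
      show "\<sigma> n t \<in> carrier B" for n using \<sigma> t by simp
      show "\<exists>N. \<forall>m\<ge>N. \<forall>n\<ge>N. nrm B (\<sigma> m t -[B] \<sigma> n t) < e" if "e > 0" for e
        using cauchy[OF that] d[OF t] by (meson le_less_trans)
    qed
    then obtain y where y: "\<And>t. t \<in> X \<Longrightarrow> y t \<in> carrier B"
      "\<And>t e. t \<in> X \<Longrightarrow> e > 0 \<Longrightarrow> \<exists>N. \<forall>n\<ge>N. nrm B (\<sigma> n t -[B] y t) < e" by metis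
    have unif: "\<exists>N. \<forall>n\<ge>N. \<forall>t\<in>X. nrm B (\<sigma> n t -[B] y t) \<le> e" if e: "e > 0" for e
    proof -
      obtain N where N: "\<And>m n. m \<ge> N \<Longrightarrow> n \<ge> N \<Longrightarrow> nrm (Cb X B) (\<sigma> m -[Cb X B] \<sigma> n) < e / 2"
        using cauchy[of "e / 2"] e by auto
      have "nrm B (\<sigma> n t -[B] y t) \<le> e" if "n \<ge> N" "t \<in> X" for n t
      proof -
        obtain M where M: "\<And>m. m \<ge> M \<Longrightarrow> nrm B (\<sigma> m t -[B] y t) < e / 2"
          using y(2)[OF \<open>t \<in> X\<close>, of "e / 2"] e by auto
        \<comment> \<open>The index \<open>?m\<close> depends on \<open>t\<close>, but the resulting
          bound \<open>e\<close> does not; this makes the pointwise limit uniform.\<close>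
        let ?m = "max M N"
        have "nrm B (\<sigma> n t -[B] y t) \<le> nrm B (\<sigma> n t -[B] \<sigma> ?m t) + nrm B (\<sigma> ?m t -[B] y t)"
          using that \<sigma> y by (intro B.nrm_diff_triangle) auto
        then show ?thesis using N[of n ?m] M[of ?m] d[OF \<open>t \<in> X\<close>, of n ?m] that by simp
      qed
      then show ?thesis by blast
    qed
    let ?y = "restrict y X"
    have "?y \<in> carrier (Cb X B)"
      unfolding c
    proof (intro conjI)
      obtain N where N: "\<forall>t\<in>X. nrm B (\<sigma> N t -[B] y t) \<le> 1" using unif[of 1] by auto
      obtain K where K: "\<forall>t\<in>X. nrm B (\<sigma> N t) \<le> K" using bounded[OF \<sigma>[of N]] by auto
      have "nrm B (y t) \<le> K + 1" if "t \<in> X" for t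
        using B.nrm_le_add_diff[of "y t" "\<sigma> N t"] B.nrm_diff_commute[of "y t" "\<sigma> N t"]
          N[rule_format, OF that] K[rule_format, OF that] y(1)[OF that] cl[OF \<sigma> that, of N] by simp
      then show "\<exists>K. \<forall>t\<in>X. nrm B (?y t) \<le> K" by auto
      have yP: "?y \<in> X \<rightarrow> carrier B" using y by auto
      show "cont_on X B ?y"
        unfolding cont_on_iff[OF B.pre_cstar_axioms yP]
      proof (intro ballI allI impI)
        fix t and e :: real assume t: "t \<in> X" and e: "e > 0"
        obtain n where n: "\<forall>t\<in>X. nrm B (\<sigma> n t -[B] y t) \<le> e / 4" using unif[of "e / 4"] e by auto
        have "\<sigma> n \<in> X \<rightarrow> carrier B" using \<sigma> by auto
        moreover have "cont_on X B (\<sigma> n)" using \<sigma>[of n] unfolding c by simp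
        moreover have "e / 4 > 0" using e by simp
        ultimately obtain \<delta> where \<delta>: "\<delta> > 0" "\<forall>t'\<in>X. \<bar>t' - t\<bar> < \<delta> \<longrightarrow> nrm B (\<sigma> n t -[B] \<sigma> n t') < e / 4"
          unfolding cont_on_iff[OF B.pre_cstar_axioms \<open>\<sigma> n \<in> X \<rightarrow> carrier B\<close>]
          using t by blast
        have "nrm B (?y t -[B] ?y t') < e" if t': "t' \<in> X" "\<bar>t' - t\<bar> < \<delta>" for t'
        proof -
          have "nrm B (y t -[B] y t') \<le> nrm B (y t -[B] \<sigma> n t) + nrm B (\<sigma> n t -[B] y t')"
            using t t' y \<sigma> by (intro B.nrm_diff_triangle) auto
          also have "nrm B (\<sigma> n t -[B] y t') \<le> nrm B (\<sigma> n t -[B] \<sigma> n t') + nrm B (\<sigma> n t' -[B] y t')"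
            using t t' y \<sigma> by (intro B.nrm_diff_triangle) auto
          also have "nrm B (y t -[B] \<sigma> n t) = nrm B (\<sigma> n t -[B] y t)"
            using t y \<sigma> by (intro B.nrm_diff_commute) auto
          finally show ?thesis
            using bspec[OF n t] bspec[OF n t'(1)] \<delta>(2)[rule_format, OF t'] e t t' by simp
        qed
        then show "\<exists>d>0. \<forall>t'\<in>X. \<bar>t' - t\<bar> < d \<longrightarrow> nrm B (?y t -[B] ?y t') < e" using \<delta>(1) by blast
      qed
    qed (use y in auto)
    moreover have "\<exists>N. \<forall>n\<ge>N. nrm (Cb X B) (\<sigma> n -[Cb X B] ?y) < e" if e: "e > 0" for e
    proof -
      obtain N where N: "\<forall>n\<ge>N. \<forall>t\<in>X. nrm B (\<sigma> n t -[B] y t) \<le> e / 2" using unif[of "e / 2"] e by auto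
      have "nrm (Cb X B) (\<sigma> n -[Cb X B] ?y) \<le> e / 2" if "n \<ge> N" for n
        by (rule nrm_CbI[OF X]) (use that N in \<open>simp add: Cb_diff\<close>)
      then show ?thesis using e by (intro exI[of _ N]) fastforce
    qed
    ultimately show "\<exists>x\<in>carrier (Cb X B). \<forall>e>0. \<exists>N. \<forall>n\<ge>N. nrm (Cb X B) (\<sigma> n -[Cb X B] x) < e" by blast
  qed
qed

subsection \<open>Products and subalgebras\<close>

definition prod_cstar :: "'a cstar \<Rightarrow> 'b cstar \<Rightarrow> ('a \<times> 'b) cstar"
  where "prod_cstar A B = \<lparr>
    carrier = carrier A \<times> carrier B,
    czero = (czero A, czero B),
    cadd = (\<lambda>x y. (fst x +[A] fst y, snd x +[B] snd y)),
    cscale = (\<lambda>c x. (c .[A] fst x, c .[B] snd x)),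
    cmult = (\<lambda>x y. (fst x *[A] fst y, snd x *[B] snd y)),
    adj = (\<lambda>x. (adj A (fst x), adj B (snd x))),
    nrm = (\<lambda>x. max (nrm A (fst x)) (nrm B (snd x)))\<rparr>"

lemma prod_cstar_simps [simp]:
  "carrier (prod_cstar A B) = carrier A \<times> carrier B"
  "czero (prod_cstar A B) = (czero A, czero B)"
  "x +[prod_cstar A B] y = (fst x +[A] fst y, snd x +[B] snd y)"
  "c .[prod_cstar A B] x = (c .[A] fst x, c .[B] snd x)"
  "x *[prod_cstar A B] y = (fst x *[A] fst y, snd x *[B] snd y)"
  "x -[prod_cstar A B] y = (fst x -[A] fst y, snd x -[B] snd y)"
  "adj (prod_cstar A B) x = (adj A (fst x), adj B (snd x))"
  "nrm (prod_cstar A B) x = max (nrm A (fst x)) (nrm B (snd x))"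
  by (simp_all add: prod_cstar_def cdiff_def)

lemma cstar_prod:
  fixes A :: "'a cstar" and B :: "'b cstar"
  assumes cA: "csa A" and cB: "csa B"
  shows "csa (prod_cstar A B)"
proof -
  interpret A: pre_cstar A using cA by (rule cstar_imp_pre)
  interpret B: pre_cstar B using cB by (rule cstar_imp_pre)
  have "pre_cstar (prod_cstar A B)"
  proof
    fix x y assume xy: "x \<in> carrier (prod_cstar A B)" "y \<in> carrier (prod_cstar A B)"
    then show "nrm (prod_cstar A B) (x +[prod_cstar A B] y) \<le> nrm (prod_cstar A B) x + nrm (prod_cstar A B) y"
      using A.nrm_triangle[of "fst x" "fst y"] B.nrm_triangle[of "snd x" "snd y"] by auto
    have "nrm A (fst x *[A] fst y) \<le> max (nrm A (fst x)) (nrm B (snd x)) * max (nrm A (fst y)) (nrm B (snd y))"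
      by (rule order_trans[OF A.nrm_mult mult_mono]) (use xy in \<open>auto simp: le_max_iff_disj\<close>)
    moreover have "nrm B (snd x *[B] snd y) \<le> max (nrm A (fst x)) (nrm B (snd x)) * max (nrm A (fst y)) (nrm B (snd y))"
      by (rule order_trans[OF B.nrm_mult mult_mono]) (use xy in \<open>auto simp: le_max_iff_disj\<close>)
    ultimately show "nrm (prod_cstar A B) (x *[prod_cstar A B] y) \<le> nrm (prod_cstar A B) x * nrm (prod_cstar A B) y"
      by simp
    show "nrm (prod_cstar A B) (adj (prod_cstar A B) x *[prod_cstar A B] x) = (nrm (prod_cstar A B) x)\<^sup>2"
      using xy by (auto simp: A.cstar_identity B.cstar_identity max_def power2_le_iff_abs_le)
    show "0 \<le> nrm (prod_cstar A B) x" using xy by (auto simp: le_max_iff_disj)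
    show "nrm (prod_cstar A B) x = 0 \<longleftrightarrow> x = czero (prod_cstar A B)"
    proof -
      have "fst x \<in> carrier A" "snd x \<in> carrier B" using xy by auto
      then have "max (nrm A (fst x)) (nrm B (snd x)) = 0 \<longleftrightarrow> fst x = czero A \<and> snd x = czero B"
        using A.nrm_nonneg[of "fst x"] B.nrm_nonneg[of "snd x"]
        unfolding A.nrm_eq_0[OF \<open>fst x \<in> carrier A\<close>, symmetric] B.nrm_eq_0[OF \<open>snd x \<in> carrier B\<close>, symmetric]
        by linarith
      then show ?thesis by (simp add: prod_eq_iff)
    qed
    show "nrm (prod_cstar A B) (c .[prod_cstar A B] x) = cmod c * nrm (prod_cstar A B) x" for c
      using xy by (auto simp: A.nrm_scale B.nrm_scale max_mult_distrib_left)
  qed (auto simp: A.add_ac B.add_ac A.scale_add_left B.scale_add_left A.scale_add_right B.scale_add_right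
      A.mult_assoc B.mult_assoc A.mult_add_left B.mult_add_left A.mult_add_right B.mult_add_right
      A.adj_add B.adj_add A.adj_scale B.adj_scale A.adj_mult B.adj_mult)
  then interpret P: pre_cstar "prod_cstar A B" .
  show ?thesis
  proof (rule P.cstar_algebraI)
    fix \<sigma> :: "nat \<Rightarrow> 'a \<times> 'b"
    assume \<sigma>: "\<And>n. \<sigma> n \<in> carrier (prod_cstar A B)"
      and cauchy: "\<And>e. e > 0 \<Longrightarrow> \<exists>N. \<forall>m\<ge>N. \<forall>n\<ge>N. nrm (prod_cstar A B) (\<sigma> m -[prod_cstar A B] \<sigma> n) < e"
    have "\<exists>x\<in>carrier A. \<forall>e>0. \<exists>N. \<forall>n\<ge>N. nrm A (fst (\<sigma> n) -[A] x) < e"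
    proof (rule cstar_complete[OF cA])
      show "\<exists>N. \<forall>m\<ge>N. \<forall>n\<ge>N. nrm A (fst (\<sigma> m) -[A] fst (\<sigma> n)) < e" if "e > 0" for e
        using cauchy[OF that] by simp meson
    qed (use \<sigma> in \<open>simp add: mem_Times_iff\<close>)
    then obtain x where x: "x \<in> carrier A" "\<And>e. e > 0 \<Longrightarrow> \<exists>N. \<forall>n\<ge>N. nrm A (fst (\<sigma> n) -[A] x) < e" by auto
    have "\<exists>y\<in>carrier B. \<forall>e>0. \<exists>N. \<forall>n\<ge>N. nrm B (snd (\<sigma> n) -[B] y) < e"
    proof (rule cstar_complete[OF cB])
      show "\<exists>N. \<forall>m\<ge>N. \<forall>n\<ge>N. nrm B (snd (\<sigma> m) -[B] snd (\<sigma> n)) < e" if "e > 0" for e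
        using cauchy[OF that] by simp meson
    qed (use \<sigma> in \<open>simp add: mem_Times_iff\<close>)
    then obtain y where y: "y \<in> carrier B" "\<And>e. e > 0 \<Longrightarrow> \<exists>N. \<forall>n\<ge>N. nrm B (snd (\<sigma> n) -[B] y) < e" by auto
    have "\<exists>N. \<forall>n\<ge>N. nrm (prod_cstar A B) (\<sigma> n -[prod_cstar A B] (x, y)) < e" if e: "e > 0" for e
    proof -
      obtain N where "\<forall>n\<ge>N. nrm A (fst (\<sigma> n) -[A] x) < e" using x(2)[OF e] by auto
      moreover obtain M where "\<forall>n\<ge>M. nrm B (snd (\<sigma> n) -[B] y) < e" using y(2)[OF e] by auto
      ultimately show ?thesis by (intro exI[of _ "max M N"]) simp
    qed
    then show "\<exists>x\<in>carrier (prod_cstar A B). \<forall>e>0. \<exists>N. \<forall>n\<ge>N. nrm (prod_cstar A B) (\<sigma> n -[prod_cstar A B] x) < e"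
      using x(1) y(1) by (intro bexI[of _ "(x, y)"]) simp_all
  qed
qed

text \<open>Completeness carries over because \<open>E\<close> is closed: the limit of the image
  sequence stays in \<open>E\<close> and hence has a preimage. This serves to copy a separable
  subalgebra onto a set of real numbers.\<close>

lemma cstar_isometric_image:
  fixes C :: "'c cstar" and W :: "'w cstar"
  assumes cW: "csa W" and E: "cstar_subalgebra W E"
    and g: "bij_betw g (carrier C) E"
    and ops: "czero C \<in> carrier C" "g (czero C) = czero W"
      "\<And>x y. \<lbrakk>x \<in> carrier C; y \<in> carrier C\<rbrakk> \<Longrightarrow> x +[C] y \<in> carrier C \<and> g (x +[C] y) = g x +[W] g y"
      "\<And>c x. x \<in> carrier C \<Longrightarrow> c .[C] x \<in> carrier C \<and> g (c .[C] x) = c .[W] g x"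
      "\<And>x y. \<lbrakk>x \<in> carrier C; y \<in> carrier C\<rbrakk> \<Longrightarrow> x *[C] y \<in> carrier C \<and> g (x *[C] y) = g x *[W] g y"
      "\<And>x. x \<in> carrier C \<Longrightarrow> adj C x \<in> carrier C \<and> g (adj C x) = adj W (g x)"
      "\<And>x. x \<in> carrier C \<Longrightarrow> nrm C x = nrm W (g x)"
  shows "csa C"
proof -
  interpret W: pre_cstar W using cW by (rule cstar_imp_pre)
  have EW: "E \<subseteq> carrier W" and Ecl: "\<And>x. x \<in> carrier W \<Longrightarrow> (\<forall>e>0. \<exists>y\<in>E. nrm W (x -[W] y) < e) \<Longrightarrow> x \<in> E"
    using E by (auto simp: cstar_subalgebra_def W.closedin_ctop_iff)
  have gc: "g x \<in> carrier W" "g x \<in> E" if "x \<in> carrier C" for x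
    using g EW that by (auto simp: bij_betw_def)
  have "pre_cstar C"
    by (rule pre_cstar_jointly_isometric[where B = W and I = "UNIV :: unit set" and g = "\<lambda>_. g"])
      (use ops gc g in \<open>auto simp: W.pre_cstar_axioms bij_betw_def dest: inj_onD\<close>)
  then interpret C: pre_cstar C .
  have gd: "g (x -[C] y) = g x -[W] g y" if "x \<in> carrier C" "y \<in> carrier C" for x y
    using that ops(3,4) by (simp add: cdiff_def)
  show ?thesis
  proof (rule C.cstar_algebraI)
    fix \<sigma> :: "nat \<Rightarrow> 'c"
    assume \<sigma>: "\<And>n. \<sigma> n \<in> carrier C"
      and cauchy: "\<And>e. e > 0 \<Longrightarrow> \<exists>N. \<forall>m\<ge>N. \<forall>n\<ge>N. nrm C (\<sigma> m -[C] \<sigma> n) < e"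
    have "\<exists>w\<in>carrier W. \<forall>e>0. \<exists>N. \<forall>n\<ge>N. nrm W (g (\<sigma> n) -[W] w) < e"
      by (rule cstar_complete[OF cW]) (use \<sigma> cauchy gc gd ops(7) in auto)
    then obtain w where w: "w \<in> carrier W" "\<And>e. e > 0 \<Longrightarrow> \<exists>N. \<forall>n\<ge>N. nrm W (g (\<sigma> n) -[W] w) < e" by auto
    have "w \<in> E"
    proof (rule Ecl[OF w(1)], intro allI impI)
      fix e :: real assume "e > 0"
      then obtain N where "nrm W (g (\<sigma> N) -[W] w) < e" using w(2) by blast
      then show "\<exists>y\<in>E. nrm W (w -[W] y) < e"
        using gc \<sigma> w(1) by (intro bexI[of _ "g (\<sigma> N)"]) (auto simp: W.nrm_diff_commute)
    qed
    then obtain x where x: "x \<in> carrier C" "g x = w" using g by (auto simp: bij_betw_def)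
    then show "\<exists>x\<in>carrier C. \<forall>e>0. \<exists>N. \<forall>n\<ge>N. nrm C (\<sigma> n -[C] x) < e"
      using w(2) \<sigma> gd ops(7) by (intro bexI[of _ x]) auto
  qed
qed

section \<open>*-homomorphisms\<close>

lemma star_homD:
  assumes "star_hom C A p"
  shows "x \<in> carrier C \<Longrightarrow> p x \<in> carrier A"
    "\<lbrakk>x \<in> carrier C; y \<in> carrier C\<rbrakk> \<Longrightarrow> p (x +[C] y) = p x +[A] p y"
    "x \<in> carrier C \<Longrightarrow> p (c .[C] x) = c .[A] p x"
    "\<lbrakk>x \<in> carrier C; y \<in> carrier C\<rbrakk> \<Longrightarrow> p (x *[C] y) = p x *[A] p y"
    "x \<in> carrier C \<Longrightarrow> p (adj C x) = adj A (p x)"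
  using assms by (auto simp: star_hom_def)

lemma star_hom_diff:
  assumes "star_hom C A p" "csa C" "x \<in> carrier C" "y \<in> carrier C"
  shows "p (x -[C] y) = p x -[A] p y"
proof -
  interpret C: pre_cstar C using assms(2) by (rule cstar_imp_pre)
  show ?thesis using assms star_homD[OF assms(1)] by (simp add: cdiff_def)
qed

lemma star_hom_zero:
  assumes "star_hom C A p" "csa C" "csa A"
  shows "p (czero C) = czero A"
proof -
  interpret C: pre_cstar C using assms(2) by (rule cstar_imp_pre)
  interpret A: pre_cstar A using assms(3) by (rule cstar_imp_pre)
  show ?thesis
    using star_homD(3)[OF assms(1), of "czero C" 0] star_homD(1)[OF assms(1), of "czero C"] by simp
qed

lemma star_hom_compose:
  "\<lbrakk>star_hom C A p; star_hom D C q\<rbrakk> \<Longrightarrow> star_hom D A (p \<circ> q)"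
  by (auto simp: star_hom_def Pi_iff)

section \<open>Contractivity of *-homomorphisms\<close>

lemma (in pre_cstar) eqI_nrm:
  assumes x: "x \<in> carrier A" "y \<in> carrier A" and e: "\<And>e. e > 0 \<Longrightarrow> nrm A (x \<boxminus> y) \<le> e"
  shows "x = y"
proof -
  have "nrm A (x \<boxminus> y) \<le> 0" by (rule field_le_epsilon) (use e in simp)
  then have "nrm A (x \<boxminus> y) = 0" using nrm_nonneg[OF diff_closed[OF x]] by linarith
  then show ?thesis using x by (simp add: nrm_eq_0 diff_eq_0)
qed

text \<open>In the unitization the last equation reads
  \<open>(1 - k)\<^sup>2 = 1 - h\<^sup>2\<close>, so \<open>k\<close> is 1 minus a square root. It
  is found as a fixed point of \<open>f\<close>, which is a contraction with constant the norm of
  \<open>h\<close> on the closed set \<open>S\<close> of self-adjoint elements that commute with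
  \<open>h\<close> and have at most that norm.\<close>

lemma (in pre_cstar) square_root_fixpoint:
  assumes complete: "M.mcomplete" and h: "h \<in> carrier A" "adj A h = h" "nrm A h < 1"
  shows "\<exists>k\<in>carrier A. adj A k = k \<and> h \<boxdot> k = k \<boxdot> h \<and> 2 \<odot> k = h \<boxdot> h \<boxplus> k \<boxdot> k"
proof -
  define q where "q = nrm A h"
  have q: "0 \<le> q" "q < 1" using h by (auto simp: q_def)
  define S where "S = {k \<in> carrier A. adj A k = k \<and> h \<boxdot> k = k \<boxdot> h \<and> nrm A k \<le> q}"
  define f where "f = (\<lambda>k. (1 / 2) \<odot> (h \<boxdot> h \<boxplus> k \<boxdot> k))"
  have SA: "S \<subseteq> carrier A" by (auto simp: S_def)
  have fS: "f k \<in> S" if "k \<in> S" for k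
  proof -
    have k: "k \<in> carrier A" "adj A k = k" "h \<boxdot> k = k \<boxdot> h" "nrm A k \<le> q" using that by (auto simp: S_def)
    have "h \<boxdot> (k \<boxdot> k) = k \<boxdot> k \<boxdot> h" using k h by (metis mult_assoc)
    then have "h \<boxdot> f k = f k \<boxdot> h"
      using k h by (simp add: f_def mult_add_left mult_add_right mult_assoc)
    moreover have "nrm A (f k) \<le> q"
    proof -
      have "nrm A (h \<boxdot> h \<boxplus> k \<boxdot> k) \<le> nrm A (h \<boxdot> h) + nrm A (k \<boxdot> k)" using h k by (intro nrm_triangle) auto
      also have "\<dots> \<le> nrm A h * nrm A h + nrm A k * nrm A k" using h k by (intro add_mono nrm_mult) auto
      also have "\<dots> \<le> q * q + q * q" using k q unfolding q_def[symmetric] by (intro add_mono mult_mono) auto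
      also have "\<dots> \<le> 2 * q" using q by (simp add: mult_left_le)
      finally show ?thesis using h k by (simp add: f_def nrm_scale norm_divide)
    qed
    ultimately show ?thesis using h k by (simp add: S_def f_def adj_scale adj_add adj_mult)
  qed
  have contr: "nrm A (f k \<boxminus> f l) \<le> q * nrm A (k \<boxminus> l)" if "k \<in> S" "l \<in> S" for k l
  proof -
    have k: "k \<in> carrier A" "l \<in> carrier A" "nrm A k \<le> q" "nrm A l \<le> q" using that by (auto simp: S_def)
    have "f k \<boxminus> f l = (1 / 2) \<odot> (k \<boxdot> k \<boxminus> l \<boxdot> l)"
      using h k by (simp add: f_def scale_diff_right[symmetric] add_diff_add)
    also have "k \<boxdot> k \<boxminus> l \<boxdot> l = (k \<boxminus> l) \<boxdot> k \<boxplus> l \<boxdot> (k \<boxminus> l)" using k by (simp add: mult_diff_mult)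
    finally have "nrm A (f k \<boxminus> f l) = (1 / 2) * nrm A ((k \<boxminus> l) \<boxdot> k \<boxplus> l \<boxdot> (k \<boxminus> l))"
      using k by (simp add: nrm_scale norm_divide)
    also have "nrm A ((k \<boxminus> l) \<boxdot> k \<boxplus> l \<boxdot> (k \<boxminus> l)) \<le> nrm A ((k \<boxminus> l) \<boxdot> k) + nrm A (l \<boxdot> (k \<boxminus> l))"
      using k by (intro nrm_triangle) auto
    also have "\<dots> \<le> nrm A (k \<boxminus> l) * nrm A k + nrm A l * nrm A (k \<boxminus> l)"
      using k by (intro add_mono nrm_mult) auto
    also have "\<dots> \<le> nrm A (k \<boxminus> l) * q + q * nrm A (k \<boxminus> l)"
      using k q by (intro add_mono mult_mono) auto
    finally show ?thesis by (simp add: algebra_simps)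
  qed
  have closed: "closedin M.mtopology S"
    unfolding ctop_def[symmetric] closedin_ctop_iff
  proof (intro conjI SA ballI impI)
    fix x assume x: "x \<in> carrier A" and lim: "\<forall>e>0. \<exists>y\<in>S. nrm A (x \<boxminus> y) < e"
    have adj: "adj A x = x"
    proof (rule eqI_nrm)
      fix e :: real assume "e > 0"
      obtain y where y: "y \<in> S" "nrm A (x \<boxminus> y) < e / 2" using lim \<open>e > 0\<close> by (meson half_gt_zero)
      then have y': "y \<in> carrier A" "adj A y = y" by (auto simp: S_def)
      have "nrm A (adj A x \<boxminus> x) \<le> nrm A (adj A x \<boxminus> y) + nrm A (y \<boxminus> x)"
        using x y' by (intro nrm_diff_triangle) auto
      also have "adj A x \<boxminus> y = adj A (x \<boxminus> y)" using x y' by (simp add: adj_diff)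
      finally show "nrm A (adj A x \<boxminus> x) \<le> e" using x y y' by (simp add: nrm_diff_commute)
    qed (use x in simp_all)
    have comm: "h \<boxdot> x = x \<boxdot> h"
    proof (rule eqI_nrm)
      fix e :: real assume "e > 0"
      obtain y where y: "y \<in> S" "nrm A (x \<boxminus> y) < e / 2" using lim \<open>e > 0\<close> by (meson half_gt_zero)
      then have y': "y \<in> carrier A" "h \<boxdot> y = y \<boxdot> h" by (auto simp: S_def)
      have "h \<boxdot> x \<boxminus> x \<boxdot> h = h \<boxdot> (x \<boxminus> y) \<boxplus> (y \<boxminus> x) \<boxdot> h"
        using x y' h by (simp add: mult_diff_left mult_diff_right diff_diff_add)
      then have "nrm A (h \<boxdot> x \<boxminus> x \<boxdot> h) \<le> nrm A (h \<boxdot> (x \<boxminus> y)) + nrm A ((y \<boxminus> x) \<boxdot> h)"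
        using x y' h by (simp add: nrm_triangle)
      also have "\<dots> \<le> nrm A h * nrm A (x \<boxminus> y) + nrm A (y \<boxminus> x) * nrm A h"
        using x y' h by (intro add_mono nrm_mult) auto
      also have "\<dots> \<le> 1 * nrm A (x \<boxminus> y) + nrm A (x \<boxminus> y) * 1"
        using x y' h by (intro add_mono mult_mono) (auto simp: nrm_diff_commute[of y x])
      finally show "nrm A (h \<boxdot> x \<boxminus> x \<boxdot> h) \<le> e" using y by simp
    qed (use x h in simp_all)
    have "nrm A x \<le> q + e" if "e > 0" for e
    proof -
      obtain y where y: "y \<in> S" "nrm A (x \<boxminus> y) < e" using lim \<open>e > 0\<close> by blast
      then show ?thesis using nrm_le_add_diff[OF x, of y] by (auto simp: S_def)
    qed
    then have "nrm A x \<le> q" by (rule field_le_epsilon)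
    then show "x \<in> S" using x adj comm by (simp add: S_def)
  qed
  interpret sub: Submetric "carrier A" "cdist A" S
    by unfold_locales (rule SA)
  have "sub.sub.mcomplete"
    using sub.closedin_mcomplete_imp_mcomplete closed complete by blast
  moreover have "czero A \<in> S" using h q by (simp add: S_def)
  moreover have "cdist A (f x) (f y) \<le> q * cdist A x y" if "x \<in> S" "y \<in> S" for x y
    using contr[OF that] fS that SA by (auto simp: cdist_def)
  ultimately obtain k where k: "k \<in> S" "f k = k"
    using sub.sub.Banach_fixedpoint_thm[of f q] fS q by auto
  then have kc: "k \<in> carrier A" using SA by auto
  have "2 \<odot> f k = h \<boxdot> h \<boxplus> k \<boxdot> k" using kc h by (simp add: f_def)
  then show ?thesis using k kc by (auto simp: S_def)
qed

text \<open>
  If \<open>h\<close> is self-adjoint with norm less than 1 and \<open>h\<^sup>2 + (1 - k)\<^sup>2 = 1\<close>, then \<open>h + i(1 - k)\<close> is a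
  unitary of the unitization. Its image under \<open>p\<close> acts isometrically, so \<open>p h\<close>, the average of that
  image and its adjoint, has norm at most 1. This avoids spectral theory.
\<close>

lemma star_hom_nrm_le_1:
  assumes cC: "csa C" and cA: "csa A" and p: "star_hom C A p"
    and h: "h \<in> carrier C" "adj C h = h" "nrm C h < 1"
  shows "nrm A (p h) \<le> 1"
proof -
  interpret C: pre_cstar C using cC by (rule cstar_imp_pre)
  interpret A: pre_cstar A using cA by (rule cstar_imp_pre)
  note pD = star_homD[OF p]
  obtain k where k: "k \<in> carrier C" "adj C k = k" "h *[C] k = k *[C] h"
      "2 .[C] k = h *[C] h +[C] k *[C] k"
    using C.square_root_fixpoint[OF cstar_algebra.complete[OF cC] h] by auto
  define H K where "H = p h" and "K = p k"
  have [simp]: "H \<in> carrier A" "K \<in> carrier A" using h k pD by (auto simp: H_def K_def)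
  have adjHK [simp]: "adj A H = H" "adj A K = K"
    using h k pD(5)[of h] pD(5)[of k] by (auto simp: H_def K_def)
  have comm: "H *[A] K = K *[A] H"
    using k(3) pD(4)[OF h(1) k(1)] pD(4)[OF k(1) h(1)] by (simp add: H_def K_def)
  have sum: "2 .[A] K = H *[A] H +[A] K *[A] K"
    using k h pD(3)[OF k(1), of 2] by (simp add: H_def K_def pD)
  \<comment> \<open>This is the unitary \<open>H + c (1 - K)\<close> acting by left multiplication
    on \<open>x\<close>; written as an action it makes sense without a unit. The mixed terms cancel
    because \<open>H\<close> and \<open>K\<close> commute and \<open>c\<close> is imaginary, and
    \<open>aabb\<close> is the equation \<open>H\<^sup>2 + (1 - K)\<^sup>2 = 1\<close> tested
    against \<open>x\<close>.\<close>
  have U: "nrm A (H *[A] x +[A] c .[A] (x -[A] K *[A] x)) = nrm A x"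
    if [simp]: "x \<in> carrier A" and c: "c = \<i> \<or> c = - \<i>" for x c
  proof -
    let ?a = "H *[A] x" and ?b = "x -[A] K *[A] x" and ?y = "adj A x"
    have ab: "adj A ?a *[A] ?b = adj A ?b *[A] ?a"
    proof -
      have "?y *[A] (H *[A] (K *[A] x)) = ?y *[A] (K *[A] (H *[A] x))"
        by (simp add: comm A.mult_assoc[symmetric])
      then show ?thesis
        by (simp add: A.adj_mult A.adj_diff A.mult_diff_left A.mult_diff_right A.mult_assoc)
    qed
    have aabb: "adj A ?a *[A] ?a +[A] adj A ?b *[A] ?b = ?y *[A] x"
    proof -
      let ?u = "?y *[A] (K *[A] x)"
      have "?u +[A] ?u = 2 .[A] ?u" using A.scale_add_left[of ?u 1 1] by simp
      also have "\<dots> = ?y *[A] ((2 .[A] K) *[A] x)" by simp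
      also have "\<dots> = ?y *[A] (H *[A] (H *[A] x)) +[A] ?y *[A] (K *[A] (K *[A] x))"
        unfolding sum by (simp add: A.mult_add_left A.mult_add_right A.mult_assoc)
      finally have *: "?u +[A] ?u = \<dots>" .
      have bb: "adj A ?b *[A] ?b = ?y *[A] x -[A] ?u -[A] (?u -[A] ?y *[A] (K *[A] (K *[A] x)))"
        by (simp add: A.adj_mult A.adj_diff A.mult_diff_left A.mult_diff_right A.mult_assoc)
      have aa: "adj A ?a *[A] ?a = ?y *[A] (H *[A] (H *[A] x))"
        by (simp add: A.adj_mult A.mult_assoc)
      have lin: "h +[A] (x -[A] u -[A] (u -[A] k)) = x"
        if "u +[A] u = h +[A] k" "u \<in> carrier A" "h \<in> carrier A" "k \<in> carrier A" "x \<in> carrier A" for u h k x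
      proof -
        have "h +[A] (x -[A] u -[A] (u -[A] k)) = (h +[A] k) +[A] x -[A] (u +[A] u)"
          using that(2-) by (simp add: A.group_simps)
        then show ?thesis using that by (simp add: A.group_simps)
      qed
      show ?thesis unfolding bb aa by (rule lin[OF *]) simp_all
    qed
    have cc: "cnj c * c = 1" "cnj c = - c" using c by auto
    have "adj A (?a +[A] c .[A] ?b) *[A] (?a +[A] c .[A] ?b) =
        (adj A ?a *[A] ?a +[A] c .[A] (adj A ?a *[A] ?b)) +[A]
        (cnj c .[A] (adj A ?b *[A] ?a) +[A] (cnj c * c) .[A] (adj A ?b *[A] ?b))"
    proof -
      have *: "adj A (a +[A] c .[A] b) *[A] (a +[A] c .[A] b) =
          (adj A a *[A] a +[A] c .[A] (adj A a *[A] b)) +[A]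
          (cnj c .[A] (adj A b *[A] a) +[A] (cnj c * c) .[A] (adj A b *[A] b))"
        if "a \<in> carrier A" "b \<in> carrier A" for a b
        using that by (simp add: A.adj_add A.adj_scale A.mult_add_left A.mult_add_right
            A.scale_add_right A.add_ac mult.commute)
      show ?thesis by (rule *) simp_all
    qed
    also have "\<dots> = (adj A ?a *[A] ?a +[A] adj A ?b *[A] ?b) +[A]
        (c .[A] (adj A ?b *[A] ?a) +[A] (- c) .[A] (adj A ?b *[A] ?a))"
      unfolding ab cc(1) unfolding cc(2) by (simp add: A.add_ac)
    also have "c .[A] (adj A ?b *[A] ?a) +[A] (- c) .[A] (adj A ?b *[A] ?a) = czero A"
      using A.scale_add_left[of "adj A ?b *[A] ?a" c "- c"] by simp
    finally have "adj A (?a +[A] c .[A] ?b) *[A] (?a +[A] c .[A] ?b) = ?y *[A] x"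
      unfolding aabb by simp
    then have "(nrm A (?a +[A] c .[A] ?b))\<^sup>2 = (nrm A x)\<^sup>2"
      using A.cstar_identity[of "?a +[A] c .[A] ?b"] A.cstar_identity[of x] by simp
    then show ?thesis by (simp add: power2_eq_iff_nonneg)
  qed
  \<comment> \<open>The two isometries are now applied to \<open>x = H\<close>. Their images add up
    to twice the square of \<open>H\<close>, so the square of the norm of \<open>H\<close> is at
    most the norm itself.\<close>
  let ?b = "H -[A] K *[A] H"
  have "(H *[A] H +[A] \<i> .[A] ?b) +[A] (H *[A] H +[A] (- \<i>) .[A] ?b) =
      (H *[A] H +[A] H *[A] H) +[A] (\<i> .[A] ?b +[A] (- \<i>) .[A] ?b)"
    by (simp add: A.add_ac)
  also have "\<i> .[A] ?b +[A] (- \<i>) .[A] ?b = czero A"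
    using A.scale_add_left[of ?b "\<i>" "- \<i>"] by simp
  finally have "2 .[A] (H *[A] H) = (H *[A] H +[A] \<i> .[A] ?b) +[A] (H *[A] H +[A] (- \<i>) .[A] ?b)"
    using A.scale_add_left[of "H *[A] H" 1 1] by simp
  then have "2 * nrm A (H *[A] H) =
      nrm A ((H *[A] H +[A] \<i> .[A] ?b) +[A] (H *[A] H +[A] (- \<i>) .[A] ?b))"
    using A.nrm_scale[of "H *[A] H" 2] by simp
  also have "\<dots> \<le> nrm A H + nrm A H"
    by (rule order_trans[OF A.nrm_triangle]) (simp_all add: U)
  finally have "nrm A H * nrm A H \<le> nrm A H"
    using A.cstar_identity[of H] by (simp add: power2_eq_square)
  then have "nrm A H \<le> 1"
    using A.nrm_nonneg[OF \<open>H \<in> carrier A\<close>] by (cases "nrm A H = 0") auto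
  then show ?thesis by (simp add: H_def)
qed

text \<open>A self-adjoint element is scaled to norm below 1, with \<open>e\<close> as the margin,
  where \<open>star_hom_nrm_le_1\<close> applies. The C*-identity on both sides reduces a general
  \<open>x\<close> to the self-adjoint product of its adjoint with \<open>x\<close>.\<close>

theorem star_hom_contractive:
  assumes cC: "csa C" and cA: "csa A" and p: "star_hom C A p"
    and x: "x \<in> carrier C"
  shows "nrm A (p x) \<le> nrm C x"
proof -
  interpret C: pre_cstar C using cC by (rule cstar_imp_pre)
  interpret A: pre_cstar A using cA by (rule cstar_imp_pre)
  note pD = star_homD[OF p]
  have sa: "nrm A (p h) \<le> nrm C h" if h: "h \<in> carrier C" "adj C h = h" for h
  proof (rule field_le_epsilon)
    fix e :: real assume "e > 0"
    let ?r = "nrm C h + e"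
    have r: "?r > 0" using \<open>e > 0\<close> h C.nrm_nonneg[of h] by linarith
    let ?c = "complex_of_real (inverse ?r)"
    have nc: "cmod ?c = inverse ?r" using r by (simp del: of_real_inverse)
    have "nrm A (p (?c .[C] h)) \<le> 1"
    proof (rule star_hom_nrm_le_1[OF cC cA p])
      show "nrm C (?c .[C] h) < 1"
        unfolding C.nrm_scale[OF h(1)] nc using r \<open>e > 0\<close> by (simp add: field_simps)
    qed (use h in \<open>auto simp: C.adj_scale\<close>)
    then have "inverse ?r * nrm A (p h) \<le> 1"
      unfolding pD(3)[OF h(1)] A.nrm_scale[OF pD(1)[OF h(1)]] nc .
    then show "nrm A (p h) \<le> nrm C h + e" using r by (simp add: field_simps)
  qed
  have "(nrm A (p x))\<^sup>2 = nrm A (p (adj C x *[C] x))"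
    using x pD by (simp add: A.cstar_identity)
  also have "\<dots> \<le> nrm C (adj C x *[C] x)"
    using x by (intro sa) (auto simp: C.adj_mult)
  finally show ?thesis
    using x pD(1)[OF x] by (simp add: C.cstar_identity power2_le_iff_abs_le)
qed

lemma star_hom_continuous:
  assumes "csa C" "csa A" "star_hom C A p"
  shows "continuous_map (ctop C) (ctop A) p"
proof -
  interpret C: pre_cstar C using assms(1) by (rule cstar_imp_pre)
  show ?thesis
    unfolding continuous_ctop_iff[OF assms(1,2)]
  proof (intro conjI ballI allI impI)
    show "p \<in> carrier C \<rightarrow> carrier A" using assms(3) by (auto simp: star_hom_def)
    fix a and e :: real assume "a \<in> carrier C" "e > 0"
    then show "\<exists>d>0. \<forall>b\<in>carrier C. nrm C (a -[C] b) < d \<longrightarrow> nrm A (p a -[A] p b) < e"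
    proof (intro exI[of _ e] conjI ballI impI)
      fix b assume b: "b \<in> carrier C" "nrm C (a -[C] b) < e"
      then show "nrm A (p a -[A] p b) < e"
        using star_hom_contractive[OF assms, of "a -[C] b"] star_hom_diff[OF assms(3,1), of a b]
          \<open>a \<in> carrier C\<close> by simp
    qed
  qed
qed

subsection \<open>C*-subalgebras\<close>

abbreviation sub_cstar :: "'a cstar \<Rightarrow> 'a set \<Rightarrow> 'a cstar"
  where "sub_cstar W E \<equiv> W\<lparr>carrier := E\<rparr>"

lemma sub_cstar_diff [simp]: "x -[sub_cstar W E] y = x -[W] y"
  by (simp add: cdiff_def)

lemma subalgebraD:
  assumes "csa W" "cstar_subalgebra W E"
  shows "E \<subseteq> carrier W" "czero W \<in> E" "\<lbrakk>x \<in> E; y \<in> E\<rbrakk> \<Longrightarrow> x +[W] y \<in> E" "x \<in> E \<Longrightarrow> c .[W] x \<in> E"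
    "\<lbrakk>x \<in> E; y \<in> E\<rbrakk> \<Longrightarrow> x *[W] y \<in> E" "x \<in> E \<Longrightarrow> adj W x \<in> E" "\<lbrakk>x \<in> E; y \<in> E\<rbrakk> \<Longrightarrow> x -[W] y \<in> E"
proof -
  interpret W: pre_cstar W using assms(1) by (rule cstar_imp_pre)
  show "E \<subseteq> carrier W" using assms(2) by (simp add: cstar_subalgebra_def W.closedin_ctop_iff)
qed (use assms(2) in \<open>simp_all add: cstar_subalgebra_def cdiff_def\<close>)

section \<open>Continuous homogeneous sections\<close>

lemma integral_periodic_shift:
  fixes h :: "real \<Rightarrow> 'a::banach"
  assumes per: "\<And>\<theta>. h (\<theta> + 2 * pi) = h \<theta>" and cont: "continuous_on UNIV h"
    and \<alpha>: "0 \<le> \<alpha>" "\<alpha> \<le> 2 * pi"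
  shows "integral {0..2 * pi} (\<lambda>\<theta>. h (\<theta> - \<alpha>)) = integral {0..2 * pi} h"
proof -
  have int: "h integrable_on {a..b}" for a b
    by (rule integrable_continuous_real) (rule continuous_on_subset[OF cont], simp)
  have "integral {0..2 * pi} (\<lambda>\<theta>. h (\<theta> - \<alpha>)) = integral {- \<alpha>..2 * pi - \<alpha>} h"
    using integral_shift_Icc_real[of 0 "2 * pi" h "- \<alpha>"] by (simp add: o_def)
  also have "\<dots> = integral {- \<alpha>..0} h + integral {0..2 * pi - \<alpha>} h"
    using \<alpha> by (intro Henstock_Kurzweil_Integration.integral_combine[symmetric] int) auto
  also have "integral {- \<alpha>..0} h = integral {- \<alpha>..0} (h \<circ> ((+) (2 * pi)))"
    using per by (intro arg_cong[where f = "integral {- \<alpha>..0}"]) (auto simp: o_def add.commute)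
  also have "\<dots> = integral {2 * pi - \<alpha>..2 * pi} h"
    using integral_shift_Icc_real[of "- \<alpha>" 0 h "2 * pi"] by (simp add: add.commute)
  also have "integral {2 * pi - \<alpha>..2 * pi} h + integral {0..2 * pi - \<alpha>} h = integral {0..2 * pi} h"
    using \<alpha> Henstock_Kurzweil_Integration.integral_combine[OF _ _ int, of 0 "2 * pi - \<alpha>" "2 * pi"]
    by (simp add: add.commute)
  finally show ?thesis .
qed

text \<open>
  A bump around the points of the circle of radius \<open>\<parallel>a\<parallel>\<close> through \<open>x\<close>. Integrating it against the
  character \<open>cis\<close> produces a weight that is equivariant under scalars.
\<close>

definition bump :: "'a cstar \<Rightarrow> 'a \<Rightarrow> 'a \<Rightarrow> real \<Rightarrow> real"
  where "bump A x a \<theta> = max 0 (nrm A a / 16 - nrm A (a -[A] (cis \<theta> * of_real (nrm A a)) .[A] x))"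

definition bump_avg :: "'a cstar \<Rightarrow> 'a \<Rightarrow> 'a \<Rightarrow> real"
  where "bump_avg A x a = integral {0..2 * pi} (bump A x a)"

text \<open>\<open>bump_avg\<close> and \<open>bump_phase\<close> are Fourier coefficients of the
  bump, of order 0 and 1. A scalar \<open>c\<close> in front of \<open>a\<close> shifts the bump by
  the argument of \<open>c\<close>, so the former is multiplied by the modulus of \<open>c\<close>
  and the latter by \<open>c\<close> itself.\<close>

definition bump_phase :: "'a cstar \<Rightarrow> 'a \<Rightarrow> 'a \<Rightarrow> complex"
  where "bump_phase A x a = integral {0..2 * pi} (\<lambda>\<theta>. cis \<theta> * of_real (bump A x a \<theta>))"

context pre_cstar
begin

lemma bump_bounds:
  assumes "x \<in> carrier A" "a \<in> carrier A"
  shows "0 \<le> bump A x a \<theta>" "bump A x a \<theta> \<le> nrm A a / 16"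
proof -
  show "0 \<le> bump A x a \<theta>" by (simp add: bump_def)
  have "0 \<le> nrm A (a \<boxminus> (cis \<theta> * of_real (nrm A a)) \<odot> x)" "0 \<le> nrm A a"
    using assms by (auto intro!: nrm_nonneg)
  then show "bump A x a \<theta> \<le> nrm A a / 16" unfolding bump_def by linarith
qed

lemma abs_max0_diff_le: "\<bar>max 0 r - max 0 s\<bar> \<le> \<bar>r - s :: real\<bar>"
  by (auto simp: max_def)

lemma bump_lipschitz:
  assumes x: "x \<in> carrier A" and a: "a \<in> carrier A" "b \<in> carrier A"
  shows "\<bar>bump A x a \<theta> - bump A x b \<theta>\<bar> \<le> (2 + nrm A x) * nrm A (a \<boxminus> b)"
proof -
  let ?f = "\<lambda>a. (cis \<theta> * of_real (nrm A a)) \<odot> x"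
  have d: "\<bar>nrm A a - nrm A b\<bar> \<le> nrm A (a \<boxminus> b)" using a by (rule nrm_diff_ineq)
  have "?f b \<boxminus> ?f a = (cis \<theta> * of_real (nrm A b - nrm A a)) \<odot> x"
    using x scale_diff_left[of x "cis \<theta> * of_real (nrm A b)" "cis \<theta> * of_real (nrm A a)"]
    by (simp add: algebra_simps)
  then have f: "nrm A (?f b \<boxminus> ?f a) = \<bar>nrm A b - nrm A a\<bar> * nrm A x"
    using x by (simp only: nrm_scale norm_mult norm_of_real) simp
  have "(a \<boxminus> ?f a) \<boxminus> (b \<boxminus> ?f b) = (a \<boxminus> b) \<boxplus> (?f b \<boxminus> ?f a)"
    using x a by (simp add: group_simps)
  then have "nrm A ((a \<boxminus> ?f a) \<boxminus> (b \<boxminus> ?f b)) \<le> nrm A (a \<boxminus> b) + nrm A (?f b \<boxminus> ?f a)"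
    using x a by (simp add: nrm_triangle)
  also have "\<dots> \<le> nrm A (a \<boxminus> b) + nrm A (a \<boxminus> b) * nrm A x"
    unfolding f using d x by (intro add_mono mult_mono) auto
  finally have *: "\<bar>nrm A (a \<boxminus> ?f a) - nrm A (b \<boxminus> ?f b)\<bar> \<le> (1 + nrm A x) * nrm A (a \<boxminus> b)"
    using nrm_diff_ineq[of "a \<boxminus> ?f a" "b \<boxminus> ?f b"] x a by (simp add: algebra_simps)
  have "\<bar>bump A x a \<theta> - bump A x b \<theta>\<bar> \<le>
      \<bar>(nrm A a / 16 - nrm A (a \<boxminus> ?f a)) - (nrm A b / 16 - nrm A (b \<boxminus> ?f b))\<bar>"
    unfolding bump_def by (rule abs_max0_diff_le)
  also have "\<dots> \<le> (2 + nrm A x) * nrm A (a \<boxminus> b)"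
    using * d by (simp add: algebra_simps abs_le_iff)
  finally show ?thesis .
qed

lemma bump_continuous:
  assumes x: "x \<in> carrier A" and a: "a \<in> carrier A"
  shows "continuous_on S (bump A x a)"
proof -
  have "continuous_on S (\<lambda>\<theta>. nrm A (a \<boxminus> (cis \<theta> * of_real (nrm A a)) \<odot> x))"
    unfolding continuous_on_iff
  proof (intro ballI allI impI)
    fix \<theta> e :: real assume \<theta>: "\<theta> \<in> S" and e: "e > 0"
    let ?K = "nrm A a * nrm A x + 1"
    have K: "?K > 0" using x a nrm_nonneg[OF x] nrm_nonneg[OF a] by (simp add: add_nonneg_pos)
    have "continuous_on S cis" by (intro continuous_intros)
    moreover have "e / ?K > 0" using e K by simp
    ultimately obtain d where d: "d > 0" "\<And>\<theta>'. \<theta>' \<in> S \<Longrightarrow> dist \<theta>' \<theta> < d \<Longrightarrow> dist (cis \<theta>') (cis \<theta>) < e / ?K"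
      unfolding continuous_on_iff using \<theta> by blast
    have "dist (nrm A (a \<boxminus> (cis \<theta>' * of_real (nrm A a)) \<odot> x)) (nrm A (a \<boxminus> (cis \<theta> * of_real (nrm A a)) \<odot> x)) < e"
      if t: "\<theta>' \<in> S" "dist \<theta>' \<theta> < d" for \<theta>'
    proof -
      let ?f = "\<lambda>\<theta>. (cis \<theta> * of_real (nrm A a)) \<odot> x"
      have "(a \<boxminus> ?f \<theta>') \<boxminus> (a \<boxminus> ?f \<theta>) = ?f \<theta> \<boxminus> ?f \<theta>'" using x a by (simp add: group_simps)
      also have "\<dots> = ((cis \<theta> - cis \<theta>') * of_real (nrm A a)) \<odot> x"
        using x by (simp add: left_diff_distrib scale_diff_left)
      finally have "nrm A ((a \<boxminus> ?f \<theta>') \<boxminus> (a \<boxminus> ?f \<theta>)) = cmod (cis \<theta> - cis \<theta>') * nrm A a * nrm A x"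
        using x a by (simp only: nrm_scale norm_mult norm_of_real) simp
      also have "\<dots> \<le> cmod (cis \<theta> - cis \<theta>') * ?K"
        by (simp add: mult.assoc algebra_simps)
      also have "\<dots> < e" using d(2)[OF t] K by (simp add: dist_norm norm_minus_commute field_simps)
      finally show ?thesis
        using nrm_diff_ineq[of "a \<boxminus> ?f \<theta>'" "a \<boxminus> ?f \<theta>"] x a by (simp add: dist_real_def)
    qed
    then show "\<exists>d>0. \<forall>\<theta>'\<in>S. dist \<theta>' \<theta> < d \<longrightarrow>
        dist (nrm A (a \<boxminus> (cis \<theta>' * of_real (nrm A a)) \<odot> x)) (nrm A (a \<boxminus> (cis \<theta> * of_real (nrm A a)) \<odot> x)) < e"
      using d(1) by blast
  qed
  then show ?thesis unfolding bump_def by (intro continuous_intros)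
qed

lemma bump_integrable:
  assumes "x \<in> carrier A" "a \<in> carrier A"
  shows "bump A x a integrable_on {r..s}"
  by (intro integrable_continuous_real bump_continuous assms)

lemma bump_phase_integrable:
  fixes z :: "real \<Rightarrow> complex"
  assumes "x \<in> carrier A" "a \<in> carrier A" "continuous_on UNIV z"
  shows "(\<lambda>\<theta>. z \<theta> * of_real (bump A x a \<theta>)) integrable_on {r..s}"
  by (intro integrable_continuous_real continuous_intros bump_continuous assms(1,2)
      continuous_on_subset[OF assms(3)] subset_UNIV)

lemma bump_avg_nonneg: "\<lbrakk>x \<in> carrier A; a \<in> carrier A\<rbrakk> \<Longrightarrow> 0 \<le> bump_avg A x a"
  unfolding bump_avg_def
  by (intro Henstock_Kurzweil_Integration.integral_nonneg bump_integrable bump_bounds) auto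

lemma bump_phase_bound:
  assumes x: "x \<in> carrier A" and a: "a \<in> carrier A"
  shows "cmod (bump_phase A x a) \<le> bump_avg A x a"
  unfolding bump_phase_def bump_avg_def
  using bump_bounds[OF x a]
  by (intro Henstock_Kurzweil_Integration.integral_norm_bound_integral bump_integrable bump_phase_integrable x a)
    (auto simp: norm_mult intro!: continuous_intros)

lemma bump_avg_bound:
  assumes x: "x \<in> carrier A" and a: "a \<in> carrier A"
  shows "bump_avg A x a \<le> nrm A a"
proof -
  have "bump_avg A x a \<le> integral {0..2 * pi} (\<lambda>_. nrm A a / 16)"
    unfolding bump_avg_def
    by (intro integral_le bump_integrable x a bump_bounds) auto
  also have "\<dots> = pi / 8 * nrm A a" by simp
  also have "\<dots> \<le> 1 * nrm A a" using pi_less_4 nrm_nonneg[OF a] by (intro mult_right_mono) auto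
  finally show ?thesis by simp
qed

lemma bump_phase_lipschitz:
  assumes x: "x \<in> carrier A" and a: "a \<in> carrier A" "b \<in> carrier A"
  shows "cmod (bump_phase A x a - bump_phase A x b) \<le> 2 * pi * (2 + nrm A x) * nrm A (a \<boxminus> b)"
proof -
  have c: "continuous_on UNIV cis" by (intro continuous_intros)
  have "bump_phase A x a - bump_phase A x b =
      integral {0..2 * pi} (\<lambda>\<theta>. cis \<theta> * of_real (bump A x a \<theta>) - cis \<theta> * of_real (bump A x b \<theta>))"
    unfolding bump_phase_def
    by (rule Henstock_Kurzweil_Integration.integral_diff[symmetric]; intro bump_phase_integrable x a c)
  also have "cmod \<dots> \<le> integral {0..2 * pi} (\<lambda>\<theta>. (2 + nrm A x) * nrm A (a \<boxminus> b))"
  proof (intro Henstock_Kurzweil_Integration.integral_norm_bound_integral integrable_diff bump_phase_integrable x a c)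
    fix \<theta> :: real
    have "cmod (cis \<theta> * of_real (bump A x a \<theta>) - cis \<theta> * of_real (bump A x b \<theta>)) =
        \<bar>bump A x a \<theta> - bump A x b \<theta>\<bar>"
      by (simp only: right_diff_distrib[symmetric] norm_mult norm_cis of_real_diff[symmetric] norm_of_real) simp
    then show "cmod (cis \<theta> * of_real (bump A x a \<theta>) - cis \<theta> * of_real (bump A x b \<theta>)) \<le>
        (2 + nrm A x) * nrm A (a \<boxminus> b)" using bump_lipschitz[OF x a] by simp
  qed auto
  finally show ?thesis by (simp add: algebra_simps)
qed

lemma bump_avg_lipschitz:
  assumes x: "x \<in> carrier A" and a: "a \<in> carrier A" "b \<in> carrier A"
  shows "\<bar>bump_avg A x a - bump_avg A x b\<bar> \<le> 2 * pi * (2 + nrm A x) * nrm A (a \<boxminus> b)"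
proof -
  have "bump_avg A x a - bump_avg A x b = integral {0..2 * pi} (\<lambda>\<theta>. bump A x a \<theta> - bump A x b \<theta>)"
    unfolding bump_avg_def
    by (rule Henstock_Kurzweil_Integration.integral_diff[symmetric]; intro bump_integrable x a)
  also have "norm \<dots> \<le> integral {0..2 * pi} (\<lambda>\<theta>. (2 + nrm A x) * nrm A (a \<boxminus> b))"
    by (intro Henstock_Kurzweil_Integration.integral_norm_bound_integral integrable_diff bump_integrable x a)
      (use bump_lipschitz[OF x a] in auto)
  finally show ?thesis by (simp add: algebra_simps)
qed

text \<open>The argument of \<open>c\<close> is absorbed by a rotation of the circle parameter. The
  modulus factors out because the radius of the circle and the width of the bump are both
  proportional to the norm of \<open>a\<close>.\<close>

lemma bump_scale:
  assumes x: "x \<in> carrier A" and a: "a \<in> carrier A"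
  shows "bump A x (c \<odot> a) \<theta> = cmod c * bump A x a (\<theta> - Arg2pi c)"
proof -
  have c: "c = of_real (cmod c) * cis (Arg2pi c)"
    using Arg2pi[of c] by (simp add: cis_conv_exp is_Arg_def)
  let ?y = "a \<boxminus> (cis (\<theta> - Arg2pi c) * of_real (nrm A a)) \<odot> x"
  have "cis \<theta> = cis (Arg2pi c) * cis (\<theta> - Arg2pi c)" by (simp add: cis_mult)
  then have "cis \<theta> * of_real (cmod c * nrm A a) = c * (cis (\<theta> - Arg2pi c) * of_real (nrm A a))"
    by (subst (2) c) (simp add: mult_ac)
  then have "cis \<theta> * of_real (nrm A (c \<odot> a)) = c * (cis (\<theta> - Arg2pi c) * of_real (nrm A a))"
    by (simp only: nrm_scale[OF a])
  then have "c \<odot> a \<boxminus> (cis \<theta> * of_real (nrm A (c \<odot> a))) \<odot> x = c \<odot> ?y"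
    using x a by (simp only:) (simp add: scale_diff_right)
  then have "bump A x (c \<odot> a) \<theta> = max 0 (cmod c * (nrm A a / 16 - nrm A ?y))"
    using x a by (simp add: bump_def nrm_scale right_diff_distrib)
  then show ?thesis by (simp add: bump_def max_mult_distrib_left)
qed

lemma bump_periodic: "bump A x a (\<theta> + 2 * pi) = bump A x a \<theta>"
  by (simp add: bump_def cis_mult[symmetric])

lemma bump_avg_scale:
  assumes x: "x \<in> carrier A" and a: "a \<in> carrier A"
  shows "bump_avg A x (c \<odot> a) = cmod c * bump_avg A x a"
proof -
  have "integral {0..2 * pi} (\<lambda>\<theta>. bump A x a (\<theta> - Arg2pi c)) = integral {0..2 * pi} (bump A x a)"
    using Arg2pi[of c] by (intro integral_periodic_shift bump_periodic bump_continuous x a) auto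
  moreover have "bump A x (c \<odot> a) = (\<lambda>\<theta>. cmod c * bump A x a (\<theta> - Arg2pi c))"
    by (simp add: fun_eq_iff bump_scale[OF x a])
  ultimately show ?thesis by (simp add: bump_avg_def)
qed

lemma bump_phase_scale:
  assumes x: "x \<in> carrier A" and a: "a \<in> carrier A"
  shows "bump_phase A x (c \<odot> a) = c * bump_phase A x a"
proof -
  let ?h = "\<lambda>\<theta>. cis \<theta> * complex_of_real (bump A x a \<theta>)"
  have c: "c = of_real (cmod c) * cis (Arg2pi c)"
    using Arg2pi[of c] by (simp add: cis_conv_exp is_Arg_def)
  have "cis \<theta> * complex_of_real (cmod c * bump A x a (\<theta> - Arg2pi c)) = c * ?h (\<theta> - Arg2pi c)" for \<theta>
  proof -
    have "cis \<theta> = cis (Arg2pi c) * cis (\<theta> - Arg2pi c)" by (simp add: cis_mult)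
    then show ?thesis by (subst (3) c) (simp add: mult_ac)
  qed
  then have "bump_phase A x (c \<odot> a) = integral {0..2 * pi} (\<lambda>\<theta>. c * ?h (\<theta> - Arg2pi c))"
    by (simp only: bump_phase_def bump_scale[OF x a])
  also have "\<dots> = c * integral {0..2 * pi} (\<lambda>\<theta>. ?h (\<theta> - Arg2pi c))" by simp
  also have "integral {0..2 * pi} (\<lambda>\<theta>. ?h (\<theta> - Arg2pi c)) = integral {0..2 * pi} ?h"
    using Arg2pi[of c]
    by (intro integral_periodic_shift)
      (auto simp: bump_periodic cis_mult[symmetric] intro!: continuous_intros bump_continuous x a)
  finally show ?thesis by (simp add: bump_phase_def)
qed

lemma bump_avg_pos:
  assumes x: "x \<in> carrier A" and a: "a \<in> carrier A" and close: "nrm A (a \<boxminus> of_real (nrm A a) \<odot> x) < nrm A a / 16"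
  shows "0 < bump_avg A x a"
proof -
  have "bump A x a 0 \<noteq> 0" using close by (simp add: bump_def)
  then have "bump_avg A x a \<noteq> 0"
    unfolding bump_avg_def
    by (subst integral_eq_0_iff) (auto intro!: bump_continuous bump_bounds x a bexI[of _ 0])
  then show ?thesis using bump_avg_nonneg[OF x a] by simp
qed

text \<open>All \<open>\<theta>\<close> in the support of the bump have nearly the same \<open>cis \<theta>\<close>.\<close>

lemma bump_phase_close:
  assumes x: "x \<in> carrier A" and a: "a \<in> carrier A" "a \<noteq> czero A"
  shows "nrm A (bump_phase A x a \<odot> x \<boxminus> of_real (bump_avg A x a / nrm A a) \<odot> a) \<le> bump_avg A x a / 2"
proof -
  have na: "nrm A a > 0" using a nrm_eq_0[of a] nrm_nonneg[OF a(1)] by linarith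
  have c: "continuous_on UNIV cis" by (intro continuous_intros)
  show ?thesis
  proof (cases "\<exists>\<theta>. bump A x a \<theta> > 0")
    case False
    then have "bump A x a \<theta> = 0" for \<theta>
      using bump_bounds(1)[OF x a(1), of \<theta>] by (meson linorder_not_less order_antisym)
    then have "bump A x a = (\<lambda>_. 0)" by (simp add: fun_eq_iff)
    then show ?thesis using x a by (simp add: bump_phase_def bump_avg_def)
  next
    case True
    then obtain \<alpha> where \<alpha>: "bump A x a \<alpha> > 0" by auto
    let ?y = "\<lambda>\<theta>. a \<boxminus> (cis \<theta> * of_real (nrm A a)) \<odot> x"
    have supp: "nrm A (?y \<theta>) < nrm A a / 16" if "bump A x a \<theta> > 0" for \<theta>
      using that by (simp add: bump_def split: if_splits)
    have ns: "nrm A ((cis \<theta> * of_real (nrm A a)) \<odot> x) = nrm A a * nrm A x" for \<theta>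
      using x a by (simp add: nrm_scale norm_mult)
    \<comment> \<open>On the support, a rotated copy of \<open>x\<close>, scaled by the norm of
      \<open>a\<close>, is within 1/16 of that norm from \<open>a\<close>. Hence the norm of
      \<open>x\<close> lies between 15/16 and 17/16, and two phases in the support differ by at most
      1/8 divided by 15/16, that is 2/15. The resulting error, 2/15 times 17/16 plus 1/16, is below
      the required 1/2.\<close>
    have "nrm A a * nrm A x \<le> nrm A a + nrm A (?y \<alpha>)"
      using nrm_le_add_diff[of "(cis \<alpha> * of_real (nrm A a)) \<odot> x" a] ns[of \<alpha>] x a
      by (simp add: nrm_diff_commute)
    then have "nrm A a * nrm A x \<le> nrm A a * (17 / 16)" using supp[OF \<alpha>] by simp
    then have nx: "nrm A x \<le> 17 / 16" using na by simp
    have "nrm A a \<le> nrm A a * nrm A x + nrm A (?y \<alpha>)"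
      using nrm_le_add_diff[of a "(cis \<alpha> * of_real (nrm A a)) \<odot> x"] ns[of \<alpha>] x a by simp
    then have "nrm A a * (15 / 16) \<le> nrm A a * nrm A x" using supp[OF \<alpha>] by simp
    then have nx': "15 / 16 \<le> nrm A x" using na by simp
    have ph: "cmod (cis \<theta> - cis \<alpha>) \<le> 2 / 15" if "bump A x a \<theta> > 0" for \<theta>
    proof -
      have "?y \<alpha> \<boxminus> ?y \<theta> = (cis \<theta> * of_real (nrm A a)) \<odot> x \<boxminus> (cis \<alpha> * of_real (nrm A a)) \<odot> x"
        using x a by (simp add: group_simps)
      also have "\<dots> = ((cis \<theta> - cis \<alpha>) * of_real (nrm A a)) \<odot> x"
        using x by (simp add: left_diff_distrib scale_diff_left)
      finally have "cmod (cis \<theta> - cis \<alpha>) * (nrm A a * nrm A x) = nrm A (?y \<alpha> \<boxminus> ?y \<theta>)"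
        using x a by (simp only: nrm_scale norm_mult norm_of_real) simp
      also have "\<dots> \<le> nrm A (?y \<alpha>) + nrm A (?y \<theta>)" using x a by (intro nrm_diff_le) auto
      also have "\<dots> \<le> nrm A a / 8" using supp[OF \<alpha>] supp[OF that] by simp
      finally have "cmod (cis \<theta> - cis \<alpha>) * (nrm A a * nrm A x) \<le> nrm A a / 8" .
      moreover have "cmod (cis \<theta> - cis \<alpha>) * (nrm A a * (15 / 16)) \<le> cmod (cis \<theta> - cis \<alpha>) * (nrm A a * nrm A x)"
        using na nx' by (intro mult_left_mono) auto
      ultimately have "nrm A a * (cmod (cis \<theta> - cis \<alpha>) * (15 / 16)) \<le> nrm A a * (1 / 8)" by (simp add: mult_ac)
      then have "cmod (cis \<theta> - cis \<alpha>) * (15 / 16) \<le> 1 / 8" using na mult_le_cancel_left_pos by blast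
      then show ?thesis by simp
    qed
    have "bump_phase A x a - cis \<alpha> * of_real (bump_avg A x a) =
        integral {0..2 * pi} (\<lambda>\<theta>. cis \<theta> * of_real (bump A x a \<theta>) - cis \<alpha> * of_real (bump A x a \<theta>))"
    proof -
      have "complex_of_real (bump_avg A x a) = integral {0..2 * pi} (\<lambda>\<theta>. of_real (bump A x a \<theta>))"
        unfolding bump_avg_def
        using integral_linear[OF bump_integrable[OF x a(1)] bounded_linear_of_real[where 'a = complex]]
        by (simp add: o_def)
      then have "cis \<alpha> * of_real (bump_avg A x a) = integral {0..2 * pi} (\<lambda>\<theta>. cis \<alpha> * of_real (bump A x a \<theta>))"
        by simp
      then show ?thesis unfolding bump_phase_def
        by (simp only:) (rule Henstock_Kurzweil_Integration.integral_diff[symmetric];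
            intro bump_phase_integrable x a c continuous_intros)
    qed
    also have "cmod \<dots> \<le> integral {0..2 * pi} (\<lambda>\<theta>. (2 / 15) * bump A x a \<theta>)"
    proof (intro Henstock_Kurzweil_Integration.integral_norm_bound_integral integrable_diff bump_integrable
        bump_phase_integrable x a c continuous_intros integrable_on_cmult_left)
      fix \<theta> :: real
      have "cmod (cis \<theta> - cis \<alpha>) * bump A x a \<theta> \<le> (2 / 15) * bump A x a \<theta>"
        using ph[of \<theta>] bump_bounds(1)[OF x a(1), of \<theta>] by (cases "bump A x a \<theta> = 0") (auto intro: mult_right_mono)
      then show "cmod (cis \<theta> * of_real (bump A x a \<theta>) - cis \<alpha> * of_real (bump A x a \<theta>)) \<le> (2 / 15) * bump A x a \<theta>"
        using bump_bounds(1)[OF x a(1), of \<theta>] by (simp only: left_diff_distrib[symmetric] norm_mult norm_of_real)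
    qed (auto intro: bump_integrable x a)
    finally have w: "cmod (bump_phase A x a - cis \<alpha> * of_real (bump_avg A x a)) \<le> 2 / 15 * bump_avg A x a"
      by (simp add: bump_avg_def)
    have G: "0 \<le> bump_avg A x a" by (rule bump_avg_nonneg[OF x a(1)])
    let ?r = "bump_avg A x a / nrm A a"
    \<comment> \<open>The error splits into the deviation of the averaged phase from the single
      phase \<open>cis \<alpha>\<close> and the distance \<open>?y \<alpha>\<close> of that one
      rotated copy of \<open>x\<close> from \<open>a\<close>.\<close>
    have "of_real ?r \<odot> ((cis \<alpha> * of_real (nrm A a)) \<odot> x) = (cis \<alpha> * of_real (bump_avg A x a)) \<odot> x"
      using x a na by (simp add: mult_ac)
    then have "bump_phase A x a \<odot> x \<boxminus> of_real ?r \<odot> a =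
        (bump_phase A x a - cis \<alpha> * of_real (bump_avg A x a)) \<odot> x \<boxminus> of_real ?r \<odot> ?y \<alpha>"
      using x a by (simp add: scale_diff_left scale_diff_right group_simps)
    then have "nrm A (bump_phase A x a \<odot> x \<boxminus> of_real ?r \<odot> a) \<le>
        nrm A ((bump_phase A x a - cis \<alpha> * of_real (bump_avg A x a)) \<odot> x) + nrm A (of_real ?r \<odot> ?y \<alpha>)"
      using x a by (simp add: nrm_diff_le)
    also have "\<dots> = cmod (bump_phase A x a - cis \<alpha> * of_real (bump_avg A x a)) * nrm A x + ?r * nrm A (?y \<alpha>)"
      using x a G na by (simp only: nrm_scale scale_closed diff_closed norm_of_real) simp
    also have "\<dots> \<le> (2 / 15 * bump_avg A x a) * (17 / 16) + ?r * (nrm A a / 16)"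
      using w nx G na supp[OF \<alpha>] x by (intro add_mono mult_mono mult_left_mono) auto
    also have "?r * (nrm A a / 16) = bump_avg A x a / 16" using na by simp
    also have "(2 / 15 * bump_avg A x a) * (17 / 16) + bump_avg A x a / 16 \<le> bump_avg A x a / 2" using G by simp
    finally show ?thesis .
  qed
qed

end

section \<open>Continuity criteria and geometric series\<close>

lemma continuous_ctop_seqI:
  assumes cA: "csa A" and cB: "csa B" and f: "f \<in> carrier A \<rightarrow> carrier B"
    and seq: "\<And>a x. \<lbrakk>a \<in> carrier A; \<And>n :: nat. x n \<in> carrier A; (\<lambda>n. nrm A (x n -[A] a)) \<longlonglongrightarrow> 0\<rbrakk>
      \<Longrightarrow> (\<lambda>n. nrm B (f (x n) -[B] f a)) \<longlonglongrightarrow> 0"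
  shows "continuous_map (ctop A) (ctop B) f"
proof -
  interpret A: pre_cstar A using cA by (rule cstar_imp_pre)
  interpret B: pre_cstar B using cB by (rule cstar_imp_pre)
  have "\<exists>d>0. \<forall>b\<in>carrier A. nrm A (a -[A] b) < d \<longrightarrow> nrm B (f a -[B] f b) < e"
    if a: "a \<in> carrier A" and e: "e > 0" for a e
  proof (rule ccontr)
    assume no: "\<not> ?thesis"
    have "\<exists>b. b \<in> carrier A \<and> nrm A (a -[A] b) < inverse (real (Suc n)) \<and> \<not> nrm B (f a -[B] f b) < e" for n
      using no by (metis inverse_positive_iff_positive of_nat_0_less_iff zero_less_Suc)
    then obtain x where x: "\<And>n. x n \<in> carrier A" "\<And>n. nrm A (a -[A] x n) < inverse (real (Suc n))"
      "\<And>n. \<not> nrm B (f a -[B] f (x n)) < e" by metis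
    have "(\<lambda>n. nrm A (x n -[A] a)) \<longlonglongrightarrow> 0"
    proof (rule Lim_null_comparison[OF _ LIMSEQ_inverse_real_of_nat])
      show "\<forall>\<^sub>F n in sequentially. norm (nrm A (x n -[A] a)) \<le> inverse (real (Suc n))"
        using x a A.nrm_diff_commute[OF x(1) a] by (intro always_eventually) (simp add: less_imp_le)
    qed
    then have "(\<lambda>n. nrm B (f (x n) -[B] f a)) \<longlonglongrightarrow> 0" by (rule seq[OF a x(1)])
    then have "\<forall>\<^sub>F n in sequentially. nrm B (f (x n) -[B] f a) < e" using e by (rule order_tendstoD)
    then obtain n where "nrm B (f (x n) -[B] f a) < e" by (auto simp: eventually_sequentially)
    then show False using x(3)[of n] B.nrm_diff_commute[of "f (x n)" "f a"] f x(1) a by (auto simp: Pi_iff)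
  qed
  then show ?thesis using f unfolding continuous_ctop_iff[OF cA cB] by blast
qed

lemma continuous_ctop_seqD:
  assumes cA: "csa A" and cB: "csa B" and f: "continuous_map (ctop A) (ctop B) f"
    and a: "a \<in> carrier A" and x: "\<And>n :: nat. x n \<in> carrier A" and lim: "(\<lambda>n. nrm A (x n -[A] a)) \<longlonglongrightarrow> 0"
  shows "(\<lambda>n. nrm B (f (x n) -[B] f a)) \<longlonglongrightarrow> 0"
  unfolding tendsto_iff
proof (intro allI impI)
  interpret A: pre_cstar A using cA by (rule cstar_imp_pre)
  interpret B: pre_cstar B using cB by (rule cstar_imp_pre)
  fix e :: real assume e: "e > 0"
  have fc: "f \<in> carrier A \<rightarrow> carrier B" using f unfolding continuous_ctop_iff[OF cA cB] by blast
  obtain d where d: "d > 0" "\<And>b. b \<in> carrier A \<Longrightarrow> nrm A (a -[A] b) < d \<Longrightarrow> nrm B (f a -[B] f b) < e"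
    using f a e unfolding continuous_ctop_iff[OF cA cB] by blast
  have "\<forall>\<^sub>F n in sequentially. nrm A (x n -[A] a) < d" using lim d(1) by (rule order_tendstoD)
  then show "\<forall>\<^sub>F n in sequentially. dist (nrm B (f (x n) -[B] f a)) 0 < e"
  proof eventually_elim
    case (elim n)
    have "f (x n) \<in> carrier B" "f a \<in> carrier B" using fc x a by auto
    then show ?case
      using d(2)[OF x, of n] elim A.nrm_diff_commute[OF x a, of n] B.nrm_diff_commute[of "f (x n)" "f a"]
      by simp
  qed
qed

lemma continuous_ctop_closed:
  shows "\<lbrakk>csa A; csa B; continuous_map (ctop A) (ctop B) f; a \<in> carrier A\<rbrakk> \<Longrightarrow> f a \<in> carrier B"
  unfolding continuous_ctop_iff by blast

text \<open>One criterion for maps assembled from two continuous maps: differences, pairs, segments,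
  orthogonal sums and joins of paths all satisfy such an estimate.\<close>

lemma continuous_dominated:
  assumes cW: "csa W" and cV: "csa V" and cU: "csa U" and cT: "csa T"
    and f: "continuous_map (ctop W) (ctop V) f" and g: "continuous_map (ctop W) (ctop U) g"
    and h: "\<And>w. w \<in> carrier W \<Longrightarrow> h w \<in> carrier T"
    and le: "\<And>x a. \<lbrakk>x \<in> carrier W; a \<in> carrier W\<rbrakk> \<Longrightarrow>
      nrm T (h x -[T] h a) \<le> K * (nrm V (f x -[V] f a) + nrm U (g x -[U] g a))"
  shows "continuous_map (ctop W) (ctop T) h"
proof (rule continuous_ctop_seqI[OF cW cT])
  interpret T: pre_cstar T using cT by (rule cstar_imp_pre)
  fix a x assume a: "a \<in> carrier W" and x: "\<And>n :: nat. x n \<in> carrier W" and lim: "(\<lambda>n. nrm W (x n -[W] a)) \<longlonglongrightarrow> 0"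
  have "(\<lambda>n. K * (nrm V (f (x n) -[V] f a) + nrm U (g (x n) -[U] g a))) \<longlonglongrightarrow> K * (0 + 0)"
    by (intro tendsto_intros continuous_ctop_seqD[OF cW cV f a x lim] continuous_ctop_seqD[OF cW cU g a x lim])
  then have "(\<lambda>n. K * (nrm V (f (x n) -[V] f a) + nrm U (g (x n) -[U] g a))) \<longlonglongrightarrow> 0" by simp
  then show "(\<lambda>n. nrm T (h (x n) -[T] h a)) \<longlonglongrightarrow> 0"
    by (rule Lim_null_comparison[rotated], intro always_eventually allI) (use le[OF x a] h[OF x] h[OF a] in simp)
qed (use h in blast)

lemma continuous_diff:
  assumes cW: "csa W" and cV: "csa V"
    and f: "continuous_map (ctop W) (ctop V) f" and g: "continuous_map (ctop W) (ctop V) g"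
  shows "continuous_map (ctop W) (ctop V) (\<lambda>w. f w -[V] g w)"
proof -
  interpret V: pre_cstar V using cV by (rule cstar_imp_pre)
  note [simp] = continuous_ctop_closed[OF cW cV f] continuous_ctop_closed[OF cW cV g]
  have "nrm V (f x -[V] g x -[V] (f a -[V] g a)) \<le> nrm V (f x -[V] f a) + nrm V (g x -[V] g a)"
    if "x \<in> carrier W" "a \<in> carrier W" for x a
  proof -
    have "f x -[V] g x -[V] (f a -[V] g a) = (f x -[V] f a) -[V] (g x -[V] g a)" using that by (simp add: V.group_simps)
    then show ?thesis using that by (simp add: V.nrm_diff_le)
  qed
  then show ?thesis by (intro continuous_dominated[OF cW cV cV cV f g, where K = 1]) simp_all
qed

lemma continuous_lipschitz:
  assumes cW: "csa W" and cT: "csa T"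
    and h: "\<And>w. w \<in> carrier W \<Longrightarrow> h w \<in> carrier T"
    and le: "\<And>x a. \<lbrakk>x \<in> carrier W; a \<in> carrier W\<rbrakk> \<Longrightarrow> nrm T (h x -[T] h a) \<le> K * nrm W (x -[W] a)"
  shows "continuous_map (ctop W) (ctop T) h"
  by (rule continuous_dominated[where f = "\<lambda>x. x" and g = "\<lambda>x. x" and K = "K / 2", OF cW cW cW cT])
    (use h le in simp_all)

lemma continuous_mult:
  assumes cW: "csa W" and x: "x \<in> carrier W"
  shows "continuous_map (ctop W) (ctop W) (\<lambda>z. z *[W] x)" "continuous_map (ctop W) (ctop W) (\<lambda>z. x *[W] z)"
proof -
  interpret W: pre_cstar W using cW by (rule cstar_imp_pre)
  note c = continuous_lipschitz[OF cW cW, where K = "nrm W x"]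
  show "continuous_map (ctop W) (ctop W) (\<lambda>z. z *[W] x)"
    by (rule c) (use x W.nrm_mult[OF _ x] in \<open>simp_all add: W.mult_diff_left[symmetric] mult.commute[of "nrm W x"]\<close>)
  show "continuous_map (ctop W) (ctop W) (\<lambda>z. x *[W] z)"
    by (rule c) (use x W.nrm_mult in \<open>simp_all add: W.mult_diff_right[symmetric]\<close>)
qed

lemma continuous_adj:
  assumes cW: "csa W"
  shows "continuous_map (ctop W) (ctop W) (adj W)"
proof -
  interpret W: pre_cstar W using cW by (rule cstar_imp_pre)
  show ?thesis by (rule continuous_lipschitz[OF cW cW, where K = 1]) (simp_all add: W.adj_diff[symmetric])
qed

lemma closedin_ball_preimage:
  assumes T: "closedin Y T" and f: "\<And>x. x \<in> S \<Longrightarrow> continuous_map X Y (f x)"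
  shows "closedin X {z \<in> topspace X. \<forall>x\<in>S. f x z \<in> T}"
proof -
  \<comment> \<open>The factor \<open>topspace X\<close> also takes care of an empty
    \<open>S\<close>, for which the intersection of the family is the whole type.\<close>
  have "{z \<in> topspace X. \<forall>x\<in>S. f x z \<in> T} = topspace X \<inter> \<Inter>((\<lambda>x. {z \<in> topspace X. f x z \<in> T}) ` S)" by auto
  moreover have "closedin X \<dots>"
    using closedin_continuous_map_preimage[OF f T] by (cases "S = {}") (auto intro!: closedin_Int closedin_Inter)
  ultimately show ?thesis by simp
qed

lemma (in pre_cstar) csum_closed [simp]: "(\<And>k. f k \<in> carrier A) \<Longrightarrow> csum A f n \<in> carrier A"
  by (induction n) auto

lemma (in pre_cstar) csum_scale:
  "(\<And>k. f k \<in> carrier A) \<Longrightarrow> csum A (\<lambda>k. c \<odot> f k) n = c \<odot> csum A f n"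
  by (induction n) (auto simp: scale_add_right)

text \<open>Sums of series are obtained below merely from an existence statement with an error
  bound. This is how identities such as homogeneity are recovered for them.\<close>

lemma (in pre_cstar) nrm_limit_unique:
  assumes "y \<in> carrier A" "y' \<in> carrier A" "\<And>n. z n \<in> carrier A"
    and "\<And>n :: nat. nrm A (y \<boxminus> z n) \<le> K * (1 / 2) ^ n" "\<And>n. nrm A (y' \<boxminus> z n) \<le> K' * (1 / 2) ^ n"
  shows "y = y'"
proof (rule eqI_nrm)
  fix e :: real assume e: "e > 0"
  have "(\<lambda>n. (K + K') * (1 / 2) ^ n) \<longlonglongrightarrow> 0"
    by (intro tendsto_mult_right_zero LIMSEQ_power_zero) auto
  then have "\<forall>\<^sub>F n in sequentially. (K + K') * (1 / 2) ^ n < e" using e by (rule order_tendstoD)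
  then obtain n where n: "(K + K') * (1 / 2) ^ n < e" by (auto simp: eventually_sequentially)
  have "nrm A (y \<boxminus> y') \<le> nrm A (y \<boxminus> z n) + nrm A (z n \<boxminus> y')" using assms by (intro nrm_diff_triangle) auto
  also have "\<dots> \<le> (K + K') * (1 / 2) ^ n"
    using assms(4)[of n] assms(5)[of n] assms(2) assms(3)[of n] nrm_diff_commute[of "z n" y']
    by (simp add: distrib_right)
  finally show "nrm A (y \<boxminus> y') \<le> e" using n by simp
qed (use assms in auto)

text \<open>The explicit tail bound is retained along with the limit, because it yields both
  uniqueness of the limit and continuity of its dependence on a parameter.\<close>

lemma cstar_geometric_series:
  assumes cC: "csa C" and f: "\<And>n. f n \<in> carrier C" and M: "\<And>n. nrm C (f n) \<le> M * (1 / 2) ^ n"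
  shows "\<exists>y\<in>carrier C. \<forall>n. nrm C (y -[C] csum C f n) \<le> 2 * M * (1 / 2) ^ n"
proof -
  interpret C: pre_cstar C using cC by (rule cstar_imp_pre)
  let ?s = "csum C f"
  have s: "?s n \<in> carrier C" for n using f by simp
  have M0: "0 \<le> M" using M[of 0] C.nrm_nonneg[OF f[of 0]] by simp
  have d: "nrm C (?s (n + k) -[C] ?s n) \<le> 2 * M * (1 / 2) ^ n - 2 * M * (1 / 2) ^ (n + k)" for n k
  proof (induction k)
    case (Suc k)
    have "?s (n + Suc k) -[C] ?s n = (?s (n + k) -[C] ?s n) +[C] f (n + k)"
      using f s by (simp add: C.group_simps)
    then have "nrm C (?s (n + Suc k) -[C] ?s n) \<le> nrm C (?s (n + k) -[C] ?s n) + nrm C (f (n + k))"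
      using f s by (simp add: C.nrm_triangle)
    also have "\<dots> \<le> 2 * M * (1 / 2) ^ n - 2 * M * (1 / 2) ^ (n + k) + M * (1 / 2) ^ (n + k)"
      using Suc M by (intro add_mono) auto
    finally show ?case by simp
  qed (use s in simp)
  have d': "nrm C (?s m -[C] ?s n) \<le> 2 * M * (1 / 2) ^ n" if "n \<le> m" for m n
    using d[of n "m - n"] that M0 by (simp add: order_trans)
  have small: "\<exists>N. 2 * M * (1 / 2) ^ N < e" if "e > 0" for e
  proof -
    have "(\<lambda>n. 2 * M * (1 / 2) ^ n) \<longlonglongrightarrow> 0" by (intro tendsto_mult_right_zero LIMSEQ_power_zero) auto
    then have "\<forall>\<^sub>F n in sequentially. 2 * M * (1 / 2) ^ n < e" using that by (rule order_tendstoD)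
    then show ?thesis by (auto simp: eventually_sequentially)
  qed
  have "\<exists>y\<in>carrier C. \<forall>e>0. \<exists>N. \<forall>n\<ge>N. nrm C (?s n -[C] y) < e"
  proof (rule cstar_complete[OF cC s])
    fix e :: real assume "e > 0"
    then obtain N where N: "2 * M * (1 / 2) ^ N < e / 2" using small[of "e / 2"] by auto
    have "nrm C (?s m -[C] ?s n) < e" if "m \<ge> N" "n \<ge> N" for m n
      using C.nrm_diff_triangle[OF s s s, of m n N] d'[OF that(1)] d'[OF that(2)]
        C.nrm_diff_commute[OF s s, of N n] N by linarith
    then show "\<exists>N. \<forall>m\<ge>N. \<forall>n\<ge>N. nrm C (?s m -[C] ?s n) < e" by blast
  qed
  then obtain y where y: "y \<in> carrier C" "\<And>e. e > 0 \<Longrightarrow> \<exists>N. \<forall>n\<ge>N. nrm C (?s n -[C] y) < e" by blast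
  have "nrm C (y -[C] ?s n) \<le> 2 * M * (1 / 2) ^ n" for n
  proof (rule field_le_epsilon)
    fix e :: real assume "e > 0"
    then obtain N where N: "\<And>m. m \<ge> N \<Longrightarrow> nrm C (?s m -[C] y) < e" using y(2) by blast
    let ?m = "max N n"
    show "nrm C (y -[C] ?s n) \<le> 2 * M * (1 / 2) ^ n + e"
      using C.nrm_diff_triangle[OF y(1) s s, of n ?m] N[of ?m] d'[of n ?m] C.nrm_diff_commute[OF y(1) s, of ?m]
      by linarith
  qed
  then show ?thesis using y(1) by blast
qed

text \<open>The error bound is proportional to the norm of \<open>a\<close>, hence uniform along a
  convergent sequence, whose norms are bounded. The limit of the partial sums is therefore
  continuous as in the Weierstrass test.\<close>

lemma series_continuous:
  assumes cA: "csa A" and cC: "csa C"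
    and f: "\<And>k. continuous_map (ctop A) (ctop C) (f k)" and F: "\<And>a. a \<in> carrier A \<Longrightarrow> F a \<in> carrier C"
    and K: "\<And>n a. a \<in> carrier A \<Longrightarrow> nrm C (F a -[C] csum C (\<lambda>k. f k a) n) \<le> K * nrm A a * (1 / 2) ^ n"
  shows "continuous_map (ctop A) (ctop C) F"
proof (rule continuous_ctop_seqI[OF cA cC])
  interpret A: pre_cstar A using cA by (rule cstar_imp_pre)
  interpret C: pre_cstar C using cC by (rule cstar_imp_pre)
  show "F \<in> carrier A \<rightarrow> carrier C" using F by auto
  fix a x assume a: "a \<in> carrier A" and x: "\<And>n :: nat. x n \<in> carrier A" and lim: "(\<lambda>n. nrm A (x n -[A] a)) \<longlonglongrightarrow> 0"
  have fc: "f k b \<in> carrier C" if "b \<in> carrier A" for k b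
    using f[of k] that unfolding continuous_ctop_iff[OF cA cC] by auto
  have S: "(\<lambda>i. nrm C (csum C (\<lambda>k. f k (x i)) n -[C] csum C (\<lambda>k. f k a) n)) \<longlonglongrightarrow> 0" for n
  proof (induction n)
    case (Suc n)
    have "(\<lambda>i. nrm C (csum C (\<lambda>k. f k (x i)) n -[C] csum C (\<lambda>k. f k a) n) + nrm C (f n (x i) -[C] f n a)) \<longlonglongrightarrow> 0"
      using tendsto_add[OF Suc continuous_ctop_seqD[OF cA cC f a x lim, of n]] by simp
    then show ?case
    proof (rule Lim_null_comparison[rotated], intro always_eventually allI)
      fix i
      have [simp]: "f n (x i) \<in> carrier C" "f n a \<in> carrier C" "csum C (\<lambda>k. f k (x i)) n \<in> carrier C"
        "csum C (\<lambda>k. f k a) n \<in> carrier C" using fc x a by auto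
      show "norm (nrm C (csum C (\<lambda>k. f k (x i)) (Suc n) -[C] csum C (\<lambda>k. f k a) (Suc n))) \<le>
        nrm C (csum C (\<lambda>k. f k (x i)) n -[C] csum C (\<lambda>k. f k a) n) + nrm C (f n (x i) -[C] f n a)"
        by (simp add: C.add_diff_add C.nrm_triangle)
    qed
  qed (use fc x a in simp)
  have nx: "(\<lambda>i. nrm A (x i)) \<longlonglongrightarrow> nrm A a"
    unfolding LIM_zero_iff[symmetric, of _ "nrm A a"]
    by (rule Lim_null_comparison[OF _ lim]) (use A.nrm_diff_ineq x a in auto)
  show "(\<lambda>n. nrm C (F (x n) -[C] F a)) \<longlonglongrightarrow> 0"
    unfolding tendsto_iff
  proof (intro allI impI)
    fix e :: real assume e: "e > 0"
    have "(\<lambda>n. \<bar>K\<bar> * (2 * nrm A a + 1) * (1 / 2) ^ n) \<longlonglongrightarrow> 0"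
      by (intro tendsto_mult_right_zero LIMSEQ_power_zero) auto
    then have "\<forall>\<^sub>F n in sequentially. \<bar>K\<bar> * (2 * nrm A a + 1) * (1 / 2) ^ n < e / 2"
      using e by (intro order_tendstoD) auto
    then obtain n where n: "\<bar>K\<bar> * (2 * nrm A a + 1) * (1 / 2) ^ n < e / 2" by (auto simp: eventually_sequentially)
    have "\<forall>\<^sub>F i in sequentially. nrm C (csum C (\<lambda>k. f k (x i)) n -[C] csum C (\<lambda>k. f k a) n) < e / 2"
      using S e by (intro order_tendstoD) auto
    moreover have "\<forall>\<^sub>F i in sequentially. nrm A (x i) < nrm A a + 1" using nx by (rule order_tendstoD) simp
    ultimately show "\<forall>\<^sub>F i in sequentially. dist (nrm C (F (x i) -[C] F a)) 0 < e"
    proof eventually_elim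
      case (elim i)
      let ?S = "\<lambda>a. csum C (\<lambda>k. f k a) n"
      have [simp]: "?S (x i) \<in> carrier C" "?S a \<in> carrier C" "F (x i) \<in> carrier C" "F a \<in> carrier C"
        using fc x a F by auto
      have "nrm C (F (x i) -[C] F a) \<le> nrm C (F (x i) -[C] ?S (x i)) + nrm C (?S (x i) -[C] F a)"
        by (intro C.nrm_diff_triangle) auto
      also have "nrm C (?S (x i) -[C] F a) \<le> nrm C (?S (x i) -[C] ?S a) + nrm C (?S a -[C] F a)"
        by (intro C.nrm_diff_triangle) auto
      also have "nrm C (?S a -[C] F a) \<le> K * nrm A a * (1 / 2) ^ n"
        using K[OF a, of n] by (simp add: C.nrm_diff_commute)
      also have "nrm C (F (x i) -[C] ?S (x i)) \<le> K * nrm A (x i) * (1 / 2) ^ n" by (rule K[OF x])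
      finally have "nrm C (F (x i) -[C] F a) \<le> K * (nrm A (x i) + nrm A a) * (1 / 2) ^ n +
          nrm C (?S (x i) -[C] ?S a)"
        by (simp add: algebra_simps)
      also have "K * (nrm A (x i) + nrm A a) * (1 / 2) ^ n \<le> \<bar>K\<bar> * (2 * nrm A a + 1) * (1 / 2) ^ n"
      proof (intro mult_right_mono)
        have "K * (nrm A (x i) + nrm A a) \<le> \<bar>K\<bar> * (nrm A (x i) + nrm A a)"
          using x a by (intro mult_right_mono) auto
        also have "\<dots> \<le> \<bar>K\<bar> * (2 * nrm A a + 1)" using elim by (intro mult_left_mono) auto
        finally show "K * (nrm A (x i) + nrm A a) \<le> \<bar>K\<bar> * (2 * nrm A a + 1)" .
      qed auto
      finally show ?case using n elim C.nrm_nonneg[of "F (x i) -[C] F a"] by simp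
    qed
  qed
qed

section \<open>Lifting along surjections\<close>

text \<open>The Baire half of the open mapping theorem: the closures \<open>F n\<close> of the
  images of the balls of radius \<open>n\<close> cover \<open>A\<close>, so one of them contains a
  ball around some \<open>a0\<close>, and subtracting approximate lifts of two points of that ball
  recentres it at the origin.\<close>

lemma bounded_approximate_lifts:
  assumes cA: "csa A" and cC: "csa C" and p: "star_epi C A p"
  shows "\<exists>K>0. \<forall>a\<in>carrier A. nrm A a \<le> 1 \<longrightarrow>
    (\<forall>e>0. \<exists>c\<in>carrier C. nrm C c \<le> K \<and> nrm A (a -[A] p c) < e)"
proof -
  interpret A: pre_cstar A using cA by (rule cstar_imp_pre)
  interpret C: pre_cstar C using cC by (rule cstar_imp_pre)
  have hom: "star_hom C A p" and surj: "p ` carrier C = carrier A" using p by (auto simp: star_epi_def)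
  note pD = star_homD[OF hom]
  define F where "F = (\<lambda>n :: nat. ctop A closure_of (p ` {c \<in> carrier C. nrm C c \<le> real n}))"
  have pF: "p ` {c \<in> carrier C. nrm C c \<le> real n} \<subseteq> carrier A" for n using pD by auto
  have F: "F n = {a \<in> carrier A. \<forall>e>0. \<exists>c\<in>carrier C. nrm C c \<le> real n \<and> nrm A (a -[A] p c) < e}" for n
    unfolding F_def A.closure_of_ctop[OF pF] by auto
  have "\<Union>(range F) = carrier A"
  proof
    show "carrier A \<subseteq> \<Union>(range F)"
    proof
      fix a assume "a \<in> carrier A"
      then obtain c where c: "c \<in> carrier C" "a = p c" using surj by auto
      then have "a \<in> F (nat \<lceil>nrm C c\<rceil>)"
        unfolding F using pD C.nrm_nonneg[OF c(1)] by (auto intro!: bexI[of _ c])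
      then show "a \<in> \<Union>(range F)" by auto
    qed
  qed (auto simp: F)
  then have "A.M.mtopology interior_of \<Union>(range F) \<noteq> {}"
    using A.zero_closed interior_of_topspace[of A.M.mtopology] by (metis A.M.topspace_mtopology empty_iff)
  moreover have "A.M.mtopology interior_of \<Union>(range F) = {}" if "\<forall>n. A.M.mtopology interior_of F n = {}"
    by (rule A.M.metric_Baire_category_alt[OF cstar_algebra.complete[OF cA]])
      (use that in \<open>auto simp: F_def ctop_def\<close>)
  ultimately obtain n where "A.M.mtopology interior_of F n \<noteq> {}" by blast
  then obtain a0 where a0: "a0 \<in> A.M.mtopology interior_of F n" by auto
  then obtain r where r: "r > 0" "A.M.mball a0 r \<subseteq> A.M.mtopology interior_of F n"
    using A.M.openin_mtopology[of "A.M.mtopology interior_of F n"] by auto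
  have ball: "A.M.mball a0 r \<subseteq> F n" using r(2) interior_of_subset by fastforce
  have a0A: "a0 \<in> carrier A" using a0 interior_of_subset_topspace[of A.M.mtopology "F n"] by auto
  \<comment> \<open>The lift of \<open>a\<close> is \<open>2 / r\<close> times a difference of two
    elements of norm at most \<open>n\<close>. The summand 1 keeps the bound positive when
    \<open>n\<close> is 0.\<close>
  let ?K = "4 * real n / r + 1"
  have "\<exists>c\<in>carrier C. nrm C c \<le> ?K \<and> nrm A (a -[A] p c) < e"
    if a: "a \<in> carrier A" "nrm A a \<le> 1" and e: "e > 0" for a e
  proof -
    let ?t = "complex_of_real (r / 2)"
    let ?b = "a0 +[A] ?t .[A] a"
    have t: "cmod ?t = r / 2" using r by simp
    have "a0 -[A] ?b = (-1) .[A] (?t .[A] a)" using a a0A by (simp add: cdiff_def A.group_simps A.scale_add_right)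
        (metis A.add_assoc A.add_zero A.neg_add_cancel A.scale_closed A.add_commute A.zero_add)
    then have "nrm A (a0 -[A] ?b) = r / 2 * nrm A a" using a t A.nrm_neg[of "?t .[A] a"] A.nrm_scale[OF a(1), of ?t] by simp
    also have "\<dots> < r" using a r by (smt (verit) A.nrm_nonneg field_sum_of_halves mult_left_le)
    finally have "?b \<in> F n" using ball a0A a by (auto simp: cdist_def)
    moreover have "a0 \<in> F n" using ball a0A r by auto
    moreover have e': "e * r / 4 > 0" using e r by simp
    ultimately obtain c1 c2 where
      c: "c1 \<in> carrier C" "nrm C c1 \<le> real n" "nrm A (a0 -[A] p c1) < e * r / 4"
         "c2 \<in> carrier C" "nrm C c2 \<le> real n" "nrm A (?b -[A] p c2) < e * r / 4"
      unfolding F by blast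
    let ?u = "complex_of_real (2 / r)"
    have u: "cmod ?u = 2 / r" using r by (simp add: norm_divide)
    have ut: "?u * ?t = 1" using r by simp
    let ?c = "?u .[C] (c2 -[C] c1)"
    have "nrm C ?c = 2 / r * nrm C (c2 -[C] c1)" using c by (simp only: C.nrm_scale C.diff_closed u)
    also have "\<dots> \<le> 2 / r * (real n + real n)"
      using c r C.nrm_diff_le[of c2 c1] by (intro mult_left_mono) auto
    finally have nc: "nrm C ?c \<le> ?K" by simp
    have "p ?c = ?u .[A] (p c2 -[A] p c1)" using c pD star_hom_diff[OF hom cC] by simp
    moreover have "a = ?u .[A] (?b -[A] a0)"
    proof -
      have "?b -[A] a0 = ?t .[A] a" using a a0A by (simp add: A.group_simps)
      then show ?thesis using a ut by (simp only: A.scale_scale A.scale_one)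
    qed
    ultimately have "a -[A] p ?c = ?u .[A] ((?b -[A] a0) -[A] (p c2 -[A] p c1))"
      using a a0A c pD by (metis A.add_closed A.diff_closed A.scale_closed A.scale_diff_right)
    also have "(?b -[A] a0) -[A] (p c2 -[A] p c1) = (?b -[A] p c2) -[A] (a0 -[A] p c1)"
    proof -
      have "(x -[A] y) -[A] (z -[A] w) = (x -[A] z) -[A] (y -[A] w)"
        if "x \<in> carrier A" "y \<in> carrier A" "z \<in> carrier A" "w \<in> carrier A" for x y z w
        using that by (simp add: A.group_simps)
      then show ?thesis using a a0A c pD by simp
    qed
    finally have "nrm A (a -[A] p ?c) = 2 / r * nrm A ((?b -[A] p c2) -[A] (a0 -[A] p c1))"
      using a a0A c pD by (simp only: A.nrm_scale A.diff_closed A.add_closed A.scale_closed u)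
    also have "\<dots> \<le> 2 / r * (nrm A (?b -[A] p c2) + nrm A (a0 -[A] p c1))"
      using a a0A c pD r by (intro mult_left_mono A.nrm_diff_le) auto
    also have "\<dots> < 2 / r * (e * r / 4 + e * r / 4)"
      using c r by (intro mult_strict_left_mono add_strict_mono) auto
    also have "\<dots> = e" using r by simp
    finally show ?thesis using nc c by (intro bexI[of _ ?c]) auto
  qed
  moreover have "?K > 0" using r by (simp add: add_nonneg_pos)
  ultimately show ?thesis by blast
qed

text \<open>
  \<open>F\<close> below is the weighted sum of the lifts \<open>c n\<close>, and \<open>W\<close> the sum of the weights; \<open>W a\<close> vanishes
  only for \<open>a = 0\<close>, where the junk value of the division does no harm.
\<close>

lemma approximate_section:
  assumes cA: "csa A" and cC: "csa C" and p: "star_epi C A p" and sep: "separable C"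
  shows "\<exists>s K. continuous_map (ctop A) (ctop C) s \<and> homogeneous A C s \<and>
    (\<forall>a\<in>carrier A. nrm C (s a) \<le> K * nrm A a \<and> nrm A (a -[A] p (s a)) \<le> nrm A a / 2)"
proof -
  interpret A: pre_cstar A using cA by (rule cstar_imp_pre)
  interpret C: pre_cstar C using cC by (rule cstar_imp_pre)
  have hom: "star_hom C A p" using p by (auto simp: star_epi_def)
  note pD = star_homD[OF hom]
  from bounded_approximate_lifts[OF cA cC p] obtain K where K1: "K > 0" and K2: "\<forall>a\<in>carrier A.
      nrm A a \<le> 1 \<longrightarrow> (\<forall>e>0. \<exists>c\<in>carrier C. nrm C c \<le> K \<and> nrm A (a -[A] p c) < e)"
    by (elim exE conjE)
  note K = K1 K2[rule_format]
  from sep obtain Q where Q1: "countable Q" "Q \<subseteq> carrier C"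
    and Q2: "\<forall>x\<in>carrier C. \<forall>e>0. \<exists>y\<in>Q. nrm C (x -[C] y) < e"
    unfolding C.separable_iff by (elim exE conjE)
  note Q = Q1 Q2[rule_format]
  \<comment> \<open>Candidates for lifts. The extra 1 in the bound leaves room for replacing a lift
    of norm at most \<open>K\<close> by a nearby point of the dense set, and the zero element makes
    \<open>R\<close> nonempty, so that it can be enumerated.\<close>
  define R where "R = insert (czero C) {q \<in> Q. nrm C q \<le> K + 1}"
  define c where "c = from_nat_into R"
  have R: "R \<noteq> {}" "countable R" using Q1 by (auto simp: R_def)
  have rc: "range c = R" unfolding c_def using R by (rule range_from_nat_into)
  have cR: "c n \<in> R" for n using rc by auto
  have cc [simp]: "c n \<in> carrier C" and nc: "nrm C (c n) \<le> K + 1" for n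
    using cR[of n] Q1 K1 by (auto simp: R_def)
  define x where "x = (\<lambda>n. p (c n))"
  have xc [simp]: "x n \<in> carrier A" for n using pD by (simp add: x_def)
  have nx: "nrm A (x n) \<le> K + 1" for n
    using star_hom_contractive[OF cC cA hom cc[of n]] nc[of n] by (simp add: x_def)
  define f where "f = (\<lambda>n a. ((1 / 2) ^ n * bump_phase A (x n) a) .[C] c n)"
  have fc [simp]: "f n a \<in> carrier C" for n a by (simp add: f_def)
  have nf: "nrm C (f n a) = (1 / 2) ^ n * cmod (bump_phase A (x n) a) * nrm C (c n)" for n a
    by (simp add: f_def C.nrm_scale norm_mult norm_power norm_divide)
  have nfb: "nrm C (f n a) \<le> (K + 1) * ((1 / 2) ^ n * bump_avg A (x n) a)" if "a \<in> carrier A" for n a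
  proof -
    have "(1 / 2) ^ n * cmod (bump_phase A (x n) a) * nrm C (c n) \<le>
        ((1 / 2) ^ n * bump_avg A (x n) a) * (K + 1)"
      using that nc[of n] K1 A.bump_phase_bound[OF xc that, of n] A.bump_avg_nonneg[OF xc that, of n]
      by (intro mult_mono mult_left_mono) auto
    then show ?thesis by (simp add: nf mult_ac)
  qed
  have nfa: "nrm C (f n a) \<le> (K + 1) * nrm A a * (1 / 2) ^ n" if a: "a \<in> carrier A" for n a
  proof -
    have "(K + 1) * ((1 / 2) ^ n * bump_avg A (x n) a) \<le> (K + 1) * ((1 / 2) ^ n * nrm A a)"
      using K1 A.bump_avg_bound[OF xc a, of n] by (intro mult_left_mono) auto
    then show ?thesis using nfb[OF a, of n] by (simp add: mult_ac)
  qed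
  have "\<forall>a\<in>carrier A. \<exists>y. y \<in> carrier C \<and> (\<forall>n. nrm C (y -[C] csum C (\<lambda>k. f k a) n) \<le> 2 * ((K + 1) * nrm A a) * (1 / 2) ^ n)"
    using cstar_geometric_series[OF cC fc nfa] by blast
  then obtain F where F: "\<And>a. a \<in> carrier A \<Longrightarrow> F a \<in> carrier C"
    "\<And>a n. a \<in> carrier A \<Longrightarrow> nrm C (F a -[C] csum C (\<lambda>k. f k a) n) \<le> 2 * ((K + 1) * nrm A a) * (1 / 2) ^ n"
    by metis
  have fcont: "continuous_map (ctop A) (ctop C) (f n)" for n
  proof (rule continuous_ctop_seqI[OF cA cC])
    fix a y assume a: "a \<in> carrier A" and y: "\<And>i :: nat. y i \<in> carrier A" and lim: "(\<lambda>i. nrm A (y i -[A] a)) \<longlonglongrightarrow> 0"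
    let ?L = "(1 / 2) ^ n * (2 * pi * (2 + nrm A (x n))) * nrm C (c n)"
    show "(\<lambda>i. nrm C (f n (y i) -[C] f n a)) \<longlonglongrightarrow> 0"
    proof (rule Lim_null_comparison[OF _ tendsto_mult_right_zero[OF lim, of ?L]], intro always_eventually allI)
      fix i
      have "f n (y i) -[C] f n a = ((1 / 2) ^ n * (bump_phase A (x n) (y i) - bump_phase A (x n) a)) .[C] c n"
        by (simp add: f_def C.scale_diff_left right_diff_distrib)
      then have "nrm C (f n (y i) -[C] f n a) =
          (1 / 2) ^ n * cmod (bump_phase A (x n) (y i) - bump_phase A (x n) a) * nrm C (c n)"
        by (simp add: C.nrm_scale norm_mult norm_power norm_divide)
      also have "\<dots> \<le> (1 / 2) ^ n * (2 * pi * (2 + nrm A (x n)) * nrm A (y i -[A] a)) * nrm C (c n)"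
        by (intro mult_right_mono mult_left_mono A.bump_phase_lipschitz xc y a) auto
      finally show "norm (nrm C (f n (y i) -[C] f n a)) \<le> ?L * nrm A (y i -[A] a)"
        by (simp add: mult_ac)
    qed
  qed auto
  have Fcont: "continuous_map (ctop A) (ctop C) F"
    by (rule series_continuous[OF cA cC fcont F(1), where K = "2 * (K + 1)"]) (use F(2) in \<open>simp_all add: mult_ac\<close>)
  have Fscale: "F (z .[A] a) = z .[C] F a" if a: "a \<in> carrier A" for z a
  proof (rule C.nrm_limit_unique)
    have fz: "f n (z .[A] a) = z .[C] f n a" for n
      using A.bump_phase_scale[OF xc a] by (simp add: f_def mult_ac)
    show "nrm C (F (z .[A] a) -[C] csum C (\<lambda>k. f k (z .[A] a)) n) \<le> 2 * ((K + 1) * nrm A (z .[A] a)) * (1 / 2) ^ n" for n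
      using F(2) a by simp
    show "nrm C (z .[C] F a -[C] csum C (\<lambda>k. f k (z .[A] a)) n) \<le> (cmod z * (2 * ((K + 1) * nrm A a))) * (1 / 2) ^ n" for n
    proof -
      have "z .[C] F a -[C] csum C (\<lambda>k. f k (z .[A] a)) n = z .[C] (F a -[C] csum C (\<lambda>k. f k a) n)"
        using F(1) a by (simp add: fz C.csum_scale C.scale_diff_right)
      then have "nrm C (z .[C] F a -[C] csum C (\<lambda>k. f k (z .[A] a)) n) = cmod z * nrm C (F a -[C] csum C (\<lambda>k. f k a) n)"
        using F(1) a by (simp add: C.nrm_scale)
      then show ?thesis using F(2)[OF a, of n] by (simp add: mult_left_mono mult.assoc)
    qed
  qed (use a F(1) in auto)
  define w where "w = (\<lambda>n a. (1 / 2) ^ n * bump_avg A (x n) a)"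
  define W where "W = (\<lambda>a. \<Sum>n. w n a)"
  have wn: "0 \<le> w n a" if "a \<in> carrier A" for n a
    using A.bump_avg_nonneg[OF xc that] by (simp add: w_def)
  have geo: "summable (\<lambda>n. (1 / 2) ^ n * r)" for r :: real
    by (intro summable_mult2 summable_geometric) simp
  have ws: "summable (\<lambda>n. w n a)" if a: "a \<in> carrier A" for a
  proof (rule summable_comparison_test'[OF geo[of "nrm A a"]])
    show "norm (w n a) \<le> (1 / 2) ^ n * nrm A a" for n
      using A.bump_avg_bound[OF xc a, of n] A.bump_avg_nonneg[OF xc a, of n] by (simp add: w_def)
  qed
  have Wn: "0 \<le> W a" if "a \<in> carrier A" for a
    unfolding W_def using ws wn that by (simp add: suminf_nonneg)
  have partial: "(\<lambda>n. \<Sum>k<n. w k a) \<longlonglongrightarrow> W a" if "a \<in> carrier A" for a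
    unfolding W_def using ws[OF that] by (rule summable_LIMSEQ)
  have Fapprox: "(\<lambda>n. nrm C (F a -[C] csum C (\<lambda>k. f k a) n)) \<longlonglongrightarrow> 0" if a: "a \<in> carrier A" for a
  proof (rule Lim_null_comparison[of _ "\<lambda>n. 2 * ((K + 1) * nrm A a) * (1 / 2) ^ n"])
    show "(\<lambda>n. 2 * ((K + 1) * nrm A a) * (1 / 2) ^ n) \<longlonglongrightarrow> 0"
      by (intro tendsto_mult_right_zero LIMSEQ_power_zero) simp
  qed (use F a in \<open>simp add: always_eventually\<close>)
  have FW: "nrm C (F a) \<le> (K + 1) * W a" if a: "a \<in> carrier A" for a
  proof (rule LIMSEQ_le[of "\<lambda>n. nrm C (F a)"])
    show "(\<lambda>n. nrm C (F a -[C] csum C (\<lambda>k. f k a) n) + (K + 1) * (\<Sum>k<n. w k a)) \<longlonglongrightarrow> (K + 1) * W a"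
      using tendsto_add[OF Fapprox[OF a] tendsto_mult_left[OF partial[OF a]]] by simp
    have "nrm C (csum C (\<lambda>k. f k a) n) \<le> (K + 1) * (\<Sum>k<n. w k a)" for n
    proof (induction n)
      case (Suc n)
      have "nrm C (csum C (\<lambda>k. f k a) (Suc n)) \<le> nrm C (csum C (\<lambda>k. f k a) n) + nrm C (f n a)"
        by (simp add: C.nrm_triangle)
      then show ?case using Suc nfb[OF a, of n] by (simp add: w_def distrib_left)
    qed simp
    then have "nrm C (F a) \<le> nrm C (F a -[C] csum C (\<lambda>k. f k a) n) + (K + 1) * (\<Sum>k<n. w k a)" for n
      using C.nrm_le_add_diff[of "F a" "csum C (\<lambda>k. f k a) n"] F(1)[OF a] by (simp add: add.commute) (smt (verit))
    then show "\<exists>N. \<forall>n\<ge>N. nrm C (F a) \<le> nrm C (F a -[C] csum C (\<lambda>k. f k a) n) + (K + 1) * (\<Sum>k<n. w k a)" by blast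
  qed simp
  \<comment> \<open>By \<open>bump_phase_close\<close> the \<open>n\<close>-th term deviates from
    its multiple of \<open>a\<close> by at most half its weight. The deviations are added up and the
    number of terms tends to infinity.\<close>
  have pF: "nrm A (p (F a) -[A] of_real (W a / nrm A a) .[A] a) \<le> W a / 2"
    if a: "a \<in> carrier A" "a \<noteq> czero A" for a
  proof (rule LIMSEQ_le[of "\<lambda>n. nrm A (p (F a) -[A] of_real (W a / nrm A a) .[A] a)"])
    let ?S = "\<lambda>n. csum C (\<lambda>k. f k a) n" and ?w = "\<lambda>n. \<Sum>k<n. w k a"
    have na: "nrm A a > 0" using a A.nrm_eq_0[of a] A.nrm_nonneg[OF a(1)] by linarith
    have Sc [simp]: "?S n \<in> carrier C" "p (?S n) \<in> carrier A" for n using pD(1) by auto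
    have Fc [simp]: "F a \<in> carrier C" "p (F a) \<in> carrier A" using F a pD(1) by auto
    have part: "nrm A (p (?S n) -[A] of_real (?w n / nrm A a) .[A] a) \<le> ?w n / 2" for n
    proof (induction n)
      case 0
      then show ?case using a star_hom_zero[OF hom cC cA] by simp
    next
      case (Suc n)
      let ?v = "bump_phase A (x n) a .[A] x n -[A] of_real (bump_avg A (x n) a / nrm A a) .[A] a"
      have wS: "of_real (?w (Suc n) / nrm A a) .[A] a =
          of_real (?w n / nrm A a) .[A] a +[A] of_real (w n a / nrm A a) .[A] a"
        using a A.scale_add_left[of a "of_real (?w n / nrm A a)" "of_real (w n a / nrm A a)"]
        by (simp add: add_divide_distrib)
      have "p (f n a) -[A] of_real (w n a / nrm A a) .[A] a = ((1 / 2) ^ n) .[A] ?v"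
        using a pD(3)[of "c n"] pD(1)[OF cc[of n]] by (simp add: f_def w_def A.scale_diff_right x_def)
      moreover have "p (?S (Suc n)) = p (?S n) +[A] p (f n a)" using pD(2) by simp
      ultimately have "p (?S (Suc n)) -[A] of_real (?w (Suc n) / nrm A a) .[A] a =
          (p (?S n) -[A] of_real (?w n / nrm A a) .[A] a) +[A] ((1 / 2) ^ n) .[A] ?v"
        unfolding wS using a pD(1) by (metis A.add_diff_add A.scale_closed Sc(2) fc)
      then have "nrm A (p (?S (Suc n)) -[A] of_real (?w (Suc n) / nrm A a) .[A] a) \<le>
          nrm A (p (?S n) -[A] of_real (?w n / nrm A a) .[A] a) + nrm A (((1 / 2) ^ n) .[A] ?v)"
        using a by (simp only: A.nrm_triangle A.diff_closed A.scale_closed Sc xc)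
      also have "nrm A (((1 / 2) ^ n) .[A] ?v) = (1 / 2) ^ n * nrm A ?v"
        using a by (simp add: A.nrm_scale norm_power norm_divide)
      also have "\<dots> \<le> (1 / 2) ^ n * (bump_avg A (x n) a / 2)"
        using a by (intro mult_left_mono A.bump_phase_close xc) auto
      finally show ?case using Suc by (simp add: w_def)
    qed
    have "(\<lambda>n. nrm C (F a -[C] ?S n) + ?w n / 2 + \<bar>?w n - W a\<bar>) \<longlonglongrightarrow> 0 + W a / 2 + \<bar>W a - W a\<bar>"
      by (intro tendsto_intros partial Fapprox a) auto
    then show "(\<lambda>n. nrm C (F a -[C] ?S n) + ?w n / 2 + \<bar>?w n - W a\<bar>) \<longlonglongrightarrow> W a / 2" by simp
    have "nrm A (p (F a) -[A] of_real (W a / nrm A a) .[A] a) \<le> nrm C (F a -[C] ?S n) + ?w n / 2 + \<bar>?w n - W a\<bar>" for n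
    proof -
      let ?y = "of_real (W a / nrm A a) .[A] a" and ?z = "of_real (?w n / nrm A a) .[A] a"
      note a(1)[simp]
      have "nrm A (p (F a) -[A] ?y) \<le> nrm A (p (F a) -[A] p (?S n)) + nrm A (p (?S n) -[A] ?y)"
        by (intro A.nrm_diff_triangle) auto
      also have "nrm A (p (?S n) -[A] ?y) \<le> nrm A (p (?S n) -[A] ?z) + nrm A (?z -[A] ?y)"
        by (intro A.nrm_diff_triangle) auto
      also have "?z -[A] ?y = of_real ((?w n - W a) / nrm A a) .[A] a"
        using A.scale_diff_left[OF a(1), of "of_real (?w n / nrm A a)" "of_real (W a / nrm A a)"]
        by (simp add: diff_divide_distrib)
      also have "nrm A \<dots> = \<bar>(?w n - W a) / nrm A a\<bar> * nrm A a" using a by (simp only: A.nrm_scale norm_of_real)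
      also have "\<dots> = \<bar>?w n - W a\<bar>" using na by simp
      also have "p (F a) -[A] p (?S n) = p (F a -[C] ?S n)" by (rule star_hom_diff[OF hom cC, symmetric]) auto
      also have "nrm A \<dots> \<le> nrm C (F a -[C] ?S n)" by (rule star_hom_contractive[OF cC cA hom]) auto
      finally show ?thesis using part[of n] by linarith
    qed
    then show "\<exists>N. \<forall>n\<ge>N. nrm A (p (F a) -[A] of_real (W a / nrm A a) .[A] a) \<le>
        nrm C (F a -[C] ?S n) + ?w n / 2 + \<bar>?w n - W a\<bar>" by blast
  qed simp
  \<comment> \<open>The unit vector \<open>?b\<close> has a lift \<open>d\<close> up to 1/32, and
    \<open>d\<close> is within 1/32 of a candidate. The total 1/16 is the width of the bump, so that
    candidate has positive weight.\<close>
  have Wpos: "0 < W a" if a: "a \<in> carrier A" "a \<noteq> czero A" for a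
  proof -
    have na: "nrm A a > 0" using a A.nrm_eq_0[of a] A.nrm_nonneg[OF a(1)] by linarith
    let ?b = "of_real (1 / nrm A a) .[A] a"
    have "nrm A ?b = 1" using a na by (simp add: A.nrm_scale norm_divide)
    then have "\<exists>d\<in>carrier C. nrm C d \<le> K \<and> nrm A (?b -[A] p d) < 1 / 32"
      using a by (intro K(2)) auto
    then obtain d where d: "d \<in> carrier C" "nrm C d \<le> K" "nrm A (?b -[A] p d) < 1 / 32" by (elim bexE conjE)
    from Q(3)[OF d(1), of "1 / 32"] obtain q where q: "q \<in> Q" "nrm C (d -[C] q) < 1 / 32" by auto
    have qC: "q \<in> carrier C" using q Q1 by auto
    have "nrm C q \<le> K + 1"
      using C.nrm_le_add_diff[OF qC d(1)] C.nrm_diff_commute[OF qC d(1)] q d by simp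
    then have "q \<in> range c" unfolding rc using q by (simp add: R_def)
    then obtain n where n: "q = c n" by auto
    have "nrm A (?b -[A] x n) \<le> nrm A (?b -[A] p d) + nrm A (p d -[A] p q)"
      unfolding x_def n[symmetric] using a pD d qC by (intro A.nrm_diff_triangle) auto
    also have "p d -[A] p q = p (d -[C] q)" using star_hom_diff[OF hom cC d(1) qC] by simp
    also have "nrm A \<dots> \<le> nrm C (d -[C] q)" using star_hom_contractive[OF cC cA hom] d qC by simp
    finally have bx: "nrm A (?b -[A] x n) < 1 / 16" using d q by simp
    have "a -[A] of_real (nrm A a) .[A] x n = of_real (nrm A a) .[A] (?b -[A] x n)"
      using a na by (simp add: A.scale_diff_right)
    then have "nrm A (a -[A] of_real (nrm A a) .[A] x n) = nrm A a * nrm A (?b -[A] x n)"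
      using a na by (simp add: A.nrm_scale)
    also have "\<dots> < nrm A a * (1 / 16)" using na bx by (intro mult_strict_left_mono) auto
    finally have "0 < bump_avg A (x n) a" using a by (intro A.bump_avg_pos xc) auto
    then have "0 < w n a" by (simp add: w_def)
    then show ?thesis unfolding W_def using wn[OF a(1)] ws[OF a(1)] by (intro suminf_pos2[where i = n]) auto
  qed
  have Wscale: "W (z .[A] a) = cmod z * W a" if a: "a \<in> carrier A" for z a
  proof -
    have "w n (z .[A] a) = cmod z * w n a" for n using A.bump_avg_scale[OF xc a] by (simp add: w_def)
    then show ?thesis unfolding W_def using ws[OF a] by (simp add: suminf_mult)
  qed
  have Wlip: "\<bar>W a - W b\<bar> \<le> (4 * pi * (3 + K)) * nrm A (a -[A] b)" if ab: "a \<in> carrier A" "b \<in> carrier A" for a b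
  proof -
    have l: "norm (w n a - w n b) \<le> (1 / 2) ^ n * (2 * pi * (3 + K) * nrm A (a -[A] b))" for n
    proof -
      have "\<bar>bump_avg A (x n) a - bump_avg A (x n) b\<bar> \<le> 2 * pi * (2 + nrm A (x n)) * nrm A (a -[A] b)"
        by (rule A.bump_avg_lipschitz[OF xc ab])
      also have "\<dots> \<le> 2 * pi * (3 + K) * nrm A (a -[A] b)"
        using nx[of n] ab by (intro mult_right_mono mult_left_mono) auto
      finally show ?thesis
        by (simp add: w_def right_diff_distrib[symmetric] abs_mult)
    qed
    have "W a - W b = (\<Sum>n. w n a - w n b)" unfolding W_def using ws ab by (simp add: suminf_diff)
    also have "norm \<dots> \<le> (\<Sum>n. (1 / 2) ^ n * (2 * pi * (3 + K) * nrm A (a -[A] b)))"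
      by (rule norm_suminf_le[OF l geo])
    also have "\<dots> = (\<Sum>n. (1 / 2 :: real) ^ n) * (2 * pi * (3 + K) * nrm A (a -[A] b))"
      by (rule suminf_mult2[symmetric]) (intro summable_geometric, simp)
    also have "(\<Sum>n. (1 / 2 :: real) ^ n) = 2" by (subst suminf_geometric) auto
    finally show ?thesis by (simp add: algebra_simps)
  qed
  \<comment> \<open>\<open>F a\<close> lifts \<open>W a / nrm A a\<close> times \<open>a\<close>
    with error at most \<open>W a / 2\<close>. This normalisation turns the error into half the norm
    of \<open>a\<close>.\<close>
  define s where "s = (\<lambda>a. of_real (nrm A a / W a) .[C] F a)"
  have sc: "s a \<in> carrier C" if "a \<in> carrier A" for a using F(1)[OF that] by (simp add: s_def)
  have ns: "nrm C (s a) \<le> (K + 1) * nrm A a" if a: "a \<in> carrier A" for a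
  proof (cases "a = czero A")
    case False
    then have W: "W a > 0" using Wpos a by auto
    have "nrm C (s a) = nrm A a / W a * nrm C (F a)"
      using F(1)[OF a] a W by (simp add: s_def C.nrm_scale norm_divide)
    also have "\<dots> \<le> nrm A a / W a * ((K + 1) * W a)" using FW[OF a] a W by (intro mult_left_mono) auto
    finally show ?thesis using W by (simp add: mult_ac)
  qed (use F(1) in \<open>simp add: s_def\<close>)
  have "homogeneous A C s"
    unfolding homogeneous_def
  proof (intro allI ballI)
    fix z a assume a: "a \<in> carrier A"
    have "z * of_real (nrm A a / W a) = of_real (nrm A (z .[A] a) / W (z .[A] a)) * z"
      using a by (cases "z = 0") (simp_all add: A.nrm_scale Wscale)
    then show "s (z .[A] a) = z .[C] s a"
      using F(1)[OF a] a by (simp only: s_def Fscale C.scale_scale)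
  qed
  moreover have "nrm A (a -[A] p (s a)) \<le> nrm A a / 2" if a: "a \<in> carrier A" for a
  proof (cases "a = czero A")
    case True
    then show ?thesis using F(1)[OF a] star_hom_zero[OF hom cC cA] by (simp add: s_def)
  next
    case False
    then have W: "W a > 0" using Wpos a by auto
    have na: "nrm A a > 0" using a False A.nrm_eq_0[of a] A.nrm_nonneg[OF a] by linarith
    have Fc: "F a \<in> carrier C" "p (F a) \<in> carrier A" using F(1)[OF a] pD(1) by auto
    let ?t = "complex_of_real (nrm A a / W a)"
    have t: "?t * of_real (W a / nrm A a) = 1" "cmod ?t = nrm A a / W a" using W na by (simp_all add: norm_divide)
    have "a = ?t .[A] (of_real (W a / nrm A a) .[A] a)" using a t by (simp only: A.scale_scale A.scale_one)
    then have "p (s a) -[A] a = ?t .[A] (p (F a) -[A] of_real (W a / nrm A a) .[A] a)"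
      using pD(3)[OF Fc(1)] Fc a by (metis A.scale_closed A.scale_diff_right s_def)
    then have "nrm A (a -[A] p (s a)) = nrm A a / W a * nrm A (p (F a) -[A] of_real (W a / nrm A a) .[A] a)"
      using A.nrm_diff_commute[OF a pD(1)[OF sc[OF a]]] Fc a
      by (simp only: A.nrm_scale A.diff_closed A.scale_closed t)
    also have "\<dots> \<le> nrm A a / W a * (W a / 2)" using pF[OF a False] na W by (intro mult_left_mono) auto
    finally show ?thesis using W by simp
  qed
  moreover have "continuous_map (ctop A) (ctop C) s"
  proof (rule continuous_ctop_seqI[OF cA cC])
    fix a y assume a: "a \<in> carrier A" and y: "\<And>i :: nat. y i \<in> carrier A" and lim: "(\<lambda>i. nrm A (y i -[A] a)) \<longlonglongrightarrow> 0"
    show "(\<lambda>i. nrm C (s (y i) -[C] s a)) \<longlonglongrightarrow> 0"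
    \<comment> \<open>At the origin the quotient is not continuous, and continuity comes from the
      linear bound \<open>ns\<close>; elsewhere \<open>W a\<close> is positive and limit arithmetic
      applies.\<close>
    proof (cases "a = czero A")
      case True
      then have s0: "s a = czero C" using F(1)[OF a] by (simp add: s_def)
      have "(\<lambda>i. nrm A (y i)) \<longlonglongrightarrow> 0" using lim y by (simp add: True)
      then have "(\<lambda>i. (K + 1) * nrm A (y i)) \<longlonglongrightarrow> 0" by (rule tendsto_mult_right_zero)
      then show ?thesis
        by (rule Lim_null_comparison[rotated], intro always_eventually allI) (use ns[OF y] sc[OF y] in \<open>simp add: s0\<close>)
    next
      case False
      then have W: "W a \<noteq> 0" using Wpos a by force
      have ny: "(\<lambda>i. nrm A (y i)) \<longlonglongrightarrow> nrm A a"
        unfolding LIM_zero_iff[symmetric, of _ "nrm A a"]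
        by (rule Lim_null_comparison[OF _ lim]) (use A.nrm_diff_ineq y a in auto)
      have Wy: "(\<lambda>i. W (y i)) \<longlonglongrightarrow> W a"
        unfolding LIM_zero_iff[symmetric, of _ "W a"]
        by (rule Lim_null_comparison[OF _ tendsto_mult_right_zero[OF lim, of "4 * pi * (3 + K)"]])
          (use Wlip[OF y a] in auto)
      let ?r = "\<lambda>a. nrm A a / W a"
      have "(\<lambda>i. \<bar>?r (y i) - ?r a\<bar> * ((K + 1) * W (y i)) + \<bar>?r a\<bar> * nrm C (F (y i) -[C] F a)) \<longlonglongrightarrow>
          \<bar>?r a - ?r a\<bar> * ((K + 1) * W a) + \<bar>?r a\<bar> * 0"
        using W by (intro tendsto_intros ny Wy continuous_ctop_seqD[OF cA cC Fcont a y lim])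
      then have lim2: "(\<lambda>i. \<bar>?r (y i) - ?r a\<bar> * ((K + 1) * W (y i)) + \<bar>?r a\<bar> * nrm C (F (y i) -[C] F a)) \<longlonglongrightarrow> 0"
        by simp
      show ?thesis
      proof (rule Lim_null_comparison[OF _ lim2], intro always_eventually allI)
        fix i
        have Fc: "F (y i) \<in> carrier C" "F a \<in> carrier C" using F(1) y a by auto
        have "of_real (?r (y i)) .[C] u -[C] of_real (?r a) .[C] v =
            of_real (?r (y i) - ?r a) .[C] u +[C] of_real (?r a) .[C] (u -[C] v)"
          if "u \<in> carrier C" "v \<in> carrier C" for u v
          unfolding of_real_diff C.scale_diff_left[OF that(1)]
          using that by (simp only: C.scale_diff_right C.diff_diff_add C.scale_closed)
        then have "s (y i) -[C] s a = of_real (?r (y i) - ?r a) .[C] F (y i) +[C] of_real (?r a) .[C] (F (y i) -[C] F a)"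
          unfolding s_def using Fc by blast
        then have "nrm C (s (y i) -[C] s a) \<le>
            nrm C (of_real (?r (y i) - ?r a) .[C] F (y i)) + nrm C (of_real (?r a) .[C] (F (y i) -[C] F a))"
          using Fc by (simp only: C.nrm_triangle C.scale_closed C.diff_closed)
        also have "\<dots> = \<bar>?r (y i) - ?r a\<bar> * nrm C (F (y i)) + \<bar>?r a\<bar> * nrm C (F (y i) -[C] F a)"
          using Fc by (simp only: C.nrm_scale C.diff_closed norm_of_real)
        also have "\<dots> \<le> \<bar>?r (y i) - ?r a\<bar> * ((K + 1) * W (y i)) + \<bar>?r a\<bar> * nrm C (F (y i) -[C] F a)"
          by (intro add_right_mono mult_left_mono FW y) auto
        finally show "norm (nrm C (s (y i) -[C] s a)) \<le>
            \<bar>?r (y i) - ?r a\<bar> * ((K + 1) * W (y i)) + \<bar>?r a\<bar> * nrm C (F (y i) -[C] F a)"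
          using sc y a by simp
      qed
    qed
  qed (use sc in auto)
  ultimately show ?thesis using ns by blast
qed

text \<open>The section is \<open>\<Sum>\<^sub>n s \<circ> (id - p \<circ> s)\<^sup>n\<close> for an approximate section \<open>s\<close>.\<close>

theorem continuous_homogeneous_section:
  assumes cA: "csa A" and cC: "csa C" and p: "star_epi C A p" and sep: "separable C"
  shows "\<exists>s. continuous_map (ctop A) (ctop C) s \<and> homogeneous A C s \<and> (\<forall>a\<in>carrier A. p (s a) = a)"
proof -
  interpret A: pre_cstar A using cA by (rule cstar_imp_pre)
  interpret C: pre_cstar C using cC by (rule cstar_imp_pre)
  have hom: "star_hom C A p" using p by (auto simp: star_epi_def)
  note pD = star_homD[OF hom]
  from approximate_section[OF assms] obtain s K where s1: "continuous_map (ctop A) (ctop C) s" "homogeneous A C s"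
    and s2: "\<forall>a\<in>carrier A. nrm C (s a) \<le> K * nrm A a \<and> nrm A (a -[A] p (s a)) \<le> nrm A a / 2"
    by (elim exE conjE)
  note s = s1 s2[rule_format, THEN conjunct1] s2[rule_format, THEN conjunct2]
  have sc [simp]: "s a \<in> carrier C" if "a \<in> carrier A" for a
    using s(1) that unfolding continuous_ctop_iff[OF cA cC] by auto
  define r where "r = (\<lambda>a. a -[A] p (s a))"
  have rc [simp]: "(r ^^ n) a \<in> carrier A" if "a \<in> carrier A" for n a
    using that by (induction n) (auto simp: r_def pD)
  have rn: "nrm A ((r ^^ n) a) \<le> nrm A a * (1 / 2) ^ n" if a: "a \<in> carrier A" for n a
  proof (induction n)
    case (Suc n)
    show ?case using s(4)[OF rc[OF a], of n] Suc by (simp add: r_def)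
  qed simp
  have rs: "(r ^^ n) (z .[A] a) = z .[A] (r ^^ n) a" if a: "a \<in> carrier A" for n z a
  proof (induction n)
    case (Suc n)
    have "r (z .[A] b) = z .[A] r b" if "b \<in> carrier A" for b
      using that s(2) pD by (simp add: r_def homogeneous_def A.scale_diff_right)
    then show ?case using Suc a by simp
  qed simp
  have rcont1: "continuous_map (ctop A) (ctop A) r"
    using continuous_diff[OF cA cA continuous_map_id[unfolded id_def] continuous_map_compose[OF s(1) star_hom_continuous[OF cC cA hom]]]
    by (simp add: r_def[abs_def])
  have rcont: "continuous_map (ctop A) (ctop A) (r ^^ n)" for n
  proof (induction n)
    case (Suc n)
    then show ?case using continuous_map_compose[OF Suc rcont1] by (simp add: o_def)
  qed simp
  have K: "0 \<le> \<bar>K\<bar>" by simp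
  have bound: "nrm C (s ((r ^^ n) a)) \<le> \<bar>K\<bar> * nrm A a * (1 / 2) ^ n" if a: "a \<in> carrier A" for n a
  proof -
    have "nrm C (s ((r ^^ n) a)) \<le> K * nrm A ((r ^^ n) a)" using s(3) a by simp
    also have "\<dots> \<le> \<bar>K\<bar> * nrm A ((r ^^ n) a)" using a by (intro mult_right_mono) auto
    also have "\<dots> \<le> \<bar>K\<bar> * (nrm A a * (1 / 2) ^ n)" using rn[OF a] by (intro mult_left_mono) auto
    finally show ?thesis by (simp add: mult.assoc)
  qed
  let ?S = "\<lambda>a n. csum C (\<lambda>k. s ((r ^^ k) a)) n"
  have Sc [simp]: "?S a n \<in> carrier C" if "a \<in> carrier A" for a n using that by simp
  have "\<forall>a\<in>carrier A. \<exists>y. y \<in> carrier C \<and> (\<forall>n. nrm C (y -[C] ?S a n) \<le> 2 * (\<bar>K\<bar> * nrm A a) * (1 / 2) ^ n)"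
    using cstar_geometric_series[OF cC _ bound] by (metis rc sc)
  then obtain t where t: "\<And>a. a \<in> carrier A \<Longrightarrow> t a \<in> carrier C"
    "\<And>a n. a \<in> carrier A \<Longrightarrow> nrm C (t a -[C] ?S a n) \<le> 2 * (\<bar>K\<bar> * nrm A a) * (1 / 2) ^ n"
    by metis
  have "continuous_map (ctop A) (ctop C) t"
  proof (rule series_continuous[OF cA cC _ t(1), where f = "\<lambda>k a. s ((r ^^ k) a)" and K = "2 * \<bar>K\<bar>"])
    show "continuous_map (ctop A) (ctop C) (\<lambda>a. s ((r ^^ k) a))" for k
      using continuous_map_compose[OF rcont s(1)] by (simp add: o_def)
  qed (use t(2) in \<open>auto simp: mult_ac\<close>)
  moreover have "homogeneous A C t"
    unfolding homogeneous_def
  proof (intro allI ballI)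
    fix z a assume a: "a \<in> carrier A"
    show "t (z .[A] a) = z .[C] t a"
    proof (rule C.nrm_limit_unique)
      show "nrm C (t (z .[A] a) -[C] ?S (z .[A] a) n) \<le> 2 * (\<bar>K\<bar> * nrm A (z .[A] a)) * (1 / 2) ^ n" for n
        using t(2) a by simp
      show "nrm C (z .[C] t a -[C] ?S (z .[A] a) n) \<le> (cmod z * (2 * (\<bar>K\<bar> * nrm A a))) * (1 / 2) ^ n" for n
      proof -
        have "?S (z .[A] a) n = z .[C] ?S a n"
          using a s(2) by (simp add: rs homogeneous_def C.csum_scale)
        then have "z .[C] t a -[C] ?S (z .[A] a) n = z .[C] (t a -[C] ?S a n)"
          using t(1) a by (simp add: C.scale_diff_right)
        then have "nrm C (z .[C] t a -[C] ?S (z .[A] a) n) = cmod z * nrm C (t a -[C] ?S a n)"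
          using t(1) a by (simp add: C.nrm_scale)
        then show ?thesis using t(2)[OF a, of n] by (simp add: mult_left_mono mult.assoc)
      qed
    qed (use a t(1) in auto)
  qed
  moreover have "p (t a) = a" if a: "a \<in> carrier A" for a
  proof (rule A.nrm_limit_unique)
    \<comment> \<open>Telescoping: \<open>p\<close> maps the \<open>k\<close>-th term of the series
      to \<open>(r ^^ k) a - (r ^^ Suc k) a\<close>.\<close>
    have tel: "a -[A] p (?S a n) = (r ^^ n) a" for n
    proof (induction n)
      case 0
      then show ?case using a star_hom_zero[OF hom cC cA] by simp
    next
      case (Suc n)
      have "a -[A] p (?S a (Suc n)) = (a -[A] p (?S a n)) -[A] p (s ((r ^^ n) a))"
        using a pD by (simp add: A.diff_diff_left)
      then show ?case using Suc by (simp add: r_def)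
    qed
    show "nrm A (a -[A] p (?S a n)) \<le> nrm A a * (1 / 2) ^ n" for n
      unfolding tel using rn[OF a] .
    show "nrm A (p (t a) -[A] p (?S a n)) \<le> 2 * (\<bar>K\<bar> * nrm A a) * (1 / 2) ^ n" for n
      using star_hom_contractive[OF cC cA hom C.diff_closed[OF t(1)[OF a] Sc[OF a]], of n]
        star_hom_diff[OF hom cC t(1)[OF a] Sc[OF a], of n] t(2)[OF a, of n] by simp
    show "p (t a) \<in> carrier A" "p (?S a n) \<in> carrier A" for n using pD(1) t(1) Sc a by blast+
  qed (use a in simp)
  ultimately show ?thesis by blast
qed

text \<open>A section \<open>s\<close> is averaged with the map that sends \<open>a\<close> to the
  adjoint of \<open>s (adj A a)\<close>. The latter is again a homogeneous section, since the two
  complex conjugations cancel.\<close>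

theorem sections_nonempty:
  assumes cA: "csa A" and X: "X \<in> extensions A"
  shows "sections A X \<noteq> {}"
proof -
  obtain C p where Xp: "X = (C, p)" by (cases X)
  have cC: "csa C" and sep: "separable C" and p: "star_epi C A p"
    using X by (auto simp: Xp extensions_def)
  interpret A: pre_cstar A using cA by (rule cstar_imp_pre)
  interpret C: pre_cstar C using cC by (rule cstar_imp_pre)
  have hom: "star_hom C A p" using p by (auto simp: star_epi_def)
  note pD = star_homD[OF hom]
  from continuous_homogeneous_section[OF cA cC p sep] obtain s where
    s1: "continuous_map (ctop A) (ctop C) s" "homogeneous A C s" and s2: "\<forall>a\<in>carrier A. p (s a) = a"
    by (elim exE conjE)
  note s = s1 s2[rule_format]
  have sc [simp]: "s a \<in> carrier C" if "a \<in> carrier A" for a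
    using s(1) that unfolding continuous_ctop_iff[OF cA cC] by auto
  define t where "t = (\<lambda>a. (1 / 2) .[C] (s a +[C] adj C (s (adj A a))))"
  have half: "(1 / 2) .[A] (a +[A] a) = a" if "a \<in> carrier A" for a
    using that A.scale_add_left[of "(1/2) .[A] a" 1 1] by (simp add: A.scale_add_right)
  have "continuous_map (ctop A) (ctop C) t"
  proof (rule continuous_ctop_seqI[OF cA cC])
    fix a x assume a: "a \<in> carrier A" and x: "\<And>n :: nat. x n \<in> carrier A" and lim: "(\<lambda>n. nrm A (x n -[A] a)) \<longlonglongrightarrow> 0"
    have lim': "(\<lambda>n. nrm A (adj A (x n) -[A] adj A a)) \<longlonglongrightarrow> 0"
      using lim x a by (simp add: A.adj_diff[symmetric])
    have "(\<lambda>n. nrm C (s (x n) -[C] s a) + nrm C (s (adj A (x n)) -[C] s (adj A a))) \<longlonglongrightarrow> 0 + 0"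
      by (intro tendsto_add continuous_ctop_seqD[OF cA cC s(1)] lim lim') (use a x in auto)
    then have "(\<lambda>n. nrm C (s (x n) -[C] s a) + nrm C (s (adj A (x n)) -[C] s (adj A a))) \<longlonglongrightarrow> 0" by simp
    then show "(\<lambda>n. nrm C (t (x n) -[C] t a)) \<longlonglongrightarrow> 0"
    proof (rule Lim_null_comparison[rotated], intro always_eventually allI)
      fix n
      have "t (x n) -[C] t a = (1 / 2) .[C] ((s (x n) -[C] s a) +[C] adj C (s (adj A (x n)) -[C] s (adj A a)))"
        using x a by (simp add: t_def C.scale_diff_right[symmetric] C.add_diff_add C.adj_diff)
      then have "nrm C (t (x n) -[C] t a) = 1 / 2 * nrm C ((s (x n) -[C] s a) +[C] adj C (s (adj A (x n)) -[C] s (adj A a)))"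
        using x a by (simp add: C.nrm_scale norm_divide)
      moreover have "nrm C ((s (x n) -[C] s a) +[C] adj C (s (adj A (x n)) -[C] s (adj A a))) \<le>
          nrm C (s (x n) -[C] s a) + nrm C (s (adj A (x n)) -[C] s (adj A a))"
        using x a C.nrm_triangle[of "s (x n) -[C] s a" "adj C (s (adj A (x n)) -[C] s (adj A a))"] by simp
      moreover have "0 \<le> nrm C (s (x n) -[C] s a)" "0 \<le> nrm C (s (adj A (x n)) -[C] s (adj A a))"
        using x a by (auto intro!: C.nrm_nonneg)
      moreover have "0 \<le> nrm C (t (x n) -[C] t a)" using x a by (intro C.nrm_nonneg) (auto simp: t_def)
      ultimately show "norm (nrm C (t (x n) -[C] t a)) \<le>
          nrm C (s (x n) -[C] s a) + nrm C (s (adj A (x n)) -[C] s (adj A a))" by simp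
    qed
  qed (auto simp: t_def)
  moreover have "homogeneous A C t"
    using s(2) by (auto simp: homogeneous_def t_def A.adj_scale C.adj_scale C.scale_add_right mult.commute)
  moreover have "t (adj A a) = adj C (t a)" if "a \<in> carrier A" for a
    using that by (simp add: t_def C.adj_scale C.adj_add C.add_commute)
  moreover have "p (t a) = a" if "a \<in> carrier A" for a
    using that s(3) pD half by (simp add: t_def)
  ultimately have "t \<in> sections A X" by (simp add: sections_def Xp)
  then show ?thesis by blast
qed

section \<open>Asymptotic equality\<close>

text \<open>Besides \<open>B\<close> itself, the locale is instantiated with \<open>IB B\<close> for
  homotopies and with \<open>CbR B\<close> for norm-continuous paths of functions.\<close>

locale codomain =
  fixes B :: "'b cstar"
  assumes cB: "csa B"
begin

abbreviation CR :: "(real \<Rightarrow> 'b) cstar"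
  where "CR \<equiv> CbR B"

lemma cR: "csa CR"
  by (rule cstar_Cb[OF cB]) auto

lemma cI: "csa (IB B)"
  by (rule cstar_Cb[OF cB]) auto

sublocale pre_cstar B
  using cB by (rule cstar_imp_pre)

sublocale R: pre_cstar "CR"
  using cR by (rule cstar_imp_pre)

sublocale I: pre_cstar "IB B"
  using cI by (rule cstar_imp_pre)

lemma CbR_apply [simp]: "\<lbrakk>f \<in> carrier CR; 0 \<le> t\<rbrakk> \<Longrightarrow> f t \<in> carrier B"
  using Cb_apply_closed[OF cB] by auto

lemma IB_apply [simp]: "\<lbrakk>f \<in> carrier (IB B); 0 \<le> r; r \<le> 1\<rbrakk> \<Longrightarrow> f r \<in> carrier B"
  using Cb_apply_closed[OF cB] by auto

lemma CbR_at [simp]: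
  assumes "0 \<le> t"
  shows "czero CR t = czero B" "(f +[CR] g) t = f t +[B] g t" "(c .[CR] f) t = c .[B] f t"
    "(f *[CR] g) t = f t *[B] g t" "adj CR f t = adj B (f t)" "(f -[CR] g) t = f t -[B] g t"
  using assms by (simp_all add: Cb_simps Cb_diff)

lemma IB_at [simp]:
  assumes "0 \<le> r" "r \<le> 1"
  shows "czero (IB B) r = czero B" "(f +[IB B] g) r = f r +[B] g r" "(c .[IB B] f) r = c .[B] f r"
    "(f *[IB B] g) r = f r *[B] g r" "adj (IB B) f r = adj B (f r)" "(f -[IB B] g) r = f r -[B] g r"
  using assms by (simp_all add: Cb_simps Cb_diff)

lemma C0R_iff: "f \<in> C0R B \<longleftrightarrow> f \<in> carrier CR \<and> ((\<lambda>t. nrm B (f t)) \<longlongrightarrow> 0) at_top"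
  by (simp add: C0R_def)

lemma C0R_carrier [simp]: "f \<in> C0R B \<Longrightarrow> f \<in> carrier CR"
  by (simp add: C0R_iff)

lemma C0R_dominated:
  assumes "f \<in> carrier CR" "(h \<longlongrightarrow> 0) at_top" "\<And>t. 0 \<le> t \<Longrightarrow> nrm B (f t) \<le> h t"
  shows "f \<in> C0R B"
proof -
  have "((\<lambda>t. nrm B (f t)) \<longlongrightarrow> 0) at_top"
  proof (rule Lim_null_comparison[OF _ assms(2)])
    show "\<forall>\<^sub>F t in at_top. norm (nrm B (f t)) \<le> h t"
      using eventually_ge_at_top[of 0] by eventually_elim (use assms in simp)
  qed
  then show ?thesis using assms(1) by (simp add: C0R_iff)
qed

lemma C0R_zero [simp]: "czero CR \<in> C0R B"
  by (rule C0R_dominated[of _ "\<lambda>_. 0"]) simp_all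

lemma C0R_add: "\<lbrakk>f \<in> C0R B; g \<in> C0R B\<rbrakk> \<Longrightarrow> f +[CR] g \<in> C0R B"
proof (rule C0R_dominated[of _ "\<lambda>t. nrm B (f t) + nrm B (g t)"])
  assume "f \<in> C0R B" "g \<in> C0R B"
  then show "((\<lambda>t. nrm B (f t) + nrm B (g t)) \<longlongrightarrow> 0) at_top"
    using tendsto_add[of "\<lambda>t. nrm B (f t)" 0 at_top "\<lambda>t. nrm B (g t)" 0] by (simp add: C0R_iff)
qed (simp_all add: nrm_triangle)

lemma C0R_scale: "f \<in> C0R B \<Longrightarrow> c .[CR] f \<in> C0R B"
proof (rule C0R_dominated[of _ "\<lambda>t. cmod c * nrm B (f t)"])
  assume "f \<in> C0R B"
  then show "((\<lambda>t. cmod c * nrm B (f t)) \<longlongrightarrow> 0) at_top" by (simp add: C0R_iff tendsto_mult_right_zero)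
qed (simp_all add: nrm_scale)

lemma C0R_adj: "f \<in> C0R B \<Longrightarrow> adj CR f \<in> C0R B"
  by (rule C0R_dominated[of _ "\<lambda>t. nrm B (f t)"]) (use C0R_iff in simp_all)

lemma C0R_mult_left: "\<lbrakk>g \<in> carrier CR; f \<in> C0R B\<rbrakk> \<Longrightarrow> g *[CR] f \<in> C0R B"
proof (rule C0R_dominated[of _ "\<lambda>t. nrm CR g * nrm B (f t)"])
  assume g: "g \<in> carrier CR" and f: "f \<in> C0R B"
  then show "((\<lambda>t. nrm CR g * nrm B (f t)) \<longlongrightarrow> 0) at_top" by (simp add: C0R_iff tendsto_mult_right_zero)
  fix t :: real assume t: "0 \<le> t"
  have "nrm B (g t *[B] f t) \<le> nrm B (g t) * nrm B (f t)" using f g t by (intro nrm_mult) auto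
  also have "\<dots> \<le> nrm CR g * nrm B (f t)"
    using f g t nrm_Cb_le[OF cB g] by (intro mult_right_mono) auto
  finally show "nrm B ((g *[CR] f) t) \<le> nrm CR g * nrm B (f t)" using t by simp
qed auto

lemma C0R_mult_right: "\<lbrakk>g \<in> carrier CR; f \<in> C0R B\<rbrakk> \<Longrightarrow> f *[CR] g \<in> C0R B"
  using C0R_adj[OF C0R_mult_left[of "adj CR g" "adj CR f"]] C0R_adj[of f]
  by (simp add: R.adj_mult)

lemma C0R_limit:
  assumes f: "f \<in> carrier CR" and lim: "\<And>e. e > 0 \<Longrightarrow> \<exists>g\<in>C0R B. nrm CR (f -[CR] g) < e"
  shows "f \<in> C0R B"
proof -
  have "\<forall>\<^sub>F t in at_top. nrm B (f t) < e" if e: "e > 0" for e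
  proof -
    obtain g where g: "g \<in> C0R B" "nrm CR (f -[CR] g) < e / 2" using lim[of "e / 2"] e by auto
    have "\<forall>\<^sub>F t in at_top. nrm B (g t) < e / 2" using g(1) e by (intro order_tendstoD) (auto simp: C0R_iff)
    moreover have "\<forall>\<^sub>F t :: real in at_top. 0 \<le> t" by (rule eventually_ge_at_top)
    ultimately show ?thesis
    proof eventually_elim
      case (elim t)
      have "nrm B (f t -[B] g t) \<le> nrm CR (f -[CR] g)"
        using nrm_Cb_le[OF cB, of "f -[CR] g" "{0..}" t] f g(1) elim by simp
      then show ?case using nrm_le_add_diff[of "f t" "g t"] g f elim by simp
    qed
  qed
  then have "((\<lambda>t. nrm B (f t)) \<longlongrightarrow> 0) at_top"
    unfolding tendsto_iff dist_real_def
  proof (intro allI impI)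
    fix e :: real assume "e > 0" and *: "\<And>e. e > 0 \<Longrightarrow> \<forall>\<^sub>F t in at_top. nrm B (f t) < e"
    show "\<forall>\<^sub>F t in at_top. \<bar>nrm B (f t) - 0\<bar> < e"
      using *[OF \<open>e > 0\<close>] eventually_ge_at_top[of 0] by eventually_elim (use f in simp)
  qed
  then show ?thesis using f by (simp add: C0R_iff)
qed

lemma C0R_closed: "closedin (ctop CR) (C0R B)"
  unfolding R.closedin_ctop_iff
proof (intro conjI ballI impI)
  show "C0R B \<subseteq> carrier CR" by auto
  show "f \<in> C0R B" if "f \<in> carrier CR" "\<forall>e>0. \<exists>g\<in>C0R B. nrm CR (f -[CR] g) < e" for f
    using C0R_limit[OF that(1)] that(2) by blast
qed

text \<open>Membership in the carrier is part of the relation, so that chains of equivalences carry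
  their own closure facts.\<close>

definition aeq :: "(real \<Rightarrow> 'b) \<Rightarrow> (real \<Rightarrow> 'b) \<Rightarrow> bool"  (infix "\<simeq>" 50)
  where "f \<simeq> g \<longleftrightarrow> f \<in> carrier CR \<and> g \<in> carrier CR \<and> f -[CR] g \<in> C0R B"

lemma aeqI: "\<lbrakk>f \<in> carrier CR; g \<in> carrier CR; f -[CR] g \<in> C0R B\<rbrakk> \<Longrightarrow> f \<simeq> g"
  by (simp add: aeq_def)

lemma aeq_carrier: "f \<simeq> g \<Longrightarrow> f \<in> carrier CR" "f \<simeq> g \<Longrightarrow> g \<in> carrier CR"
  by (auto simp: aeq_def)

lemma aeq_refl [simp]: "f \<in> carrier CR \<Longrightarrow> f \<simeq> f"
  by (simp add: aeq_def)

lemma aeq_sym: "f \<simeq> g \<Longrightarrow> g \<simeq> f"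
  using C0R_scale[of "f -[CR] g" "-1"]
  by (simp add: aeq_def cdiff_def R.scale_add_right R.add_commute)

lemma aeq_trans [trans]: "\<lbrakk>f \<simeq> g; g \<simeq> h\<rbrakk> \<Longrightarrow> f \<simeq> h"
  using C0R_add[of "f -[CR] g" "g -[CR] h"] by (auto simp: aeq_def R.diff_diff_add)

lemma aeq_eq_trans [trans]: "\<lbrakk>f \<simeq> g; g = h\<rbrakk> \<Longrightarrow> f \<simeq> h" "\<lbrakk>f = g; g \<simeq> h\<rbrakk> \<Longrightarrow> f \<simeq> h"
  by auto

lemma aeq_add: "\<lbrakk>f \<simeq> f'; g \<simeq> g'\<rbrakk> \<Longrightarrow> f +[CR] g \<simeq> f' +[CR] g'"
  using C0R_add[of "f -[CR] f'" "g -[CR] g'"] by (auto simp: aeq_def R.add_diff_add)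

lemma aeq_scale: "f \<simeq> g \<Longrightarrow> c .[CR] f \<simeq> c .[CR] g"
  using C0R_scale[of "f -[CR] g" c] by (auto simp: aeq_def R.scale_diff_right)

lemma aeq_diff: "\<lbrakk>f \<simeq> f'; g \<simeq> g'\<rbrakk> \<Longrightarrow> f -[CR] g \<simeq> f' -[CR] g'"
  unfolding cdiff_def by (intro aeq_add aeq_scale)

lemma aeq_mult: "\<lbrakk>f \<simeq> f'; g \<simeq> g'\<rbrakk> \<Longrightarrow> f *[CR] g \<simeq> f' *[CR] g'"
  using C0R_add[OF C0R_mult_right[of g "f -[CR] f'"] C0R_mult_left[of f' "g -[CR] g'"]]
  by (auto simp: aeq_def R.mult_diff_mult)

lemma aeq_adj: "f \<simeq> g \<Longrightarrow> adj CR f \<simeq> adj CR g"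
  using C0R_adj[of "f -[CR] g"] by (auto simp: aeq_def R.adj_diff)

lemma aeq_zero_iff: "f \<simeq> czero CR \<longleftrightarrow> f \<in> C0R B"
  by (auto simp: aeq_def)

lemma aeq_C0R: "\<lbrakk>f \<simeq> g; g \<in> C0R B\<rbrakk> \<Longrightarrow> f \<in> C0R B"
  using aeq_trans aeq_zero_iff by blast

lemma aeq_diff_iff:
  "\<lbrakk>f \<in> carrier CR; g \<in> carrier CR\<rbrakk> \<Longrightarrow> f -[CR] g \<in> C0R B \<longleftrightarrow> f \<simeq> g"
  by (simp add: aeq_def)

lemma CbR_eqI: "\<lbrakk>f \<in> carrier CR; g \<in> carrier CR; \<And>t. 0 \<le> t \<Longrightarrow> f t = g t\<rbrakk> \<Longrightarrow> f = g"
  by (rule Cb_eqI[OF cB]) auto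

lemma IB_eqI: "\<lbrakk>f \<in> carrier (IB B); g \<in> carrier (IB B); \<And>r. 0 \<le> r \<Longrightarrow> r \<le> 1 \<Longrightarrow> f r = g r\<rbrakk> \<Longrightarrow> f = g"
  by (rule Cb_eqI[OF cB]) auto

lemma nrm_IB_le: "\<lbrakk>f \<in> carrier (IB B); 0 \<le> r; r \<le> 1\<rbrakk> \<Longrightarrow> nrm B (f r) \<le> nrm (IB B) f"
  by (rule nrm_Cb_le[OF cB]) auto

lemma nrm_CbR_le: "\<lbrakk>f \<in> carrier CR; 0 \<le> t\<rbrakk> \<Longrightarrow> nrm B (f t) \<le> nrm CR f"
  by (rule nrm_Cb_le[OF cB]) auto

lemma nrm_IB_leI: "(\<And>r. 0 \<le> r \<Longrightarrow> r \<le> 1 \<Longrightarrow> nrm B (f r) \<le> K) \<Longrightarrow> nrm (IB B) f \<le> K"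
  by (rule nrm_CbI) auto

lemma nrm_CbR_leI: "(\<And>t. 0 \<le> t \<Longrightarrow> nrm B (f t) \<le> K) \<Longrightarrow> nrm CR f \<le> K"
  by (rule nrm_CbI) auto

lemma Cb_cont:
  assumes "f \<in> carrier (Cb X B)" "t \<in> X" "e > 0"
  shows "\<exists>d>0. \<forall>t'\<in>X. \<bar>t' - t\<bar> < d \<longrightarrow> nrm B (f t -[B] f t') < e"
proof -
  have "f \<in> X \<rightarrow> carrier B" "cont_on X B f" using assms(1) unfolding carrier_Cb[OF cB] by blast+
  then show ?thesis using assms(2,3) unfolding cont_on_iff[OF pre_cstar_axioms \<open>f \<in> X \<rightarrow> carrier B\<close>] by blast
qed

lemma Cb_carrierI:
  assumes "f \<in> extensional X" "\<And>t. t \<in> X \<Longrightarrow> f t \<in> carrier B"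
    and "\<And>t e. t \<in> X \<Longrightarrow> e > 0 \<Longrightarrow> \<exists>d>0. \<forall>t'\<in>X. \<bar>t' - t\<bar> < d \<longrightarrow> nrm B (f t -[B] f t') < e"
    and "\<And>t. t \<in> X \<Longrightarrow> nrm B (f t) \<le> K"
  shows "f \<in> carrier (Cb X B)"
proof -
  have "f \<in> X \<rightarrow> carrier B" using assms(2) by auto
  then show ?thesis
    unfolding carrier_Cb[OF cB] cont_on_iff[OF pre_cstar_axioms \<open>f \<in> X \<rightarrow> carrier B\<close>]
    using assms(4) \<open>f \<in> X \<rightarrow> carrier B\<close> by (intro conjI ballI allI impI assms(1,3) exI[of "\<lambda>K. \<forall>t\<in>X. nrm B (f t) \<le> K" K])
qed

text \<open>A continuous path is locally bounded, and Bolzano bisection turns this into a bound on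
  all of the unit interval.\<close>

lemma IB_carrierI:
  assumes ext: "f \<in> extensional {0..1}" and cl: "\<And>r. 0 \<le> r \<Longrightarrow> r \<le> 1 \<Longrightarrow> f r \<in> carrier B"
    and cont: "\<And>r e. 0 \<le> r \<Longrightarrow> r \<le> 1 \<Longrightarrow> e > 0 \<Longrightarrow> \<exists>d>0. \<forall>r'\<in>{0..1}. \<bar>r' - r\<bar> < d \<longrightarrow> nrm B (f r -[B] f r') < e"
  shows "f \<in> carrier (IB B)"
proof -
  have "\<exists>K. \<forall>r. 0 \<le> r \<and> r \<le> 1 \<and> 0 \<le> r \<and> r \<le> 1 \<longrightarrow> nrm B (f r) \<le> K"
  proof (rule Bolzano[where a = 0 and b = 1 and P = "\<lambda>a b. \<exists>K. \<forall>r. 0 \<le> r \<and> r \<le> 1 \<and> a \<le> r \<and> r \<le> b \<longrightarrow> nrm B (f r) \<le> K"])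
    fix a b c :: real
    assume "\<exists>K. \<forall>r. 0 \<le> r \<and> r \<le> 1 \<and> a \<le> r \<and> r \<le> b \<longrightarrow> nrm B (f r) \<le> K"
      "\<exists>K. \<forall>r. 0 \<le> r \<and> r \<le> 1 \<and> b \<le> r \<and> r \<le> c \<longrightarrow> nrm B (f r) \<le> K"
    then obtain K L where "\<forall>r. 0 \<le> r \<and> r \<le> 1 \<and> a \<le> r \<and> r \<le> b \<longrightarrow> nrm B (f r) \<le> K"
      "\<forall>r. 0 \<le> r \<and> r \<le> 1 \<and> b \<le> r \<and> r \<le> c \<longrightarrow> nrm B (f r) \<le> L" by auto
    then show "\<exists>K. \<forall>r. 0 \<le> r \<and> r \<le> 1 \<and> a \<le> r \<and> r \<le> c \<longrightarrow> nrm B (f r) \<le> K"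
      by (intro exI[of _ "max K L"]) (metis linear max.coboundedI1 max.coboundedI2)
  next
    fix x :: real assume x: "0 \<le> x" "x \<le> 1"
    then obtain d where d: "d > 0" "\<forall>r'\<in>{0..1}. \<bar>r' - x\<bar> < d \<longrightarrow> nrm B (f x -[B] f r') < 1"
      using cont[of x 1] by auto
    have "nrm B (f r) \<le> nrm B (f x) + 1" if "0 \<le> r" "r \<le> 1" "\<bar>r - x\<bar> < d" for r
      using that d(2)[rule_format, of r] x cl[of r] cl[of x] nrm_le_add_diff[of "f r" "f x"]
        nrm_diff_commute[of "f r" "f x"] by simp
    then show "\<exists>d>0. \<forall>a b. a \<le> x \<and> x \<le> b \<and> b - a < d \<longrightarrow> (\<exists>K. \<forall>r. 0 \<le> r \<and> r \<le> 1 \<and> a \<le> r \<and> r \<le> b \<longrightarrow> nrm B (f r) \<le> K)"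
      by (intro exI[of _ d] conjI allI impI d(1) exI[of _ "nrm B (f x) + 1"]) auto
  qed simp
  then obtain K where "\<And>r. r \<in> {0..1} \<Longrightarrow> nrm B (f r) \<le> K" by auto
  then show ?thesis by (intro Cb_carrierI[where K = K] ext) (use cl cont in simp_all)
qed

end

subsection \<open>Pointwise application of *-homomorphisms\<close>

definition push :: "('b \<Rightarrow> 'c) \<Rightarrow> (real \<Rightarrow> 'b) \<Rightarrow> real \<Rightarrow> 'c"
  where "push k f = (\<lambda>t\<in>{0..}. k (f t))"

lemma push_at [simp]: "0 \<le> t \<Longrightarrow> push k f t = k (f t)"
  by (simp add: push_def)

text \<open>Instances are evaluation at a path parameter, constant paths, restriction to half of the
  interval, reversal, and conjugation by an isometry. Contractivity is what makes them preserve
  functions vanishing at infinity.\<close>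

locale codomain_hom = B: codomain B + B': codomain B'
  for B :: "'b cstar" and B' :: "'c cstar" +
  fixes k :: "'b \<Rightarrow> 'c"
  assumes k: "star_hom B B' k"
begin

lemmas kD [simp] = star_homD[OF k]

lemma k_diff: "\<lbrakk>x \<in> carrier B; y \<in> carrier B\<rbrakk> \<Longrightarrow> k (x -[B] y) = k x -[B'] k y"
  by (rule star_hom_diff[OF k B.cB])

lemma k_nrm: "x \<in> carrier B \<Longrightarrow> nrm B' (k x) \<le> nrm B x"
  by (rule star_hom_contractive[OF B.cB B'.cB k])

lemma push_closed [simp]: "f \<in> carrier (CbR B) \<Longrightarrow> push k f \<in> carrier (CbR B')"
proof (rule B'.Cb_carrierI[where K = "nrm (CbR B) f"])
  assume f: "f \<in> carrier (CbR B)"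
  show "push k f t \<in> carrier B'" if "t \<in> {0..}" for t using that f by simp
  show "nrm B' (push k f t) \<le> nrm (CbR B) f" if "t \<in> {0..}" for t
    using that f k_nrm[of "f t"] B.nrm_CbR_le[of f t] by simp
  fix t e :: real assume t: "t \<in> {0..}" "e > 0"
  obtain d where d: "d > 0" "\<forall>t'\<in>{0..}. \<bar>t' - t\<bar> < d \<longrightarrow> nrm B (f t -[B] f t') < e"
    using B.Cb_cont[OF f t] by blast
  have "nrm B' (push k f t -[B'] push k f t') < e" if "t' \<in> {0..}" "\<bar>t' - t\<bar> < d" for t'
  proof -
    have "push k f t -[B'] push k f t' = k (f t -[B] f t')" using that t f by (simp add: k_diff)
    then show ?thesis using k_nrm[of "f t -[B] f t'"] d(2)[rule_format, OF that] that t f by simp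
  qed
  then show "\<exists>d>0. \<forall>t'\<in>{0..}. \<bar>t' - t\<bar> < d \<longrightarrow> nrm B' (push k f t -[B'] push k f t') < e" using d(1) by blast
qed (simp add: push_def)

lemma push_star_hom: "star_hom (CbR B) (CbR B') (push k)"
  unfolding star_hom_def
proof (intro conjI ballI allI)
  show "push k \<in> carrier (CbR B) \<rightarrow> carrier (CbR B')" by auto
qed (rule B'.CbR_eqI; simp)+

lemmas pushD = star_homD[OF push_star_hom] star_hom_diff[OF push_star_hom B.cR]
  star_hom_contractive[OF B.cR B'.cR push_star_hom] star_hom_zero[OF push_star_hom B.cR B'.cR]

lemma push_C0R: "f \<in> C0R B \<Longrightarrow> push k f \<in> C0R B'"
proof (rule B'.C0R_dominated[of _ "\<lambda>t. nrm B (f t)"])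
  show "f \<in> C0R B \<Longrightarrow> ((\<lambda>t. nrm B (f t)) \<longlongrightarrow> 0) at_top" by (simp add: B.C0R_iff)
qed (simp_all add: k_nrm)

lemma push_aeq:
  assumes "B.aeq f g"
  shows "B'.aeq (push k f) (push k g)"
proof (rule B'.aeqI)
  have c: "f \<in> carrier (CbR B)" "g \<in> carrier (CbR B)" "f -[CbR B] g \<in> C0R B"
    using assms unfolding B.aeq_def by blast+
  show "push k f \<in> carrier (CbR B')" "push k g \<in> carrier (CbR B')" using c by simp_all
  show "push k f -[CbR B'] push k g \<in> C0R B'"
    using push_C0R[OF c(3)] unfolding pushD(6)[OF c(1,2)] .
qed

end

section \<open>Algebras of paths\<close>

definition const_path :: "'b \<Rightarrow> real \<Rightarrow> 'b"
  where "const_path b = (\<lambda>r\<in>{0..1}. b)"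

definition reparam :: "(real \<Rightarrow> real) \<Rightarrow> (real \<Rightarrow> 'b) \<Rightarrow> real \<Rightarrow> 'b"
  where "reparam \<alpha> g = (\<lambda>r\<in>{0..1}. g (\<alpha> r))"

text \<open>Exchanges the path parameter \<open>r\<close> and the asymptotic parameter
  \<open>t\<close>. It embeds norm-continuous paths in \<open>CbR B\<close> into
  \<open>CbR (IB B)\<close>; a function in the latter need not come from such a path, since its
  continuity in \<open>r\<close> may fail to be uniform in \<open>t\<close>.\<close>

definition flip :: "(real \<Rightarrow> real \<Rightarrow> 'b) \<Rightarrow> real \<Rightarrow> real \<Rightarrow> 'b"
  where "flip G = (\<lambda>t\<in>{0..}. \<lambda>r\<in>{0..1}. G r t)"

lemma const_path_at [simp]: "\<lbrakk>0 \<le> r; r \<le> 1\<rbrakk> \<Longrightarrow> const_path b r = b"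
  by (simp add: const_path_def)

lemma reparam_at [simp]: "\<lbrakk>0 \<le> r; r \<le> 1\<rbrakk> \<Longrightarrow> reparam \<alpha> g r = g (\<alpha> r)"
  by (simp add: reparam_def)

lemma flip_at [simp]: "\<lbrakk>0 \<le> t; 0 \<le> r; r \<le> 1\<rbrakk> \<Longrightarrow> flip G t r = G r t"
  by (simp add: flip_def)

lemma eval_at_push: "eval_at r = push (\<lambda>g. g r)"
  by (simp add: eval_at_def push_def fun_eq_iff)

text \<open>The compactness argument behind all uniformity in the path parameter: if
  \<open>h\<close> varies in \<open>r\<close> by at most \<open>D\<close>, independently of
  \<open>y\<close>, then smallness for each \<open>r\<close> becomes smallness for all
  \<open>r\<close> at once. The filter is \<open>at_top\<close> for vanishing at infinity and a
  neighbourhood filter for continuity in \<open>t\<close>.\<close>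

lemma uniform_interval:
  fixes h :: "real \<Rightarrow> 'y \<Rightarrow> real" and D :: "real \<Rightarrow> real \<Rightarrow> real"
  assumes F: "\<And>r e. \<lbrakk>0 \<le> r; r \<le> 1; e > 0\<rbrakk> \<Longrightarrow> \<forall>\<^sub>F y in F. h r y < e"
    and P: "\<forall>\<^sub>F y in F. P y"
    and var: "\<And>r r' y. \<lbrakk>0 \<le> r; r \<le> 1; 0 \<le> r'; r' \<le> 1; P y\<rbrakk> \<Longrightarrow> h r' y \<le> h r y + D r r'"
    and D: "\<And>r e. \<lbrakk>0 \<le> r; r \<le> 1; e > 0\<rbrakk> \<Longrightarrow> \<exists>d>0. \<forall>r'\<in>{0..1}. \<bar>r' - r\<bar> < d \<longrightarrow> D r r' < e"
    and e: "e > 0"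
  shows "\<forall>\<^sub>F y in F. \<forall>r\<in>{0..1}. h r y < e"
proof -
  have "\<forall>\<^sub>F y in F. \<forall>r. 0 \<le> r \<and> r \<le> 1 \<and> 0 \<le> r \<and> r \<le> 1 \<longrightarrow> h r y < e"
  proof (rule Bolzano[where a = 0 and b = 1 and P = "\<lambda>a b. \<forall>\<^sub>F y in F. \<forall>r. 0 \<le> r \<and> r \<le> 1 \<and> a \<le> r \<and> r \<le> b \<longrightarrow> h r y < e"])
    fix a b c :: real
    assume "\<forall>\<^sub>F y in F. \<forall>r. 0 \<le> r \<and> r \<le> 1 \<and> a \<le> r \<and> r \<le> b \<longrightarrow> h r y < e"
      "\<forall>\<^sub>F y in F. \<forall>r. 0 \<le> r \<and> r \<le> 1 \<and> b \<le> r \<and> r \<le> c \<longrightarrow> h r y < e"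
    then show "\<forall>\<^sub>F y in F. \<forall>r. 0 \<le> r \<and> r \<le> 1 \<and> a \<le> r \<and> r \<le> c \<longrightarrow> h r y < e"
      by eventually_elim (metis linear)
  next
    fix x :: real assume x: "0 \<le> x" "x \<le> 1"
    obtain d where d: "d > 0" "\<forall>r'\<in>{0..1}. \<bar>r' - x\<bar> < d \<longrightarrow> D x r' < e / 2"
      using D[OF x, of "e / 2"] e by auto
    have "\<forall>\<^sub>F y in F. \<forall>r. 0 \<le> r \<and> r \<le> 1 \<and> a \<le> r \<and> r \<le> b \<longrightarrow> h r y < e" if ab: "a \<le> x \<and> x \<le> b \<and> b - a < d" for a b
    proof -
      have "\<forall>\<^sub>F y in F. h x y < e / 2" using F[OF x half_gt_zero[OF e]] .
      then show ?thesis using P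
      proof eventually_elim
        case (elim y)
        have "h r y < e" if r: "0 \<le> r" "r \<le> 1" "a \<le> r" "r \<le> b" for r
        proof -
          have "\<bar>r - x\<bar> < d" using r ab by linarith
          then show ?thesis using var[OF x r(1,2) elim(2)] d(2)[rule_format, of r] elim(1) r by simp
        qed
        then show ?case by blast
      qed
    qed
    then show "\<exists>d>0. \<forall>a b. a \<le> x \<and> x \<le> b \<and> b - a < d \<longrightarrow>
        (\<forall>\<^sub>F y in F. \<forall>r. 0 \<le> r \<and> r \<le> 1 \<and> a \<le> r \<and> r \<le> b \<longrightarrow> h r y < e)"
      using d(1) by blast
  qed simp
  then show ?thesis by eventually_elim simp
qed

context codomain
begin

lemma codomain_IB: "codomain (IB B)"
  by (rule codomain.intro) (rule cI)

lemma codomain_CbR: "codomain CR"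
  by (rule codomain.intro) (rule cR)

lemma eval_hom: "\<lbrakk>0 \<le> r; r \<le> 1\<rbrakk> \<Longrightarrow> codomain_hom (IB B) B (\<lambda>g. g r)"
  by (intro codomain_hom.intro codomain_IB codomain_axioms codomain_hom_axioms.intro)
    (simp add: star_hom_def)

lemma const_path_closed [simp]: "b \<in> carrier B \<Longrightarrow> const_path b \<in> carrier (IB B)"
  by (rule IB_carrierI) (auto simp: const_path_def intro!: exI[of _ 1])

lemma const_path_hom: "codomain_hom B (IB B) const_path"
proof (intro codomain_hom.intro codomain_IB codomain_axioms codomain_hom_axioms.intro)
  show "star_hom B (IB B) const_path"
    unfolding star_hom_def
    by (intro conjI ballI allI IB_eqI) simp_all
qed

text \<open>Lipschitz constant 1 covers reversal and the two halves of the interval, and lets a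
  modulus of continuity carry over unchanged.\<close>

lemma reparam_hom:
  assumes \<alpha>: "\<And>r. \<lbrakk>0 \<le> r; r \<le> 1\<rbrakk> \<Longrightarrow> 0 \<le> \<alpha> r \<and> \<alpha> r \<le> 1"
    and lip: "\<And>r r'. \<lbrakk>0 \<le> r; r \<le> 1; 0 \<le> r'; r' \<le> 1\<rbrakk> \<Longrightarrow> \<bar>\<alpha> r' - \<alpha> r\<bar> \<le> \<bar>r' - r\<bar>"
  shows "codomain_hom (IB B) (IB B) (reparam \<alpha>)"
proof (intro codomain_hom.intro codomain_IB codomain_hom_axioms.intro)
  have cl: "reparam \<alpha> g \<in> carrier (IB B)" if g: "g \<in> carrier (IB B)" for g
  proof (rule IB_carrierI)
    fix r e :: real assume r: "0 \<le> r" "r \<le> 1" "e > 0"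
    then obtain d where d: "d > 0" "\<forall>r'\<in>{0..1}. \<bar>r' - \<alpha> r\<bar> < d \<longrightarrow> nrm B (g (\<alpha> r) -[B] g r') < e"
      using Cb_cont[OF g, of "\<alpha> r" e] \<alpha>[of r] by auto
    have "nrm B (reparam \<alpha> g r -[B] reparam \<alpha> g r') < e" if "r' \<in> {0..1}" "\<bar>r' - r\<bar> < d" for r'
      using d(2)[rule_format, of "\<alpha> r'"] \<alpha>[of r'] lip[of r r'] that r by simp
    then show "\<exists>d>0. \<forall>r'\<in>{0..1}. \<bar>r' - r\<bar> < d \<longrightarrow> nrm B (reparam \<alpha> g r -[B] reparam \<alpha> g r') < e"
      using d(1) by blast
  qed (use g \<alpha> in \<open>auto simp: reparam_def\<close>)
  show "star_hom (IB B) (IB B) (reparam \<alpha>)"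
    unfolding star_hom_def
    by (intro conjI ballI allI IB_eqI) (use \<alpha> cl in simp_all)
qed

lemma flip_closed [simp]:
  assumes G: "G \<in> carrier (IB CR)"
  shows "flip G \<in> carrier (CbR (IB B))"
proof -
  interpret J: codomain "CR" by (rule codomain_CbR)
  interpret K: codomain "IB B" by (rule codomain_IB)
  have Gc [simp]: "G r \<in> carrier CR" if "0 \<le> r" "r \<le> 1" for r using G that by simp
  have Gd: "nrm B (G r t -[B] G r' t) \<le> nrm CR (G r -[CR] G r')"
    if "0 \<le> r" "r \<le> 1" "0 \<le> r'" "r' \<le> 1" "0 \<le> t" for r r' t
    using nrm_CbR_le[of "G r -[CR] G r'" t] that by simp
  have at: "flip G t \<in> carrier (IB B)" if t: "0 \<le> t" for t
  proof (rule IB_carrierI)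
    fix r e :: real assume r: "0 \<le> r" "r \<le> 1" "e > 0"
    then obtain d where d: "d > 0" "\<forall>r'\<in>{0..1}. \<bar>r' - r\<bar> < d \<longrightarrow> nrm CR (G r -[CR] G r') < e"
      using J.Cb_cont[OF G, of r e] by auto
    have "nrm B (flip G t r -[B] flip G t r') < e" if "r' \<in> {0..1}" "\<bar>r' - r\<bar> < d" for r'
      using d(2)[rule_format, OF that] Gd[of r r' t] that r t by simp
    then show "\<exists>d>0. \<forall>r'\<in>{0..1}. \<bar>r' - r\<bar> < d \<longrightarrow> nrm B (flip G t r -[B] flip G t r') < e"
      using d(1) by blast
  qed (use t in \<open>auto simp: flip_def\<close>)
  show ?thesis
  proof (rule K.Cb_carrierI[where K = "nrm (IB CR) G"])
    show "flip G \<in> extensional {0..}" by (simp add: flip_def)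
    show "flip G t \<in> carrier (IB B)" if "t \<in> {0..}" for t using at that by simp
    show "nrm (IB B) (flip G t) \<le> nrm (IB CR) G" if t: "t \<in> {0..}" for t
    proof (rule nrm_IB_leI)
      fix r :: real assume r: "0 \<le> r" "r \<le> 1"
      have "nrm B (G r t) \<le> nrm CR (G r)" using r t by (intro nrm_CbR_le) auto
      also have "\<dots> \<le> nrm (IB CR) G" using r by (intro J.nrm_IB_le[OF G])
      finally show "nrm B (flip G t r) \<le> nrm (IB CR) G" using r t by simp
    qed
    fix t e :: real assume t: "t \<in> {0..}" and e: "e > 0"
    have "\<forall>\<^sub>F t' in at t within {0..}. \<forall>r\<in>{0..1}. nrm B (G r t -[B] G r t') < e / 2"
    \<comment> \<open>The factor 2 in \<open>D\<close> appears because a change of \<open>r\<close>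
      moves both \<open>G r t\<close> and \<open>G r t'\<close>.\<close>
    proof (rule uniform_interval[where P = "\<lambda>t'. 0 \<le> t'" and D = "\<lambda>r r'. 2 * nrm CR (G r -[CR] G r')"])
      show "\<forall>\<^sub>F t' in at t within {0..}. nrm B (G r t -[B] G r t') < e'" if r: "0 \<le> r" "r \<le> 1" and e': "e' > 0" for r e'
      proof -
        obtain d where "d > 0" "\<forall>t'\<in>{0..}. \<bar>t' - t\<bar> < d \<longrightarrow> nrm B (G r t -[B] G r t') < e'"
          using Cb_cont[OF Gc[OF r] t e'] by blast
        then show ?thesis unfolding eventually_at dist_real_def by blast
      qed
      show "\<forall>\<^sub>F t' in at t within {0..}. 0 \<le> t'" by (simp add: eventually_at_filter)
      fix r :: real assume r: "0 \<le> r" "r \<le> 1"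
      show "\<exists>d>0. \<forall>r'\<in>{0..1}. \<bar>r' - r\<bar> < d \<longrightarrow> 2 * nrm CR (G r -[CR] G r') < e'" if "e' > 0" for e'
      proof -
        have "r \<in> {0..1}" using r by simp
        from J.Cb_cont[OF G this half_gt_zero[OF that]]
        obtain d where "d > 0" "\<forall>r'\<in>{0..1}. \<bar>r' - r\<bar> < d \<longrightarrow> nrm CR (G r -[CR] G r') < e' / 2"
          by blast
        then show ?thesis by (intro exI[of _ d]) auto
      qed
      fix r' t' :: real assume r': "0 \<le> r'" "r' \<le> 1" and t': "0 \<le> t'"
      have t0: "0 \<le> t" using t by simp
      have "nrm B (G r' t -[B] G r' t') \<le> nrm B (G r' t -[B] G r t) + nrm B (G r t -[B] G r' t')"
        using r r' t0 t' by (intro nrm_diff_triangle) auto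
      also have "nrm B (G r t -[B] G r' t') \<le> nrm B (G r t -[B] G r t') + nrm B (G r t' -[B] G r' t')"
        using r r' t0 t' by (intro nrm_diff_triangle) auto
      also have "nrm B (G r' t -[B] G r t) = nrm B (G r t -[B] G r' t)"
        using r r' t0 by (intro nrm_diff_commute) auto
      finally show "nrm B (G r' t -[B] G r' t') \<le> nrm B (G r t -[B] G r t') + 2 * nrm CR (G r -[CR] G r')"
        using Gd[OF r r' t0] Gd[OF r r' t'] by simp
    qed (use e in simp)
    then obtain d where d: "d > 0" "\<forall>t'\<in>{0..}. t' \<noteq> t \<and> dist t' t < d \<longrightarrow> (\<forall>r\<in>{0..1}. nrm B (G r t -[B] G r t') < e / 2)"
      unfolding eventually_at by blast
    have "nrm (IB B) (flip G t -[IB B] flip G t') < e" if t': "t' \<in> {0..}" "\<bar>t' - t\<bar> < d" for t'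
    proof -
      have "nrm (IB B) (flip G t -[IB B] flip G t') \<le> e / 2"
      proof (rule nrm_IB_leI)
        fix r :: real assume r: "0 \<le> r" "r \<le> 1"
        show "nrm B ((flip G t -[IB B] flip G t') r) \<le> e / 2"
        proof (cases "t' = t")
          case True
          then show ?thesis using r t e by simp
        next
          case False
          then show ?thesis using d(2)[rule_format, OF t'(1)] t' t r by (simp add: dist_real_def less_imp_le)
        qed
      qed
      then show ?thesis using e by simp
    qed
    then show "\<exists>d>0. \<forall>t'\<in>{0..}. \<bar>t' - t\<bar> < d \<longrightarrow> nrm (IB B) (flip G t -[IB B] flip G t') < e"
      using d(1) by blast
  qed
qed

lemma eval_at_flip: "\<lbrakk>G \<in> carrier (IB CR); 0 \<le> r; r \<le> 1\<rbrakk> \<Longrightarrow> eval_at r (flip G) = G r"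
proof -
  assume G: "G \<in> carrier (IB CR)" and r: "0 \<le> r" "r \<le> 1"
  interpret J: codomain "CR" by (rule codomain_CbR)
  interpret E: codomain_hom "IB B" B "\<lambda>g. g r" using r by (rule eval_hom)
  show ?thesis
    unfolding eval_at_push using G r by (intro CbR_eqI) simp_all
qed

lemma flip_star_hom: "star_hom (IB CR) (CbR (IB B)) flip"
proof -
  interpret J: codomain "CR" by (rule codomain_CbR)
  interpret K: codomain "IB B" by (rule codomain_IB)
  show ?thesis
    unfolding star_hom_def
  proof (intro conjI ballI allI)
    show "flip \<in> carrier (IB CR) \<rightarrow> carrier (CbR (IB B))" by auto
  qed (rule K.CbR_eqI; (simp; fail)?; rule IB_eqI; simp)+
qed

text \<open>For a general function into \<open>IB B\<close>, vanishing at infinity at each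
  \<open>r\<close> would not be uniform in \<open>r\<close>. Norm continuity of \<open>G\<close> as
  a path in \<open>CbR B\<close> supplies the uniformity.\<close>

lemma flip_C0R:
  assumes G: "G \<in> carrier (IB CR)" and C0: "\<And>r. \<lbrakk>0 \<le> r; r \<le> 1\<rbrakk> \<Longrightarrow> G r \<in> C0R B"
  shows "flip G \<in> C0R (IB B)"
proof -
  interpret J: codomain "CR" by (rule codomain_CbR)
  interpret K: codomain "IB B" by (rule codomain_IB)
  have Gc [simp]: "G r \<in> carrier CR" if "0 \<le> r" "r \<le> 1" for r using G that by simp
  have ev: "\<forall>\<^sub>F t in at_top. \<forall>r\<in>{0..1}. nrm B (G r t) < e" if e: "e > 0" for e
  proof (rule uniform_interval[where P = "\<lambda>t. 0 \<le> t" and D = "\<lambda>r r'. nrm CR (G r -[CR] G r')"])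
    show "\<forall>\<^sub>F t in at_top. nrm B (G r t) < e'" if "0 \<le> r" "r \<le> 1" "e' > 0" for r e'
      using C0[OF that(1,2)] that(3) by (intro order_tendstoD) (auto simp: C0R_iff)
    show "\<forall>\<^sub>F t :: real in at_top. 0 \<le> t" by (rule eventually_ge_at_top)
    fix r :: real assume r: "0 \<le> r" "r \<le> 1"
    show "\<exists>d>0. \<forall>r'\<in>{0..1}. \<bar>r' - r\<bar> < d \<longrightarrow> nrm CR (G r -[CR] G r') < e'" if "e' > 0" for e'
      using J.Cb_cont[OF G, of r e'] r that by simp
    fix r' t :: real assume r': "0 \<le> r'" "r' \<le> 1" and t: "0 \<le> t"
    show "nrm B (G r' t) \<le> nrm B (G r t) + nrm CR (G r -[CR] G r')"
      using nrm_le_add_diff[of "G r' t" "G r t"] nrm_CbR_le[of "G r -[CR] G r'" t]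
        nrm_diff_commute[of "G r' t" "G r t"] r r' t by simp
  qed (rule e)
  have "((\<lambda>t. nrm (IB B) (flip G t)) \<longlongrightarrow> 0) at_top"
    unfolding tendsto_iff
  proof (intro allI impI)
    fix e :: real assume e: "e > 0"
    have "\<forall>\<^sub>F t in at_top. \<forall>r\<in>{0..1}. nrm B (G r t) < e / 2" by (rule ev[OF half_gt_zero[OF e]])
    then show "\<forall>\<^sub>F t in at_top. dist (nrm (IB B) (flip G t)) 0 < e" using eventually_ge_at_top[of 0]
    proof eventually_elim
      case (elim t)
      have "nrm (IB B) (flip G t) \<le> e / 2" using elim by (intro nrm_IB_leI) (simp add: less_imp_le)
      then show ?case using e elim K.CbR_apply[OF flip_closed[OF G], of t] I.nrm_nonneg[of "flip G t"] by simp
    qed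
  qed
  then show ?thesis using G by (simp add: K.C0R_iff)
qed

end

text \<open>The typical \<open>k1\<close>, \<open>k2\<close> are the restrictions of a path to the two halves of the interval.\<close>

locale norming_pair = k1: codomain_hom B' B k1 + k2: codomain_hom B' B k2
  for B' :: "'c cstar" and B :: "'b cstar" and k1 k2 :: "'c \<Rightarrow> 'b" +
  assumes norming: "x \<in> carrier B' \<Longrightarrow> nrm B' x \<le> max (nrm B (k1 x)) (nrm B (k2 x))"
begin

lemma nrm_le_push:
  assumes f: "f \<in> carrier (CbR B')"
  shows "nrm (CbR B') f \<le> max (nrm (CbR B) (push k1 f)) (nrm (CbR B) (push k2 f))"
proof (rule k1.B.nrm_CbR_leI)
  fix t :: real assume t: "0 \<le> t"
  have "nrm B' (f t) \<le> max (nrm B (k1 (f t))) (nrm B (k2 (f t)))" using f t by (intro norming) simp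
  also have "\<dots> \<le> max (nrm (CbR B) (push k1 f)) (nrm (CbR B) (push k2 f))"
    using k1.B'.nrm_CbR_le[of "push k1 f" t] k1.B'.nrm_CbR_le[of "push k2 f" t] f t by fastforce
  finally show "nrm B' (f t) \<le> max (nrm (CbR B) (push k1 f)) (nrm (CbR B) (push k2 f))" .
qed

lemma push_eqI:
  assumes f: "f \<in> carrier (CbR B')" "g \<in> carrier (CbR B')" and eq: "push k1 f = push k1 g" "push k2 f = push k2 g"
  shows "f = g"
proof -
  have "push k1 (f -[CbR B'] g) = czero (CbR B)" "push k2 (f -[CbR B'] g) = czero (CbR B)"
    using f eq by (simp_all add: k1.pushD(6) k2.pushD(6))
  then have "nrm (CbR B') (f -[CbR B'] g) \<le> 0" using nrm_le_push[of "f -[CbR B'] g"] f by simp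
  then show ?thesis using f by (intro k1.B.R.eqI_nrm) auto
qed

lemma continuous_pushI:
  assumes cC: "csa C"
    and f: "continuous_map (ctop C) (ctop (CbR B)) \<phi>" and g: "continuous_map (ctop C) (ctop (CbR B)) \<psi>"
    and cl: "\<And>c. c \<in> carrier C \<Longrightarrow> \<theta> c \<in> carrier (CbR B') \<and> push k1 (\<theta> c) = \<phi> c \<and> push k2 (\<theta> c) = \<psi> c"
  shows "continuous_map (ctop C) (ctop (CbR B')) \<theta>"
proof (rule continuous_dominated[OF cC k1.B'.cR k1.B'.cR k1.B.cR f g, where K = 1])
  fix x a assume a: "x \<in> carrier C" "a \<in> carrier C"
  have "nrm (CbR B') (\<theta> x -[CbR B'] \<theta> a) \<le> max (nrm (CbR B) (\<phi> x -[CbR B] \<phi> a)) (nrm (CbR B) (\<psi> x -[CbR B] \<psi> a))"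
    using nrm_le_push[of "\<theta> x -[CbR B'] \<theta> a"] cl[OF a(1)] cl[OF a(2)] by (simp add: k1.pushD(6) k2.pushD(6))
  moreover have "0 \<le> nrm (CbR B) (\<phi> x -[CbR B] \<phi> a)" "0 \<le> nrm (CbR B) (\<psi> x -[CbR B] \<psi> a)"
    using continuous_ctop_closed[OF cC k1.B'.cR f] continuous_ctop_closed[OF cC k1.B'.cR g] a by simp_all
  ultimately show "nrm (CbR B') (\<theta> x -[CbR B'] \<theta> a) \<le> 1 * (nrm (CbR B) (\<phi> x -[CbR B] \<phi> a) + nrm (CbR B) (\<psi> x -[CbR B] \<psi> a))"
    by simp
qed (use cl in blast)

lemma C0R_pushI:
  assumes f: "f \<in> carrier (CbR B')" and C0: "push k1 f \<in> C0R B" "push k2 f \<in> C0R B"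
  shows "f \<in> C0R B'"
proof (rule k1.B.C0R_dominated[OF f, of "\<lambda>t. nrm B (push k1 f t) + nrm B (push k2 f t)"])
  show "((\<lambda>t. nrm B (push k1 f t) + nrm B (push k2 f t)) \<longlongrightarrow> 0) at_top"
    using tendsto_add[of "\<lambda>t. nrm B (push k1 f t)" 0 at_top "\<lambda>t. nrm B (push k2 f t)" 0] C0
    by (simp add: k1.B'.C0R_iff)
  fix t :: real assume t: "0 \<le> t"
  have ft: "f t \<in> carrier B'" using f t by simp
  show "nrm B' (f t) \<le> nrm B (push k1 f t) + nrm B (push k2 f t)"
    unfolding push_at[OF t]
    using norming[OF ft] k1.B'.nrm_nonneg[OF k1.kD(1)[OF ft]] k1.B'.nrm_nonneg[OF k2.kD(1)[OF ft]] by linarith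
qed

lemma aeq_pushI:
  assumes "f \<in> carrier (CbR B')" "g \<in> carrier (CbR B')"
    "k1.B'.aeq (push k1 f) (push k1 g)" "k1.B'.aeq (push k2 f) (push k2 g)"
  shows "k1.B.aeq f g"
  using assms C0R_pushI[of "f -[CbR B'] g"]
  by (simp add: k1.B.aeq_def k1.B'.aeq_def k1.pushD(6) k2.pushD(6))

end

subsection \<open>Concatenation of paths\<close>

abbreviation first_half :: "(real \<Rightarrow> 'b) \<Rightarrow> real \<Rightarrow> 'b"
  where "first_half \<equiv> reparam (\<lambda>r. r / 2)"

abbreviation second_half :: "(real \<Rightarrow> 'b) \<Rightarrow> real \<Rightarrow> 'b"
  where "second_half \<equiv> reparam (\<lambda>r. (r + 1) / 2)"

definition path_join :: "(real \<Rightarrow> 'b) \<Rightarrow> (real \<Rightarrow> 'b) \<Rightarrow> real \<Rightarrow> 'b"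
  where "path_join f g = (\<lambda>r\<in>{0..1}. if r \<le> 1 / 2 then f (2 * r) else g (2 * r - 1))"

definition path_join_R :: "(real \<Rightarrow> real \<Rightarrow> 'b) \<Rightarrow> (real \<Rightarrow> real \<Rightarrow> 'b) \<Rightarrow> real \<Rightarrow> real \<Rightarrow> 'b"
  where "path_join_R F G = (\<lambda>t\<in>{0..}. path_join (F t) (G t))"

context codomain
begin

lemma first_half_hom: "codomain_hom (IB B) (IB B) first_half"
  by (rule reparam_hom) auto

lemma second_half_hom: "codomain_hom (IB B) (IB B) second_half"
proof (rule reparam_hom)
  fix r r' :: real
  show "\<bar>(r' + 1) / 2 - (r + 1) / 2\<bar> \<le> \<bar>r' - r\<bar>"
    unfolding add_divide_distrib by linarith
qed auto

lemma halves: "norming_pair (IB B) (IB B) first_half second_half"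
proof (intro norming_pair.intro norming_pair_axioms.intro first_half_hom second_half_hom)
  fix x assume x: "x \<in> carrier (IB B)"
  interpret k1: codomain_hom "IB B" "IB B" first_half by (rule first_half_hom)
  interpret k2: codomain_hom "IB B" "IB B" second_half by (rule second_half_hom)
  show "nrm (IB B) x \<le> max (nrm (IB B) (first_half x)) (nrm (IB B) (second_half x))"
  proof (rule nrm_IB_leI)
    fix r :: real assume r: "0 \<le> r" "r \<le> 1"
    show "nrm B (x r) \<le> max (nrm (IB B) (first_half x)) (nrm (IB B) (second_half x))"
    proof (cases "r \<le> 1 / 2")
      case True
      then show ?thesis using nrm_IB_le[OF k1.kD(1)[OF x], of "2 * r"] r by simp
    next
      case False
      then show ?thesis using nrm_IB_le[OF k2.kD(1)[OF x], of "2 * r - 1"] r by simp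
    qed
  qed
qed

lemma path_join_closed:
  assumes f: "f \<in> carrier (IB B)" and g: "g \<in> carrier (IB B)" and fg: "f 1 = g 0"
  shows "path_join f g \<in> carrier (IB B)"
proof (rule IB_carrierI)
  show "path_join f g \<in> extensional {0..1}" by (simp add: path_join_def)
  show "path_join f g r \<in> carrier B" if "0 \<le> r" "r \<le> 1" for r
    using that f g by (simp add: path_join_def)
  fix r e :: real assume r: "0 \<le> r" "r \<le> 1" and e: "e > 0"
  let ?l = "min (2 * r) 1" and ?u = "max (2 * r - 1) 0"
  have lu: "?l \<in> {0..1}" "?u \<in> {0..1}" using r by auto
  obtain d1 where d1: "d1 > 0" "\<forall>r'\<in>{0..1}. \<bar>r' - ?l\<bar> < d1 \<longrightarrow> nrm B (f ?l -[B] f r') < e / 2"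
    using Cb_cont[OF f lu(1), of "e / 2"] e by auto
  obtain d2 where d2: "d2 > 0" "\<forall>r'\<in>{0..1}. \<bar>r' - ?u\<bar> < d2 \<longrightarrow> nrm B (g ?u -[B] g r') < e / 2"
    using Cb_cont[OF g lu(2), of "e / 2"] e by auto
  have decomp: "path_join f g s -[B] path_join f g s' =
      (f (min (2 * s) 1) -[B] f (min (2 * s') 1)) +[B] (g (max (2 * s - 1) 0) -[B] g (max (2 * s' - 1) 0))"
    if s: "0 \<le> s" "s \<le> 1" "0 \<le> s'" "s' \<le> 1" for s s'
  proof -
    \<comment> \<open>This removes the case distinction at 1/2. The clamped arguments move at most
      twice as fast as \<open>s\<close>, which is the reason for halving the distance below.\<close>
    have j: "path_join f g s = f (min (2 * s) 1) +[B] g (max (2 * s - 1) 0) -[B] f 1" if "0 \<le> s" "s \<le> 1" for s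
    proof (cases "s \<le> 1 / 2")
      case True
      then show ?thesis using that f g by (simp add: path_join_def fg min_def max_def)
    next
      case False
      then have "path_join f g s = g (2 * s - 1)" "min (2 * s) 1 = 1" "max (2 * s - 1) 0 = 2 * s - 1"
        using that by (auto simp: path_join_def)
      moreover have "g (2 * s - 1) = f 1 +[B] g (2 * s - 1) -[B] f 1"
        using f g that False by (simp add: group_simps)
      ultimately show ?thesis by simp
    qed
    show ?thesis
      unfolding j[OF s(1,2)] j[OF s(3,4)] using f g s by (simp add: group_simps)
  qed
  have "nrm B (path_join f g r -[B] path_join f g r') < e"
    if r': "r' \<in> {0..1}" "\<bar>r' - r\<bar> < min d1 d2 / 2" for r'
  proof -
    have lu': "min (2 * r') 1 \<in> {0..1}" "max (2 * r' - 1) 0 \<in> {0..1}" using r' by auto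
    have "\<bar>min (2 * r') 1 - ?l\<bar> < d1" "\<bar>max (2 * r' - 1) 0 - ?u\<bar> < d2" using r'(2) by linarith+
    then have "nrm B (f ?l -[B] f (min (2 * r') 1)) < e / 2" "nrm B (g ?u -[B] g (max (2 * r' - 1) 0)) < e / 2"
      using d1(2)[rule_format, OF lu'(1)] d2(2)[rule_format, OF lu'(2)] by blast+
    moreover have "nrm B (path_join f g r -[B] path_join f g r') \<le>
        nrm B (f ?l -[B] f (min (2 * r') 1)) + nrm B (g ?u -[B] g (max (2 * r' - 1) 0))"
    proof -
      have rr: "0 \<le> r'" "r' \<le> 1" using r' by auto
      show ?thesis
        unfolding decomp[OF r rr] using f g lu lu' by (intro nrm_triangle) auto
    qed
    ultimately show ?thesis by linarith
  qed
  then show "\<exists>d>0. \<forall>r'\<in>{0..1}. \<bar>r' - r\<bar> < d \<longrightarrow> nrm B (path_join f g r -[B] path_join f g r') < e"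
    using d1(1) d2(1) by (intro exI[of _ "min d1 d2 / 2"]) auto
qed

lemma path_join_halves:
  assumes f: "f \<in> carrier (IB B)" and g: "g \<in> carrier (IB B)" and fg: "f 1 = g 0"
  shows "first_half (path_join f g) = f" "second_half (path_join f g) = g"
proof -
  interpret k1: codomain_hom "IB B" "IB B" first_half by (rule first_half_hom)
  interpret k2: codomain_hom "IB B" "IB B" second_half by (rule second_half_hom)
  note pj = path_join_closed[OF assms]
  show "first_half (path_join f g) = f"
    by (rule IB_eqI[OF k1.kD(1)[OF pj] f]) (auto simp: path_join_def)
  show "second_half (path_join f g) = g"
  proof (rule IB_eqI[OF k2.kD(1)[OF pj] g])
    fix r :: real assume r: "0 \<le> r" "r \<le> 1"
    show "second_half (path_join f g) r = g r"
    proof (cases "r = 0")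
      case True
      then show ?thesis by (simp add: path_join_def fg)
    next
      case False
      have "2 * ((r + 1) / 2) - 1 = r" by (simp add: add_divide_distrib)
      moreover have "\<not> (r + 1) / 2 \<le> 1 / 2" "(r + 1) / 2 \<in> {0..1}" using r False by auto
      ultimately show ?thesis using r unfolding reparam_at[OF r] path_join_def by (simp only: restrict_apply if_True if_False)
    qed
  qed
qed

lemma path_join_R:
  assumes F: "F \<in> carrier (CbR (IB B))" and G: "G \<in> carrier (CbR (IB B))" and FG: "eval_at 1 F = eval_at 0 G"
  shows "path_join_R F G \<in> carrier (CbR (IB B))" "push first_half (path_join_R F G) = F"
    "push second_half (path_join_R F G) = G"
    "eval_at 0 (path_join_R F G) = eval_at 0 F" "eval_at 1 (path_join_R F G) = eval_at 1 G"
proof -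
  interpret K: codomain "IB B" by (rule codomain_IB)
  interpret H: norming_pair "IB B" "IB B" first_half second_half by (rule halves)
  have fg: "F t 1 = G t 0" if "0 \<le> t" for t
    using fun_cong[OF FG, of t] that by (simp add: eval_at_def)
  have at: "path_join_R F G t = path_join (F t) (G t)" "path_join_R F G t \<in> carrier (IB B)"
    "first_half (path_join_R F G t) = F t" "second_half (path_join_R F G t) = G t" if t: "0 \<le> t" for t
    using F G t fg[OF t] path_join_closed[of "F t" "G t"] path_join_halves[of "F t" "G t"]
    by (simp_all add: path_join_R_def)
  show cl: "path_join_R F G \<in> carrier (CbR (IB B))"
  proof (rule K.Cb_carrierI[where K = "max (nrm (CbR (IB B)) F) (nrm (CbR (IB B)) G)"])
    show "path_join_R F G \<in> extensional {0..}" by (simp add: path_join_R_def)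
    show "path_join_R F G t \<in> carrier (IB B)" if "t \<in> {0..}" for t using at that by simp
    show "nrm (IB B) (path_join_R F G t) \<le> max (nrm (CbR (IB B)) F) (nrm (CbR (IB B)) G)" if "t \<in> {0..}" for t
      using H.norming[OF at(2), of t] at(3,4)[of t] K.nrm_CbR_le[OF F, of t] K.nrm_CbR_le[OF G, of t] that
      by auto
    fix t e :: real assume t: "t \<in> {0..}" "e > 0"
    obtain d1 where d1: "d1 > 0" "\<forall>t'\<in>{0..}. \<bar>t' - t\<bar> < d1 \<longrightarrow> nrm (IB B) (F t -[IB B] F t') < e"
      using K.Cb_cont[OF F t] by blast
    obtain d2 where d2: "d2 > 0" "\<forall>t'\<in>{0..}. \<bar>t' - t\<bar> < d2 \<longrightarrow> nrm (IB B) (G t -[IB B] G t') < e"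
      using K.Cb_cont[OF G t] by blast
    have "nrm (IB B) (path_join_R F G t -[IB B] path_join_R F G t') < e"
      if t': "t' \<in> {0..}" "\<bar>t' - t\<bar> < min d1 d2" for t'
    proof -
      have p: "path_join_R F G t \<in> carrier (IB B)" "path_join_R F G t' \<in> carrier (IB B)" using at t t' by simp_all
      have "nrm (IB B) (path_join_R F G t -[IB B] path_join_R F G t') \<le>
          max (nrm (IB B) (F t -[IB B] F t')) (nrm (IB B) (G t -[IB B] G t'))"
        using H.norming[OF I.diff_closed[OF p]] H.k1.k_diff[OF p] H.k2.k_diff[OF p] at(3,4)[of t] at(3,4)[of t'] t t'
        by simp
      then show ?thesis using d1(2)[rule_format, OF t'(1)] d2(2)[rule_format, OF t'(1)] t'(2) by simp
    qed
    then show "\<exists>d>0. \<forall>t'\<in>{0..}. \<bar>t' - t\<bar> < d \<longrightarrow> nrm (IB B) (path_join_R F G t -[IB B] path_join_R F G t') < e"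
      using d1(1) d2(1) by (intro exI[of _ "min d1 d2"]) auto
  qed
  show "push first_half (path_join_R F G) = F" "push second_half (path_join_R F G) = G"
    by (rule K.CbR_eqI; use cl F G at in simp)+
  show "eval_at 0 (path_join_R F G) = eval_at 0 F" "eval_at 1 (path_join_R F G) = eval_at 1 G"
    using at(1) by (auto simp: eval_at_def path_join_def fun_eq_iff)
qed

end

lemma (in pre_cstar) convex_combination_eq:
  assumes x: "x \<in> carrier A" "y \<in> carrier A"
  shows "of_real (1 - s) \<odot> x \<boxplus> of_real s \<odot> y = x \<boxplus> of_real s \<odot> (y \<boxminus> x)"
proof -
  have "of_real (1 - s) \<odot> x = x \<boxminus> of_real s \<odot> x" using scale_diff_left[OF x(1), of 1 "of_real s"] x by simp
  then have "of_real (1 - s) \<odot> x \<boxplus> of_real s \<odot> y = (x \<boxminus> of_real s \<odot> x) \<boxplus> of_real s \<odot> y" by (simp only:)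
  then show ?thesis using x by (simp only: scale_diff_right) (simp add: group_simps)
qed

section \<open>Asymptotic homomorphisms\<close>

context codomain
begin

lemma asymptotic_homI:
  assumes "continuous_map (ctop C) (ctop CR) \<psi>" "homogeneous C CR \<psi>"
    and "\<And>a b. \<lbrakk>a \<in> carrier C; b \<in> carrier C\<rbrakk> \<Longrightarrow> \<psi> (a +[C] b) \<simeq> \<psi> a +[CR] \<psi> b"
    and "\<And>a b. \<lbrakk>a \<in> carrier C; b \<in> carrier C\<rbrakk> \<Longrightarrow> \<psi> (a *[C] b) \<simeq> \<psi> a *[CR] \<psi> b"
    and "\<And>a. a \<in> carrier C \<Longrightarrow> \<psi> (adj C a) \<simeq> adj CR (\<psi> a)"
  shows "asymptotic_hom C B \<psi>"
  using assms by (simp add: asymptotic_hom_def aeq_def)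

lemma asymptotic_homD:
  assumes cC: "csa C" and h: "asymptotic_hom C B \<psi>"
  shows "a \<in> carrier C \<Longrightarrow> \<psi> a \<in> carrier CR"
    "a \<in> carrier C \<Longrightarrow> \<psi> (c .[C] a) = c .[CR] \<psi> a"
    "\<lbrakk>a \<in> carrier C; b \<in> carrier C\<rbrakk> \<Longrightarrow> \<psi> (a +[C] b) \<simeq> \<psi> a +[CR] \<psi> b"
    "\<lbrakk>a \<in> carrier C; b \<in> carrier C\<rbrakk> \<Longrightarrow> \<psi> (a *[C] b) \<simeq> \<psi> a *[CR] \<psi> b"
    "a \<in> carrier C \<Longrightarrow> \<psi> (adj C a) \<simeq> adj CR (\<psi> a)"
    "continuous_map (ctop C) (ctop CR) \<psi>" "homogeneous C CR \<psi>"
    "\<lbrakk>a \<in> carrier C; b \<in> carrier C\<rbrakk> \<Longrightarrow> \<psi> (a -[C] b) \<simeq> \<psi> a -[CR] \<psi> b"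
    "\<psi> (czero C) = czero CR"
proof -
  interpret C: pre_cstar C using cC by (rule cstar_imp_pre)
  show cont: "continuous_map (ctop C) (ctop CR) \<psi>" and hom: "homogeneous C CR \<psi>"
    using h by (simp_all add: asymptotic_hom_def)
  have cl: "\<psi> a \<in> carrier CR" if "a \<in> carrier C" for a
    using cont that unfolding continuous_ctop_iff[OF cC cR] by blast
  then show "a \<in> carrier C \<Longrightarrow> \<psi> a \<in> carrier CR" .
  have sc: "\<psi> (c .[C] a) = c .[CR] \<psi> a" if "a \<in> carrier C" for a c
    using hom that by (simp add: homogeneous_def)
  then show "a \<in> carrier C \<Longrightarrow> \<psi> (c .[C] a) = c .[CR] \<psi> a" .
  have add: "\<psi> (a +[C] b) \<simeq> \<psi> a +[CR] \<psi> b" if "a \<in> carrier C" "b \<in> carrier C" for a b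
    using h that cl by (intro aeqI) (simp_all add: asymptotic_hom_def)
  then show "\<lbrakk>a \<in> carrier C; b \<in> carrier C\<rbrakk> \<Longrightarrow> \<psi> (a +[C] b) \<simeq> \<psi> a +[CR] \<psi> b" .
  show "\<lbrakk>a \<in> carrier C; b \<in> carrier C\<rbrakk> \<Longrightarrow> \<psi> (a *[C] b) \<simeq> \<psi> a *[CR] \<psi> b"
    using h cl by (intro aeqI) (simp_all add: asymptotic_hom_def)
  show "a \<in> carrier C \<Longrightarrow> \<psi> (adj C a) \<simeq> adj CR (\<psi> a)"
    using h cl by (intro aeqI) (simp_all add: asymptotic_hom_def)
  show "\<psi> (a -[C] b) \<simeq> \<psi> a -[CR] \<psi> b" if "a \<in> carrier C" "b \<in> carrier C"
    using add[of a "(-1) .[C] b"] that sc by (simp add: cdiff_def)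
  show "\<psi> (czero C) = czero CR" using sc[of "czero C" 0] cl by simp
qed

lemma asymptotic_hom_comp:
  assumes cC: "csa C" and cD: "csa D" and h: "asymptotic_hom C B \<psi>" and l: "star_hom D C l"
  shows "asymptotic_hom D B (\<psi> \<circ> l)"
proof -
  note hD = asymptotic_homD[OF cC h] and lD = star_homD[OF l]
  show ?thesis
  proof (rule asymptotic_homI)
    show "continuous_map (ctop D) (ctop CR) (\<psi> \<circ> l)"
      using star_hom_continuous[OF cD cC l] hD(6) by (rule continuous_map_compose)
  qed (use hD(1-5) lD in \<open>simp_all add: homogeneous_def\<close>)
qed

lemma star_hom_asymptotic:
  assumes cC: "csa C" and p: "star_hom C CR p"
  shows "asymptotic_hom C B p"
proof -
  interpret C: pre_cstar C using cC by (rule cstar_imp_pre)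
  show ?thesis
    by (rule asymptotic_homI[OF star_hom_continuous[OF cC cR p]])
      (use star_homD[OF p] in \<open>simp_all add: homogeneous_def\<close>)
qed

text \<open>The algebraic relations depend only on the classes modulo \<open>C\<^sub>0\<close>,
  whereas continuity and homogeneity are statements about the map itself and have to be supplied for
  \<open>\<theta>\<close>.\<close>

lemma asymptotic_hom_aeq:
  assumes cC: "csa C" and h: "asymptotic_hom C B \<psi>"
    and cont: "continuous_map (ctop C) (ctop CR) \<theta>" and hom: "homogeneous C CR \<theta>"
    and eq: "\<And>c. c \<in> carrier C \<Longrightarrow> \<theta> c \<simeq> \<psi> c"
  shows "asymptotic_hom C B \<theta>"
proof -
  interpret C: pre_cstar C using cC by (rule cstar_imp_pre)
  note hD = asymptotic_homD[OF cC h]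
  show ?thesis
  proof (rule asymptotic_homI[OF cont hom])
    fix a b assume ab: "a \<in> carrier C" "b \<in> carrier C"
    have "\<theta> (a +[C] b) \<simeq> \<psi> (a +[C] b)" using ab by (intro eq) simp
    also have "\<dots> \<simeq> \<psi> a +[CR] \<psi> b" by (rule hD(3)[OF ab])
    also have "\<dots> \<simeq> \<theta> a +[CR] \<theta> b" by (intro aeq_add aeq_sym[OF eq] ab)
    finally show "\<theta> (a +[C] b) \<simeq> \<theta> a +[CR] \<theta> b" .
    have "\<theta> (a *[C] b) \<simeq> \<psi> (a *[C] b)" using ab by (intro eq) simp
    also have "\<dots> \<simeq> \<psi> a *[CR] \<psi> b" by (rule hD(4)[OF ab])
    also have "\<dots> \<simeq> \<theta> a *[CR] \<theta> b" by (intro aeq_mult aeq_sym[OF eq] ab)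
    finally show "\<theta> (a *[C] b) \<simeq> \<theta> a *[CR] \<theta> b" .
    have "\<theta> (adj C a) \<simeq> \<psi> (adj C a)" using ab by (intro eq) simp
    also have "\<dots> \<simeq> adj CR (\<psi> a)" by (rule hD(5)[OF ab(1)])
    also have "\<dots> \<simeq> adj CR (\<theta> a)" by (intro aeq_adj aeq_sym[OF eq] ab)
    finally show "\<theta> (adj C a) \<simeq> adj CR (\<theta> a)" .
  qed
qed

subsection \<open>Segments\<close>

definition segment :: "'b \<Rightarrow> 'b \<Rightarrow> real \<Rightarrow> 'b"
  where "segment x y = (\<lambda>r\<in>{0..1}. of_real (1 - r) .[B] x +[B] of_real r .[B] y)"

lemma segment_at [simp]:
  "\<lbrakk>0 \<le> r; r \<le> 1\<rbrakk> \<Longrightarrow> segment x y r = of_real (1 - r) .[B] x +[B] of_real r .[B] y"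
  by (simp add: segment_def)

lemma segment_ends [simp]:
  "\<lbrakk>x \<in> carrier B; y \<in> carrier B\<rbrakk> \<Longrightarrow> segment x y 0 = x" "\<lbrakk>x \<in> carrier B; y \<in> carrier B\<rbrakk> \<Longrightarrow> segment x y 1 = y"
  by simp_all

lemma segment_closed [simp]:
  assumes x: "x \<in> carrier B" "y \<in> carrier B"
  shows "segment x y \<in> carrier (IB B)"
proof (rule IB_carrierI)
  fix r e :: real assume r: "0 \<le> r" "r \<le> 1" and e: "e > 0"
  let ?d = "e / (nrm B (y -[B] x) + 1)"
  have d: "?d > 0" using e x by (simp add: add_nonneg_pos)
  have "nrm B (segment x y r -[B] segment x y r') < e" if r': "r' \<in> {0..1}" "\<bar>r' - r\<bar> < ?d" for r'
  proof -
    have eq: "segment x y s = x +[B] of_real s .[B] (y -[B] x)" if "0 \<le> s" "s \<le> 1" for s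
      unfolding segment_at[OF that] by (rule convex_combination_eq[OF x])
    have "segment x y r -[B] segment x y r' = of_real (r - r') .[B] (y -[B] x)"
      using r r' x eq[of r] eq[of r'] scale_diff_left[of "y -[B] x" "of_real r" "of_real r'"]
      by (simp add: add_diff_add)
    then have "nrm B (segment x y r -[B] segment x y r') = \<bar>r - r'\<bar> * nrm B (y -[B] x)"
      using x by (simp only: nrm_scale diff_closed norm_of_real)
    also have "\<dots> \<le> \<bar>r' - r\<bar> * (nrm B (y -[B] x) + 1)" by (simp add: abs_minus_commute mult_left_mono)
    also have "\<dots> < e" using r'(2) x by (simp add: pos_less_divide_eq add_nonneg_pos)
    finally show ?thesis .
  qed
  then show "\<exists>d>0. \<forall>r'\<in>{0..1}. \<bar>r' - r\<bar> < d \<longrightarrow> nrm B (segment x y r -[B] segment x y r') < e"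
    using d by blast
qed (use x in \<open>auto simp: segment_def\<close>)

lemma nrm_segment_diff:
  assumes "x \<in> carrier B" "y \<in> carrier B" "x' \<in> carrier B" "y' \<in> carrier B"
  shows "nrm (IB B) (segment x y -[IB B] segment x' y') \<le> nrm B (x -[B] x') + nrm B (y -[B] y')"
proof (rule nrm_IB_leI)
  fix r :: real assume r: "0 \<le> r" "r \<le> 1"
  have "(segment x y -[IB B] segment x' y') r = of_real (1 - r) .[B] (x -[B] x') +[B] of_real r .[B] (y -[B] y')"
    using r assms by (simp add: add_diff_add scale_diff_right)
  also have "nrm B \<dots> \<le> nrm B (of_real (1 - r) .[B] (x -[B] x')) + nrm B (of_real r .[B] (y -[B] y'))"
    using assms by (intro nrm_triangle) simp_all
  also have "\<dots> = \<bar>1 - r\<bar> * nrm B (x -[B] x') + \<bar>r\<bar> * nrm B (y -[B] y')"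
    using assms by (simp only: nrm_scale diff_closed norm_of_real)
  also have "\<dots> \<le> 1 * nrm B (x -[B] x') + 1 * nrm B (y -[B] y')"
    using r assms by (intro add_mono mult_right_mono) simp_all
  finally show "nrm B ((segment x y -[IB B] segment x' y') r) \<le> nrm B (x -[B] x') + nrm B (y -[B] y')" by simp
qed

lemma segment_scale:
  assumes "x \<in> carrier B" "y \<in> carrier B"
  shows "segment (c .[B] x) (c .[B] y) = c .[IB B] segment x y"
  by (rule IB_eqI) (use assms in \<open>simp_all add: scale_add_right mult.commute\<close>)

lemma segment_continuous:
  assumes cC: "csa C" and f: "continuous_map (ctop C) (ctop B) f" and g: "continuous_map (ctop C) (ctop B) g"
  shows "continuous_map (ctop C) (ctop (IB B)) (\<lambda>c. segment (f c) (g c))"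
  by (rule continuous_dominated[OF cC cB cB cI f g, where K = 1])
    (use nrm_segment_diff continuous_ctop_closed[OF cC cB f] continuous_ctop_closed[OF cC cB g] in simp_all)

lemma push_const_path: "f \<in> carrier CR \<Longrightarrow> push const_path f = flip (const_path f)"
  by (simp add: push_def flip_def const_path_def fun_eq_iff restrict_def)

text \<open>At parameter \<open>r\<close> the segment differs from the constant path by
  \<open>r\<close> times \<open>g - f\<close>, which lies in \<open>C\<^sub>0\<close>. Hence a
  straight-line homotopy between asymptotically equal functions is asymptotically constant.\<close>

lemma flip_segment_aeq:
  assumes fg: "f \<simeq> g"
  shows "codomain.aeq (IB B) (flip (codomain.segment CR f g)) (push const_path f)"
proof -
  interpret K: codomain "IB B" by (rule codomain_IB)
  interpret J: codomain "CR" by (rule codomain_CbR)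
  have c: "f \<in> carrier CR" "g \<in> carrier CR" "f -[CR] g \<in> C0R B"
    using fg unfolding aeq_def by blast+
  let ?G = "J.segment f g -[IB CR] const_path f"
  have G: "?G \<in> carrier (IB CR)" using c by simp
  have "?G r \<in> C0R B" if "0 \<le> r" "r \<le> 1" for r
  proof -
    have "?G r = f +[CR] of_real r .[CR] (g -[CR] f) -[CR] f"
      unfolding R.convex_combination_eq[OF c(1,2), symmetric] using that by simp
    also have "\<dots> = of_real r .[CR] (g -[CR] f)" using c by (simp add: R.group_simps)
    finally show ?thesis using aeq_sym[OF fg] C0R_scale by (simp add: aeq_def)
  qed
  then have "flip ?G \<in> C0R (IB B)" by (rule flip_C0R[OF G])
  then show ?thesis
    using c star_hom_diff[OF flip_star_hom J.cI, of "J.segment f g" "const_path f"]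
    by (intro K.aeqI) (simp_all add: push_const_path)
qed

subsection \<open>The path of an asymptotic homomorphism\<close>

text \<open>The asymptotic homomorphism from \<open>IB C\<close> to \<open>IB B\<close> induced by
  \<open>\<psi>\<close>. A norm-continuous \<open>\<psi>\<close> sends a path in \<open>C\<close> to
  a norm-continuous path in \<open>CbR B\<close>, which is where \<open>flip\<close> becomes
  applicable.\<close>

definition path_map :: "('c \<Rightarrow> real \<Rightarrow> 'b) \<Rightarrow> (real \<Rightarrow> 'c) \<Rightarrow> real \<Rightarrow> real \<Rightarrow> 'b"
  where "path_map \<psi> h = flip (\<lambda>r\<in>{0..1}. \<psi> (h r))"

end

section \<open>Paths composed with continuous maps\<close>

lemma compose_path_closed:
  assumes cC: "csa C" and cD: "csa D" and f: "continuous_map (ctop C) (ctop D) f"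
    and h: "h \<in> carrier (IB C)"
  shows "(\<lambda>r\<in>{0..1}. f (h r)) \<in> carrier (IB D)"
proof -
  interpret C: codomain C using cC by (rule codomain.intro)
  interpret D: codomain D using cD by (rule codomain.intro)
  have fc: "f c \<in> carrier D" if "c \<in> carrier C" for c
    using f that unfolding continuous_ctop_iff[OF cC cD] by blast
  show ?thesis
  proof (rule D.IB_carrierI)
    fix r e :: real assume r: "0 \<le> r" "r \<le> 1" and e: "e > 0"
    have "h r \<in> carrier C" using h r by simp
    then obtain d where d: "d > 0" "\<forall>b\<in>carrier C. nrm C (h r -[C] b) < d \<longrightarrow> nrm D (f (h r) -[D] f b) < e"
      using f e unfolding continuous_ctop_iff[OF cC cD] by blast
    have "r \<in> {0..1}" using r by simp
    from C.Cb_cont[OF h this d(1)] obtain d' where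
      d': "d' > 0" "\<forall>r'\<in>{0..1}. \<bar>r' - r\<bar> < d' \<longrightarrow> nrm C (h r -[C] h r') < d" by blast
    have "nrm D ((\<lambda>r\<in>{0..1}. f (h r)) r -[D] (\<lambda>r\<in>{0..1}. f (h r)) r') < e" if "r' \<in> {0..1}" "\<bar>r' - r\<bar> < d'" for r'
      using d(2)[rule_format, of "h r'"] d'(2)[rule_format, OF that] that r h by simp
    then show "\<exists>d>0. \<forall>r'\<in>{0..1}. \<bar>r' - r\<bar> < d \<longrightarrow> nrm D ((\<lambda>r\<in>{0..1}. f (h r)) r -[D] (\<lambda>r\<in>{0..1}. f (h r)) r') < e"
      using d'(1) by blast
  qed (use fc h in auto)
qed

text \<open>A continuous \<open>f\<close> need not be uniformly continuous, but it is so near the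
  compact range of a single path \<open>h\<close>.\<close>

lemma compose_path_continuous:
  assumes cC: "csa C" and cD: "csa D" and f: "continuous_map (ctop C) (ctop D) f"
  shows "continuous_map (ctop (IB C)) (ctop (IB D)) (\<lambda>h. \<lambda>r\<in>{0..1}. f (h r))"
proof -
  interpret C: codomain C using cC by (rule codomain.intro)
  interpret D: codomain D using cD by (rule codomain.intro)
  have fc [simp]: "f c \<in> carrier D" if "c \<in> carrier C" for c
    using f that unfolding continuous_ctop_iff[OF cC cD] by blast
  let ?F = "\<lambda>h. \<lambda>r\<in>{0..1}. f (h r)"
  note cl = compose_path_closed[OF cC cD f]
  have "\<exists>\<delta>>0. \<forall>h'\<in>carrier (IB C). nrm (IB C) (h -[IB C] h') < \<delta> \<longrightarrow> nrm (IB D) (?F h -[IB D] ?F h') < e"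
    if h: "h \<in> carrier (IB C)" and e: "e > 0" for h e
  proof -
    \<comment> \<open>One \<open>\<delta>\<close> for all parameters between \<open>a\<close> and
      \<open>b\<close>; bisection extends it to the whole interval.\<close>
    let ?P = "\<lambda>a b. \<exists>\<delta>>0. \<forall>r. 0 \<le> r \<and> r \<le> 1 \<and> a \<le> r \<and> r \<le> b \<longrightarrow>
        (\<forall>c\<in>carrier C. nrm C (h r -[C] c) < \<delta> \<longrightarrow> nrm D (f (h r) -[D] f c) < e / 2)"
    have "?P 0 1"
    proof (rule Bolzano[where P = ?P])
      fix a b c :: real
      assume "?P a b" "?P b c"
      then obtain d d' where d: "d > 0" "\<forall>r. 0 \<le> r \<and> r \<le> 1 \<and> a \<le> r \<and> r \<le> b \<longrightarrow>
          (\<forall>c\<in>carrier C. nrm C (h r -[C] c) < d \<longrightarrow> nrm D (f (h r) -[D] f c) < e / 2)"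
        and d': "d' > 0" "\<forall>r. 0 \<le> r \<and> r \<le> 1 \<and> b \<le> r \<and> r \<le> c \<longrightarrow>
          (\<forall>c\<in>carrier C. nrm C (h r -[C] c) < d' \<longrightarrow> nrm D (f (h r) -[D] f c) < e / 2)"
        by (elim exE conjE)
      show "?P a c"
      proof (intro exI[of _ "min d d'"] conjI allI impI ballI)
        fix r x assume r: "0 \<le> r \<and> r \<le> 1 \<and> a \<le> r \<and> r \<le> c" and x: "x \<in> carrier C" "nrm C (h r -[C] x) < min d d'"
        show "nrm D (f (h r) -[D] f x) < e / 2"
          using d(2)[rule_format, of r x] d'(2)[rule_format, of r x] r x by (cases "r \<le> b") simp_all
      qed (use d d' in simp)
    next
      fix x :: real assume x: "0 \<le> x" "x \<le> 1"
      have hx: "h x \<in> carrier C" using h x by simp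
      have e4: "e / 4 > 0" using e by simp
      obtain d where d: "d > 0" "\<forall>c\<in>carrier C. nrm C (h x -[C] c) < d \<longrightarrow> nrm D (f (h x) -[D] f c) < e / 4"
        using f hx e4 unfolding continuous_ctop_iff[OF cC cD] by blast
      have "x \<in> {0..1}" using x by simp
      from C.Cb_cont[OF h this half_gt_zero[OF d(1)]] obtain d' where
        d': "d' > 0" "\<forall>r'\<in>{0..1}. \<bar>r' - x\<bar> < d' \<longrightarrow> nrm C (h x -[C] h r') < d / 2" by blast
      have "?P a b" if ab: "a \<le> x \<and> x \<le> b \<and> b - a < d'" for a b
      proof (intro exI[of _ "d / 2"] conjI allI impI ballI)
        fix r c assume r: "0 \<le> r \<and> r \<le> 1 \<and> a \<le> r \<and> r \<le> b" and c: "c \<in> carrier C" "nrm C (h r -[C] c) < d / 2"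
        have "\<bar>r - x\<bar> < d'" using r ab by linarith
        then have n: "nrm C (h x -[C] h r) < d / 2" using d'(2) r by simp
        have hr: "h r \<in> carrier C" using h r by simp
        have "nrm C (h x -[C] c) < d" using C.nrm_diff_triangle[OF hx hr c(1)] n c(2) by linarith
        then have "nrm D (f (h x) -[D] f c) < e / 4" using d(2) c(1) by blast
        moreover have "nrm D (f (h x) -[D] f (h r)) < e / 4" using d(2)[rule_format, OF hr] n d(1) by linarith
        ultimately show "nrm D (f (h r) -[D] f c) < e / 2"
          using D.nrm_diff_triangle[OF fc[OF hr] fc[OF hx] fc[OF c(1)]] D.nrm_diff_commute[OF fc[OF hr] fc[OF hx]]
          by linarith
      qed (use d in simp)
      then show "\<exists>d>0. \<forall>a b. a \<le> x \<and> x \<le> b \<and> b - a < d \<longrightarrow> ?P a b" using d'(1) by blast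
    qed simp
    then obtain \<delta> where \<delta>: "\<delta> > 0" "\<forall>r. 0 \<le> r \<and> r \<le> 1 \<and> 0 \<le> r \<and> r \<le> 1 \<longrightarrow>
        (\<forall>c\<in>carrier C. nrm C (h r -[C] c) < \<delta> \<longrightarrow> nrm D (f (h r) -[D] f c) < e / 2)" by (elim exE conjE)
    have "nrm (IB D) (?F h -[IB D] ?F h') < e"
      if h': "h' \<in> carrier (IB C)" "nrm (IB C) (h -[IB C] h') < \<delta>" for h'
    proof -
      have "nrm (IB D) (?F h -[IB D] ?F h') \<le> e / 2"
      proof (rule D.nrm_IB_leI)
        fix r :: real assume r: "0 \<le> r" "r \<le> 1"
        have "nrm C (h r -[C] h' r) < \<delta>"
          using C.nrm_IB_le[OF C.I.diff_closed[OF h h'(1)] r] h'(2) r by simp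
        then show "nrm D ((?F h -[IB D] ?F h') r) \<le> e / 2"
          using \<delta>(2)[rule_format, of r "h' r"] h' r by (simp add: less_imp_le)
      qed
      then show ?thesis using e by simp
    qed
    then show ?thesis using \<delta>(1) by blast
  qed
  then show ?thesis using cl unfolding continuous_ctop_iff[OF C.cI D.cI] by blast
qed

context codomain
begin

lemma flip_aeq:
  assumes G: "G \<in> carrier (IB CR)" and H: "H \<in> carrier (IB CR)"
    and GH: "\<And>r. \<lbrakk>0 \<le> r; r \<le> 1\<rbrakk> \<Longrightarrow> G r \<simeq> H r"
  shows "codomain.aeq (IB B) (flip G) (flip H)"
proof -
  interpret K: codomain "IB B" by (rule codomain_IB)
  interpret J: codomain "CR" by (rule codomain_CbR)
  show ?thesis
  proof (rule K.aeqI)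
    have "flip (G -[IB CR] H) \<in> C0R (IB B)"
      by (rule flip_C0R) (use G H GH in \<open>simp_all add: aeq_def\<close>)
    then show "flip G -[CbR (IB B)] flip H \<in> C0R (IB B)"
      using star_hom_diff[OF flip_star_hom J.cI G H] by simp
  qed (use G H in simp_all)
qed

text \<open>Each relation holds modulo \<open>C\<^sub>0\<close> at every fixed parameter of the
  path, and \<open>flip_aeq\<close> makes this uniform.\<close>

lemma path_map_asymptotic:
  assumes cC: "csa C" and h: "asymptotic_hom C B \<psi>"
  shows "asymptotic_hom (IB C) (IB B) (path_map \<psi>)"
proof -
  interpret C: codomain C using cC by (rule codomain.intro)
  interpret K: codomain "IB B" by (rule codomain_IB)
  interpret J: codomain "CR" by (rule codomain_CbR)
  note hD = asymptotic_homD[OF cC h]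
  let ?F = "\<lambda>h. \<lambda>r\<in>{0..1}. \<psi> (h r)"
  have Fc [simp]: "?F x \<in> carrier (IB CR)" if "x \<in> carrier (IB C)" for x
    by (rule compose_path_closed[OF cC cR hD(6) that])
  note fD = star_homD[OF flip_star_hom]
  have pm: "path_map \<psi> = flip \<circ> ?F" by (auto simp: path_map_def)
  show ?thesis
  proof (rule K.asymptotic_homI)
    show "continuous_map (ctop (IB C)) (ctop (CbR (IB B))) (path_map \<psi>)"
      unfolding pm using compose_path_continuous[OF cC cR hD(6)] star_hom_continuous[OF J.cI K.cR flip_star_hom]
      by (rule continuous_map_compose)
    show "homogeneous (IB C) (CbR (IB B)) (path_map \<psi>)"
      unfolding homogeneous_def
    proof (intro allI ballI)
      fix c x assume x: "x \<in> carrier (IB C)"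
      have "?F (c .[IB C] x) = c .[IB CR] ?F x"
        by (rule J.IB_eqI) (use x Fc[OF x] Fc[OF C.I.scale_closed[OF x, of c]] hD(2) in simp_all)
      then show "path_map \<psi> (c .[IB C] x) = c .[CbR (IB B)] path_map \<psi> x"
        using fD(3)[OF Fc[OF x]] by (simp add: path_map_def)
    qed
    fix x assume x: "x \<in> carrier (IB C)"
    show "K.aeq (path_map \<psi> (adj (IB C) x)) (adj (CbR (IB B)) (path_map \<psi> x))"
      unfolding path_map_def fD(5)[OF Fc[OF x], symmetric]
      by (rule flip_aeq) (use x Fc[OF C.I.adj_closed[OF x]] Fc[OF x] hD(5) in simp_all)
    fix y assume y: "y \<in> carrier (IB C)"
    show "K.aeq (path_map \<psi> (x +[IB C] y)) (path_map \<psi> x +[CbR (IB B)] path_map \<psi> y)"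
      unfolding path_map_def fD(2)[OF Fc[OF x] Fc[OF y], symmetric]
      by (rule flip_aeq) (use x y Fc[OF C.I.add_closed[OF x y]] Fc[OF x] Fc[OF y] hD(3) in simp_all)
    show "K.aeq (path_map \<psi> (x *[IB C] y)) (path_map \<psi> x *[CbR (IB B)] path_map \<psi> y)"
      unfolding path_map_def fD(4)[OF Fc[OF x] Fc[OF y], symmetric]
      by (rule flip_aeq) (use x y Fc[OF C.I.mult_closed[OF x y]] Fc[OF x] Fc[OF y] hD(4) in simp_all)
  qed
qed

lemma eval_at_path_map:
  assumes cC: "csa C" and h: "asymptotic_hom C B \<psi>" and x: "x \<in> carrier (IB C)" and r: "0 \<le> r" "r \<le> 1"
  shows "eval_at r (path_map \<psi> x) = \<psi> (x r)"
  using eval_at_flip[OF compose_path_closed[OF cC cR asymptotic_homD(6)[OF cC h] x] r] r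
  by (simp add: path_map_def)

lemma path_map_aeq:
  assumes cC: "csa C" and h: "asymptotic_hom C B \<phi>" "asymptotic_hom C B \<psi>" and x: "x \<in> carrier (IB C)"
    and eq: "\<And>r. \<lbrakk>0 \<le> r; r \<le> 1\<rbrakk> \<Longrightarrow> \<phi> (x r) \<simeq> \<psi> (x r)"
  shows "codomain.aeq (IB B) (path_map \<phi> x) (path_map \<psi> x)"
proof -
  interpret K: codomain "IB B" by (rule codomain_IB)
  interpret J: codomain "CR" by (rule codomain_CbR)
  let ?G = "\<lambda>r\<in>{0..1}. \<phi> (x r)" and ?H = "\<lambda>r\<in>{0..1}. \<psi> (x r)"
  have G: "?G \<in> carrier (IB CR)" by (rule compose_path_closed[OF cC cR asymptotic_homD(6)[OF cC h(1)] x])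
  have H: "?H \<in> carrier (IB CR)" by (rule compose_path_closed[OF cC cR asymptotic_homD(6)[OF cC h(2)] x])
  show ?thesis
    unfolding path_map_def
  proof (rule K.aeqI)
    have "flip (?G -[IB CR] ?H) \<in> C0R (IB B)"
      by (rule flip_C0R) (use G H eq in \<open>simp_all add: aeq_def\<close>)
    then show "flip ?G -[CbR (IB B)] flip ?H \<in> C0R (IB B)"
      using star_hom_diff[OF flip_star_hom J.cI G H] by simp
  qed (use flip_closed[OF G] flip_closed[OF H] in simp_all)
qed

end

lemma (in codomain_hom) asymptotic_hom_push:
  assumes cC: "csa C" and h: "asymptotic_hom C B \<psi>"
  shows "asymptotic_hom C B' (push k \<circ> \<psi>)"
proof -
  note hD = B.asymptotic_homD[OF cC h]
  show ?thesis
  proof (rule B'.asymptotic_homI)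
    show "continuous_map (ctop C) (ctop (CbR B')) (push k \<circ> \<psi>)"
      using hD(6) star_hom_continuous[OF B.cR B'.cR push_star_hom] by (rule continuous_map_compose)
    show "homogeneous C (CbR B') (push k \<circ> \<psi>)"
      using hD(1,2) pushD(3) by (simp add: homogeneous_def)
  qed (use push_aeq[OF hD(3)] push_aeq[OF hD(4)] push_aeq[OF hD(5)] hD(1) pushD(2,4,5) in simp_all)
qed

lemma (in norming_pair) asymptotic_hom_pushI:
  assumes cC: "csa C" and cl: "\<And>c. c \<in> carrier C \<Longrightarrow> \<theta> c \<in> carrier (CbR B')"
    and h1: "asymptotic_hom C B (push k1 \<circ> \<theta>)" and h2: "asymptotic_hom C B (push k2 \<circ> \<theta>)"
  shows "asymptotic_hom C B' \<theta>"
proof -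
  interpret C: pre_cstar C using cC by (rule cstar_imp_pre)
  note h1D = k1.B'.asymptotic_homD[OF cC h1] and h2D = k1.B'.asymptotic_homD[OF cC h2]
  show ?thesis
  proof (rule k1.B.asymptotic_homI)
    show "continuous_map (ctop C) (ctop (CbR B')) \<theta>"
      by (rule continuous_pushI[OF cC h1D(6) h2D(6)]) (use cl in simp)
    show "homogeneous C (CbR B') \<theta>"
      unfolding homogeneous_def
    proof (intro allI ballI)
      fix c a assume a: "a \<in> carrier C"
      show "\<theta> (c .[C] a) = c .[CbR B'] \<theta> a"
        by (rule push_eqI) (use cl a h1D(2)[OF a, of c] h2D(2)[OF a, of c] in \<open>simp_all add: k1.pushD(3) k2.pushD(3)\<close>)
    qed
    fix a assume a: "a \<in> carrier C"
    show "k1.B.aeq (\<theta> (adj C a)) (adj (CbR B') (\<theta> a))"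
      by (rule aeq_pushI) (use cl a h1D(5)[OF a] h2D(5)[OF a] in \<open>simp_all add: k1.pushD(5) k2.pushD(5)\<close>)
    fix b assume b: "b \<in> carrier C"
    show "k1.B.aeq (\<theta> (a +[C] b)) (\<theta> a +[CbR B'] \<theta> b)"
      by (rule aeq_pushI) (use cl a b h1D(3)[OF a b] h2D(3)[OF a b] in \<open>simp_all add: k1.pushD(2) k2.pushD(2)\<close>)
    show "k1.B.aeq (\<theta> (a *[C] b)) (\<theta> a *[CbR B'] \<theta> b)"
      by (rule aeq_pushI) (use cl a b h1D(4)[OF a b] h2D(4)[OF a b] in \<open>simp_all add: k1.pushD(4) k2.pushD(4)\<close>)
  qed
qed

section \<open>Orthogonal sums\<close>

definition pointwise :: "('b \<Rightarrow> 'c) \<Rightarrow> (real \<Rightarrow> 'b) \<Rightarrow> real \<Rightarrow> 'c"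
  where "pointwise k g = (\<lambda>r\<in>{0..1}. k (g r))"

lemma pointwise_at [simp]: "\<lbrakk>0 \<le> r; r \<le> 1\<rbrakk> \<Longrightarrow> pointwise k g r = k (g r)"
  by (simp add: pointwise_def)

lemma (in codomain_hom) pointwise_hom: "codomain_hom (IB B) (IB B') (pointwise k)"
proof (intro codomain_hom.intro B.codomain_IB B'.codomain_IB codomain_hom_axioms.intro)
  have cl: "pointwise k g \<in> carrier (IB B')" if "g \<in> carrier (IB B)" for g
    unfolding pointwise_def
    by (rule compose_path_closed[OF B.cB B'.cB star_hom_continuous[OF B.cB B'.cB k] that])
  show "star_hom (IB B) (IB B') (pointwise k)"
    unfolding star_hom_def by (intro conjI ballI allI B'.IB_eqI) (use cl in simp_all)
qed

lemma eval_at_push_pointwise: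
  "\<lbrakk>0 \<le> r; r \<le> 1\<rbrakk> \<Longrightarrow> eval_at r (push (pointwise k) F) = push k (eval_at r F)"
  by (auto simp: eval_at_def push_def fun_eq_iff)

text \<open>Models the conjugations by \<open>s1\<close> and \<open>s2\<close>. Keeping the two
  homomorphisms abstract allows the same lemmas to be applied pointwise to paths, which turns sums
  of homotopies into homotopies of sums.\<close>

locale orthogonal_homs = k1: codomain_hom B B' k1 + k2: codomain_hom B B' k2
  for B :: "'b cstar" and B' :: "'c cstar" and k1 k2 :: "'b \<Rightarrow> 'c" +
  assumes orth: "\<lbrakk>x \<in> carrier B; y \<in> carrier B\<rbrakk> \<Longrightarrow> k1 x *[B'] k2 y = czero B'"
    "\<lbrakk>x \<in> carrier B; y \<in> carrier B\<rbrakk> \<Longrightarrow> k2 x *[B'] k1 y = czero B'"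
begin

lemma push_orth:
  assumes "f \<in> carrier (CbR B)" "g \<in> carrier (CbR B)"
  shows "push k1 f *[CbR B'] push k2 g = czero (CbR B')" "push k2 f *[CbR B'] push k1 g = czero (CbR B')"
  by (rule k1.B'.CbR_eqI; use assms orth in simp)+

definition osum :: "('a \<Rightarrow> real \<Rightarrow> 'b) \<Rightarrow> ('a \<Rightarrow> real \<Rightarrow> 'b) \<Rightarrow> 'a \<Rightarrow> real \<Rightarrow> 'c"
  where "osum \<phi> \<psi> a = push k1 (\<phi> a) +[CbR B'] push k2 (\<psi> a)"

lemma mult_osum:
  assumes [simp]: "f \<in> carrier (CbR B)" "g \<in> carrier (CbR B)" "f' \<in> carrier (CbR B)" "g' \<in> carrier (CbR B)"
  shows "(push k1 f +[CbR B'] push k2 g) *[CbR B'] (push k1 f' +[CbR B'] push k2 g') =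
    push k1 (f *[CbR B] f') +[CbR B'] push k2 (g *[CbR B] g')"
  by (simp add: k1.B'.R.mult_add_left k1.B'.R.mult_add_right push_orth k1.pushD(4) k2.pushD(4))

lemma osum_continuous:
  assumes cC: "csa C" and f: "continuous_map (ctop C) (ctop (CbR B)) \<phi>" and g: "continuous_map (ctop C) (ctop (CbR B)) \<psi>"
  shows "continuous_map (ctop C) (ctop (CbR B')) (osum \<phi> \<psi>)"
proof (rule continuous_dominated[OF cC k1.B.cR k1.B.cR k1.B'.cR f g, where K = 1])
  note [simp] = continuous_ctop_closed[OF cC k1.B.cR f] continuous_ctop_closed[OF cC k1.B.cR g]
  show "osum \<phi> \<psi> w \<in> carrier (CbR B')" if "w \<in> carrier C" for w using that by (simp add: osum_def)
  fix x a assume a: "x \<in> carrier C" "a \<in> carrier C"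
  let ?u = "\<phi> x -[CbR B] \<phi> a" and ?v = "\<psi> x -[CbR B] \<psi> a"
  have "osum \<phi> \<psi> x -[CbR B'] osum \<phi> \<psi> a = push k1 ?u +[CbR B'] push k2 ?v"
    using a by (simp add: osum_def k1.B'.R.add_diff_add k1.pushD(6) k2.pushD(6))
  then have "nrm (CbR B') (osum \<phi> \<psi> x -[CbR B'] osum \<phi> \<psi> a) \<le> nrm (CbR B') (push k1 ?u) + nrm (CbR B') (push k2 ?v)"
    using a by (simp add: k1.B'.R.nrm_triangle)
  also have "\<dots> \<le> nrm (CbR B) ?u + nrm (CbR B) ?v"
    using a by (intro add_mono k1.pushD(7) k2.pushD(7)) simp_all
  finally show "nrm (CbR B') (osum \<phi> \<psi> x -[CbR B'] osum \<phi> \<psi> a) \<le> 1 * (nrm (CbR B) ?u + nrm (CbR B) ?v)" by simp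
qed

lemma osum_homogeneous:
  assumes "homogeneous C (CbR B) \<phi>" "homogeneous C (CbR B) \<psi>"
    and "\<And>c. c \<in> carrier C \<Longrightarrow> \<phi> c \<in> carrier (CbR B)" "\<And>c. c \<in> carrier C \<Longrightarrow> \<psi> c \<in> carrier (CbR B)"
  shows "homogeneous C (CbR B') (osum \<phi> \<psi>)"
  using assms by (simp add: homogeneous_def osum_def k1.pushD(3) k2.pushD(3) k1.B'.R.scale_add_right)

lemma push_sum_aeq:
  "\<lbrakk>k1.B.aeq f f'; k1.B.aeq g g'\<rbrakk> \<Longrightarrow> k1.B'.aeq (push k1 f +[CbR B'] push k2 g) (push k1 f' +[CbR B'] push k2 g')"
  by (intro k1.B'.aeq_add k1.push_aeq k2.push_aeq)

lemma osum_asymptotic: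
  assumes cC: "csa C" and f: "asymptotic_hom C B \<phi>" and g: "asymptotic_hom C B \<psi>"
  shows "asymptotic_hom C B' (osum \<phi> \<psi>)"
proof -
  interpret C: pre_cstar C using cC by (rule cstar_imp_pre)
  note fD = k1.B.asymptotic_homD[OF cC f] and gD = k1.B.asymptotic_homD[OF cC g]
  show ?thesis
  proof (rule k1.B'.asymptotic_homI)
    show "continuous_map (ctop C) (ctop (CbR B')) (osum \<phi> \<psi>)" by (rule osum_continuous[OF cC fD(6) gD(6)])
    show "homogeneous C (CbR B') (osum \<phi> \<psi>)" by (rule osum_homogeneous[OF fD(7) gD(7) fD(1) gD(1)])
    fix a assume a: "a \<in> carrier C"
    note [simp] = fD(1)[OF a] gD(1)[OF a]
    have "osum \<phi> \<psi> a \<in> carrier (CbR B')" by (simp add: osum_def)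
    show "k1.B'.aeq (osum \<phi> \<psi> (adj C a)) (adj (CbR B') (osum \<phi> \<psi> a))"
      using push_sum_aeq[OF fD(5)[OF a] gD(5)[OF a]]
      by (simp add: osum_def k1.B'.R.adj_add k1.pushD(5) k2.pushD(5))
    fix b assume b: "b \<in> carrier C"
    note [simp] = fD(1)[OF b] gD(1)[OF b]
    show "k1.B'.aeq (osum \<phi> \<psi> (a +[C] b)) (osum \<phi> \<psi> a +[CbR B'] osum \<phi> \<psi> b)"
      using push_sum_aeq[OF fD(3)[OF a b] gD(3)[OF a b]]
      by (simp add: osum_def k1.pushD(2) k2.pushD(2) k1.B'.R.add_ac)
    show "k1.B'.aeq (osum \<phi> \<psi> (a *[C] b)) (osum \<phi> \<psi> a *[CbR B'] osum \<phi> \<psi> b)"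
      using push_sum_aeq[OF fD(4)[OF a b] gD(4)[OF a b]] by (simp add: osum_def mult_osum)
  qed
qed

lemma pointwise_orthogonal: "orthogonal_homs (IB B) (IB B') (pointwise k1) (pointwise k2)"
proof (intro orthogonal_homs.intro orthogonal_homs_axioms.intro k1.pointwise_hom k2.pointwise_hom)
  interpret p1: codomain_hom "IB B" "IB B'" "pointwise k1" by (rule k1.pointwise_hom)
  interpret p2: codomain_hom "IB B" "IB B'" "pointwise k2" by (rule k2.pointwise_hom)
  fix x y assume "x \<in> carrier (IB B)" "y \<in> carrier (IB B)"
  then show "pointwise k1 x *[IB B'] pointwise k2 y = czero (IB B')" "pointwise k2 x *[IB B'] pointwise k1 y = czero (IB B')"
    by (intro k1.B'.IB_eqI; use orth p1.kD(1) p2.kD(1) in simp)+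
qed

lemma eval_at_osum:
  assumes F: "f a \<in> carrier (CbR (IB B))" and G: "g a \<in> carrier (CbR (IB B))" and r: "0 \<le> r" "r \<le> 1"
  shows "eval_at r (orthogonal_homs.osum (IB B') (pointwise k1) (pointwise k2) f g a) =
    push k1 (eval_at r (f a)) +[CbR B'] push k2 (eval_at r (g a))"
proof -
  interpret P: orthogonal_homs "IB B" "IB B'" "pointwise k1" "pointwise k2" by (rule pointwise_orthogonal)
  interpret E: codomain_hom "IB B'" B' "\<lambda>g. g r" using r by (rule k1.B'.eval_hom)
  show ?thesis
    unfolding P.osum_def eval_at_push_pointwise[OF r, symmetric]
    using E.pushD(2)[of "push (pointwise k1) (f a)" "push (pointwise k2) (g a)"] F G by (simp add: eval_at_push)
qed

end

subsection \<open>Conjugation by the isometries\<close>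

context codomain
begin

text \<open>Taking \<open>z\<close> to be the adjoint of \<open>x\<close>, the C*-identity makes the
  norm of \<open>x\<close> vanish. In a possibly nonunital algebra this replaces cancellation by a
  unit.\<close>

lemma mult_right_zero_imp:
  assumes x: "x \<in> carrier B" and 0: "\<And>z. z \<in> carrier B \<Longrightarrow> z *[B] x = czero B"
  shows "x = czero B"
proof -
  have "(nrm B x)\<^sup>2 = 0" using cstar_identity[OF x] 0[of "adj B x"] x by simp
  then show ?thesis using x by (simp add: nrm_eq_0)
qed

text \<open>The last two facts are the two coordinates of the equation saying that \<open>s\<close>
  is an isometry: its left multiplication on \<open>x\<close>, and its right multiplication on
  \<open>x\<close>.\<close>

lemma multiplierD:
  assumes s: "multiplier_isometry B s"
  defines "L \<equiv> fst s" and "R \<equiv> snd s"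
  shows "x \<in> carrier B \<Longrightarrow> L x \<in> carrier B" "x \<in> carrier B \<Longrightarrow> R x \<in> carrier B"
    "\<lbrakk>x \<in> carrier B; y \<in> carrier B\<rbrakk> \<Longrightarrow> L (x +[B] y) = L x +[B] L y"
    "x \<in> carrier B \<Longrightarrow> L (c .[B] x) = c .[B] L x"
    "\<lbrakk>x \<in> carrier B; y \<in> carrier B\<rbrakk> \<Longrightarrow> L (x *[B] y) = L x *[B] y"
    "\<lbrakk>x \<in> carrier B; y \<in> carrier B\<rbrakk> \<Longrightarrow> R (x *[B] y) = x *[B] R y"
    "\<lbrakk>x \<in> carrier B; y \<in> carrier B\<rbrakk> \<Longrightarrow> R x *[B] y = x *[B] L y"
    "x \<in> carrier B \<Longrightarrow> adj B (R (adj B (L x))) = x"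
    "x \<in> carrier B \<Longrightarrow> R (adj B (L (adj B x))) = x"
proof -
  obtain L' R' where LR: "s = (L', R')" by (cases s)
  have [simp]: "L = L'" "R = R'" by (simp_all add: L_def R_def LR)
  have dc: "double_centralizer B L' R'"
    using s by (simp add: multiplier_isometry_def multiplier_algebra_def LR)
  show "x \<in> carrier B \<Longrightarrow> L x \<in> carrier B" "x \<in> carrier B \<Longrightarrow> R x \<in> carrier B"
    "\<lbrakk>x \<in> carrier B; y \<in> carrier B\<rbrakk> \<Longrightarrow> L (x +[B] y) = L x +[B] L y"
    "x \<in> carrier B \<Longrightarrow> L (c .[B] x) = c .[B] L x"
    "\<lbrakk>x \<in> carrier B; y \<in> carrier B\<rbrakk> \<Longrightarrow> L (x *[B] y) = L x *[B] y"
    "\<lbrakk>x \<in> carrier B; y \<in> carrier B\<rbrakk> \<Longrightarrow> R (x *[B] y) = x *[B] R y"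
    "\<lbrakk>x \<in> carrier B; y \<in> carrier B\<rbrakk> \<Longrightarrow> R x *[B] y = x *[B] L y"
    using dc by (auto simp: double_centralizer_def bounded_linear_op_def)
  have L'c: "x \<in> carrier B \<Longrightarrow> L' x \<in> carrier B" for x
    using dc by (auto simp: double_centralizer_def bounded_linear_op_def)
  have eq: "(\<lambda>x\<in>carrier B. (\<lambda>x\<in>carrier B. adj B (R' (adj B x))) (L' x)) = (\<lambda>x\<in>carrier B. x)"
    "(\<lambda>x\<in>carrier B. R' ((\<lambda>x\<in>carrier B. adj B (L' (adj B x))) x)) = (\<lambda>x\<in>carrier B. x)"
    using s by (simp_all add: multiplier_isometry_def multiplier_algebra_def multiplier_one_def LR)
  show "adj B (R (adj B (L x))) = x" if "x \<in> carrier B"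
    using fun_cong[OF eq(1), of x] that L'c by simp
  show "R (adj B (L (adj B x))) = x" if "x \<in> carrier B"
    using fun_cong[OF eq(2), of x] that by simp
qed

lemma conjugate_eq:
  assumes s: "multiplier_isometry B s" and x: "x \<in> carrier B"
  shows "conjugate B s x = fst s (adj B (fst s (adj B x)))"
  using x by (cases s) (simp add: conjugate_def multiplier_algebra_def)

lemma conjugate_hom:
  assumes s: "multiplier_isometry B s"
  shows "codomain_hom B B (conjugate B s)"
proof (intro codomain_hom.intro codomain_axioms codomain_hom_axioms.intro)
  let ?L = "fst s" and ?R = "snd s"
  note sD = multiplierD[OF s]
  let ?T = "\<lambda>x. adj B (?L (adj B x))"
  have T: "?T x \<in> carrier B" if "x \<in> carrier B" for x using sD(1) that by simp
  have Tmult: "?T (x *[B] y) = x *[B] ?T y" if "x \<in> carrier B" "y \<in> carrier B" for x y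
    using that sD(1,5) by (simp add: adj_mult)
  \<comment> \<open>\<open>?T\<close> is right multiplication by the adjoint of \<open>s\<close>.
    That it commutes with \<open>?L\<close> is not an axiom of double centralizers; it follows by
    testing both sides against all left factors \<open>z\<close>, where \<open>?L\<close> can be
    moved across as \<open>?R\<close>.\<close>
  have comm: "?L (?T x) = ?T (?L x)" if x: "x \<in> carrier B" for x
  proof -
    have "?L (?T x) -[B] ?T (?L x) = czero B"
    proof (rule mult_right_zero_imp)
      fix z assume z: "z \<in> carrier B"
      have "z *[B] ?L (?T x) = ?R z *[B] ?T x" using sD(7)[OF z T[OF x]] by simp
      also have "\<dots> = ?T (?R z *[B] x)" using Tmult[OF sD(2)[OF z] x] by simp
      also have "\<dots> = ?T (z *[B] ?L x)" using sD(7)[OF z x] by simp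
      also have "\<dots> = z *[B] ?T (?L x)" using Tmult[OF z sD(1)[OF x]] by simp
      finally show "z *[B] (?L (?T x) -[B] ?T (?L x)) = czero B"
        using z x T sD(1) by (simp add: mult_diff_right)
    qed (use x T sD(1) in simp)
    then show ?thesis using x T sD(1) by (simp add: diff_eq_0)
  qed
  show "star_hom B B (conjugate B s)"
    unfolding star_hom_def
  proof (intro conjI ballI allI)
    show "conjugate B s \<in> carrier B \<rightarrow> carrier B" using sD(1) conjugate_eq[OF s] by simp
    fix x assume x: "x \<in> carrier B"
    show "conjugate B s (c .[B] x) = c .[B] conjugate B s x" for c
      using x sD(1,4) by (simp add: conjugate_eq[OF s] adj_scale)
    show "conjugate B s (adj B x) = adj B (conjugate B s x)"
      using comm[OF adj_closed[OF x]] x sD(1) by (simp add: conjugate_eq[OF s])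
    fix y assume y: "y \<in> carrier B"
    show "conjugate B s (x +[B] y) = conjugate B s x +[B] conjugate B s y"
      using x y sD(1,3) by (simp add: conjugate_eq[OF s] adj_add)
    have "conjugate B s x *[B] conjugate B s y = ?L (?T x *[B] ?L (?T y))"
      using x y T sD(1) sD(5)[OF T[OF x] sD(1)[OF T[OF y]]] by (simp add: conjugate_eq[OF s])
    also have "?T x *[B] ?L (?T y) = ?R (?T x) *[B] ?T y" using sD(7)[OF T[OF x] T[OF y]] by simp
    also have "\<dots> = ?T (x *[B] y)" using sD(9)[OF x] Tmult[OF x y] by simp
    finally show "conjugate B s (x *[B] y) = conjugate B s x *[B] conjugate B s y"
      using x y by (simp add: conjugate_eq[OF s])
  qed
qed

lemma conjugate_orthogonal:
  assumes s1: "multiplier_isometry B s1" and s2: "multiplier_isometry B s2"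
    and sum: "(s1 *[multiplier_algebra B] adj (multiplier_algebra B) s1)
       +[multiplier_algebra B] (s2 *[multiplier_algebra B] adj (multiplier_algebra B) s2) = multiplier_one B"
  shows "orthogonal_homs B B (conjugate B s1) (conjugate B s2)"
proof (intro orthogonal_homs.intro orthogonal_homs_axioms.intro conjugate_hom s1 s2)
  note sD = multiplierD
  let ?T = "\<lambda>s x. adj B (fst s (adj B x))"
  have T: "?T s x \<in> carrier B" if "multiplier_isometry B s" "x \<in> carrier B" for s x
    using sD(1)[OF that(1)] that by simp
  have sum': "?T s1 (snd s1 x) +[B] ?T s2 (snd s2 x) = x" if x: "x \<in> carrier B" for x
  proof -
    obtain L1 R1 L2 R2 where LR: "s1 = (L1, R1)" "s2 = (L2, R2)" by (cases s1, cases s2)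
    have "snd ((s1 *[multiplier_algebra B] adj (multiplier_algebra B) s1)
       +[multiplier_algebra B] (s2 *[multiplier_algebra B] adj (multiplier_algebra B) s2)) x = x"
      unfolding sum using x by (simp add: multiplier_one_def)
    then show ?thesis
      using x sD(2)[OF s1 x] sD(2)[OF s2 x] by (simp add: multiplier_algebra_def LR)
  qed
  \<comment> \<open>For \<open>y\<close> the product of \<open>x\<close> with the adjoint of
    \<open>s\<close>, the decomposition of \<open>y\<close> along the two range projections has
    \<open>y\<close> itself as its \<open>s\<close>-part. The \<open>s'\<close>-part therefore
    vanishes, and multiplying it by \<open>s'\<close> on the right gives the claim. In effect the
    product of the adjoint of \<open>s\<close> with \<open>s'\<close> is 0.\<close>
  have vanish: "snd s' (?T s x) = czero B"
    if s: "multiplier_isometry B s" and s': "multiplier_isometry B s'" and x: "x \<in> carrier B"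
      and sum: "\<And>x. x \<in> carrier B \<Longrightarrow> ?T s (snd s x) +[B] ?T s' (snd s' x) = x" for s s' x
  proof -
    let ?y = "?T s x"
    have y: "?y \<in> carrier B" by (rule T[OF s x])
    have "?y +[B] ?T s' (snd s' ?y) = ?y +[B] czero B"
      using sum[OF y] sD(9)[OF s x] y by simp
    then have "?T s' (snd s' ?y) = czero B"
      using y T[OF s' sD(2)[OF s' y]] by (simp only: add_left_cancel zero_closed)
    then show ?thesis using sD(9)[OF s' sD(2)[OF s' y]] sD(2)[OF s' zero_closed] sD(6)[OF s' zero_closed zero_closed] by simp
  qed
  have mult: "conjugate B s x *[B] conjugate B s' y = czero B"
    if s: "multiplier_isometry B s" and s': "multiplier_isometry B s'" and xy: "x \<in> carrier B" "y \<in> carrier B"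
      and v: "snd s' (?T s x) = czero B" for s s' x y
  proof -
    have "conjugate B s x *[B] conjugate B s' y = fst s (?T s x *[B] fst s' (?T s' y))"
      using xy T sD(1) s s' sD(5)[OF s T[OF s xy(1)] sD(1)[OF s' T[OF s' xy(2)]]] by (simp add: conjugate_eq)
    also have "?T s x *[B] fst s' (?T s' y) = snd s' (?T s x) *[B] ?T s' y"
      using sD(7)[OF s' T[OF s xy(1)] T[OF s' xy(2)]] by simp
    also have "\<dots> = czero B" unfolding v using T[OF s' xy(2)] by simp
    finally show ?thesis using sD(4)[OF s zero_closed, of 0] sD(1)[OF s zero_closed] by simp
  qed
  fix x y assume xy: "x \<in> carrier B" "y \<in> carrier B"
  show "conjugate B s1 x *[B] conjugate B s2 y = czero B"
    by (rule mult[OF s1 s2 xy vanish[OF s1 s2 xy(1) sum']])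
  have sum'': "?T s2 (snd s2 x) +[B] ?T s1 (snd s1 x) = x" if "x \<in> carrier B" for x
    using sum'[OF that] add_commute[OF T[OF s2 sD(2)[OF s2 that]] T[OF s1 sD(2)[OF s1 that]]] by simp
  show "conjugate B s2 x *[B] conjugate B s1 y = czero B"
    by (rule mult[OF s2 s1 xy vanish[OF s2 s1 xy(1) sum'']])
qed

end

lemma orth_sum_eq: "orth_sum B s1 s2 \<phi> \<psi> a = push (conjugate B s1) (\<phi> a) +[CbR B] push (conjugate B s2) (\<psi> a)"
  by (simp add: orth_sum_def push_def Cb_simps fun_eq_iff)

section \<open>Homotopy of pairs\<close>

definition map_pair :: "('x \<Rightarrow> 'y) \<Rightarrow> ('a \<Rightarrow> 'x) \<times> ('a \<Rightarrow> 'x) \<Rightarrow> ('a \<Rightarrow> 'y) \<times> ('a \<Rightarrow> 'y)"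
  where "map_pair k \<Phi> = (k \<circ> fst \<Phi>, k \<circ> snd \<Phi>)"

lemma map_pair_simps [simp]: "fst (map_pair k \<Phi>) a = k (fst \<Phi> a)" "snd (map_pair k \<Phi>) a = k (snd \<Phi> a)"
  by (simp_all add: map_pair_def)

lemma pair_comp_simps [simp]: "fst (pair_comp \<Phi> s) a = fst \<Phi> (s a)" "snd (pair_comp \<Phi> s) a = snd \<Phi> (s a)"
  by (simp_all add: pair_comp_def)

definition join_pair where
  "join_pair \<Theta> \<Theta>' = (\<lambda>a. path_join_R (fst \<Theta> a) (fst \<Theta>' a), \<lambda>a. path_join_R (snd \<Theta> a) (snd \<Theta>' a))"

context codomain
begin

lemma eval_at_const_path:
  assumes f: "f \<in> carrier CR" and r: "0 \<le> r" "r \<le> 1"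
  shows "eval_at r (push const_path f) = f"
proof -
  have "f \<in> extensional {0..}" using f unfolding carrier_Cb[OF cB] by blast
  then show ?thesis
    using r by (simp add: eval_at_def push_def fun_eq_iff extensional_def)
qed

lemma eval_at_reparam:
  "\<lbrakk>0 \<le> r; r \<le> 1\<rbrakk> \<Longrightarrow> eval_at r (push (reparam \<alpha>) F) = eval_at (\<alpha> r) F"
  by (auto simp: eval_at_def push_def fun_eq_iff)

lemma reverse_hom: "codomain_hom (IB B) (IB B) (reparam (\<lambda>r. 1 - r))"
  by (rule reparam_hom) auto

text \<open>The predicates \<open>P\<close> and \<open>P'\<close> are those defining cycles over \<open>B\<close> and over \<open>IB\<close>.\<close>

lemma homotopy_equiv:
  assumes closed: "\<And>\<Phi> a. \<lbrakk>P \<Phi>; a \<in> carrier A\<rbrakk> \<Longrightarrow> fst \<Phi> a \<in> carrier CR \<and> snd \<Phi> a \<in> carrier CR"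
    and closed': "\<And>\<Theta> a. \<lbrakk>P' \<Theta>; a \<in> carrier A\<rbrakk> \<Longrightarrow> fst \<Theta> a \<in> carrier (CbR (IB B)) \<and> snd \<Theta> a \<in> carrier (CbR (IB B))"
    and const: "\<And>\<Phi>. P \<Phi> \<Longrightarrow> P' (map_pair (push const_path) \<Phi>)"
    and rev: "\<And>\<Theta>. P' \<Theta> \<Longrightarrow> P' (map_pair (push (reparam (\<lambda>r. 1 - r))) \<Theta>)"
    and join: "\<And>\<Theta> \<Theta>' \<Theta>''. \<lbrakk>P' \<Theta>; P' \<Theta>'; \<And>a. a \<in> carrier A \<Longrightarrow> fst \<Theta>'' a \<in> carrier (CbR (IB B)) \<and>
        snd \<Theta>'' a \<in> carrier (CbR (IB B)) \<and>
        push first_half (fst \<Theta>'' a) = fst \<Theta> a \<and> push second_half (fst \<Theta>'' a) = fst \<Theta>' a \<and>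
        push first_half (snd \<Theta>'' a) = snd \<Theta> a \<and> push second_half (snd \<Theta>'' a) = snd \<Theta>' a\<rbrakk> \<Longrightarrow> P' \<Theta>''"
  shows "equiv {\<Phi>. P \<Phi>} {(\<Phi>, \<Psi>). P \<Phi> \<and> P \<Psi> \<and> (\<exists>\<Theta>. P' \<Theta> \<and> evaluates_to A 0 \<Theta> \<Phi> \<and> evaluates_to A 1 \<Theta> \<Psi>)}"
    (is "equiv _ ?H")
proof (rule equivI)
  show "?H \<subseteq> {\<Phi>. P \<Phi>} \<times> {\<Phi>. P \<Phi>}" by auto
  show "refl_on {\<Phi>. P \<Phi>} ?H"
  proof (rule refl_onI)
    fix \<Phi> assume "\<Phi> \<in> {\<Phi>. P \<Phi>}"
    then have P: "P \<Phi>" by simp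
    have "evaluates_to A 0 (map_pair (push const_path) \<Phi>) \<Phi>" "evaluates_to A 1 (map_pair (push const_path) \<Phi>) \<Phi>"
      using closed[OF P] by (simp_all add: evaluates_to_def eval_at_const_path)
    then show "(\<Phi>, \<Phi>) \<in> ?H" using P const[OF P] by blast
  qed
  show "sym ?H"
  proof (rule symI)
    fix \<Phi> \<Psi> assume "(\<Phi>, \<Psi>) \<in> ?H"
    then obtain \<Theta> where \<Theta>: "P \<Phi>" "P \<Psi>" "P' \<Theta>" "evaluates_to A 0 \<Theta> \<Phi>" "evaluates_to A 1 \<Theta> \<Psi>" by blast
    let ?\<Theta> = "map_pair (push (reparam (\<lambda>r. 1 - r))) \<Theta>"
    have "evaluates_to A 0 ?\<Theta> \<Psi>" "evaluates_to A 1 ?\<Theta> \<Phi>"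
      using \<Theta>(4,5) by (simp_all add: evaluates_to_def eval_at_reparam)
    then show "(\<Psi>, \<Phi>) \<in> ?H" using \<Theta> rev[OF \<Theta>(3)] by blast
  qed
  show "trans ?H"
  proof (rule transI)
    fix \<Phi> \<Psi> \<Xi> assume "(\<Phi>, \<Psi>) \<in> ?H" "(\<Psi>, \<Xi>) \<in> ?H"
    then obtain \<Theta> \<Theta>' where \<Theta>: "P \<Phi>" "P \<Psi>" "P \<Xi>" "P' \<Theta>" "evaluates_to A 0 \<Theta> \<Phi>" "evaluates_to A 1 \<Theta> \<Psi>"
      "P' \<Theta>'" "evaluates_to A 0 \<Theta>' \<Psi>" "evaluates_to A 1 \<Theta>' \<Xi>" by blast
    have e: "eval_at 1 (fst \<Theta> a) = eval_at 0 (fst \<Theta>' a)" "eval_at 1 (snd \<Theta> a) = eval_at 0 (snd \<Theta>' a)"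
      if "a \<in> carrier A" for a using that \<Theta>(6,8) by (simp_all add: evaluates_to_def)
    have "P' (join_pair \<Theta> \<Theta>')"
      by (rule join[OF \<Theta>(4,7)]) (use closed'[OF \<Theta>(4)] closed'[OF \<Theta>(7)] e path_join_R in \<open>simp add: join_pair_def\<close>)
    moreover have "evaluates_to A 0 (join_pair \<Theta> \<Theta>') \<Phi>" "evaluates_to A 1 (join_pair \<Theta> \<Theta>') \<Xi>"
      using \<Theta>(5,9) closed'[OF \<Theta>(4)] closed'[OF \<Theta>(7)] e path_join_R(4,5)
      by (simp_all add: evaluates_to_def join_pair_def)
    ultimately show "(\<Phi>, \<Xi>) \<in> ?H" using \<Theta> by blast
  qed
qed

subsection \<open>Agreeing pairs\<close>

lemma agreeing_pairD:
  assumes cC: "csa C" and J: "J \<subseteq> carrier C" and h: "agreeing_pair C J B \<psi>"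
  shows "asymptotic_hom C B (fst \<psi>)" "asymptotic_hom C B (snd \<psi>)" "j \<in> J \<Longrightarrow> fst \<psi> j \<simeq> snd \<psi> j"
proof -
  show 1: "asymptotic_hom C B (fst \<psi>)" and 2: "asymptotic_hom C B (snd \<psi>)"
    using h by (simp_all add: agreeing_pair_def)
  show "j \<in> J \<Longrightarrow> fst \<psi> j \<simeq> snd \<psi> j"
    using h J asymptotic_homD(1)[OF cC 1, of j] asymptotic_homD(1)[OF cC 2, of j]
    by (auto simp: agreeing_pair_def aeq_def)
qed

lemma agreeing_pairI:
  "\<lbrakk>asymptotic_hom C B (fst \<psi>); asymptotic_hom C B (snd \<psi>); \<And>j. j \<in> J \<Longrightarrow> fst \<psi> j \<simeq> snd \<psi> j\<rbrakk>
    \<Longrightarrow> agreeing_pair C J B \<psi>"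
  by (simp add: agreeing_pair_def aeq_def)

lemma asymptotic_hom_cong:
  assumes cC: "csa C" and h: "asymptotic_hom C B \<psi>" and eq: "\<And>c. c \<in> carrier C \<Longrightarrow> \<theta> c = \<psi> c"
  shows "asymptotic_hom C B \<theta>"
proof -
  interpret C: pre_cstar C using cC by (rule cstar_imp_pre)
  note hD = asymptotic_homD[OF cC h]
  show ?thesis
  proof (rule asymptotic_homI)
    show "continuous_map (ctop C) (ctop CR) \<theta>"
      by (rule continuous_map_eq[OF hD(6)]) (use eq in simp)
  qed (use hD(1-5) eq in \<open>simp_all add: homogeneous_def\<close>)
qed

lemma agreeing_pair_comp:
  assumes cC: "csa C" and cD: "csa D" and J: "J \<subseteq> carrier C"
    and h: "agreeing_pair C J B \<psi>" and l: "star_hom D C l" and lJ: "\<And>j. j \<in> J' \<Longrightarrow> l j \<in> J"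
  shows "agreeing_pair D J' B (pair_comp \<psi> l)"
  using agreeing_pairD[OF cC J h] lJ asymptotic_hom_comp[OF cC cD _ l]
  by (intro agreeing_pairI) (simp_all add: pair_comp_def)

end

lemma (in codomain_hom) agreeing_pair_push:
  assumes cC: "csa C" and J: "J \<subseteq> carrier C" and h: "agreeing_pair C J B \<psi>"
  shows "agreeing_pair C J B' (map_pair (push k) \<psi>)"
  using B.agreeing_pairD[OF cC J h] asymptotic_hom_push[OF cC] push_aeq
  by (intro B'.agreeing_pairI) (simp_all add: map_pair_def)

lemma (in norming_pair) agreeing_pair_pushI:
  assumes cC: "csa C" and J: "J \<subseteq> carrier C"
    and h: "agreeing_pair C J B \<phi>" "agreeing_pair C J B \<psi>"
    and cl: "\<And>c. c \<in> carrier C \<Longrightarrow> fst \<theta> c \<in> carrier (CbR B') \<and> snd \<theta> c \<in> carrier (CbR B') \<and>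
        push k1 (fst \<theta> c) = fst \<phi> c \<and> push k2 (fst \<theta> c) = fst \<psi> c \<and>
        push k1 (snd \<theta> c) = snd \<phi> c \<and> push k2 (snd \<theta> c) = snd \<psi> c"
  shows "agreeing_pair C J B' \<theta>"
proof (rule k1.B.agreeing_pairI)
  note fD = k1.B'.agreeing_pairD[OF cC J h(1)] and gD = k1.B'.agreeing_pairD[OF cC J h(2)]
  show "asymptotic_hom C B' (fst \<theta>)"
    by (rule asymptotic_hom_pushI[OF cC]; (rule k1.B'.asymptotic_hom_cong[OF cC fD(1)] k1.B'.asymptotic_hom_cong[OF cC gD(1)])?)
      (use cl in simp_all)
  show "asymptotic_hom C B' (snd \<theta>)"
    by (rule asymptotic_hom_pushI[OF cC]; (rule k1.B'.asymptotic_hom_cong[OF cC fD(2)] k1.B'.asymptotic_hom_cong[OF cC gD(2)])?)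
      (use cl in simp_all)
  fix j assume j: "j \<in> J"
  then show "k1.B.aeq (fst \<theta> j) (snd \<theta> j)"
    by (intro aeq_pushI) (use j J cl[of j] fD(3)[OF j] gD(3)[OF j] in auto)
qed

context codomain
begin

lemma en_homotopy_equiv:
  assumes cC: "csa C" and J: "J \<subseteq> carrier C"
  shows "equiv {\<psi>. agreeing_pair C J B \<psi>} (en_homotopy C J B)"
  unfolding en_homotopy_def
proof (rule homotopy_equiv)
  interpret K: codomain "IB B" by (rule codomain_IB)
  interpret H: norming_pair "IB B" "IB B" first_half second_half by (rule halves)
  show "fst \<Phi> a \<in> carrier CR \<and> snd \<Phi> a \<in> carrier CR" if "agreeing_pair C J B \<Phi>" "a \<in> carrier C" for \<Phi> a
    using agreeing_pairD(1,2)[OF cC J that(1)] asymptotic_homD(1)[OF cC _ that(2)] by blast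
  show "fst \<Phi> a \<in> carrier (CbR (IB B)) \<and> snd \<Phi> a \<in> carrier (CbR (IB B))"
    if "agreeing_pair C J (IB B) \<Phi>" "a \<in> carrier C" for \<Phi> a
    using K.agreeing_pairD(1,2)[OF cC J that(1)] K.asymptotic_homD(1)[OF cC _ that(2)] by blast
  show "agreeing_pair C J (IB B) (map_pair (push const_path) \<Phi>)" if "agreeing_pair C J B \<Phi>" for \<Phi>
    by (rule codomain_hom.agreeing_pair_push[OF const_path_hom cC J that])
  show "agreeing_pair C J (IB B) (map_pair (push (reparam (\<lambda>r. 1 - r))) \<Theta>)" if "agreeing_pair C J (IB B) \<Theta>" for \<Theta>
    by (rule codomain_hom.agreeing_pair_push[OF reverse_hom cC J that])
qed (rule norming_pair.agreeing_pair_pushI[OF halves cC J])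

lemma en_homotopyI:
  "\<lbrakk>agreeing_pair C J B \<phi>; agreeing_pair C J B \<psi>; agreeing_pair C J (IB B) \<theta>;
    evaluates_to C 0 \<theta> \<phi>; evaluates_to C 1 \<theta> \<psi>\<rbrakk> \<Longrightarrow> (\<phi>, \<psi>) \<in> en_homotopy C J B"
  unfolding en_homotopy_def by blast

lemma en_homotopy_comp:
  assumes cC: "csa C" and cD: "csa D" and J: "J \<subseteq> carrier C"
    and h: "(\<phi>, \<psi>) \<in> en_homotopy C J B" and l: "star_hom D C l" and lJ: "\<And>j. j \<in> J' \<Longrightarrow> l j \<in> J"
  shows "(pair_comp \<phi> l, pair_comp \<psi> l) \<in> en_homotopy D J' B"
proof -
  interpret K: codomain "IB B" by (rule codomain_IB)
  obtain \<theta> where \<theta>: "agreeing_pair C J B \<phi>" "agreeing_pair C J B \<psi>" "agreeing_pair C J (IB B) \<theta>"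
    "evaluates_to C 0 \<theta> \<phi>" "evaluates_to C 1 \<theta> \<psi>" using h by (auto simp: en_homotopy_def)
  show ?thesis
    by (rule en_homotopyI[where \<theta> = "pair_comp \<theta> l"])
      (use \<theta> agreeing_pair_comp[OF cC cD J _ l lJ] K.agreeing_pair_comp[OF cC cD J _ l lJ] star_homD(1)[OF l]
        in \<open>auto simp: evaluates_to_def\<close>)
qed

text \<open>The homotopy consists of \<open>path_map\<close> of both maps composed with
  \<open>f\<close>; since the paths of elements of \<open>J'\<close> stay in \<open>J\<close>, the
  two maps agree on \<open>J'\<close> uniformly along them. This allows elements of an extension to
  be moved inside their fibres.\<close>

lemma en_homotopy_path:
  assumes cC: "csa C" and cD: "csa D" and J: "J \<subseteq> carrier C"
    and h: "agreeing_pair C J B \<psi>" and f: "star_hom D (IB C) f"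
    and fJ: "\<And>j r. \<lbrakk>j \<in> J'; 0 \<le> r; r \<le> 1\<rbrakk> \<Longrightarrow> f j r \<in> J" and J': "J' \<subseteq> carrier D"
  shows "(pair_comp \<psi> (\<lambda>d. f d 0), pair_comp \<psi> (\<lambda>d. f d 1)) \<in> en_homotopy D J' B"
proof -
  interpret C: codomain C using cC by (rule codomain.intro)
  interpret K: codomain "IB B" by (rule codomain_IB)
  note hD = agreeing_pairD[OF cC J h]
  have ev: "star_hom D C (\<lambda>d. f d r)" if "0 \<le> r" "r \<le> 1" for r
    using star_hom_compose[OF codomain_hom.k[OF C.eval_hom[OF that]] f] by (simp add: o_def)
  let ?\<theta> = "(path_map (fst \<psi>) \<circ> f, path_map (snd \<psi>) \<circ> f)"
  show ?thesis
  proof (rule en_homotopyI[where \<theta> = ?\<theta>])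
    show "agreeing_pair D J' B (pair_comp \<psi> (\<lambda>d. f d 0))" "agreeing_pair D J' B (pair_comp \<psi> (\<lambda>d. f d 1))"
      by (rule agreeing_pair_comp[OF cC cD J h ev]; use fJ in simp)+
    show "agreeing_pair D J' (IB B) ?\<theta>"
    proof (rule K.agreeing_pairI)
      show "asymptotic_hom D (IB B) (fst ?\<theta>)" "asymptotic_hom D (IB B) (snd ?\<theta>)"
        using K.asymptotic_hom_comp[OF C.cI cD path_map_asymptotic[OF cC hD(1)] f]
          K.asymptotic_hom_comp[OF C.cI cD path_map_asymptotic[OF cC hD(2)] f] by simp_all
      fix j assume j: "j \<in> J'"
      then have "f j \<in> carrier (IB C)" using J' star_homD(1)[OF f] by auto
      then show "K.aeq (fst ?\<theta> j) (snd ?\<theta> j)"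
        using path_map_aeq[OF cC hD(1,2), of "f j"] fJ[OF j] hD(3) by simp
    qed
    show "evaluates_to D 0 ?\<theta> (pair_comp \<psi> (\<lambda>d. f d 0))" "evaluates_to D 1 ?\<theta> (pair_comp \<psi> (\<lambda>d. f d 1))"
      using star_homD(1)[OF f] by (simp_all add: evaluates_to_def eval_at_path_map[OF cC hD(1)] eval_at_path_map[OF cC hD(2)])
  qed
qed

text \<open>The straight-line homotopy is asymptotically a constant path by
  \<open>flip_segment_aeq\<close>, so it inherits the algebraic relations and the agreement on
  \<open>J\<close> from \<open>\<phi>\<close>.\<close>

lemma en_homotopy_aeq:
  assumes cC: "csa C" and J: "J \<subseteq> carrier C"
    and h: "agreeing_pair C J B \<phi>" "agreeing_pair C J B \<psi>"
    and eq: "\<And>c. c \<in> carrier C \<Longrightarrow> fst \<phi> c \<simeq> fst \<psi> c \<and> snd \<phi> c \<simeq> snd \<psi> c"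
  shows "(\<phi>, \<psi>) \<in> en_homotopy C J B"
proof -
  interpret K: codomain "IB B" by (rule codomain_IB)
  interpret R: codomain "CR" by (rule codomain_CbR)
  interpret P: codomain_hom B "IB B" const_path by (rule const_path_hom)
  note fD = agreeing_pairD[OF cC J h(1)] and gD = agreeing_pairD[OF cC J h(2)]
  let ?s = "\<lambda>f g c. flip (R.segment (f c) (g c))"
  have ah: "asymptotic_hom C (IB B) (?s f g)"
    if f: "asymptotic_hom C B f" and g: "asymptotic_hom C B g" and fg: "\<And>c. c \<in> carrier C \<Longrightarrow> f c \<simeq> g c" for f g
  proof (rule K.asymptotic_hom_aeq[OF cC P.asymptotic_hom_push[OF cC f]])
    note fD = asymptotic_homD[OF cC f] and gD = asymptotic_homD[OF cC g]
    show "continuous_map (ctop C) (ctop (CbR (IB B))) (?s f g)"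
      using continuous_map_compose[OF R.segment_continuous[OF cC fD(6) gD(6)] star_hom_continuous[OF R.cI K.cR flip_star_hom]]
      by (simp add: o_def)
    show "homogeneous C (CbR (IB B)) (?s f g)"
      unfolding homogeneous_def
      using fD(1,2) gD(1,2) by (simp add: R.segment_scale star_homD(3)[OF flip_star_hom])
    show "K.aeq (?s f g c) ((push const_path \<circ> f) c)" if "c \<in> carrier C" for c
      using flip_segment_aeq[OF fg[OF that]] by simp
  qed
  have cl: "fst \<phi> c \<in> carrier CR" "fst \<psi> c \<in> carrier CR" "snd \<phi> c \<in> carrier CR" "snd \<psi> c \<in> carrier CR"
    if "c \<in> carrier C" for c
    using asymptotic_homD(1)[OF cC _ that] fD gD by blast+
  let ?\<theta> = "(?s (fst \<phi>) (fst \<psi>), ?s (snd \<phi>) (snd \<psi>))"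
  show ?thesis
  proof (rule en_homotopyI[where \<theta> = ?\<theta>])
    show "agreeing_pair C J (IB B) ?\<theta>"
    proof (rule K.agreeing_pairI)
      fix j assume j: "j \<in> J"
      then have jC: "j \<in> carrier C" using J by auto
      have "K.aeq (?s (fst \<phi>) (fst \<psi>) j) (push const_path (fst \<phi> j))" using eq[OF jC] by (intro flip_segment_aeq) simp
      also have "K.aeq \<dots> (push const_path (snd \<phi> j))" by (intro P.push_aeq fD(3) j)
      also have "K.aeq \<dots> (?s (snd \<phi>) (snd \<psi>) j)" using eq[OF jC] by (intro K.aeq_sym[OF flip_segment_aeq]) simp
      finally show "K.aeq (fst ?\<theta> j) (snd ?\<theta> j)" by simp
    qed (use ah fD gD eq in simp_all)
    show "evaluates_to C 0 ?\<theta> \<phi>" "evaluates_to C 1 ?\<theta> \<psi>"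
      using cl by (simp_all add: evaluates_to_def eval_at_flip)
  qed (use h in simp_all)
qed

end

context orthogonal_homs
begin

definition osum_pair where
  "osum_pair \<Phi> \<Psi> = (osum (fst \<Phi>) (fst \<Psi>), osum (snd \<Phi>) (snd \<Psi>))"

lemma osum_agreeing:
  assumes cC: "csa C" and J: "J \<subseteq> carrier C"
    and h: "agreeing_pair C J B \<phi>" "agreeing_pair C J B \<psi>"
  shows "agreeing_pair C J B' (osum_pair \<phi> \<psi>)"
proof (rule k1.B'.agreeing_pairI)
  note fD = k1.B.agreeing_pairD[OF cC J h(1)] and gD = k1.B.agreeing_pairD[OF cC J h(2)]
  show "asymptotic_hom C B' (fst (osum_pair \<phi> \<psi>))" "asymptotic_hom C B' (snd (osum_pair \<phi> \<psi>))"
    using osum_asymptotic[OF cC] fD gD by (simp_all add: osum_pair_def)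
  show "k1.B'.aeq (fst (osum_pair \<phi> \<psi>) j) (snd (osum_pair \<phi> \<psi>) j)" if "j \<in> J" for j
    using push_sum_aeq[OF fD(3)[OF that] gD(3)[OF that]] by (simp add: osum_pair_def osum_def)
qed

lemma osum_evaluates:
  assumes "evaluates_to C r \<Theta> \<Phi>" "evaluates_to C r \<Theta>' \<Phi>'" and r: "0 \<le> r" "r \<le> 1"
    and "\<And>c. c \<in> carrier C \<Longrightarrow> fst \<Theta> c \<in> carrier (CbR (IB B)) \<and> snd \<Theta> c \<in> carrier (CbR (IB B))"
    and "\<And>c. c \<in> carrier C \<Longrightarrow> fst \<Theta>' c \<in> carrier (CbR (IB B)) \<and> snd \<Theta>' c \<in> carrier (CbR (IB B))"
  shows "evaluates_to C r (orthogonal_homs.osum_pair (IB B') (pointwise k1) (pointwise k2) \<Theta> \<Theta>') (osum_pair \<Phi> \<Phi>')"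
proof -
  interpret P: orthogonal_homs "IB B" "IB B'" "pointwise k1" "pointwise k2" by (rule pointwise_orthogonal)
  show ?thesis
    using assms by (simp add: evaluates_to_def P.osum_pair_def osum_pair_def eval_at_osum osum_def)
qed

lemma osum_en_homotopy:
  assumes cC: "csa C" and J: "J \<subseteq> carrier C"
    and h: "(\<phi>, \<phi>') \<in> en_homotopy C J B" "(\<psi>, \<psi>') \<in> en_homotopy C J B"
  shows "(osum_pair \<phi> \<psi>, osum_pair \<phi>' \<psi>') \<in> en_homotopy C J B'"
proof -
  interpret K: codomain "IB B" by (rule k1.B.codomain_IB)
  interpret P: orthogonal_homs "IB B" "IB B'" "pointwise k1" "pointwise k2" by (rule pointwise_orthogonal)
  obtain \<theta> where f: "agreeing_pair C J B \<phi>" "agreeing_pair C J B \<phi>'" "agreeing_pair C J (IB B) \<theta>"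
    "evaluates_to C 0 \<theta> \<phi>" "evaluates_to C 1 \<theta> \<phi>'" using h(1) by (auto simp: en_homotopy_def)
  obtain \<eta> where g: "agreeing_pair C J B \<psi>" "agreeing_pair C J B \<psi>'" "agreeing_pair C J (IB B) \<eta>"
    "evaluates_to C 0 \<eta> \<psi>" "evaluates_to C 1 \<eta> \<psi>'" using h(2) by (auto simp: en_homotopy_def)
  have cl: "fst \<Theta> c \<in> carrier (CbR (IB B)) \<and> snd \<Theta> c \<in> carrier (CbR (IB B))"
    if "agreeing_pair C J (IB B) \<Theta>" "c \<in> carrier C" for \<Theta> c
    using K.agreeing_pairD(1,2)[OF cC J that(1)] K.asymptotic_homD(1)[OF cC _ that(2)] by blast
  show ?thesis
  proof (rule k1.B'.en_homotopyI)
    show "agreeing_pair C J B' (osum_pair \<phi> \<psi>)" by (rule osum_agreeing[OF cC J f(1) g(1)])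
    show "agreeing_pair C J B' (osum_pair \<phi>' \<psi>')" by (rule osum_agreeing[OF cC J f(2) g(2)])
    show "agreeing_pair C J (IB B') (P.osum_pair \<theta> \<eta>)" by (rule P.osum_agreeing[OF cC J f(3) g(3)])
    show "evaluates_to C 0 (P.osum_pair \<theta> \<eta>) (osum_pair \<phi> \<psi>)"
      by (rule osum_evaluates[OF f(4) g(4) _ _ cl[OF f(3)] cl[OF g(3)]]) simp_all
    show "evaluates_to C 1 (P.osum_pair \<theta> \<eta>) (osum_pair \<phi>' \<psi>')"
      by (rule osum_evaluates[OF f(5) g(5) _ _ cl[OF f(3)] cl[OF g(3)]]) simp_all
  qed
qed

end

section \<open>Compact asymptotic KK-cycles\<close>

lemma closed_star_subalgebraI:
  assumes cW: "csa W" and E: "E \<subseteq> carrier W" "czero W \<in> E"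
    "\<And>x y. \<lbrakk>x \<in> E; y \<in> E\<rbrakk> \<Longrightarrow> x +[W] y \<in> E" "\<And>c x. x \<in> E \<Longrightarrow> c .[W] x \<in> E"
    "\<And>x y. \<lbrakk>x \<in> E; y \<in> E\<rbrakk> \<Longrightarrow> x *[W] y \<in> E" "\<And>x. x \<in> E \<Longrightarrow> adj W x \<in> E"
    "\<And>x. \<lbrakk>x \<in> carrier W; \<And>e. e > 0 \<Longrightarrow> \<exists>y\<in>E. nrm W (x -[W] y) < e\<rbrakk> \<Longrightarrow> x \<in> E"
  shows "cstar_subalgebra W E"
proof -
  interpret W: pre_cstar W using cW by (rule cstar_imp_pre)
  show ?thesis
    unfolding cstar_subalgebra_def W.closedin_ctop_iff
    by (intro conjI ballI allI impI E(1-6)) (use E(7) in blast)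
qed

lemma closed_star_subalgebra_iff:
  assumes cW: "csa W" and E: "closedin (ctop W) E" "czero W \<in> E"
    "\<And>x y. \<lbrakk>x \<in> E; y \<in> E\<rbrakk> \<Longrightarrow> x +[W] y \<in> E" "\<And>c x. x \<in> E \<Longrightarrow> c .[W] x \<in> E"
    "\<And>x y. \<lbrakk>x \<in> E; y \<in> E\<rbrakk> \<Longrightarrow> x *[W] y \<in> E" "\<And>x. x \<in> E \<Longrightarrow> adj W x \<in> E"
  shows "cstar_subalgebra W E"
  unfolding cstar_subalgebra_def by (intro conjI ballI allI E)

lemma cstar_subalgebra_carrier:
  assumes cW: "csa W"
  shows "cstar_subalgebra W (carrier W)"
proof -
  interpret W: pre_cstar W using cW by (rule cstar_imp_pre)
  show ?thesis by (rule closed_star_subalgebraI[OF cW]) auto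
qed

lemma cstar_generated_subalgebra:
  assumes cW: "csa W" and S: "S \<subseteq> carrier W"
  shows "cstar_subalgebra W (cstar_generated W S)" "S \<subseteq> cstar_generated W S"
proof -
  have "carrier W \<in> {E. cstar_subalgebra W E \<and> S \<subseteq> E}" using cstar_subalgebra_carrier[OF cW] S by simp
  then have "closedin (ctop W) (cstar_generated W S)"
    unfolding cstar_generated_def by (intro closedin_Inter) (auto simp: cstar_subalgebra_def)
  then show "cstar_subalgebra W (cstar_generated W S)"
    by (auto simp: cstar_subalgebra_def cstar_generated_def)
  show "S \<subseteq> cstar_generated W S" by (auto simp: cstar_generated_def)
qed

lemma cstar_generated_minimal: "\<lbrakk>cstar_subalgebra W E; S \<subseteq> E\<rbrakk> \<Longrightarrow> cstar_generated W S \<subseteq> E"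
  by (auto simp: cstar_generated_def)

lemma ideal_generated_ideal:
  assumes cW: "csa W" and E: "cstar_subalgebra W E" and S: "S \<subseteq> E"
  shows "closed_ideal W E (ideal_generated W E S)" "S \<subseteq> ideal_generated W E S"
proof -
  have E': "E \<in> {I. closed_ideal W E I \<and> S \<subseteq> I}"
    using E S by (auto simp: closed_ideal_def cstar_subalgebra_def)
  then have "closedin (ctop W) (ideal_generated W E S)"
    unfolding ideal_generated_def by (intro closedin_Inter) (auto simp: closed_ideal_def)
  moreover have "ideal_generated W E S \<subseteq> E" using E' by (auto simp: ideal_generated_def)
  ultimately show "closed_ideal W E (ideal_generated W E S)"
    by (auto simp: closed_ideal_def ideal_generated_def)
  show "S \<subseteq> ideal_generated W E S" by (auto simp: ideal_generated_def)
qed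

lemma ideal_generated_minimal: "\<lbrakk>closed_ideal W E I; S \<subseteq> I\<rbrakk> \<Longrightarrow> ideal_generated W E S \<subseteq> I"
  by (auto simp: ideal_generated_def)

lemma cstar_subalgebra_Int:
  "\<lbrakk>cstar_subalgebra W E; cstar_subalgebra W F\<rbrakk> \<Longrightarrow> cstar_subalgebra W (E \<inter> F)"
  by (auto simp: cstar_subalgebra_def)

lemma cstar_subalgebra_preimage:
  assumes cW: "csa W" and cV: "csa V" and f: "star_hom W V f" and E: "cstar_subalgebra V E"
  shows "cstar_subalgebra W {w \<in> carrier W. f w \<in> E}"
proof -
  interpret W: pre_cstar W using cW by (rule cstar_imp_pre)
  have "closedin (ctop W) {w \<in> topspace (ctop W). f w \<in> E}"
    using E by (intro closedin_continuous_map_preimage[OF star_hom_continuous[OF cW cV f]]) (simp add: cstar_subalgebra_def)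
  then show ?thesis
    using star_homD[OF f] star_hom_zero[OF f cW cV] subalgebraD[OF cV E]
    by (intro closed_star_subalgebra_iff[OF cW]) simp_all
qed

lemma prod_homs:
  fixes V :: "'v cstar" and U :: "'u cstar"
  shows "star_hom (prod_cstar V U) V fst" "star_hom (prod_cstar V U) U snd"
  by (auto simp: star_hom_def)

lemma star_hom_pair:
  fixes V :: "'v cstar" and U :: "'u cstar" and W :: "'w cstar"
  shows "\<lbrakk>star_hom W V f; star_hom W U g\<rbrakk> \<Longrightarrow> star_hom W (prod_cstar V U) (\<lambda>w. (f w, g w))"
  by (auto simp: star_hom_def Pi_iff)

section \<open>Annihilators modulo C_0 and the algebra of a cycle\<close>

context codomain
begin

text \<open>The conditions on a single map of a cycle that do not involve the ideal.\<close>

definition kk_map :: "'a cstar \<Rightarrow> ('a \<Rightarrow> real \<Rightarrow> 'b) \<Rightarrow> bool"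
  where "kk_map A \<phi> \<longleftrightarrow> continuous_map (ctop A) (ctop CR) \<phi> \<and> homogeneous A CR \<phi> \<and>
    (\<forall>a\<in>carrier A. \<phi> (adj A a) \<simeq> adj CR (\<phi> a))"

text \<open>
  The ideal \<open>kk_ideal A B \<Phi>\<close> enters the definition of a cycle only through its annihilator modulo
  \<open>C\<^sub>0\<close>. It suffices to have a set \<open>N\<close> that contains the defects, is invariant under right
  multiplication by the values of \<open>\<Phi>\<close> and annihilates the differences \<open>\<Phi>\<^sup>+ a - \<Phi>\<^sup>- a\<close>.
\<close>

definition annihilating :: "'a cstar \<Rightarrow> ('a, 'b) fun_pair \<Rightarrow> (real \<Rightarrow> 'b) set \<Rightarrow> bool"
  where "annihilating A \<Phi> N \<longleftrightarrow> N \<subseteq> carrier CR \<and>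
    (\<forall>\<phi>\<in>{fst \<Phi>, snd \<Phi>}. (\<forall>a\<in>carrier A. \<forall>b\<in>carrier A.
        \<phi> (a +[A] b) -[CR] \<phi> a -[CR] \<phi> b \<in> N \<and> \<phi> (a *[A] b) -[CR] \<phi> a *[CR] \<phi> b \<in> N) \<and>
      (\<forall>z\<in>N. \<forall>a\<in>carrier A. z *[CR] \<phi> a \<in> N)) \<and>
    (\<forall>z\<in>N. \<forall>a\<in>carrier A. z *[CR] (fst \<Phi> a -[CR] snd \<Phi> a) \<in> C0R B)"

lemma closedin_annihilator:
  assumes S: "S \<subseteq> carrier CR"
  shows "closedin (ctop CR) {z \<in> carrier CR. \<forall>x\<in>S. z *[CR] x \<in> C0R B}"
    "closedin (ctop CR) {z \<in> carrier CR. \<forall>x\<in>S. x *[CR] z \<in> C0R B}"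
  using closedin_ball_preimage[OF C0R_closed continuous_mult(1)[OF cR], of S "\<lambda>x. x"]
    closedin_ball_preimage[OF C0R_closed continuous_mult(2)[OF cR], of S "\<lambda>x. x"] S by auto

lemma kk_map_closed:
  assumes "csa A" "kk_map A \<phi>" "a \<in> carrier A"
  shows "\<phi> a \<in> carrier CR"
  using assms unfolding kk_map_def continuous_ctop_iff[OF assms(1) cR] by blast

lemma kk_map_zero:
  assumes cA: "csa A" and "kk_map A \<phi>"
  shows "\<phi> (czero A) = czero CR"
proof -
  interpret A: pre_cstar A using cA by (rule cstar_imp_pre)
  have "\<phi> (0 .[A] czero A) = 0 .[CR] \<phi> (czero A)" using assms(2) by (simp only: kk_map_def homogeneous_def A.zero_closed)
  then show ?thesis using kk_map_closed[OF assms A.zero_closed] by simp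
qed

lemma kk_generated:
  assumes cA: "csa A" and maps: "kk_map A (fst \<Phi>)" "kk_map A (snd \<Phi>)"
  defines "E \<equiv> kk_algebra A B \<Phi>" and "D \<equiv> kk_ideal A B \<Phi>"
  shows "cstar_subalgebra CR E" "a \<in> carrier A \<Longrightarrow> fst \<Phi> a \<in> E" "a \<in> carrier A \<Longrightarrow> snd \<Phi> a \<in> E"
    "closed_ideal CR E D" "a \<in> carrier A \<Longrightarrow> fst \<Phi> a -[CR] snd \<Phi> a \<in> D"
proof -
  let ?G = "fst \<Phi> ` carrier A \<union> snd \<Phi> ` carrier A"
  have G: "?G \<subseteq> carrier CR" using kk_map_closed[OF cA] maps by auto
  show E: "cstar_subalgebra CR E" unfolding E_def kk_algebra_def by (rule cstar_generated_subalgebra[OF cR G])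
  have GE: "?G \<subseteq> E" unfolding E_def kk_algebra_def by (rule cstar_generated_subalgebra[OF cR G])
  then show 1: "fst \<Phi> a \<in> E" and 2: "snd \<Phi> a \<in> E" if "a \<in> carrier A" for a using that by auto
  let ?S = "{fst \<Phi> a -[CR] snd \<Phi> a |a. a \<in> carrier A}"
  have S: "?S \<subseteq> E" using 1 2 subalgebraD(7)[OF cR E] by auto
  show "closed_ideal CR E D" unfolding D_def kk_ideal_def E_def[symmetric]
    by (rule ideal_generated_ideal[OF cR E S])
  show "a \<in> carrier A \<Longrightarrow> fst \<Phi> a -[CR] snd \<Phi> a \<in> D"
    using ideal_generated_ideal(2)[OF cR E S] unfolding D_def kk_ideal_def E_def[symmetric] by blast
qed

lemma kk_cycle_maps:
  assumes cA: "csa A" and h: "kk_cycle A B \<Phi>"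
  shows "kk_map A (fst \<Phi>)" "kk_map A (snd \<Phi>)"
proof -
  interpret A: pre_cstar A using cA by (rule cstar_imp_pre)
  have "kk_map A \<phi>" if "\<phi> \<in> {fst \<Phi>, snd \<Phi>}" for \<phi>
  proof -
    have c: "continuous_map (ctop A) (ctop CR) \<phi>" "homogeneous A CR \<phi>"
      "\<And>a. a \<in> carrier A \<Longrightarrow> \<phi> (adj A a) -[CR] adj CR (\<phi> a) \<in> C0R B"
      using h that unfolding kk_cycle_def by blast+
    have "\<phi> a \<in> carrier CR" if "a \<in> carrier A" for a
      using c(1) that unfolding continuous_ctop_iff[OF cA cR] by blast
    then show ?thesis using c by (simp add: kk_map_def aeq_def)
  qed
  then show "kk_map A (fst \<Phi>)" "kk_map A (snd \<Phi>)" by simp_all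
qed

text \<open>\<open>T\<close> is the right annihilator of \<open>N\<close> modulo
  \<open>C\<^sub>0\<close>, and \<open>F\<close> is the set of multipliers of \<open>T\<close>.
  \<open>F\<close> is a C*-algebra containing the values of the cycle, so it contains the generated
  algebra. The elements of that algebra lying in \<open>T\<close> thus form an ideal which contains
  the differences of the two maps, and with them the generated ideal.\<close>

lemma annihilator_of_ideal:
  assumes cA: "csa A" and maps: "kk_map A (fst \<Phi>)" "kk_map A (snd \<Phi>)"
    and N: "annihilating A \<Phi> N" and z: "z \<in> N" and x: "x \<in> kk_ideal A B \<Phi>"
  shows "z *[CR] x \<in> C0R B"
proof -
  interpret A: pre_cstar A using cA by (rule cstar_imp_pre)
  note gen = kk_generated[OF cA maps]
  define T where "T = {x \<in> carrier CR. \<forall>z\<in>N. z *[CR] x \<in> C0R B}"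
  \<comment> \<open>The adjoint is built in: \<open>T\<close> is not known to be self-adjoint, so
    that stability under \<open>e\<close> alone would not give stability under its adjoint.\<close>
  define F where "F = {e \<in> carrier CR. \<forall>x\<in>T. e *[CR] x \<in> T \<and> adj CR e *[CR] x \<in> T}"
  have NC: "z \<in> carrier CR" if "z \<in> N" for z using N that by (auto simp: annihilating_def)
  have TC: "x \<in> carrier CR" and Tz: "z \<in> N \<Longrightarrow> z *[CR] x \<in> C0R B" if "x \<in> T" for x z
    using that by (auto simp: T_def)
  have TI: "x \<in> T" if "x \<in> carrier CR" "\<And>z. z \<in> N \<Longrightarrow> z *[CR] x \<in> C0R B" for x
    using that by (simp add: T_def)
  have Tadd: "x +[CR] y \<in> T" if "x \<in> T" "y \<in> T" for x y
    using that NC by (intro TI) (simp_all add: TC Tz R.mult_add_right C0R_add)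
  have Tscale: "c .[CR] x \<in> T" if "x \<in> T" for c x
    using that NC by (intro TI) (simp_all add: TC Tz C0R_scale)
  have T: "closedin (ctop CR) T"
    unfolding T_def using NC by (intro closedin_annihilator) blast
  have FC: "e \<in> carrier CR" and FT: "x \<in> T \<Longrightarrow> e *[CR] x \<in> T" "x \<in> T \<Longrightarrow> adj CR e *[CR] x \<in> T"
    if "e \<in> F" for e x using that by (auto simp: F_def)
  have Fsub: "cstar_subalgebra CR F"
  proof (rule closed_star_subalgebra_iff[OF cR])
    have "closedin (ctop CR) ({z \<in> topspace (ctop CR). \<forall>x\<in>T. z *[CR] x \<in> T} \<inter>
        {z \<in> topspace (ctop CR). \<forall>x\<in>T. adj CR z *[CR] x \<in> T})"
      using continuous_mult(1)[OF cR TC] continuous_map_compose[OF continuous_adj[OF cR] continuous_mult(1)[OF cR TC]]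
      by (intro closedin_Int closedin_ball_preimage[OF T]) (simp_all add: o_def)
    also have "\<dots> = F" by (auto simp: F_def)
    finally show "closedin (ctop CR) F" .
    have zT: "czero CR \<in> T" using NC by (intro TI) simp_all
    then show "czero CR \<in> F" by (simp add: F_def TC)
    fix e assume e: "e \<in> F"
    show "c .[CR] e \<in> F" for c using e by (simp add: F_def TC R.adj_scale Tscale)
    show "adj CR e \<in> F" using e by (simp add: F_def)
    fix f assume f: "f \<in> F"
    show "e +[CR] f \<in> F" using e f by (simp add: F_def TC R.adj_add R.mult_add_left Tadd)
    show "e *[CR] f \<in> F"
      using FC[OF e] FC[OF f] FT[OF e] FT[OF f] by (simp add: F_def TC R.adj_mult R.mult_assoc)
  qed
  have gF: "\<phi> a \<in> F" if \<phi>: "\<phi> \<in> {fst \<Phi>, snd \<Phi>}" and a: "a \<in> carrier A" for \<phi> a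
  proof -
    have m: "kk_map A \<phi>" using \<phi> maps by auto
    have c: "\<phi> a \<in> carrier CR" "\<phi> (adj A a) \<in> carrier CR" using kk_map_closed[OF cA m] a by auto
    have star: "adj CR (\<phi> a) \<simeq> \<phi> (adj A a)" using m a by (simp add: kk_map_def aeq_sym)
    have N\<phi>: "z *[CR] \<phi> a \<in> N" if "z \<in> N" "a \<in> carrier A" for z a
      using N \<phi> that unfolding annihilating_def by blast
    have 1: "\<phi> a *[CR] x \<in> T" if x: "x \<in> T" and a: "a \<in> carrier A" for x a
    proof (rule TI)
      have c: "\<phi> a \<in> carrier CR" using kk_map_closed[OF cA m] a by auto
      show "\<phi> a *[CR] x \<in> carrier CR" using c TC[OF x] by simp
      show "z *[CR] (\<phi> a *[CR] x) \<in> C0R B" if "z \<in> N" for z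
        using Tz[OF x N\<phi>[OF that a]] NC[OF that] c TC[OF x] by (simp add: R.mult_assoc)
    qed
    \<comment> \<open>The adjoint of a value is asymptotically the value at the adjoint, which
      reduces this to the previous step.\<close>
    have 2: "adj CR (\<phi> a) *[CR] x \<in> T" if x: "x \<in> T" for x
    proof (rule TI)
      show "adj CR (\<phi> a) *[CR] x \<in> carrier CR" using c TC[OF x] by simp
      fix z assume z: "z \<in> N"
      have "z *[CR] (adj CR (\<phi> a) *[CR] x) \<simeq> z *[CR] (\<phi> (adj A a) *[CR] x)"
        using NC[OF z] TC[OF x] star by (intro aeq_mult) simp_all
      then show "z *[CR] (adj CR (\<phi> a) *[CR] x) \<in> C0R B"
        using Tz[OF 1[OF x A.adj_closed[OF a]] z] by (rule aeq_C0R)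
    qed
    show ?thesis using 1[OF _ a] 2 c by (simp add: F_def)
  qed
  have "kk_algebra A B \<Phi> \<subseteq> F"
    unfolding kk_algebra_def by (rule cstar_generated_minimal[OF Fsub]) (use gF in auto)
  then have EF: "e \<in> F" if "e \<in> kk_algebra A B \<Phi>" for e using that by auto
  have EC: "e \<in> carrier CR" if "e \<in> kk_algebra A B \<Phi>" for e using EF FC that by blast
  note ED = subalgebraD[OF cR gen(1)]
  have "closed_ideal CR (kk_algebra A B \<Phi>) (kk_algebra A B \<Phi> \<inter> T)"
    unfolding closed_ideal_def
  proof (intro conjI ballI allI)
    show "closedin (ctop CR) (kk_algebra A B \<Phi> \<inter> T)"
      using gen(1) T by (intro closedin_Int) (simp_all add: cstar_subalgebra_def)
    show "kk_algebra A B \<Phi> \<inter> T \<subseteq> kk_algebra A B \<Phi>" by simp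
    show "czero CR \<in> kk_algebra A B \<Phi> \<inter> T" using ED(2) NC by (auto intro!: TI)
    fix x assume x: "x \<in> kk_algebra A B \<Phi> \<inter> T"
    show "c .[CR] x \<in> kk_algebra A B \<Phi> \<inter> T" for c using x ED(4) Tscale by blast
    show "x +[CR] y \<in> kk_algebra A B \<Phi> \<inter> T" if "y \<in> kk_algebra A B \<Phi> \<inter> T" for y
      using x that ED(3) Tadd by blast
    fix e assume e: "e \<in> kk_algebra A B \<Phi>"
    show "e *[CR] x \<in> kk_algebra A B \<Phi> \<inter> T" using x e ED(5) FT(1)[OF EF[OF e]] by blast
    have "x *[CR] e \<in> T"
    proof (rule TI)
      have xT: "x \<in> T" using x by simp
      show "x *[CR] e \<in> carrier CR" using TC[OF xT] EC[OF e] by simp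
      show "z *[CR] (x *[CR] e) \<in> C0R B" if "z \<in> N" for z
        using C0R_mult_right[OF EC[OF e] Tz[OF xT that]] NC[OF that] TC[OF xT] EC[OF e] by (simp add: R.mult_assoc)
    qed
    then show "x *[CR] e \<in> kk_algebra A B \<Phi> \<inter> T" using x e ED(5) by blast
  qed
  moreover have "{fst \<Phi> a -[CR] snd \<Phi> a |a. a \<in> carrier A} \<subseteq> kk_algebra A B \<Phi> \<inter> T"
  proof clarify
    fix a assume a: "a \<in> carrier A"
    have "fst \<Phi> a -[CR] snd \<Phi> a \<in> T"
      using N a kk_map_closed[OF cA maps(1) a] kk_map_closed[OF cA maps(2) a]
      by (intro TI) (auto simp: annihilating_def)
    then show "fst \<Phi> a -[CR] snd \<Phi> a \<in> kk_algebra A B \<Phi> \<inter> T"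
      using ED(7)[OF gen(2)[OF a] gen(3)[OF a]] by blast
  qed
  ultimately have "kk_ideal A B \<Phi> \<subseteq> kk_algebra A B \<Phi> \<inter> T"
    unfolding kk_ideal_def by (rule ideal_generated_minimal)
  then show ?thesis using x z Tz by blast
qed

lemma kk_cycleI:
  assumes cA: "csa A" and maps: "kk_map A (fst \<Phi>)" "kk_map A (snd \<Phi>)" and N: "annihilating A \<Phi> N"
  shows "kk_cycle A B \<Phi>"
  unfolding kk_cycle_def
proof
  fix \<phi> assume \<phi>: "\<phi> \<in> {fst \<Phi>, snd \<Phi>}"
  then have m: "kk_map A \<phi>" using maps by auto
  have d: "\<phi> (a +[A] b) -[CR] \<phi> a -[CR] \<phi> b \<in> N" "\<phi> (a *[A] b) -[CR] \<phi> a *[CR] \<phi> b \<in> N"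
    if "a \<in> carrier A" "b \<in> carrier A" for a b using N \<phi> that unfolding annihilating_def by blast+
  show "continuous_map (ctop A) (ctop CR) \<phi> \<and> homogeneous A CR \<phi> \<and>
    (\<forall>a\<in>carrier A. \<phi> (adj A a) -[CR] adj CR (\<phi> a) \<in> C0R B) \<and>
    (\<forall>a\<in>carrier A. \<forall>b\<in>carrier A. \<forall>x\<in>kk_ideal A B \<Phi>.
      (\<phi> (a +[A] b) -[CR] \<phi> a -[CR] \<phi> b) *[CR] x \<in> C0R B \<and>
      (\<phi> (a *[A] b) -[CR] \<phi> a *[CR] \<phi> b) *[CR] x \<in> C0R B)"
  proof (intro conjI ballI)
    fix a assume a: "a \<in> carrier A"
    show "\<phi> (adj A a) -[CR] adj CR (\<phi> a) \<in> C0R B" using m a by (simp add: kk_map_def aeq_def)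
    fix b x assume b: "b \<in> carrier A" and x: "x \<in> kk_ideal A B \<Phi>"
    show "(\<phi> (a +[A] b) -[CR] \<phi> a -[CR] \<phi> b) *[CR] x \<in> C0R B"
      by (rule annihilator_of_ideal[OF cA maps N d(1)[OF a b] x])
    show "(\<phi> (a *[A] b) -[CR] \<phi> a *[CR] \<phi> b) *[CR] x \<in> C0R B"
      by (rule annihilator_of_ideal[OF cA maps N d(2)[OF a b] x])
  qed (use m in \<open>simp_all add: kk_map_def\<close>)
qed

text \<open>At each \<open>t\<close> the norm of \<open>w t\<close> is the square root of the norm
  of the product, by the C*-identity.\<close>

lemma C0R_adj_mult_self:
  assumes w: "w \<in> carrier CR" and C0: "adj CR w *[CR] w \<in> C0R B"
  shows "w \<in> C0R B"
proof (rule C0R_dominated[OF w])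
  have "((\<lambda>t. nrm B ((adj CR w *[CR] w) t)) \<longlongrightarrow> 0) at_top" using C0 by (simp add: C0R_iff)
  from tendsto_real_sqrt[OF this]
  show "((\<lambda>t. sqrt (nrm B ((adj CR w *[CR] w) t))) \<longlongrightarrow> 0) at_top" by simp
  fix t :: real assume t: "0 \<le> t"
  have wt: "w t \<in> carrier B" using w t by simp
  then have "nrm B (w t) = sqrt (nrm B (adj B (w t) *[B] w t))" using cstar_identity[OF wt] nrm_nonneg[OF wt] by simp
  then show "nrm B (w t) \<le> sqrt (nrm B ((adj CR w *[CR] w) t))" using t by simp
qed

lemma cycle_algebra:
  assumes cA: "csa A" and h: "kk_cycle A B \<Phi>"
  shows "\<exists>Q. cstar_subalgebra (prod_cstar A (prod_cstar CR CR)) Q \<and>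
    (\<forall>a\<in>carrier A. (a, fst \<Phi> a, snd \<Phi> a) \<in> Q) \<and> (\<forall>e e'. (czero A, e, e') \<in> Q \<longrightarrow> e \<simeq> e')"
proof -
  interpret A: pre_cstar A using cA by (rule cstar_imp_pre)
  note maps = kk_cycle_maps[OF cA h]
  note gen = kk_generated[OF cA maps]
  let ?E = "kk_algebra A B \<Phi>" and ?D = "kk_ideal A B \<Phi>"
  note ED = subalgebraD[OF cR gen(1)]
  have EC [simp]: "e \<in> carrier CR" if "e \<in> ?E" for e using ED(1) that by auto
  have DE: "x \<in> ?E" and eD: "e \<in> ?E \<Longrightarrow> e *[CR] x \<in> ?D" if "x \<in> ?D" for x e
    using gen(4) that by (auto simp: closed_ideal_def)
  define N where "N = ?E \<inter> {z \<in> carrier CR. \<forall>x\<in>?D. z *[CR] x \<in> C0R B}"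
  have NE [simp]: "z \<in> ?E" and NC [simp]: "z \<in> carrier CR" and ND: "x \<in> ?D \<Longrightarrow> z *[CR] x \<in> C0R B" if "z \<in> N" for z x
    using that by (auto simp: N_def)
  have NI: "z \<in> N" if "z \<in> ?E" "\<And>x. x \<in> ?D \<Longrightarrow> z *[CR] x \<in> C0R B" for z unfolding N_def using that ED(1) by blast
  have Nclosed: "closedin (ctop CR) N"
    unfolding N_def using gen(1) DE
    by (intro closedin_Int closedin_annihilator subsetI) (simp_all add: cstar_subalgebra_def)
  have Nadd: "z +[CR] w \<in> N" if "z \<in> N" "w \<in> N" for z w
    using that by (intro NI) (simp_all add: ED DE ND R.mult_add_left C0R_add)
  have Nscale: "c .[CR] z \<in> N" if "z \<in> N" for c z
    using that by (intro NI) (simp_all add: ED DE ND C0R_scale)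
  have Ndiff: "z -[CR] w \<in> N" if "z \<in> N" "w \<in> N" for z w
    using that by (simp add: cdiff_def Nadd Nscale)
  have NmultR: "z *[CR] e \<in> N" if "z \<in> N" "e \<in> ?E" for z e
    using that by (intro NI) (simp_all add: ED DE ND eD R.mult_assoc)
  have NmultL: "e *[CR] z \<in> N" if "z \<in> N" "e \<in> ?E" for z e
    using that by (intro NI) (simp_all add: ED DE ND R.mult_assoc C0R_mult_left)
  \<comment> \<open>Let \<open>w\<close> be the product of the adjoint of \<open>z\<close> with
    \<open>x\<close>. It lies again in the ideal, so \<open>z\<close> sends it into
    \<open>C\<^sub>0\<close>; multiplying by the adjoint of \<open>x\<close> shows that the adjoint
    of \<open>w\<close> times \<open>w\<close> is in \<open>C\<^sub>0\<close>, hence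
    \<open>w\<close> is too.\<close>
  have Nadj: "adj CR z \<in> N" if z: "z \<in> N" for z
  proof (rule NI)
    show "adj CR z \<in> ?E" using z by (simp add: ED)
    fix x assume x: "x \<in> ?D"
    note [simp] = DE[OF x] z
    have "adj CR z *[CR] x \<in> ?D" using x by (intro eD) (simp_all add: ED)
    then have "z *[CR] (adj CR z *[CR] x) \<in> C0R B" by (rule ND[OF z])
    then have "adj CR x *[CR] (z *[CR] (adj CR z *[CR] x)) \<in> C0R B"
      by (rule C0R_mult_left[rotated]) simp
    then show "adj CR z *[CR] x \<in> C0R B"
      using C0R_adj_mult_self[of "adj CR z *[CR] x"] by (simp add: R.adj_mult R.mult_assoc)
  qed
  have NC0: "z \<in> N" if "z \<in> ?E" "z \<in> C0R B" for z
    using that DE by (intro NI C0R_mult_right) simp_all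
  \<comment> \<open>The second condition is the first one for the adjoint of \<open>y\<close>, so
    that \<open>T\<close> is self-adjoint by construction.\<close>
  define T where "T = ?E \<inter> {y \<in> carrier CR. \<forall>z\<in>N. z *[CR] y \<in> C0R B} \<inter>
    {y \<in> carrier CR. \<forall>z\<in>adj CR ` N. y *[CR] z \<in> C0R B}"
  have TE [simp]: "y \<in> ?E" and TN: "z \<in> N \<Longrightarrow> z *[CR] y \<in> C0R B" and TN': "z \<in> N \<Longrightarrow> y *[CR] adj CR z \<in> C0R B"
    if "y \<in> T" for y z using that by (auto simp: T_def)
  have TI: "y \<in> T" if "y \<in> ?E" "\<And>z. z \<in> N \<Longrightarrow> z *[CR] y \<in> C0R B" "\<And>z. z \<in> N \<Longrightarrow> y *[CR] adj CR z \<in> C0R B" for y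
    unfolding T_def using that ED(1) by blast
  have Tclosed: "closedin (ctop CR) T"
    unfolding T_def using gen(1)
    by (intro closedin_Int closedin_annihilator subsetI) (auto simp: cstar_subalgebra_def)
  have Tzero: "czero CR \<in> T" by (intro TI) (simp_all add: ED)
  have Tadd: "x +[CR] y \<in> T" if "x \<in> T" "y \<in> T" for x y
    using that by (intro TI) (simp_all add: ED TN TN' R.mult_add_left R.mult_add_right C0R_add)
  have Tscale: "c .[CR] x \<in> T" if "x \<in> T" for c x
    using that by (intro TI) (simp_all add: ED TN TN' C0R_scale)
  have TmultL: "e *[CR] x \<in> T" if x: "x \<in> T" and e: "e \<in> ?E" for x e
  proof (rule TI)
    note [simp] = x e
    show "e *[CR] x \<in> ?E" by (simp add: ED)
    fix z assume z [simp]: "z \<in> N"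
    show "z *[CR] (e *[CR] x) \<in> C0R B" using TN[OF x NmultR[OF z e]] by (simp add: R.mult_assoc)
    show "e *[CR] x *[CR] adj CR z \<in> C0R B"
      using C0R_mult_left[OF EC[OF e] TN'[OF x z]] by (simp add: R.mult_assoc)
  qed
  have TmultR: "x *[CR] e \<in> T" if x: "x \<in> T" and e: "e \<in> ?E" for x e
  proof (rule TI)
    note [simp] = x e
    show "x *[CR] e \<in> ?E" by (simp add: ED)
    fix z assume z [simp]: "z \<in> N"
    show "z *[CR] (x *[CR] e) \<in> C0R B"
      using C0R_mult_right[OF EC[OF e] TN[OF x z]] by (simp add: R.mult_assoc)
    show "x *[CR] e *[CR] adj CR z \<in> C0R B"
      using TN'[OF x NmultR[OF z ED(6)[OF e]]] by (simp add: R.mult_assoc R.adj_mult)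
  qed
  have Tadj: "adj CR x \<in> T" if x: "x \<in> T" for x
  proof (rule TI)
    note [simp] = x
    show "adj CR x \<in> ?E" by (simp add: ED)
    fix z assume z [simp]: "z \<in> N"
    show "z *[CR] adj CR x \<in> C0R B" using C0R_adj[OF TN'[OF x z]] by (simp add: R.adj_mult)
    show "adj CR x *[CR] adj CR z \<in> C0R B" using C0R_adj[OF TN[OF x z]] by (simp add: R.adj_mult)
  qed
  have Tgen: "fst \<Phi> a -[CR] snd \<Phi> a \<in> T" if a: "a \<in> carrier A" for a
  proof (rule TI)
    note c [simp] = kk_map_closed[OF cA maps(1)] kk_map_closed[OF cA maps(2)]
    show "fst \<Phi> a -[CR] snd \<Phi> a \<in> ?E" using a by (intro ED gen(2,3))
    fix z assume z [simp]: "z \<in> N"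
    show "z *[CR] (fst \<Phi> a -[CR] snd \<Phi> a) \<in> C0R B" by (rule ND[OF z gen(5)[OF a]])
    have "adj CR (fst \<Phi> a -[CR] snd \<Phi> a) \<simeq> fst \<Phi> (adj A a) -[CR] snd \<Phi> (adj A a)"
      using maps a by (simp add: R.adj_diff kk_map_def aeq_diff aeq_sym)
    then have "z *[CR] adj CR (fst \<Phi> a -[CR] snd \<Phi> a) \<simeq> z *[CR] (fst \<Phi> (adj A a) -[CR] snd \<Phi> (adj A a))"
      by (intro aeq_mult aeq_refl) simp
    from aeq_C0R[OF this ND[OF z gen(5)[OF A.adj_closed[OF a]]]]
    have "adj CR (z *[CR] adj CR (fst \<Phi> a -[CR] snd \<Phi> a)) \<in> C0R B" by (rule C0R_adj)
    then show "(fst \<Phi> a -[CR] snd \<Phi> a) *[CR] adj CR z \<in> C0R B" using a by (simp add: R.adj_mult)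
  qed
  \<comment> \<open>The graph of \<open>\<phi>\<close> thickened by \<open>N\<close>. As
    \<open>N\<close> is a closed self-adjoint ideal of the generated algebra containing all defects
    of \<open>\<phi>\<close>, the thickened graph is a C*-algebra although the graph is not.\<close>
  have sub1: "cstar_subalgebra (prod_cstar A CR) {w \<in> carrier (prod_cstar A CR). snd w \<in> ?E \<and> snd w -[CR] \<phi> (fst w) \<in> N}"
    (is "cstar_subalgebra ?W ?R") if \<phi>: "\<phi> \<in> {fst \<Phi>, snd \<Phi>}" for \<phi>
  proof -
    have cW: "csa ?W" by (rule cstar_prod[OF cA cR])
    interpret W: pre_cstar ?W using cW by (rule cstar_imp_pre)
    have m: "kk_map A \<phi>" using \<phi> maps by auto
    have \<phi>E [simp]: "\<phi> a \<in> ?E" if "a \<in> carrier A" for a using gen(2,3) that \<phi> by auto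
    have d: "\<phi> (a +[A] b) -[CR] \<phi> a -[CR] \<phi> b \<in> N" "\<phi> (a *[A] b) -[CR] \<phi> a *[CR] \<phi> b \<in> N"
      if ab: "a \<in> carrier A" "b \<in> carrier A" for a b
    proof -
      have "(\<phi> (a +[A] b) -[CR] \<phi> a -[CR] \<phi> b) *[CR] x \<in> C0R B"
        "(\<phi> (a *[A] b) -[CR] \<phi> a *[CR] \<phi> b) *[CR] x \<in> C0R B" if "x \<in> ?D" for x
        using h \<phi> ab that unfolding kk_cycle_def by blast+
      then show "\<phi> (a +[A] b) -[CR] \<phi> a -[CR] \<phi> b \<in> N" "\<phi> (a *[A] b) -[CR] \<phi> a *[CR] \<phi> b \<in> N"
        using ab by (intro NI; simp add: ED)+
    qed
    have ds: "\<phi> (adj A a) -[CR] adj CR (\<phi> a) \<in> N" if "a \<in> carrier A" for a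
      using m that by (intro NC0 ED) (simp_all add: kk_map_def aeq_def)
    note star = star_hom_continuous[OF cW cA prod_homs(1)] star_hom_continuous[OF cW cR prod_homs(2)]
    have "continuous_map (ctop ?W) (ctop CR) (\<lambda>w. snd w -[CR] \<phi> (fst w))"
      using continuous_map_compose[OF star(1), of "ctop CR" \<phi>] m
      by (intro continuous_diff[OF cW cR star(2)]) (simp add: kk_map_def o_def)
    note closedin_continuous_map_preimage[OF this Nclosed]
    moreover have "closedin (ctop ?W) {w \<in> topspace (ctop ?W). snd w \<in> ?E}"
      using gen(1) by (intro closedin_continuous_map_preimage[OF star(2)]) (simp add: cstar_subalgebra_def)
    ultimately have "closedin (ctop ?W) ({w \<in> topspace (ctop ?W). snd w \<in> ?E} \<inter> {w \<in> topspace (ctop ?W). snd w -[CR] \<phi> (fst w) \<in> N})"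
      by (intro closedin_Int)
    moreover have "{w \<in> topspace (ctop ?W). snd w \<in> ?E} \<inter> {w \<in> topspace (ctop ?W). snd w -[CR] \<phi> (fst w) \<in> N} = ?R"
      by auto
    ultimately have closed: "closedin (ctop ?W) ?R" by simp
    show ?thesis
    proof (rule closed_star_subalgebra_iff[OF cW closed])
      show "czero ?W \<in> ?R" using kk_map_zero[OF cA m] NC0[OF ED(2)] by (simp add: ED)
      fix x assume "x \<in> ?R"
      then obtain a e where x [simp]: "x = (a, e)" "a \<in> carrier A" "e \<in> ?E" and eN: "e -[CR] \<phi> a \<in> N" by auto
      have "\<phi> (c .[A] a) = c .[CR] \<phi> a" for c using m by (simp add: kk_map_def homogeneous_def)
      then have "c .[CR] e -[CR] \<phi> (c .[A] a) \<in> N" for c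
        using Nscale[OF eN, of c] by (simp add: R.scale_diff_right)
      then show "c .[?W] x \<in> ?R" for c by (simp add: ED)
      have "adj CR e -[CR] \<phi> (adj A a) = adj CR (e -[CR] \<phi> a) -[CR] (\<phi> (adj A a) -[CR] adj CR (\<phi> a))"
        by (simp add: R.adj_diff R.group_simps)
      then have "adj CR e -[CR] \<phi> (adj A a) \<in> N" using Ndiff[OF Nadj[OF eN] ds] by simp
      then show "adj ?W x \<in> ?R" by (simp add: ED)
      fix y assume "y \<in> ?R"
      then obtain b f where y [simp]: "y = (b, f)" "b \<in> carrier A" "f \<in> ?E" and fN: "f -[CR] \<phi> b \<in> N" by auto
      have "e +[CR] f -[CR] \<phi> (a +[A] b) =
          ((e -[CR] \<phi> a) +[CR] (f -[CR] \<phi> b)) -[CR] (\<phi> (a +[A] b) -[CR] \<phi> a -[CR] \<phi> b)"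
        by (simp add: R.group_simps)
      then have "e +[CR] f -[CR] \<phi> (a +[A] b) \<in> N" using Ndiff[OF Nadd[OF eN fN] d(1)] by simp
      then show "x +[?W] y \<in> ?R" by (simp add: ED)
      have "e *[CR] f -[CR] \<phi> (a *[A] b) =
          (e *[CR] f -[CR] \<phi> a *[CR] \<phi> b) -[CR] (\<phi> (a *[A] b) -[CR] \<phi> a *[CR] \<phi> b)"
        by (simp add: R.group_simps)
      also have "e *[CR] f -[CR] \<phi> a *[CR] \<phi> b = (e -[CR] \<phi> a) *[CR] f +[CR] \<phi> a *[CR] (f -[CR] \<phi> b)"
        by (simp add: R.mult_diff_mult)
      finally have "e *[CR] f -[CR] \<phi> (a *[A] b) \<in> N"
        using Ndiff[OF Nadd[OF NmultR[OF eN y(3)] NmultL[OF fN, of "\<phi> a"]] d(2)] by simp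
      then show "x *[?W] y \<in> ?R" by (simp add: ED)
    qed
  qed
  let ?V = "prod_cstar CR CR"
  let ?P = "{w \<in> carrier ?V. fst w \<in> ?E \<and> snd w \<in> ?E \<and> fst w -[CR] snd w \<in> T}"
  have cV: "csa ?V" by (rule cstar_prod[OF cR cR])
  have sub2: "cstar_subalgebra ?V ?P"
  proof -
    interpret V: pre_cstar ?V using cV by (rule cstar_imp_pre)
    note star = star_hom_continuous[OF cV cR prod_homs(1)] star_hom_continuous[OF cV cR prod_homs(2)]
    have Ecl: "closedin (ctop CR) ?E" using gen(1) by (simp add: cstar_subalgebra_def)
    have "closedin (ctop ?V) ({w \<in> topspace (ctop ?V). fst w \<in> ?E} \<inter> {w \<in> topspace (ctop ?V). snd w \<in> ?E} \<inter>
        {w \<in> topspace (ctop ?V). fst w -[CR] snd w \<in> T})"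
      by (intro closedin_Int closedin_continuous_map_preimage[OF star(1) Ecl] closedin_continuous_map_preimage[OF star(2) Ecl]
          closedin_continuous_map_preimage[OF continuous_diff[OF cV cR star] Tclosed])
    moreover have "{w \<in> topspace (ctop ?V). fst w \<in> ?E} \<inter> {w \<in> topspace (ctop ?V). snd w \<in> ?E} \<inter>
        {w \<in> topspace (ctop ?V). fst w -[CR] snd w \<in> T} = ?P" by auto
    ultimately have closed: "closedin (ctop ?V) ?P" by simp
    show ?thesis
    proof (rule closed_star_subalgebra_iff[OF cV closed])
      show "czero ?V \<in> ?P" using Tzero by (simp add: ED)
      fix x assume "x \<in> ?P"
      then obtain e e' where x [simp]: "x = (e, e')" "e \<in> ?E" "e' \<in> ?E" and eT: "e -[CR] e' \<in> T" by auto
      show "c .[?V] x \<in> ?P" for c using Tscale[OF eT, of c] by (simp add: ED R.scale_diff_right)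
      show "adj ?V x \<in> ?P" using Tadj[OF eT] by (simp add: ED R.adj_diff)
      fix y assume "y \<in> ?P"
      then obtain f f' where y [simp]: "y = (f, f')" "f \<in> ?E" "f' \<in> ?E" and fT: "f -[CR] f' \<in> T" by auto
      show "x +[?V] y \<in> ?P" using Tadd[OF eT fT] by (simp add: ED R.add_diff_add)
      show "x *[?V] y \<in> ?P"
        using Tadd[OF TmultR[OF eT y(2)] TmultL[OF fT x(3)]] by (simp add: ED R.mult_diff_mult)
    qed
  qed
  let ?U = "prod_cstar A ?V"
  have cU: "csa ?U" by (rule cstar_prod[OF cA cV])
  have cW: "csa (prod_cstar A CR)" by (rule cstar_prod[OF cA cR])
  note hom = star_hom_pair[OF prod_homs(1) star_hom_compose[OF prod_homs(1) prod_homs(2)]]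
    star_hom_pair[OF prod_homs(1) star_hom_compose[OF prod_homs(2) prod_homs(2)]]
  define Q where "Q = {w \<in> carrier ?U. snd w \<in> ?P} \<inter>
    ({w \<in> carrier ?U. (fst w, (fst \<circ> snd) w) \<in> {w \<in> carrier (prod_cstar A CR). snd w \<in> ?E \<and> snd w -[CR] fst \<Phi> (fst w) \<in> N}} \<inter>
    {w \<in> carrier ?U. (fst w, (snd \<circ> snd) w) \<in> {w \<in> carrier (prod_cstar A CR). snd w \<in> ?E \<and> snd w -[CR] snd \<Phi> (fst w) \<in> N}})"
  have "cstar_subalgebra ?U Q"
    unfolding Q_def
    by (intro cstar_subalgebra_Int cstar_subalgebra_preimage[OF cU cV prod_homs(2) sub2]
        cstar_subalgebra_preimage[OF cU cW hom(1) sub1] cstar_subalgebra_preimage[OF cU cW hom(2) sub1]) simp_all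
  moreover have "(a, fst \<Phi> a, snd \<Phi> a) \<in> Q" if a: "a \<in> carrier A" for a
    using gen(2,3)[OF a] Tgen[OF a] NC0[OF ED(2)] a by (simp add: Q_def)
  moreover have "e \<simeq> e'" if "(czero A, e, e') \<in> Q" for e e'
  proof -
    have e: "e \<in> ?E" "e' \<in> ?E" "e -[CR] e' \<in> T" "e \<in> N" "e' \<in> N"
      using that kk_map_zero[OF cA maps(1)] kk_map_zero[OF cA maps(2)] by (auto simp: Q_def)
    let ?y = "e -[CR] e'"
    have "?y *[CR] adj CR ?y \<in> C0R B" by (rule TN'[OF e(3) Ndiff[OF e(4,5)]])
    then have "adj CR ?y \<in> C0R B" using C0R_adj_mult_self[of "adj CR ?y"] e(1,2) by simp
    then have "?y \<in> C0R B" using C0R_adj[of "adj CR ?y"] e(1,2) by simp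
    then show ?thesis using e(1,2) by (simp add: aeq_def)
  qed
  ultimately show ?thesis by blast
qed

text \<open>
  A relation \<open>Q\<close> as in \<open>cycle_lift\<close> is an extension of \<open>A\<close> to which both maps lift, such that the
  two coordinates \<open>e\<close>, \<open>e'\<close> agree over \<open>0\<close>. Having such an extension characterises cycles, and it is
  easier to transport than the ideal in the definition.
\<close>

definition cycle_lift :: "'a cstar \<Rightarrow> ('a, 'b) fun_pair \<Rightarrow> ('a \<Rightarrow> (real \<Rightarrow> 'b) \<Rightarrow> (real \<Rightarrow> 'b) \<Rightarrow> bool) \<Rightarrow> bool"
  where "cycle_lift A \<Phi> Q \<longleftrightarrow>
    (\<forall>a e e'. Q a e e' \<longrightarrow> a \<in> carrier A \<and> e \<in> carrier CR \<and> e' \<in> carrier CR) \<and>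
    (\<forall>a e e' b f f'. Q a e e' \<longrightarrow> Q b f f' \<longrightarrow>
      Q (a -[A] b) (e -[CR] f) (e' -[CR] f') \<and> Q (a *[A] b) (e *[CR] f) (e' *[CR] f')) \<and>
    (\<forall>a\<in>carrier A. Q a (fst \<Phi> a) (snd \<Phi> a)) \<and> (\<forall>e e'. Q (czero A) e e' \<longrightarrow> e \<simeq> e')"

lemma cycle_liftD:
  assumes "cycle_lift A \<Phi> Q"
  shows "Q a e e' \<Longrightarrow> a \<in> carrier A" "Q a e e' \<Longrightarrow> e \<in> carrier CR" "Q a e e' \<Longrightarrow> e' \<in> carrier CR"
    "\<lbrakk>Q a e e'; Q b f f'\<rbrakk> \<Longrightarrow> Q (a -[A] b) (e -[CR] f) (e' -[CR] f')"
    "\<lbrakk>Q a e e'; Q b f f'\<rbrakk> \<Longrightarrow> Q (a *[A] b) (e *[CR] f) (e' *[CR] f')"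
    "a \<in> carrier A \<Longrightarrow> Q a (fst \<Phi> a) (snd \<Phi> a)" "Q (czero A) e e' \<Longrightarrow> e \<simeq> e'"
  using assms unfolding cycle_lift_def by blast+

lemma cycle_liftI:
  assumes "\<And>a e e'. Q a e e' \<Longrightarrow> a \<in> carrier A \<and> e \<in> carrier CR \<and> e' \<in> carrier CR"
    and "\<And>a e e' b f f'. \<lbrakk>Q a e e'; Q b f f'\<rbrakk> \<Longrightarrow>
      Q (a -[A] b) (e -[CR] f) (e' -[CR] f') \<and> Q (a *[A] b) (e *[CR] f) (e' *[CR] f')"
    and "\<And>a. a \<in> carrier A \<Longrightarrow> Q a (fst \<Phi> a) (snd \<Phi> a)" and "\<And>e e'. Q (czero A) e e' \<Longrightarrow> e \<simeq> e'"
  shows "cycle_lift A \<Phi> Q"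
  using assms unfolding cycle_lift_def by blast

text \<open>\<open>?N\<close> consists of what is asymptotically a first coordinate over 0.
  Coordinates over 0 agree, so second coordinates belong to it as well. It absorbs the values of
  both maps on the right, because a pair over 0 times the pair over \<open>a\<close> is again a pair
  over 0; agreement of that product shows that \<open>?N\<close> annihilates the
  differences.\<close>

lemma kk_cycle_liftI:
  assumes cA: "csa A" and maps: "kk_map A (fst \<Phi>)" "kk_map A (snd \<Phi>)" and Q: "cycle_lift A \<Phi> Q"
  shows "kk_cycle A B \<Phi>"
proof (rule kk_cycleI[OF cA maps])
  interpret A: pre_cstar A using cA by (rule cstar_imp_pre)
  note QD = cycle_liftD[OF Q]
  note [simp] = kk_map_closed[OF cA maps(1)] kk_map_closed[OF cA maps(2)]
  let ?N = "{z. \<exists>e e'. Q (czero A) e e' \<and> z \<simeq> e}"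
  have N: "e \<in> ?N" "e' \<in> ?N" if "Q (czero A) e e'" for e e'
    using that QD(2,7)[OF that] aeq_refl aeq_sym by blast+
  have prod: "z *[CR] fst \<Phi> a \<in> ?N \<and> z *[CR] fst \<Phi> a \<simeq> z *[CR] snd \<Phi> a" if z: "z \<in> ?N" and a: "a \<in> carrier A" for z a
  proof -
    obtain e e' where e: "Q (czero A) e e'" "z \<simeq> e" using z by blast
    have q: "Q (czero A) (e *[CR] fst \<Phi> a) (e' *[CR] snd \<Phi> a)" using QD(5)[OF e(1) QD(6)[OF a]] a by simp
    have 1: "z *[CR] fst \<Phi> a \<simeq> e *[CR] fst \<Phi> a" using a by (intro aeq_mult e(2)) simp
    also have "\<dots> \<simeq> e' *[CR] snd \<Phi> a" by (rule QD(7)[OF q])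
    also have "\<dots> \<simeq> z *[CR] snd \<Phi> a" using a by (intro aeq_mult aeq_sym[OF aeq_trans[OF e(2) QD(7)[OF e(1)]]]) simp
    finally show ?thesis using 1 q by blast
  qed
  have closed: "w \<in> ?N" if "w \<simeq> z" "z \<in> ?N" for w z using that aeq_trans by blast
  show "annihilating A \<Phi> ?N"
    unfolding annihilating_def
  proof (intro conjI ballI)
    fix \<phi> a b assume \<phi>: "\<phi> \<in> {fst \<Phi>, snd \<Phi>}" and a: "a \<in> carrier A" and b: "b \<in> carrier A"
    have "a +[A] b -[A] a -[A] b = czero A" using a b by (simp add: A.group_simps)
    then have "Q (czero A) (fst \<Phi> (a +[A] b) -[CR] fst \<Phi> a -[CR] fst \<Phi> b) (snd \<Phi> (a +[A] b) -[CR] snd \<Phi> a -[CR] snd \<Phi> b)"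
      using QD(4)[OF QD(4)[OF QD(6)[OF A.add_closed[OF a b]] QD(6)[OF a]] QD(6)[OF b]] by simp
    then show "\<phi> (a +[A] b) -[CR] \<phi> a -[CR] \<phi> b \<in> ?N" using N \<phi> by blast
    have "Q (czero A) (fst \<Phi> (a *[A] b) -[CR] fst \<Phi> a *[CR] fst \<Phi> b) (snd \<Phi> (a *[A] b) -[CR] snd \<Phi> a *[CR] snd \<Phi> b)"
      using QD(4)[OF QD(6)[OF A.mult_closed[OF a b]] QD(5)[OF QD(6)[OF a] QD(6)[OF b]]] a b by simp
    then show "\<phi> (a *[A] b) -[CR] \<phi> a *[CR] \<phi> b \<in> ?N" using N \<phi> by blast
  next
    show "?N \<subseteq> carrier CR" using aeq_carrier by blast
    fix z a assume z: "z \<in> ?N" and a: "a \<in> carrier A"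
    note p = prod[OF z a]
    show "z *[CR] \<phi> a \<in> ?N" if "\<phi> \<in> {fst \<Phi>, snd \<Phi>}" for \<phi> using p closed[OF aeq_sym] that by blast
    have "z \<in> carrier CR" using z aeq_carrier by blast
    then show "z *[CR] (fst \<Phi> a -[CR] snd \<Phi> a) \<in> C0R B" using p a by (simp add: aeq_def R.mult_diff_right)
  qed
qed

lemma kk_cycle_lift:
  assumes cA: "csa A" and h: "kk_cycle A B \<Phi>"
  shows "\<exists>Q. cycle_lift A \<Phi> Q"
proof -
  let ?W = "prod_cstar A (prod_cstar CR CR)"
  have cW: "csa ?W" by (intro cstar_prod cA cR)
  obtain Q where Q: "cstar_subalgebra ?W Q" "\<And>a. a \<in> carrier A \<Longrightarrow> (a, fst \<Phi> a, snd \<Phi> a) \<in> Q"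
      "\<And>e e'. (czero A, e, e') \<in> Q \<Longrightarrow> e \<simeq> e'"
    using cycle_algebra[OF cA h] by blast
  note QD = subalgebraD[OF cW Q(1)]
  have "cycle_lift A \<Phi> (\<lambda>a e e'. (a, e, e') \<in> Q)"
    using QD(1) QD(5,7)[of "(_, _, _)" "(_, _, _)"] Q(2,3) by (intro cycle_liftI) auto
  then show ?thesis by blast
qed

end

section \<open>Cycles under *-homomorphisms, concatenation and sums\<close>

lemma (in codomain_hom) kk_map_push:
  assumes cA: "csa A" and h: "B.kk_map A \<phi>"
  shows "B'.kk_map A (push k \<circ> \<phi>)"
proof -
  have "continuous_map (ctop A) (ctop (CbR B')) (push k \<circ> \<phi>)"
    using h star_hom_continuous[OF B.cR B'.cR push_star_hom] unfolding B.kk_map_def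
    by (intro continuous_map_compose[of _ "ctop (CbR B)"]) simp_all
  moreover have "homogeneous A (CbR B') (push k \<circ> \<phi>)"
    using h B.kk_map_closed[OF cA h] by (simp add: B.kk_map_def homogeneous_def pushD(3))
  moreover have "B'.aeq ((push k \<circ> \<phi>) (adj A a)) (adj (CbR B') ((push k \<circ> \<phi>) a))" if "a \<in> carrier A" for a
    using h that push_aeq[of "\<phi> (adj A a)" "adj (CbR B) (\<phi> a)"] B.kk_map_closed[OF cA h that]
    by (simp add: B.kk_map_def pushD(5))
  ultimately show ?thesis by (simp add: B'.kk_map_def)
qed

text \<open>The image of a lift is a lift. With the ideal of the definition one would have to relate
  the ideals generated before and after applying \<open>k\<close>.\<close>

lemma (in codomain_hom) kk_cycle_push:
  assumes cA: "csa A" and h: "kk_cycle A B \<Phi>"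
  shows "kk_cycle A B' (map_pair (push k) \<Phi>)"
proof -
  note maps = B.kk_cycle_maps[OF cA h]
  obtain Q where Q: "B.cycle_lift A \<Phi> Q" using B.kk_cycle_lift[OF cA h] by blast
  note QD = B.cycle_liftD[OF Q]
  show ?thesis
  proof (rule B'.kk_cycle_liftI[OF cA])
    show "B'.kk_map A (fst (map_pair (push k) \<Phi>))" "B'.kk_map A (snd (map_pair (push k) \<Phi>))"
      using kk_map_push[OF cA] maps by (simp_all add: map_pair_def)
    let ?Q = "\<lambda>a f f'. \<exists>e e'. Q a e e' \<and> f = push k e \<and> f' = push k e'"
    show "B'.cycle_lift A (map_pair (push k) \<Phi>) ?Q"
    proof (rule B'.cycle_liftI)
      fix a f f' b g g' assume "?Q a f f'" "?Q b g g'"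
      then obtain e e' d d' where e: "Q a e e'" "Q b d d'" "f = push k e" "f' = push k e'" "g = push k d" "g' = push k d'"
        by blast
      show "?Q (a -[A] b) (f -[CbR B'] g) (f' -[CbR B'] g') \<and> ?Q (a *[A] b) (f *[CbR B'] g) (f' *[CbR B'] g')"
        using QD(4,5)[OF e(1,2)] QD(2,3)[OF e(1)] QD(2,3)[OF e(2)] pushD(4,6) e(3-6) by metis
    qed (use QD push_aeq in \<open>fastforce+\<close>)
  qed
qed

lemma (in norming_pair) kk_map_pushI:
  assumes cA: "csa A" and h: "k1.B'.kk_map A \<phi>" "k1.B'.kk_map A \<psi>"
    and cl: "\<And>a. a \<in> carrier A \<Longrightarrow> \<theta> a \<in> carrier (CbR B') \<and> push k1 (\<theta> a) = \<phi> a \<and> push k2 (\<theta> a) = \<psi> a"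
  shows "k1.B.kk_map A \<theta>"
proof -
  interpret A: pre_cstar A using cA by (rule cstar_imp_pre)
  have cont: "continuous_map (ctop A) (ctop (CbR B)) \<phi>" "continuous_map (ctop A) (ctop (CbR B)) \<psi>"
    using h by (simp_all add: k1.B'.kk_map_def)
  have "continuous_map (ctop A) (ctop (CbR B')) \<theta>"
    by (rule continuous_pushI[OF cA cont]) (use cl in simp)
  moreover have "homogeneous A (CbR B') \<theta>"
    unfolding homogeneous_def
  proof (intro allI ballI)
    fix c a assume a: "a \<in> carrier A"
    show "\<theta> (c .[A] a) = c .[CbR B'] \<theta> a"
      by (rule push_eqI)
        (use cl[OF a] cl[OF A.scale_closed[OF a, of c]] h a in
          \<open>simp_all add: k1.pushD(3) k2.pushD(3) k1.B'.kk_map_def homogeneous_def\<close>)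
  qed
  moreover have "k1.B.aeq (\<theta> (adj A a)) (adj (CbR B') (\<theta> a))" if a: "a \<in> carrier A" for a
    by (rule aeq_pushI)
      (use cl[OF a] cl[OF A.adj_closed[OF a]] h a in \<open>simp_all add: k1.pushD(5) k2.pushD(5) k1.B'.kk_map_def\<close>)
  ultimately show ?thesis by (simp add: k1.B.kk_map_def)
qed

text \<open>The lift is the joint preimage of the two given lifts. Coordinates over 0 agree after
  \<open>k1\<close> and after \<open>k2\<close>, hence agree, since the two maps are jointly
  norming.\<close>

lemma (in norming_pair) kk_cycle_pushI:
  assumes cA: "csa A" and h: "kk_cycle A B \<Phi>" "kk_cycle A B \<Psi>"
    and cl: "\<And>a. a \<in> carrier A \<Longrightarrow> fst \<Theta> a \<in> carrier (CbR B') \<and> snd \<Theta> a \<in> carrier (CbR B') \<and>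
        push k1 (fst \<Theta> a) = fst \<Phi> a \<and> push k2 (fst \<Theta> a) = fst \<Psi> a \<and>
        push k1 (snd \<Theta> a) = snd \<Phi> a \<and> push k2 (snd \<Theta> a) = snd \<Psi> a"
  shows "kk_cycle A B' \<Theta>"
proof -
  note maps = k1.B'.kk_cycle_maps[OF cA h(1)] and maps' = k1.B'.kk_cycle_maps[OF cA h(2)]
  obtain Q Q' where Q: "k1.B'.cycle_lift A \<Phi> Q" and Q': "k1.B'.cycle_lift A \<Psi> Q'"
    using k1.B'.kk_cycle_lift[OF cA h(1)] k1.B'.kk_cycle_lift[OF cA h(2)] by blast
  note QD = k1.B'.cycle_liftD[OF Q] and QD' = k1.B'.cycle_liftD[OF Q']
  show ?thesis
  proof (rule k1.B.kk_cycle_liftI[OF cA])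
    show "k1.B.kk_map A (fst \<Theta>)" by (rule kk_map_pushI[OF cA maps(1) maps'(1)]) (use cl in simp)
    show "k1.B.kk_map A (snd \<Theta>)" by (rule kk_map_pushI[OF cA maps(2) maps'(2)]) (use cl in simp)
    show "k1.B.cycle_lift A \<Theta> (\<lambda>a f f'. f \<in> carrier (CbR B') \<and> f' \<in> carrier (CbR B') \<and>
        Q a (push k1 f) (push k1 f') \<and> Q' a (push k2 f) (push k2 f'))"
      by (rule k1.B.cycle_liftI) (use QD QD' cl in \<open>auto simp: k1.pushD(4,6) k2.pushD(4,6) intro: aeq_pushI\<close>)
  qed
qed

context codomain
begin

lemma kk_homotopy_equiv:
  assumes cA: "csa A"
  shows "equiv {\<Phi>. kk_cycle A B \<Phi>} (kk_homotopy A B)"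
  unfolding kk_homotopy_def
proof (rule homotopy_equiv)
  interpret K: codomain "IB B" by (rule codomain_IB)
  show "fst \<Phi> a \<in> carrier CR \<and> snd \<Phi> a \<in> carrier CR" if "kk_cycle A B \<Phi>" "a \<in> carrier A" for \<Phi> a
    using kk_map_closed[OF cA _ that(2)] kk_cycle_maps[OF cA that(1)] by blast
  show "fst \<Phi> a \<in> carrier (CbR (IB B)) \<and> snd \<Phi> a \<in> carrier (CbR (IB B))"
    if "kk_cycle A (IB B) \<Phi>" "a \<in> carrier A" for \<Phi> a
    using K.kk_map_closed[OF cA _ that(2)] K.kk_cycle_maps[OF cA that(1)] by blast
  show "kk_cycle A (IB B) (map_pair (push const_path) \<Phi>)" if "kk_cycle A B \<Phi>" for \<Phi>
    by (rule codomain_hom.kk_cycle_push[OF const_path_hom cA that])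
  show "kk_cycle A (IB B) (map_pair (push (reparam (\<lambda>r. 1 - r))) \<Theta>)" if "kk_cycle A (IB B) \<Theta>" for \<Theta>
    by (rule codomain_hom.kk_cycle_push[OF reverse_hom cA that])
qed (rule norming_pair.kk_cycle_pushI[OF halves cA])

lemma kk_homotopyI:
  "\<lbrakk>kk_cycle A B \<Phi>; kk_cycle A B \<Psi>; kk_cycle A (IB B) \<Theta>; evaluates_to A 0 \<Theta> \<Phi>; evaluates_to A 1 \<Theta> \<Psi>\<rbrakk>
    \<Longrightarrow> (\<Phi>, \<Psi>) \<in> kk_homotopy A B"
  unfolding kk_homotopy_def by blast

end

context orthogonal_homs
begin

lemma osum_kk_map:
  assumes cA: "csa A" and f: "k1.B.kk_map A \<phi>" and g: "k1.B.kk_map A \<psi>"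
  shows "k1.B'.kk_map A (osum \<phi> \<psi>)"
proof -
  interpret A: pre_cstar A using cA by (rule cstar_imp_pre)
  note c = k1.B.kk_map_closed[OF cA f] k1.B.kk_map_closed[OF cA g]
  have "k1.B'.aeq (osum \<phi> \<psi> (adj A a)) (adj (CbR B') (osum \<phi> \<psi> a))" if a: "a \<in> carrier A" for a
    using push_sum_aeq[of "\<phi> (adj A a)" "adj (CbR B) (\<phi> a)" "\<psi> (adj A a)" "adj (CbR B) (\<psi> a)"] f g a c
    by (simp add: osum_def k1.B.kk_map_def k1.B'.R.adj_add k1.pushD(5) k2.pushD(5))
  then show ?thesis
    using f g c osum_continuous[OF cA, of \<phi> \<psi>] osum_homogeneous[of A \<phi> \<psi>]
    by (simp add: k1.B'.kk_map_def k1.B.kk_map_def)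
qed

text \<open>The lift is the fibre product over \<open>A\<close> of the two given lifts, with
  coordinates added orthogonally; cross terms vanish, so it is closed under products.\<close>

lemma osum_kk_cycle:
  assumes cA: "csa A" and h: "kk_cycle A B \<Phi>" "kk_cycle A B \<Psi>"
  shows "kk_cycle A B' (osum_pair \<Phi> \<Psi>)"
proof -
  note maps = k1.B.kk_cycle_maps[OF cA h(1)] and maps' = k1.B.kk_cycle_maps[OF cA h(2)]
  obtain Q Q' where Q: "k1.B.cycle_lift A \<Phi> Q" and Q': "k1.B.cycle_lift A \<Psi> Q'"
    using k1.B.kk_cycle_lift[OF cA h(1)] k1.B.kk_cycle_lift[OF cA h(2)] by blast
  note QD = k1.B.cycle_liftD[OF Q] and QD' = k1.B.cycle_liftD[OF Q']
  show ?thesis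
  proof (rule k1.B'.kk_cycle_liftI[OF cA])
    show "k1.B'.kk_map A (fst (osum_pair \<Phi> \<Psi>))" "k1.B'.kk_map A (snd (osum_pair \<Phi> \<Psi>))"
      using osum_kk_map[OF cA] maps maps' by (simp_all add: osum_pair_def)
    let ?s = "\<lambda>e g. push k1 e +[CbR B'] push k2 g"
    let ?Q = "\<lambda>a f f'. \<exists>e e' g g'. Q a e e' \<and> Q' a g g' \<and> f = ?s e g \<and> f' = ?s e' g'"
    have QI: "?Q a (?s e g) (?s e' g')" if "Q a e e'" "Q' a g g'" for a e e' g g' using that by blast
    show "k1.B'.cycle_lift A (osum_pair \<Phi> \<Psi>) ?Q"
    proof (rule k1.B'.cycle_liftI)
      fix a f f' b d d' assume "?Q a f f'" "?Q b d d'"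
      then obtain e e' g g' i i' j j' where e: "Q a e e'" "Q' a g g'" "Q b i i'" "Q' b j j'"
          "f = ?s e g" "f' = ?s e' g'" "d = ?s i j" "d' = ?s i' j'" by blast
      note [simp] = QD(2,3)[OF e(1)] QD'(2,3)[OF e(2)] QD(2,3)[OF e(3)] QD'(2,3)[OF e(4)]
      have "f -[CbR B'] d = ?s (e -[CbR B] i) (g -[CbR B] j)" "f' -[CbR B'] d' = ?s (e' -[CbR B] i') (g' -[CbR B] j')"
        "f *[CbR B'] d = ?s (e *[CbR B] i) (g *[CbR B] j)" "f' *[CbR B'] d' = ?s (e' *[CbR B] i') (g' *[CbR B] j')"
        by (simp_all add: e(5-8) k1.B'.R.add_diff_add k1.pushD(6) k2.pushD(6) mult_osum)
      then show "?Q (a -[A] b) (f -[CbR B'] d) (f' -[CbR B'] d') \<and> ?Q (a *[A] b) (f *[CbR B'] d) (f' *[CbR B'] d')"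
        using QI[OF QD(4)[OF e(1,3)] QD'(4)[OF e(2,4)]] QI[OF QD(5)[OF e(1,3)] QD'(5)[OF e(2,4)]] by simp
    next
      show "?Q a (fst (osum_pair \<Phi> \<Psi>) a) (snd (osum_pair \<Phi> \<Psi>) a)" if "a \<in> carrier A" for a
        using QI[OF QD(6)[OF that] QD'(6)[OF that]] by (simp add: osum_pair_def osum_def)
      show "k1.B'.aeq f f'" if "?Q (czero A) f f'" for f f'
        using that QD(7) QD'(7) push_sum_aeq by blast
      show "a \<in> carrier A \<and> f \<in> carrier (CbR B') \<and> f' \<in> carrier (CbR B')" if "?Q a f f'" for a f f'
        using that QD(1-3) QD'(2,3) by auto
    qed
  qed
qed

lemma osum_kk_homotopy:
  assumes cA: "csa A" and h: "(\<Phi>, \<Phi>') \<in> kk_homotopy A B" "(\<Psi>, \<Psi>') \<in> kk_homotopy A B"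
  shows "(osum_pair \<Phi> \<Psi>, osum_pair \<Phi>' \<Psi>') \<in> kk_homotopy A B'"
proof -
  interpret K: codomain "IB B" by (rule k1.B.codomain_IB)
  interpret P: orthogonal_homs "IB B" "IB B'" "pointwise k1" "pointwise k2" by (rule pointwise_orthogonal)
  obtain \<Theta> where f: "kk_cycle A B \<Phi>" "kk_cycle A B \<Phi>'" "kk_cycle A (IB B) \<Theta>"
    "evaluates_to A 0 \<Theta> \<Phi>" "evaluates_to A 1 \<Theta> \<Phi>'" using h(1) by (auto simp: kk_homotopy_def)
  obtain \<Xi> where g: "kk_cycle A B \<Psi>" "kk_cycle A B \<Psi>'" "kk_cycle A (IB B) \<Xi>"
    "evaluates_to A 0 \<Xi> \<Psi>" "evaluates_to A 1 \<Xi> \<Psi>'" using h(2) by (auto simp: kk_homotopy_def)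
  have cl: "fst \<Theta> a \<in> carrier (CbR (IB B)) \<and> snd \<Theta> a \<in> carrier (CbR (IB B))"
    if "kk_cycle A (IB B) \<Theta>" "a \<in> carrier A" for \<Theta> a
    using K.kk_map_closed[OF cA _ that(2)] K.kk_cycle_maps[OF cA that(1)] by blast
  show ?thesis
  proof (rule k1.B'.kk_homotopyI)
    show "kk_cycle A B' (osum_pair \<Phi> \<Psi>)" by (rule osum_kk_cycle[OF cA f(1) g(1)])
    show "kk_cycle A B' (osum_pair \<Phi>' \<Psi>')" by (rule osum_kk_cycle[OF cA f(2) g(2)])
    show "kk_cycle A (IB B') (P.osum_pair \<Theta> \<Xi>)" by (rule P.osum_kk_cycle[OF cA f(3) g(3)])
    show "evaluates_to A 0 (P.osum_pair \<Theta> \<Xi>) (osum_pair \<Phi> \<Psi>)"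
      by (rule osum_evaluates[OF f(4) g(4) _ _ cl[OF f(3)] cl[OF g(3)]]) simp_all
    show "evaluates_to A 1 (P.osum_pair \<Theta> \<Xi>) (osum_pair \<Phi>' \<Psi>')"
      by (rule osum_evaluates[OF f(5) g(5) _ _ cl[OF f(3)] cl[OF g(3)]]) simp_all
  qed
qed

end

section \<open>Composing agreeing pairs with sections\<close>

text \<open>Compatibility with adjoints, which \<open>sections\<close> demands, is left out, because
  the tautological section of an extension built from a cycle need not have it.\<close>

definition continuous_section :: "'a cstar \<Rightarrow> 'c cstar \<Rightarrow> ('c \<Rightarrow> 'a) \<Rightarrow> ('a \<Rightarrow> 'c) \<Rightarrow> bool"
  where "continuous_section A C p s \<longleftrightarrow> continuous_map (ctop A) (ctop C) s \<and> homogeneous A C s \<and>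
    (\<forall>a\<in>carrier A. p (s a) = a)"

lemma continuous_section_closed:
  assumes "csa A" "csa C" "continuous_section A C p s" "a \<in> carrier A"
  shows "s a \<in> carrier C"
  using assms(3,4) unfolding continuous_section_def continuous_ctop_iff[OF assms(1,2)] by blast

context codomain
begin

text \<open>The substitute for compatibility of \<open>s\<close> with adjoints: it is required only
  after applying \<open>\<psi>\<close> and only modulo \<open>C\<^sub>0\<close>, which is all that a
  composed cycle needs.\<close>

definition star_along :: "'a cstar \<Rightarrow> ('c, 'b) fun_pair \<Rightarrow> ('a \<Rightarrow> 'c) \<Rightarrow> bool"
  where "star_along A \<psi> s \<longleftrightarrow> (\<forall>\<phi>\<in>{fst \<psi>, snd \<psi>}. \<forall>a\<in>carrier A. \<phi> (s (adj A a)) \<simeq> adj CR (\<phi> (s a)))"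

text \<open>The lift consists of the values of the pair on the elements over \<open>a\<close>. The
  relation \<open>P\<close>, meaning that \<open>c\<close> lies over \<open>a\<close>, is kept
  general since it is also needed for paths lying over a single point, where not every path lies
  over a point.\<close>

lemma kk_cycle_comp:
  assumes cA: "csa A" and cC: "csa C" and J: "J \<subseteq> carrier C" and h: "agreeing_pair C J B \<psi>"
    and s: "continuous_map (ctop A) (ctop C) s" "homogeneous A C s" "star_along A \<psi> s"
    and over: "\<And>a c. P a c \<Longrightarrow> a \<in> carrier A \<and> c \<in> carrier C" "\<And>a. a \<in> carrier A \<Longrightarrow> P a (s a)"
      "\<And>c. P (czero A) c \<Longrightarrow> c \<in> J"
      "\<And>a b c d. \<lbrakk>P a c; P b d\<rbrakk> \<Longrightarrow> P (a -[A] b) (c -[C] d) \<and> P (a *[A] b) (c *[C] d)"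
  shows "kk_cycle A B (pair_comp \<psi> s)"
proof (rule kk_cycle_liftI[OF cA])
  note hD = agreeing_pairD[OF cC J h]
  note fD = asymptotic_homD[OF cC hD(1)] and gD = asymptotic_homD[OF cC hD(2)]
  have "kk_map A (\<phi> \<circ> s)" if \<phi>: "\<phi> \<in> {fst \<psi>, snd \<psi>}" for \<phi>
  proof -
    have "asymptotic_hom C B \<phi>" using \<phi> hD(1,2) by auto
    note fD = asymptotic_homD[OF cC this]
    have "continuous_map (ctop A) (ctop CR) (\<phi> \<circ> s)" by (rule continuous_map_compose[OF s(1) fD(6)])
    moreover have "homogeneous A CR (\<phi> \<circ> s)" using s(2) fD(2) over(1)[OF over(2)] by (simp add: homogeneous_def)
    moreover have "\<phi> (s (adj A a)) \<simeq> adj CR (\<phi> (s a))" if "a \<in> carrier A" for a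
      using s(3) \<phi> that unfolding star_along_def by blast
    ultimately show ?thesis by (simp add: kk_map_def)
  qed
  then show "kk_map A (fst (pair_comp \<psi> s))" "kk_map A (snd (pair_comp \<psi> s))" by (simp_all add: pair_comp_def)
  let ?Q = "\<lambda>a e e'. \<exists>c. P a c \<and> e \<simeq> fst \<psi> c \<and> e' \<simeq> snd \<psi> c"
  show "cycle_lift A (pair_comp \<psi> s) ?Q"
  proof (rule cycle_liftI)
    fix a e e' b f f' assume "?Q a e e'" "?Q b f f'"
    then obtain c d where c: "P a c" "e \<simeq> fst \<psi> c" "e' \<simeq> snd \<psi> c" and d: "P b d" "f \<simeq> fst \<psi> d" "f' \<simeq> snd \<psi> d" by blast
    have C: "c \<in> carrier C" "d \<in> carrier C" using over(1) c(1) d(1) by blast+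
    show "?Q (a -[A] b) (e -[CR] f) (e' -[CR] f') \<and> ?Q (a *[A] b) (e *[CR] f) (e' *[CR] f')"
      using over(4)[OF c(1) d(1)] aeq_trans[OF aeq_diff[OF c(2) d(2)] aeq_sym[OF fD(8)[OF C]]]
        aeq_trans[OF aeq_diff[OF c(3) d(3)] aeq_sym[OF gD(8)[OF C]]]
        aeq_trans[OF aeq_mult[OF c(2) d(2)] aeq_sym[OF fD(4)[OF C]]]
        aeq_trans[OF aeq_mult[OF c(3) d(3)] aeq_sym[OF gD(4)[OF C]]] by blast
  next
    show "?Q a (fst (pair_comp \<psi> s) a) (snd (pair_comp \<psi> s) a)" if a: "a \<in> carrier A" for a
      using over(1)[OF over(2)[OF a]] over(2)[OF a] fD(1) gD(1) by (intro exI[of _ "s a"]) simp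
    show "e \<simeq> e'" if "?Q (czero A) e e'" for e e'
      using that over(3) hD(3) aeq_trans aeq_sym by meson
    show "a \<in> carrier A \<and> e \<in> carrier CR \<and> e' \<in> carrier CR" if "?Q a e e'" for a e e'
      using that over(1) aeq_carrier by blast
  qed
qed

lemma kk_cycle_section:
  assumes cA: "csa A" and cC: "csa C" and p: "star_hom C A p"
    and h: "agreeing_pair C (star_ker C A p) B \<psi>"
    and s: "continuous_section A C p s" "star_along A \<psi> s"
  shows "kk_cycle A B (pair_comp \<psi> s)"
proof -
  interpret A: pre_cstar A using cA by (rule cstar_imp_pre)
  interpret C: pre_cstar C using cC by (rule cstar_imp_pre)
  note pD [simp] = star_homD[OF p] star_hom_diff[OF p cC]
  note sc [simp] = continuous_section_closed[OF cA cC s(1)]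
  have ps: "p (s a) = a" if "a \<in> carrier A" for a using s(1) that by (simp add: continuous_section_def)
  show ?thesis
    by (rule kk_cycle_comp[OF cA cC _ h _ _ s(2), where P = "\<lambda>a c. c \<in> carrier C \<and> a = p c"])
      (use s(1) ps in \<open>auto simp: continuous_section_def star_ker_def\<close>)
qed

lemma star_along_section:
  assumes "csa A" "csa C" "agreeing_pair C J B \<psi>"
    and "\<And>a. a \<in> carrier A \<Longrightarrow> s a \<in> carrier C" "\<And>a. a \<in> carrier A \<Longrightarrow> s (adj A a) = adj C (s a)"
  shows "star_along A \<psi> s"
  using assms(3-) asymptotic_homD(5)[OF assms(2)] by (auto simp: star_along_def agreeing_pair_def)

lemma kk_homotopy_comp:
  assumes cA: "csa A" and cC: "csa C" and p: "star_hom C A p"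
    and h: "(\<psi>, \<psi>') \<in> en_homotopy C (star_ker C A p) B"
    and s: "continuous_section A C p s" "\<And>a. a \<in> carrier A \<Longrightarrow> s (adj A a) = adj C (s a)"
  shows "(pair_comp \<psi> s, pair_comp \<psi>' s) \<in> kk_homotopy A B"
proof -
  interpret K: codomain "IB B" by (rule codomain_IB)
  note sc = continuous_section_closed[OF cA cC s(1)]
  obtain \<theta> where \<theta>: "agreeing_pair C (star_ker C A p) B \<psi>" "agreeing_pair C (star_ker C A p) B \<psi>'"
    "agreeing_pair C (star_ker C A p) (IB B) \<theta>" "evaluates_to C 0 \<theta> \<psi>" "evaluates_to C 1 \<theta> \<psi>'"
    using h by (auto simp: en_homotopy_def)
  show ?thesis
  proof (rule kk_homotopyI)
    show "kk_cycle A B (pair_comp \<psi> s)"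
      by (rule kk_cycle_section[OF cA cC p \<theta>(1) s(1) star_along_section[where s = s, OF cA cC \<theta>(1) sc s(2)]])
    show "kk_cycle A B (pair_comp \<psi>' s)"
      by (rule kk_cycle_section[OF cA cC p \<theta>(2) s(1) star_along_section[where s = s, OF cA cC \<theta>(2) sc s(2)]])
    show "kk_cycle A (IB B) (pair_comp \<theta> s)"
      by (rule K.kk_cycle_section[OF cA cC p \<theta>(3) s(1) K.star_along_section[where s = s, OF cA cC \<theta>(3) sc s(2)]])
  qed (use \<theta>(4,5) sc in \<open>simp_all add: evaluates_to_def\<close>)
qed

text \<open>Fibres of \<open>p\<close> are affine, so the segment between two section values lies
  over one point, and the segments form a section into paths. The maps of \<open>\<psi>\<close> are
  asymptotically linear, so compatibility with adjoints passes from the two ends to the whole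
  segment.\<close>

lemma kk_homotopy_sections:
  assumes cA: "csa A" and cC: "csa C" and p: "star_hom C A p"
    and h: "agreeing_pair C (star_ker C A p) B \<psi>"
    and s: "continuous_section A C p s" "star_along A \<psi> s"
    and s': "continuous_section A C p s'" "star_along A \<psi> s'"
  shows "(pair_comp \<psi> s, pair_comp \<psi> s') \<in> kk_homotopy A B"
proof -
  interpret A: pre_cstar A using cA by (rule cstar_imp_pre)
  interpret C: codomain C using cC by (rule codomain.intro)
  interpret K: codomain "IB B" by (rule codomain_IB)
  interpret RR: codomain "CR" by (rule codomain_CbR)
  have J: "star_ker C A p \<subseteq> carrier C" by (auto simp: star_ker_def)
  note hD = agreeing_pairD[OF cC J h]
  note pD = star_homD[OF p] star_hom_diff[OF p cC]
  note sc [simp] = continuous_section_closed[OF cA cC s(1)] continuous_section_closed[OF cA cC s'(1)]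
  have ps: "p (s a) = a" "p (s' a) = a" if "a \<in> carrier A" for a
    using s(1) s'(1) that by (simp_all add: continuous_section_def)
  let ?J = "{g \<in> carrier (IB C). \<forall>r. 0 \<le> r \<and> r \<le> 1 \<longrightarrow> g r \<in> star_ker C A p}"
  let ?P = "\<lambda>a g. a \<in> carrier A \<and> g \<in> carrier (IB C) \<and> (\<forall>r. 0 \<le> r \<and> r \<le> 1 \<longrightarrow> p (g r) = a)"
  let ?S = "\<lambda>a. C.segment (s a) (s' a)"
  let ?\<theta> = "(path_map (fst \<psi>), path_map (snd \<psi>))"
  have pS: "p (?S a r) = a" if "a \<in> carrier A" "0 \<le> r" "r \<le> 1" for a r
    using A.scale_add_left[OF that(1), of "of_real (1 - r)" "of_real r"] that ps by (simp add: pD(2,3))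
  have ah: "asymptotic_hom C B \<phi>" if "\<phi> \<in> {fst \<psi>, snd \<psi>}" for \<phi> using that hD(1,2) by auto
  have "kk_cycle A (IB B) (pair_comp ?\<theta> ?S)"
  proof (rule K.kk_cycle_comp[OF cA C.cI, where J = ?J and P = ?P])
    show "?J \<subseteq> carrier (IB C)" by auto
    show "agreeing_pair (IB C) ?J (IB B) ?\<theta>"
    proof (rule K.agreeing_pairI)
      show "asymptotic_hom (IB C) (IB B) (fst ?\<theta>)" "asymptotic_hom (IB C) (IB B) (snd ?\<theta>)"
        using path_map_asymptotic[OF cC] hD by simp_all
      show "K.aeq (fst ?\<theta> j) (snd ?\<theta> j)" if "j \<in> ?J" for j
        using path_map_aeq[OF cC hD(1,2), of j] hD(3) that by simp
    qed
    show "continuous_map (ctop A) (ctop (IB C)) ?S"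
      using s(1) s'(1) by (intro C.segment_continuous[OF cA]) (simp_all add: continuous_section_def)
    show "homogeneous A (IB C) ?S"
      using s(1) s'(1) by (simp add: continuous_section_def homogeneous_def C.segment_scale)
    show "K.star_along A ?\<theta> ?S"
      unfolding K.star_along_def
    proof (intro ballI)
      fix \<theta> a assume "\<theta> \<in> {fst ?\<theta>, snd ?\<theta>}" and a: "a \<in> carrier A"
      then obtain \<phi> where \<phi>: "\<phi> \<in> {fst \<psi>, snd \<psi>}" and \<theta>: "\<theta> = path_map \<phi>" by auto
      note fD = asymptotic_homD[OF cC ah[OF \<phi>]]
      let ?F = "\<lambda>g. \<lambda>r\<in>{0..1}. \<phi> (g r)"
      have Fc: "?F g \<in> carrier (IB CR)" if "g \<in> carrier (IB C)" for g
        by (rule compose_path_closed[OF cC cR fD(6) that])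
      have S: "?S a \<in> carrier (IB C)" "?S (adj A a) \<in> carrier (IB C)" using a by simp_all
      have st: "\<phi> (s (adj A a)) \<simeq> adj CR (\<phi> (s a))" "\<phi> (s' (adj A a)) \<simeq> adj CR (\<phi> (s' a))"
        using s(2) s'(2) \<phi> a unfolding star_along_def by blast+
      have lin: "\<phi> (of_real u .[C] x +[C] of_real v .[C] y) \<simeq> of_real u .[CR] \<phi> x +[CR] of_real v .[CR] \<phi> y"
        if "x \<in> carrier C" "y \<in> carrier C" for u v x y
        using fD(3)[of "of_real u .[C] x" "of_real v .[C] y"] that by (simp add: fD(2))
      have "\<phi> (?S (adj A a) r) \<simeq> adj CR (\<phi> (?S a r))" if r: "0 \<le> r" "r \<le> 1" for r
      proof -
        have "\<phi> (?S (adj A a) r) \<simeq> of_real (1 - r) .[CR] \<phi> (s (adj A a)) +[CR] of_real r .[CR] \<phi> (s' (adj A a))"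
          using lin[of "s (adj A a)" "s' (adj A a)" "1 - r" r] a r by simp
        also have "\<dots> \<simeq> of_real (1 - r) .[CR] adj CR (\<phi> (s a)) +[CR] of_real r .[CR] adj CR (\<phi> (s' a))"
          by (intro aeq_add aeq_scale st)
        also have "\<dots> = adj CR (of_real (1 - r) .[CR] \<phi> (s a) +[CR] of_real r .[CR] \<phi> (s' a))"
          using a fD(1) by (simp add: R.adj_add R.adj_scale)
        also have "\<dots> \<simeq> adj CR (\<phi> (?S a r))"
          by (rule aeq_adj, rule aeq_sym) (use lin[of "s a" "s' a" "1 - r" r] a r in simp)
        finally show ?thesis .
      qed
      then have "K.aeq (flip (?F (?S (adj A a)))) (flip (adj (IB CR) (?F (?S a))))"
        using Fc[OF S(1)] Fc[OF S(2)] by (intro flip_aeq RR.I.adj_closed) simp_all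
      then show "K.aeq (\<theta> (?S (adj A a))) (adj (CbR (IB B)) (\<theta> (?S a)))"
        using star_homD(5)[OF flip_star_hom Fc[OF S(1)]] by (simp add: \<theta> path_map_def)
    qed
    show "?P a (?S a)" if "a \<in> carrier A" for a using that pS by simp
    show "?P (a -[A] b) (c -[IB C] d) \<and> ?P (a *[A] b) (c *[IB C] d)" if "?P a c" "?P b d" for a b c d
      using that pD(4,6) by simp
  qed (auto simp: star_ker_def)
  then show ?thesis
  proof (rule kk_homotopyI[rotated 2])
    show "kk_cycle A B (pair_comp \<psi> s)" by (rule kk_cycle_section[OF cA cC p h s])
    show "kk_cycle A B (pair_comp \<psi> s')" by (rule kk_cycle_section[OF cA cC p h s'])
    show "evaluates_to A 0 (pair_comp ?\<theta> ?S) (pair_comp \<psi> s)" "evaluates_to A 1 (pair_comp ?\<theta> ?S) (pair_comp \<psi> s')"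
      by (simp_all add: evaluates_to_def eval_at_path_map[OF cC hD(1)] eval_at_path_map[OF cC hD(2)])
  qed
qed

end

section \<open>Realising separable C*-subalgebras on sets of reals\<close>

context pre_cstar
begin

fun countable_span :: "complex set \<Rightarrow> 'a set \<Rightarrow> nat \<Rightarrow> 'a set"
  where "countable_span D S 0 = insert (czero A) S"
  | "countable_span D S (Suc n) = (let Q = countable_span D S n in
      Q \<union> (\<lambda>(x, y). x \<boxplus> y) ` (Q \<times> Q) \<union> (\<lambda>(c, x). c \<odot> x) ` (D \<times> Q) \<union> (\<lambda>(x, y). x \<boxdot> y) ` (Q \<times> Q) \<union> adj A ` Q)"

end

text \<open>\<open>Q\<close> is the closure of \<open>Q0\<close> under the operations, with scalars
  taken from a countable dense set. Its norm closure is a C*-algebra: continuity in one argument at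
  a time extends sums and products from \<open>Q\<close>, and density of \<open>D\<close> gives all
  scalars.\<close>

lemma cstar_generated_separable:
  assumes cW: "csa W" and S: "S \<subseteq> carrier W"
    and Q0: "countable Q0" "Q0 \<subseteq> S" "\<And>x e. \<lbrakk>x \<in> S; e > 0\<rbrakk> \<Longrightarrow> \<exists>y\<in>Q0. nrm W (x -[W] y) < e"
  shows "\<exists>Q. countable Q \<and> Q \<subseteq> cstar_generated W S \<and>
    (\<forall>x\<in>cstar_generated W S. \<forall>e>0. \<exists>y\<in>Q. nrm W (x -[W] y) < e)"
proof -
  interpret W: pre_cstar W using cW by (rule cstar_imp_pre)
  let ?E = "cstar_generated W S"
  have E: "cstar_subalgebra W ?E" "S \<subseteq> ?E" by (rule cstar_generated_subalgebra[OF cW S])+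
  note ED = subalgebraD[OF cW E(1)]
  obtain D :: "complex set" where D: "countable D" "\<And>X. \<lbrakk>open X; X \<noteq> {}\<rbrakk> \<Longrightarrow> \<exists>d\<in>D. d \<in> X"
    by (rule countable_dense_setE) blast
  let ?Q = "W.countable_span D Q0"
  have cnt: "countable (?Q n)" for n
    by (induction n) (use Q0(1) D(1) in \<open>auto simp: Let_def intro!: countable_Un countable_image countable_SIGMA\<close>)
  have sub: "?Q n \<subseteq> ?E" for n
  proof (induction n)
    case 0
    then show ?case using Q0(2) E(2) ED(2) by auto
  next
    case (Suc n)
    then have "x \<in> ?E" if "x \<in> ?Q n" for x using that by blast
    then show ?case using ED(3-6) by (auto simp: Let_def)
  qed
  have mono: "?Q n \<subseteq> ?Q (n + k)" for n k by (induction k) (auto simp: Let_def)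
  define Q where "Q = (\<Union>n. ?Q n)"
  have QE: "Q \<subseteq> ?E" using sub by (auto simp: Q_def)
  then have QW: "Q \<subseteq> carrier W" using ED(1) by auto
  have pair: "\<exists>n. x \<in> ?Q n \<and> y \<in> ?Q n" if xy: "x \<in> Q" "y \<in> Q" for x y
  proof -
    obtain m n where "x \<in> ?Q m" "y \<in> ?Q n" using xy by (auto simp: Q_def)
    then have "x \<in> ?Q (m + n)" "y \<in> ?Q (m + n)" using mono[of m n] mono[of n m] by (auto simp: add.commute)
    then show ?thesis by blast
  qed
  have Qadd: "x +[W] y \<in> Q" and Qmult: "x *[W] y \<in> Q" if xy: "x \<in> Q" "y \<in> Q" for x y
  proof -
    obtain n where n: "x \<in> ?Q n" "y \<in> ?Q n" using pair[OF xy] by blast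
    then have "x +[W] y \<in> ?Q (Suc n)" "x *[W] y \<in> ?Q (Suc n)" unfolding W.countable_span.simps Let_def by force+
    then show "x +[W] y \<in> Q" "x *[W] y \<in> Q" unfolding Q_def by blast+
  qed
  have Qscale: "c .[W] x \<in> Q" and Qadj: "adj W x \<in> Q" if xc: "x \<in> Q" "c \<in> D" for x c
  proof -
    obtain n where "x \<in> ?Q n" using xc by (auto simp: Q_def)
    then have "c .[W] x \<in> ?Q (Suc n)" "adj W x \<in> ?Q (Suc n)" using xc unfolding W.countable_span.simps Let_def by force+
    then show "c .[W] x \<in> Q" "adj W x \<in> Q" unfolding Q_def by blast+
  qed
  have Dne: "\<exists>d. d \<in> D" using D(2)[of UNIV] by auto
  let ?F = "ctop W closure_of Q"
  have FW: "x \<in> carrier W" if "x \<in> ?F" for x using closure_of_subset_topspace[of "ctop W" Q] that by auto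
  have QF: "Q \<subseteq> ?F" using QW by (simp add: closure_of_subset)
  have inv: "f x \<in> ?F" if "continuous_map (ctop W) (ctop W) f" "\<And>q. q \<in> Q \<Longrightarrow> f q \<in> ?F" "x \<in> ?F" for f x
  proof -
    have "f ` ?F \<subseteq> ctop W closure_of (f ` Q)" by (rule continuous_map_image_closure_subset[OF that(1)])
    also have "\<dots> \<subseteq> ?F" using that(2) by (intro closure_of_minimal) auto
    finally show ?thesis using that(3) by blast
  qed
  have "cstar_subalgebra W ?F"
  proof (rule closed_star_subalgebra_iff[OF cW])
    have "czero W \<in> ?Q 0" by simp
    then show "czero W \<in> ?F" using QF unfolding Q_def by blast
    fix x assume x: "x \<in> ?F"
    obtain d0 where "d0 \<in> D" using Dne by blast
    then show "adj W x \<in> ?F" using Qadj[OF _ \<open>d0 \<in> D\<close>] QF by (intro inv[OF continuous_adj[OF cW] _ x]) (simp add: subset_iff)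
    show "c .[W] x \<in> ?F" for c
    proof -
      have d: "d .[W] x \<in> ?F" if "d \<in> D" for d
      proof (rule inv[OF _ _ x])
        show "continuous_map (ctop W) (ctop W) (\<lambda>x. d .[W] x)"
          by (rule continuous_lipschitz[OF cW cW, where K = "cmod d"]) (simp_all add: W.scale_diff_right[symmetric] W.nrm_scale)
      qed (use Qscale[OF _ that] QF in blast)
      have "\<exists>y\<in>?F. nrm W (c .[W] x -[W] y) < e" if e: "e > 0" for e
      proof -
        have nx: "0 \<le> nrm W x" using FW[OF x] by simp
        then have "e / (nrm W x + 1) > 0" using e by (simp add: add_nonneg_pos)
        then obtain b where b: "b \<in> D" "cmod (c - b) < e / (nrm W x + 1)"
          using D(2)[of "ball c (e / (nrm W x + 1))"] by (auto simp: dist_norm)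
        have "nrm W (c .[W] x -[W] b .[W] x) = cmod (c - b) * nrm W x"
          using FW[OF x] by (simp add: W.scale_diff_left[symmetric] W.nrm_scale)
        also have "\<dots> \<le> cmod (c - b) * (nrm W x + 1)" by (intro mult_left_mono) auto
        also have "\<dots> < e" using b(2) nx by (simp add: pos_less_divide_eq add_nonneg_pos)
        finally show ?thesis using d[OF b(1)] by blast
      qed
      moreover have "closedin (ctop W) ?F" by simp
      ultimately show ?thesis unfolding W.closedin_ctop_iff using FW[OF x] by simp
    qed
    fix y assume y: "y \<in> ?F"
    have add: "continuous_map (ctop W) (ctop W) (\<lambda>z. z +[W] w)" "continuous_map (ctop W) (ctop W) (\<lambda>z. w +[W] z)"
      if "w \<in> carrier W" for w
      using that by (auto intro!: continuous_lipschitz[OF cW cW, where K = 1] simp: W.add_diff_add)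
    have "x +[W] q \<in> ?F" if "q \<in> Q" for q
      using Qadd[OF _ that] QF that QW by (intro inv[OF add(1) _ x]) auto
    then show "x +[W] y \<in> ?F" by (rule inv[OF add(2)[OF FW[OF x]] _ y])
    have "x *[W] q \<in> ?F" if "q \<in> Q" for q
      using Qmult[OF _ that] QF that QW by (intro inv[OF continuous_mult(1)[OF cW] _ x]) auto
    then show "x *[W] y \<in> ?F" by (rule inv[OF continuous_mult(2)[OF cW FW[OF x]] _ y])
  qed simp
  moreover have "S \<subseteq> ?F"
  proof
    fix x assume x: "x \<in> S"
    have "Q0 \<subseteq> ?Q 0" by auto
    then have "Q0 \<subseteq> Q" unfolding Q_def by blast
    then have "\<exists>y\<in>Q. nrm W (x -[W] y) < e" if "e > 0" for e using Q0(3)[OF x that] by blast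
    then show "x \<in> ?F" using x S by (auto simp: W.closure_of_ctop[OF QW])
  qed
  ultimately have "?E \<subseteq> ?F" by (rule cstar_generated_minimal)
  then have "\<forall>x\<in>?E. \<forall>e>0. \<exists>y\<in>Q. nrm W (x -[W] y) < e" by (auto simp: W.closure_of_ctop[OF QW])
  moreover have "countable Q" unfolding Q_def using cnt by simp
  ultimately show ?thesis using QE by blast
qed

text \<open>An element of \<open>E\<close> is determined by the balls of radius
  \<open>1 / (k + 1)\<close> around points of \<open>Q\<close> that contain it. This is a set of
  natural numbers after coding pairs, and sets of natural numbers inject into the reals.\<close>

lemma separable_inj_real:
  assumes cW: "csa W" and Q: "countable Q" "Q \<subseteq> carrier W" and E: "E \<subseteq> carrier W"
    and dense: "\<And>x e. \<lbrakk>x \<in> E; e > 0\<rbrakk> \<Longrightarrow> \<exists>y\<in>Q. nrm W (x -[W] y) < e"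
  shows "\<exists>\<iota> :: 'w \<Rightarrow> real. inj_on \<iota> E"
proof -
  interpret W: pre_cstar W using cW by (rule cstar_imp_pre)
  obtain \<kappa> :: "nat set \<Rightarrow> real" where \<kappa>: "inj \<kappa>"
    using nat_sets_eqpoll_reals unfolding eqpoll_def bij_betw_def by blast
  show ?thesis
  proof (cases "Q = {}")
    case True
    then have "E = {}" using dense[of _ 1] by auto
    then show ?thesis by simp
  next
    case False
    let ?q = "from_nat_into Q"
    let ?N = "\<lambda>x. {n. case prod_decode n of (m, k) \<Rightarrow> nrm W (x -[W] ?q m) < inverse (real (Suc k))}"
    have q: "?q m \<in> carrier W" for m using from_nat_into[OF False] Q(2) by auto
    have "inj_on ?N E"
    proof (rule inj_onI)
      fix x y assume x: "x \<in> E" and y: "y \<in> E" and eq: "?N x = ?N y"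
      have xW: "x \<in> carrier W" "y \<in> carrier W" using x y E by auto
      show "x = y"
      proof (rule W.eqI_nrm[OF xW])
        fix e :: real assume "e > 0"
        then obtain k where k: "inverse (real (Suc k)) < e / 2" using reals_Archimedean[of "e / 2"] by auto
        obtain z where z: "z \<in> Q" "nrm W (x -[W] z) < inverse (real (Suc k))" using dense[OF x, of "inverse (real (Suc k))"] by auto
        obtain m where m: "z = ?q m" using z(1) from_nat_into_surj[OF Q(1)] by metis
        have "prod_encode (m, k) \<in> ?N x" using z(2) m by simp
        then have "prod_encode (m, k) \<in> ?N y" unfolding eq .
        then have "nrm W (y -[W] z) < inverse (real (Suc k))" using m by simp
        then show "nrm W (x -[W] y) \<le> e"
          using W.nrm_diff_triangle[OF xW(1) q xW(2), of m] W.nrm_diff_commute[OF xW(2) q, of m] z(2) k m by simp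
      qed
    qed
    then have "inj_on (\<kappa> \<circ> ?N) E" using \<kappa> by (intro comp_inj_on) (auto intro: inj_on_subset)
    then show ?thesis by blast
  qed
qed

text \<open>The indices of the limit are algebras whose elements are real numbers, so a separable
  subalgebra is copied there along an injection, operations and norm included.\<close>

lemma realisation:
  fixes W :: "'w cstar" and A :: "'a cstar"
  assumes cW: "csa W" and E: "cstar_subalgebra W E"
    and Q: "countable Q" "Q \<subseteq> E" "\<And>x e. \<lbrakk>x \<in> E; e > 0\<rbrakk> \<Longrightarrow> \<exists>y\<in>Q. nrm W (x -[W] y) < e"
    and P: "star_epi (sub_cstar W E) A P"
  shows "\<exists>Z j. Z \<in> extensions A \<and> star_hom (fst Z) W j \<and> bij_betw j (carrier (fst Z)) E \<and>
    (\<forall>z\<in>carrier (fst Z). snd Z z = P (j z) \<and> nrm (fst Z) z = nrm W (j z))"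
proof -
  interpret W: pre_cstar W using cW by (rule cstar_imp_pre)
  note ED = subalgebraD[OF cW E]
  obtain \<iota> :: "'w \<Rightarrow> real" where \<iota>: "inj_on \<iota> E"
    using separable_inj_real[OF cW Q(1) _ ED(1) Q(3)] Q(2) ED(1) by blast
  define g where "g = the_inv_into E \<iota>"
  define C :: "real cstar" where "C = \<lparr>carrier = \<iota> ` E, czero = \<iota> (czero W), cadd = (\<lambda>x y. \<iota> (g x +[W] g y)),
    cscale = (\<lambda>c x. \<iota> (c .[W] g x)), cmult = (\<lambda>x y. \<iota> (g x *[W] g y)), adj = (\<lambda>x. \<iota> (adj W (g x))),
    nrm = (\<lambda>x. nrm W (g x))\<rparr>"
  have g\<iota>: "g (\<iota> x) = x" if "x \<in> E" for x using the_inv_into_f_f[OF \<iota> that] by (simp add: g_def)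
  have gE: "g x \<in> E" if "x \<in> carrier C" for x using that g\<iota> by (auto simp: C_def)
  have bij: "bij_betw g (carrier C) E"
    unfolding g_def C_def by (simp add: bij_betw_the_inv_into \<iota> bij_betw_imageI)
  have ops: "czero C \<in> carrier C" "g (czero C) = czero W"
      "\<lbrakk>x \<in> carrier C; y \<in> carrier C\<rbrakk> \<Longrightarrow> x +[C] y \<in> carrier C \<and> g (x +[C] y) = g x +[W] g y"
      "x \<in> carrier C \<Longrightarrow> c .[C] x \<in> carrier C \<and> g (c .[C] x) = c .[W] g x"
      "\<lbrakk>x \<in> carrier C; y \<in> carrier C\<rbrakk> \<Longrightarrow> x *[C] y \<in> carrier C \<and> g (x *[C] y) = g x *[W] g y"
      "x \<in> carrier C \<Longrightarrow> adj C x \<in> carrier C \<and> g (adj C x) = adj W (g x)" for x y c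
    using gE[of x] gE[of y] ED(2-6) g\<iota> by (auto simp: C_def)
  have nrm: "nrm C x = nrm W (g x)" for x by (simp add: C_def)
  have cC: "csa C" by (rule cstar_isometric_image[OF cW E bij ops nrm])
  interpret C: pre_cstar C using cC by (rule cstar_imp_pre)
  have g_hom: "star_hom C (sub_cstar W E) g"
    unfolding star_hom_def using ops gE by (auto simp: Pi_iff)
  have g_diff: "g (x -[C] y) = g x -[W] g y" if "x \<in> carrier C" "y \<in> carrier C" for x y
    using star_hom_diff[OF g_hom cC that] by simp
  have "separable C"
    unfolding C.separable_iff
  proof (intro exI conjI ballI allI impI)
    show "countable (\<iota> ` Q)" using Q(1) by simp
    show "\<iota> ` Q \<subseteq> carrier C" using Q(2) by (auto simp: C_def)
    fix x e assume x: "x \<in> carrier C" and e: "(e :: real) > 0"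
    obtain y where y: "y \<in> Q" "nrm W (g x -[W] y) < e" using Q(3)[OF gE[OF x] e] by blast
    have "\<iota> y \<in> carrier C" "y \<in> E" using y Q(2) by (auto simp: C_def)
    then show "\<exists>y\<in>\<iota> ` Q. nrm C (x -[C] y) < e" using y x g_diff g\<iota> by (intro bexI[of _ "\<iota> y"]) (simp_all add: nrm)
  qed
  moreover have "star_epi C A (P \<circ> g)"
  proof -
    have "star_hom C A (P \<circ> g)" using P g_hom by (intro star_hom_compose) (simp_all add: star_epi_def)
    moreover have "(P \<circ> g) ` carrier C = carrier A"
      using P bij by (simp add: star_epi_def bij_betw_def image_comp[symmetric] del: o_apply)
    ultimately show ?thesis by (simp add: star_epi_def)
  qed
  ultimately have "(C, P \<circ> g) \<in> extensions A" using cC by (simp add: extensions_def)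
  moreover have "star_hom C W g"
    using g_hom ED(1) by (auto simp: star_hom_def Pi_iff)
  ultimately show ?thesis using bij by (intro exI[of _ "(C, P \<circ> g)"] exI[of _ g]) (simp add: nrm)
qed

section \<open>Equalizers\<close>

lemma star_hom_equalizer:
  assumes cW: "csa W" and cV: "csa V" and f: "star_hom W V f" and g: "star_hom W V g"
  shows "cstar_subalgebra W {w \<in> carrier W. f w = g w}"
proof -
  interpret W: pre_cstar W using cW by (rule cstar_imp_pre)
  interpret V: pre_cstar V using cV by (rule cstar_imp_pre)
  have "closedin (ctop V) {czero V}"
  proof -
    have "x = czero V" if x: "x \<in> carrier V" and lim: "\<forall>e>0. \<exists>y\<in>{czero V}. nrm V (x -[V] y) < e" for x
      by (rule V.eqI_nrm[OF x]) (use lim in \<open>auto simp: less_imp_le\<close>)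
    then show ?thesis unfolding V.closedin_ctop_iff by simp
  qed
  then have "closedin (ctop W) {w \<in> topspace (ctop W). f w -[V] g w \<in> {czero V}}"
    by (rule closedin_continuous_map_preimage[OF continuous_diff[OF cW cV star_hom_continuous[OF cW cV f] star_hom_continuous[OF cW cV g]]])
  moreover have "f w -[V] g w \<in> {czero V} \<longleftrightarrow> f w = g w" if "w \<in> carrier W" for w
    using star_homD(1)[OF f that] star_homD(1)[OF g that] by (simp add: V.diff_eq_0)
  then have "{w \<in> topspace (ctop W). f w -[V] g w \<in> {czero V}} = {w \<in> carrier W. f w = g w}" by auto
  ultimately have "closedin (ctop W) {w \<in> carrier W. f w = g w}" by simp
  then show ?thesis
    using star_homD[OF f] star_homD[OF g] star_hom_zero[OF f cW cV] star_hom_zero[OF g cW cV]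
    by (intro closed_star_subalgebra_iff[OF cW]) simp_all
qed

context codomain
begin

section \<open>Comparing asymptotic homomorphisms\<close>

lemma asymptotic_equalizer:
  assumes cW: "csa W" and f: "asymptotic_hom W B f" and g: "asymptotic_hom W B g"
  shows "cstar_subalgebra W {w \<in> carrier W. f w \<simeq> g w}"
proof -
  interpret W: pre_cstar W using cW by (rule cstar_imp_pre)
  note fD = asymptotic_homD[OF cW f] and gD = asymptotic_homD[OF cW g]
  have "closedin (ctop W) {w \<in> topspace (ctop W). f w -[CR] g w \<in> C0R B}"
    by (rule closedin_continuous_map_preimage[OF continuous_diff[OF cW cR fD(6) gD(6)] C0R_closed])
  moreover have "{w \<in> topspace (ctop W). f w -[CR] g w \<in> C0R B} = {w \<in> carrier W. f w \<simeq> g w}"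
    using fD(1) gD(1) by (auto simp: aeq_diff_iff)
  ultimately have closed: "closedin (ctop W) {w \<in> carrier W. f w \<simeq> g w}" by simp
  show ?thesis
  proof (rule closed_star_subalgebra_iff[OF cW closed])
    show "czero W \<in> {w \<in> carrier W. f w \<simeq> g w}" by (simp add: fD(9) gD(9))
    fix x assume x: "x \<in> {w \<in> carrier W. f w \<simeq> g w}"
    show "c .[W] x \<in> {w \<in> carrier W. f w \<simeq> g w}" for c
      using x by (simp add: fD(2) gD(2) aeq_scale)
    have "f (adj W x) \<simeq> g (adj W x)"
      using x by (intro aeq_trans[OF fD(5) aeq_trans[OF aeq_adj aeq_sym[OF gD(5)]]]) simp_all
    then show "adj W x \<in> {w \<in> carrier W. f w \<simeq> g w}" using x by simp
    fix y assume y: "y \<in> {w \<in> carrier W. f w \<simeq> g w}"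
    have "f (x +[W] y) \<simeq> g (x +[W] y)"
      using x y by (intro aeq_trans[OF fD(3) aeq_trans[OF aeq_add aeq_sym[OF gD(3)]]]) simp_all
    then show "x +[W] y \<in> {w \<in> carrier W. f w \<simeq> g w}" using x y by simp
    have "f (x *[W] y) \<simeq> g (x *[W] y)"
      using x y by (intro aeq_trans[OF fD(4) aeq_trans[OF aeq_mult aeq_sym[OF gD(4)]]]) simp_all
    then show "x *[W] y \<in> {w \<in> carrier W. f w \<simeq> g w}" using x y by simp
  qed
qed

end

section \<open>Extensions built from cycles and homotopies\<close>

lemma continuous_pair:
  assumes cW: "csa W" and cV: "csa V" and cU: "csa U"
    and f: "continuous_map (ctop W) (ctop V) f" and g: "continuous_map (ctop W) (ctop U) g"
  shows "continuous_map (ctop W) (ctop (prod_cstar V U)) (\<lambda>w. (f w, g w))"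
proof -
  interpret V: pre_cstar V using cV by (rule cstar_imp_pre)
  interpret U: pre_cstar U using cU by (rule cstar_imp_pre)
  show ?thesis
    by (rule continuous_dominated[OF cW cV cU cstar_prod[OF cV cU] f g, where K = 1])
      (use continuous_ctop_closed[OF cW cV f] continuous_ctop_closed[OF cW cU g] in simp_all)
qed

lemma dense_image:
  assumes cW: "csa W" and cC: "csa C" and sep: "separable C"
    and f: "continuous_map (ctop C) (ctop W) f"
  shows "\<exists>Q. countable Q \<and> Q \<subseteq> f ` carrier C \<and> (\<forall>x\<in>f ` carrier C. \<forall>e>0. \<exists>y\<in>Q. nrm W (x -[W] y) < e)"
proof -
  interpret C: pre_cstar C using cC by (rule cstar_imp_pre)
  obtain Q where Q: "countable Q" "Q \<subseteq> carrier C" "\<forall>x\<in>carrier C. \<forall>e>0. \<exists>y\<in>Q. nrm C (x -[C] y) < e"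
    using sep unfolding C.separable_iff by blast
  have "\<exists>y\<in>f ` Q. nrm W (f c -[W] y) < e" if c: "c \<in> carrier C" and e: "e > 0" for c e
  proof -
    obtain d where d: "d > 0" "\<forall>b\<in>carrier C. nrm C (c -[C] b) < d \<longrightarrow> nrm W (f c -[W] f b) < e"
      using f c e unfolding continuous_ctop_iff[OF cC cW] by blast
    obtain y where "y \<in> Q" "nrm C (c -[C] y) < d" using Q(3) c d(1) by blast
    then show ?thesis using d(2) Q(2) by blast
  qed
  then show ?thesis using Q(1,2) by (intro exI[of _ "f ` Q"]) auto
qed

lemma generated_equalizer:
  assumes cW: "csa W" and cV: "csa V" and f: "star_hom W V f" and g: "star_hom W V g"
    and S: "S \<subseteq> carrier W" and eq: "\<And>w. w \<in> S \<Longrightarrow> f w = g w" and w: "w \<in> cstar_generated W S"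
  shows "f w = g w"
  using cstar_generated_minimal[OF star_hom_equalizer[OF cW cV f g], of S] S eq w by blast

lemma star_hom_sub: "\<lbrakk>star_hom W V f; E \<subseteq> carrier W\<rbrakk> \<Longrightarrow> star_hom (sub_cstar W E) V f"
  by (simp add: star_hom_def Pi_iff subset_iff)

lemma extensionsD:
  assumes "X \<in> extensions A"
  shows "csa (fst X)" "separable (fst X)" "star_hom (fst X) A (snd X)" "snd X ` carrier (fst X) = carrier A"
  using assms by (auto simp: extensions_def star_epi_def)

lemma sectionsD:
  assumes cA: "csa A" and X: "X \<in> extensions A" and s: "s \<in> sections A X"
  shows "continuous_section A (fst X) (snd X) s" "a \<in> carrier A \<Longrightarrow> s (adj A a) = adj (fst X) (s a)"
    "a \<in> carrier A \<Longrightarrow> s a \<in> carrier (fst X)" "a \<in> carrier A \<Longrightarrow> snd X (s a) = a"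
    "continuous_map (ctop A) (ctop (fst X)) s"
proof -
  show *: "continuous_section A (fst X) (snd X) s" using s by (simp add: sections_def continuous_section_def)
  show "a \<in> carrier A \<Longrightarrow> s a \<in> carrier (fst X)" by (rule continuous_section_closed[OF cA extensionsD(1)[OF X] *])
qed (use s in \<open>simp_all add: sections_def\<close>)

context codomain
begin

text \<open>The set where two asymptotic homomorphisms agree modulo \<open>C\<^sub>0\<close> is a
  C*-algebra, so agreement has to be checked on generators only.\<close>

lemma generated_aeq:
  assumes cW: "csa W" and f: "asymptotic_hom W B f" and g: "asymptotic_hom W B g"
    and S: "S \<subseteq> carrier W" and eq: "\<And>w. w \<in> S \<Longrightarrow> f w \<simeq> g w" and w: "w \<in> cstar_generated W S"
  shows "f w \<simeq> g w"
  using cstar_generated_minimal[OF asymptotic_equalizer[OF cW f g], of S] S eq w by blast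

text \<open>Pairs are functions on the whole type, but a homotopy constrains its ends on the carrier
  only; the same homotopy therefore ends at \<open>\<Psi>'\<close>.\<close>

lemma kk_homotopy_cong:
  assumes h: "(\<Phi>, \<Psi>) \<in> kk_homotopy A B" and "kk_cycle A B \<Psi>'"
    and "\<And>a. a \<in> carrier A \<Longrightarrow> fst \<Psi>' a = fst \<Psi> a \<and> snd \<Psi>' a = snd \<Psi> a"
  shows "(\<Phi>, \<Psi>') \<in> kk_homotopy A B"
  using assms unfolding kk_homotopy_def by (auto simp: evaluates_to_def)

end


lemma realise_generated:
  fixes W :: "'w cstar" and A :: "'a cstar"
  assumes cW: "csa W" and S: "S \<subseteq> carrier W"
    and Q: "countable Q" "Q \<subseteq> S" "\<forall>x\<in>S. \<forall>e>0. \<exists>y\<in>Q. nrm W (x -[W] y) < e"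
    and P: "star_hom W A P" "carrier A \<subseteq> P ` S"
  shows "\<exists>Z j. Z \<in> extensions A \<and> star_hom (fst Z) W j \<and> bij_betw j (carrier (fst Z)) (cstar_generated W S) \<and>
    (\<forall>z\<in>carrier (fst Z). snd Z z = P (j z) \<and> nrm (fst Z) z = nrm W (j z))"
proof -
  let ?E = "cstar_generated W S"
  note E = cstar_generated_subalgebra[OF cW S]
  have EW: "?E \<subseteq> carrier W" by (rule subalgebraD(1)[OF cW E(1)])
  have "P ` ?E = carrier A" using star_homD(1)[OF P(1)] EW P(2) E(2) by blast
  then have epi: "star_epi (sub_cstar W ?E) A P"
    using star_hom_sub[OF P(1) EW] by (simp add: star_epi_def)
  obtain Q' where Q': "countable Q'" "Q' \<subseteq> ?E" "\<forall>x\<in>?E. \<forall>e>0. \<exists>y\<in>Q'. nrm W (x -[W] y) < e"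
    using cstar_generated_separable[OF cW S Q(1,2)] Q(3) by blast
  show ?thesis using realisation[OF cW E(1) Q'(1,2) _ epi] Q'(3) by blast
qed

section \<open>Surjectivity: the extension of a cycle\<close>

context codomain
begin

lemma cycle_from_extension:
  assumes cA: "csa A" and sep: "separable A" and h: "kk_cycle A B \<Phi>"
  shows "\<exists>Z \<psi>. Z \<in> extensions A \<and> agreeing_pair (fst Z) (ext_ker A Z) B \<psi> \<and>
    (\<forall>s\<in>sections A Z. (pair_comp \<psi> s, \<Phi>) \<in> kk_homotopy A B)"
proof -
  note maps = kk_cycle_maps[OF cA h]
  let ?V = "prod_cstar CR CR"
  let ?W = "prod_cstar A ?V"
  have cV: "csa ?V" by (rule cstar_prod[OF cR cR])
  have cW: "csa ?W" by (rule cstar_prod[OF cA cV])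
  define u where "u = (\<lambda>a. (a, fst \<Phi> a, snd \<Phi> a))"
  have S: "u ` carrier A \<subseteq> carrier ?W" using kk_map_closed[OF cA] maps by (auto simp: u_def)
  have cont: "continuous_map (ctop A) (ctop ?W) u"
    unfolding u_def using maps by (intro continuous_pair cA cV cR) (simp_all add: kk_map_def)
  obtain Q0 where Q0: "countable Q0" "Q0 \<subseteq> u ` carrier A"
      "\<forall>x\<in>u ` carrier A. \<forall>e>0. \<exists>y\<in>Q0. nrm ?W (x -[?W] y) < e"
    using dense_image[OF cW cA sep cont] by blast
  have "carrier A \<subseteq> fst ` u ` carrier A" by (auto simp: u_def image_image)
  then obtain Z j where Z: "Z \<in> extensions A" and j: "star_hom (fst Z) ?W j"
      "bij_betw j (carrier (fst Z)) (cstar_generated ?W (u ` carrier A))"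
    and Zj: "\<And>z. z \<in> carrier (fst Z) \<Longrightarrow> snd Z z = fst (j z) \<and> nrm (fst Z) z = nrm ?W (j z)"
    using realise_generated[OF cW S Q0 prod_homs(1)] by blast
  note Zext = extensionsD[OF Z]
  define \<psi> where "\<psi> = (fst \<circ> (snd \<circ> j), snd \<circ> (snd \<circ> j))"
  \<comment> \<open>The algebra of all triples serves only as an upper bound for the generated one:
    inside it, coordinates over 0 agree.\<close>
  obtain Q where Q: "cstar_subalgebra ?W Q" "\<And>a. a \<in> carrier A \<Longrightarrow> u a \<in> Q"
      "\<And>e e'. (czero A, e, e') \<in> Q \<Longrightarrow> e \<simeq> e'"
    using cycle_algebra[OF cA h] unfolding u_def by blast
  have jQ: "j z \<in> Q" if "z \<in> carrier (fst Z)" for z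
    using cstar_generated_minimal[OF Q(1), of "u ` carrier A"] Q(2) bij_betwE[OF j(2)] that by blast
  have agree: "agreeing_pair (fst Z) (ext_ker A Z) B \<psi>"
  proof (rule agreeing_pairI)
    show "asymptotic_hom (fst Z) B (fst \<psi>)" "asymptotic_hom (fst Z) B (snd \<psi>)"
      using star_hom_asymptotic[OF Zext(1) star_hom_compose[OF prod_homs(1) star_hom_compose[OF prod_homs(2) j(1)]]]
        star_hom_asymptotic[OF Zext(1) star_hom_compose[OF prod_homs(2) star_hom_compose[OF prod_homs(2) j(1)]]]
      by (simp_all add: \<psi>_def)
    fix z assume "z \<in> ext_ker A Z"
    then have "z \<in> carrier (fst Z)" "fst (j z) = czero A" using Zj by (auto simp: ext_ker_def star_ker_def)
    then show "fst \<psi> z \<simeq> snd \<psi> z"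
      using Q(3)[of "fst \<psi> z" "snd \<psi> z"] jQ[of z] by (metis \<psi>_def comp_apply fst_conv prod.collapse snd_conv)
  qed
  \<comment> \<open>The tautological section. Composing \<open>\<psi>\<close> with it returns
    \<open>\<Phi>\<close> on the nose, but it respects adjoints only modulo \<open>C\<^sub>0\<close>
    after \<open>\<psi>\<close>, so it may fail to be in \<open>sections A Z\<close> and is compared
    with these by \<open>kk_homotopy_sections\<close>.\<close>
  define t where "t = (\<lambda>a. inv_into (carrier (fst Z)) j (u a))"
  have t: "t a \<in> carrier (fst Z)" "j (t a) = u a" if "a \<in> carrier A" for a
  proof -
    have "u a \<in> j ` carrier (fst Z)"
      using j(2) cstar_generated_subalgebra(2)[OF cW S] that unfolding bij_betw_def by blast
    then show "t a \<in> carrier (fst Z)" "j (t a) = u a" unfolding t_def by (rule inv_into_into, rule f_inv_into_f)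
  qed
  have inj: "z = z'" if "z \<in> carrier (fst Z)" "z' \<in> carrier (fst Z)" "j z = j z'" for z z'
    using j(2) that unfolding bij_betw_def inj_on_def by blast
  interpret Z: pre_cstar "fst Z" using Zext(1) by (rule cstar_imp_pre)
  interpret A: pre_cstar A using cA by (rule cstar_imp_pre)
  have "continuous_map (ctop A) (ctop (fst Z)) t"
    unfolding continuous_ctop_iff[OF cA Zext(1)]
  proof (intro conjI ballI allI impI)
    show "t \<in> carrier A \<rightarrow> carrier (fst Z)" using t by blast
    fix a and e :: real assume "a \<in> carrier A" "e > 0"
    moreover have "nrm (fst Z) (t a -[fst Z] t b) = nrm ?W (u a -[?W] u b)" if "a \<in> carrier A" "b \<in> carrier A" for a b
      using Zj[of "t a -[fst Z] t b"] star_hom_diff[OF j(1) Zext(1)] t that by simp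
    ultimately show "\<exists>d>0. \<forall>b\<in>carrier A. nrm A (a -[A] b) < d \<longrightarrow> nrm (fst Z) (t a -[fst Z] t b) < e"
      using cont unfolding continuous_ctop_iff[OF cA cW] by simp
  qed
  moreover have "t (c .[A] a) = c .[fst Z] t a" if a: "a \<in> carrier A" for c a
  proof (rule inj)
    have "u (c .[A] a) = c .[?W] u a"
      using maps a by (simp add: u_def kk_map_def homogeneous_def)
    then show "j (t (c .[A] a)) = j (c .[fst Z] t a)" using star_homD(3)[OF j(1) t(1)[OF a], of c] t a by simp
  qed (use t a in simp_all)
  ultimately have "continuous_section A (fst Z) (snd Z) t"
    using t Zj by (auto simp: continuous_section_def homogeneous_def u_def)
  moreover have \<psi>t: "fst \<psi> (t a) = fst \<Phi> a \<and> snd \<psi> (t a) = snd \<Phi> a" if "a \<in> carrier A" for a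
    using t[OF that] by (simp add: \<psi>_def u_def)
  moreover have "star_along A \<psi> t"
    using maps \<psi>t by (auto simp: star_along_def kk_map_def)
  ultimately have st: "(pair_comp \<psi> s, pair_comp \<psi> t) \<in> kk_homotopy A B" if s: "s \<in> sections A Z" for s
    using kk_homotopy_sections[OF cA Zext(1,3) agree[unfolded ext_ker_def] _ star_along_section[OF cA Zext(1) agree]]
      sectionsD[OF cA Z s] by blast
  have "(pair_comp \<psi> s, \<Phi>) \<in> kk_homotopy A B" if "s \<in> sections A Z" for s
    using kk_homotopy_cong[OF st[OF that] h] \<psi>t by simp
  with Z agree show ?thesis by blast
qed

end


section \<open>Injectivity: the extension of a homotopy of cycles\<close>

context codomain begin

text \<open>
  For a cycle homotopy \<open>\<Theta>\<close> from \<open>\<psi> \<circ> s\<close> to \<open>\<phi> \<circ> s'\<close>, the extension is generated by the quadruples of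
  the segment from \<open>x\<close> to \<open>s a\<close>, the segment from \<open>s' a\<close> to \<open>y\<close>, \<open>\<Theta>\<^sup>+ a\<close> and \<open>\<Theta>\<^sup>- a\<close> with \<open>x\<close>, \<open>y\<close> over \<open>a\<close>.
  With \<open>F r\<close>, \<open>G r\<close> the evaluations of the segments, \<open>\<psi> \<circ> F 0\<close> is homotopic to \<open>\<psi> \<circ> F 1\<close>, which
  equals the evaluation of the last two coordinates at \<open>0\<close> modulo \<open>C\<^sub>0\<close>; similarly for \<open>\<phi> \<circ> G\<close> at \<open>1\<close>.
\<close>

lemma homotopy_from_extension:
  fixes A :: "'a cstar"
  assumes cA: "csa A" and X: "X \<in> extensions A" and Y: "Y \<in> extensions A"
    and \<psi>: "agreeing_pair (fst X) (ext_ker A X) B \<psi>" and \<phi>: "agreeing_pair (fst Y) (ext_ker A Y) B \<phi>"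
    and s: "s \<in> sections A X" and s': "s' \<in> sections A Y"
    and h: "(pair_comp \<psi> s, pair_comp \<phi> s') \<in> kk_homotopy A B"
  shows "\<exists>Z l m. Z \<in> extensions A \<and> over_map X Z l \<and> over_map Y Z m \<and>
    (pair_comp \<psi> l, pair_comp \<phi> m) \<in> en_homotopy (fst Z) (ext_ker A Z) B"
proof -
  obtain C p where Xd: "X = (C, p)" by (cases X)
  obtain D q where Yd: "Y = (D, q)" by (cases Y)
  note Xe = extensionsD[OF X, unfolded Xd fst_conv snd_conv] and Ye = extensionsD[OF Y, unfolded Yd fst_conv snd_conv]
  note ss = sectionsD[OF cA X s, unfolded Xd fst_conv snd_conv] and ss' = sectionsD[OF cA Y s', unfolded Yd fst_conv snd_conv]
  interpret C: codomain C using Xe(1) by (rule codomain.intro)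
  interpret D: codomain D using Ye(1) by (rule codomain.intro)
  interpret BI: codomain "IB B" by (rule codomain_IB)
  interpret A: pre_cstar A using cA by (rule cstar_imp_pre)
  obtain \<Theta> where \<Theta>: "kk_cycle A (IB B) \<Theta>"
    and \<Theta>0: "\<And>a. a \<in> carrier A \<Longrightarrow> eval_at 0 (fst \<Theta> a) = fst \<psi> (s a) \<and> eval_at 0 (snd \<Theta> a) = snd \<psi> (s a)"
    and \<Theta>1: "\<And>a. a \<in> carrier A \<Longrightarrow> eval_at 1 (fst \<Theta> a) = fst \<phi> (s' a) \<and> eval_at 1 (snd \<Theta> a) = snd \<phi> (s' a)"
    using h by (auto simp: kk_homotopy_def evaluates_to_def)
  note maps = BI.kk_cycle_maps[OF cA \<Theta>]
  let ?R = "CbR (IB B)"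
  let ?U = "prod_cstar ?R ?R" let ?V = "prod_cstar (IB D) ?U" let ?W = "prod_cstar (IB C) ?V"
  have cU: "csa ?U" by (rule cstar_prod[OF BI.cR BI.cR])
  have cV: "csa ?V" by (rule cstar_prod[OF D.cI cU])
  have cW: "csa ?W" by (rule cstar_prod[OF C.cI cV])
  define w where "w = (\<lambda>x y a. (C.segment x (s a), D.segment (s' a) y, fst \<Theta> a, snd \<Theta> a))"
  define F where "F = (\<lambda>r (z :: (real \<Rightarrow> real) \<times> (real \<Rightarrow> real) \<times> (real \<Rightarrow> real \<Rightarrow> 'b) \<times> (real \<Rightarrow> real \<Rightarrow> 'b)). fst z r)"
  define G where "G = (\<lambda>r (z :: (real \<Rightarrow> real) \<times> (real \<Rightarrow> real) \<times> (real \<Rightarrow> real \<Rightarrow> 'b) \<times> (real \<Rightarrow> real \<Rightarrow> 'b)). fst (snd z) r)"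
  have hF: "star_hom ?W C (F r)" if "0 \<le> r" "r \<le> 1" for r
    using star_hom_compose[OF codomain_hom.k[OF C.eval_hom[OF that]] prod_homs(1)] by (simp add: F_def o_def)
  have hG: "star_hom ?W D (G r)" if "0 \<le> r" "r \<le> 1" for r
    using star_hom_compose[OF codomain_hom.k[OF D.eval_hom[OF that]] star_hom_compose[OF prod_homs(1,2)]] by (simp add: G_def o_def)
  let ?e = "fst \<circ> (snd \<circ> snd)" and ?e' = "snd \<circ> (snd \<circ> snd)"
  have he: "star_hom ?W ?R ?e" "star_hom ?W ?R ?e'"
    by (rule star_hom_compose[OF prod_homs(1) star_hom_compose[OF prod_homs(2,2)]]
        star_hom_compose[OF prod_homs(2) star_hom_compose[OF prod_homs(2,2)]])+
  \<comment> \<open>In each family one of \<open>x\<close> and \<open>y\<close> is free and the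
    other is a section value. The first family makes the evaluation \<open>F 0\<close> map onto
    \<open>C\<close>, the second makes \<open>G 1\<close> map onto \<open>D\<close>, and each is a
    continuous image of a separable algebra.\<close>
  define S where "S = (\<lambda>x. w x (s' (p x)) (p x)) ` carrier C \<union> (\<lambda>y. w (s (q y)) y (q y)) ` carrier D"
  have Scases: "\<exists>x y a. v = w x y a \<and> x \<in> carrier C \<and> y \<in> carrier D \<and> a \<in> carrier A \<and> p x = a \<and> q y = a" if "v \<in> S" for v
    using that unfolding S_def
  proof (elim UnE imageE)
    fix x assume x: "x \<in> carrier C" "v = w x (s' (p x)) (p x)"
    have "p x \<in> carrier A" using star_homD(1)[OF Xe(3) x(1)] .
    with x show ?thesis using ss'(3,4)[of "p x"] by metis
  next
    fix y assume y: "y \<in> carrier D" "v = w (s (q y)) y (q y)"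
    have "q y \<in> carrier A" using star_homD(1)[OF Ye(3) y(1)] .
    with y show ?thesis using ss(3,4)[of "q y"] by metis
  qed
  have wW: "w x y a \<in> carrier ?W" if "x \<in> carrier C" "y \<in> carrier D" "a \<in> carrier A" for x y a
    using that ss(3) ss'(3) BI.kk_map_closed[OF cA maps(1)] BI.kk_map_closed[OF cA maps(2)] by (simp add: w_def)
  have S: "S \<subseteq> carrier ?W" using Scases wW by blast
  have \<Theta>c: "continuous_map (ctop A) (ctop ?R) (fst \<Theta>)" "continuous_map (ctop A) (ctop ?R) (snd \<Theta>)"
    using maps by (simp_all add: BI.kk_map_def)
  have cont1: "continuous_map (ctop C) (ctop ?W) (\<lambda>x. w x (s' (p x)) (p x))" (is ?c1)
    and cont2: "continuous_map (ctop D) (ctop ?W) (\<lambda>y. w (s (q y)) y (q y))" (is ?c2)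
  proof -
    note pc = star_hom_continuous[OF Xe(1) cA Xe(3)] and qc = star_hom_continuous[OF Ye(1) cA Ye(3)]
    note pf = continuous_map_compose[OF pc, unfolded o_def] and qf = continuous_map_compose[OF qc, unfolded o_def]
    show ?c1 unfolding w_def
      by (intro continuous_pair Xe(1) C.cI D.cI cV cU BI.cR C.segment_continuous D.segment_continuous
          pf ss(5) ss'(5) \<Theta>c continuous_map_id[unfolded id_def])
    show ?c2 unfolding w_def
      by (intro continuous_pair Ye(1) C.cI D.cI cV cU BI.cR C.segment_continuous D.segment_continuous
          qf ss(5) ss'(5) \<Theta>c continuous_map_id[unfolded id_def])
  qed
  obtain Q1 Q2 where Q12: "countable Q1" "Q1 \<subseteq> (\<lambda>x. w x (s' (p x)) (p x)) ` carrier C"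
      "\<forall>x\<in>(\<lambda>x. w x (s' (p x)) (p x)) ` carrier C. \<forall>e>0. \<exists>y\<in>Q1. nrm ?W (x -[?W] y) < e"
      "countable Q2" "Q2 \<subseteq> (\<lambda>y. w (s (q y)) y (q y)) ` carrier D"
      "\<forall>x\<in>(\<lambda>y. w (s (q y)) y (q y)) ` carrier D. \<forall>e>0. \<exists>y\<in>Q2. nrm ?W (x -[?W] y) < e"
    using dense_image[OF cW Xe(1,2) cont1] dense_image[OF cW Ye(1,2) cont2] by (elim exE conjE) rule
  have Q: "countable (Q1 \<union> Q2)" "Q1 \<union> Q2 \<subseteq> S" using Q12(1,2,4,5) by (auto simp: S_def)
  have Qd: "\<forall>x\<in>S. \<forall>e>0. \<exists>y\<in>Q1 \<union> Q2. nrm ?W (x -[?W] y) < e"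
    using Q12(3,6) unfolding S_def by blast
  have hP: "star_hom ?W A (p \<circ> F 0)" by (rule star_hom_compose[OF Xe(3) hF]) simp_all
  have F0w: "F 0 (w x y a) = x" "F 1 (w x y a) = s a" "G 0 (w x y a) = s' a" "G 1 (w x y a) = y"
    if "x \<in> carrier C" "y \<in> carrier D" "a \<in> carrier A" for x y a
    using that ss(3) ss'(3) unfolding F_def G_def w_def fst_conv snd_conv by (simp_all only: C.segment_ends D.segment_ends)
  have surj1: "carrier C \<subseteq> F 0 ` S" and surj2: "carrier D \<subseteq> G 1 ` S"
  proof -
    have "w x (s' (p x)) (p x) \<in> S \<and> F 0 (w x (s' (p x)) (p x)) = x" if "x \<in> carrier C" for x
      using that F0w(1) ss'(3) star_homD(1)[OF Xe(3)] by (simp add: S_def)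
    then show "carrier C \<subseteq> F 0 ` S" by (metis image_eqI subsetI)
    have "w (s (q y)) y (q y) \<in> S \<and> G 1 (w (s (q y)) y (q y)) = y" if "y \<in> carrier D" for y
      using that F0w(4) ss(3) star_homD(1)[OF Ye(3)] by (simp add: S_def)
    then show "carrier D \<subseteq> G 1 ` S" by (metis image_eqI subsetI)
  qed
  have "carrier A \<subseteq> (p \<circ> F 0) ` S" using surj1 Xe(4) unfolding image_comp[symmetric] by blast
  then obtain Z j where Z: "Z \<in> extensions A" and j: "star_hom (fst Z) ?W j"
      "bij_betw j (carrier (fst Z)) (cstar_generated ?W S)"
    and Zj: "\<And>z. z \<in> carrier (fst Z) \<Longrightarrow> snd Z z = p (F 0 (j z))"
    using realise_generated[OF cW S Q Qd hP] unfolding o_def by blast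
  note Ze = extensionsD[OF Z]
  have jE: "j z \<in> cstar_generated ?W S" "j z \<in> carrier ?W" if "z \<in> carrier (fst Z)" for z
    using bij_betwE[OF j(2)] star_homD(1)[OF j(1)] that by blast+
  \<comment> \<open>All these compositions are *-homomorphisms into \<open>A\<close> that coincide
    on the generators, because a segment between two points of a fibre stays in the fibre.
    Consequently the paths of kernel elements remain in the kernels of the two given
    extensions.\<close>
  have const: "p (F r (j z)) = snd Z z" "q (G r (j z)) = snd Z z"
    if z: "z \<in> carrier (fst Z)" and r: "0 \<le> r" "r \<le> 1" for r z
  proof -
    have avg: "of_real (1 - r) .[A] a +[A] of_real r .[A] a = a" if "a \<in> carrier A" for a
      using that A.scale_add_left[of a "of_real (1 - r)" "of_real r"] by simp
    have "(p \<circ> F r) v = (p \<circ> F 0) v \<and> (q \<circ> G r) v = (p \<circ> F 0) v" if v: "v \<in> S" for v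
    proof -
      obtain x y a where v: "v = w x y a" and xy: "x \<in> carrier C" "y \<in> carrier D" "a \<in> carrier A" "p x = a" "q y = a"
        using Scases[OF v] by blast
      have "p (F r v) = of_real (1 - r) .[A] p x +[A] of_real r .[A] p (s a)"
        using xy(1-3) ss(3) r star_homD[OF Xe(3)] by (simp add: v F_def w_def)
      moreover have "q (G r v) = of_real (1 - r) .[A] q (s' a) +[A] of_real r .[A] q y"
        using xy(1-3) ss'(3) r star_homD[OF Ye(3)] by (simp add: v G_def w_def)
      ultimately show ?thesis using xy ss(4) ss'(4) avg F0w(1)[OF xy(1-3)] by (simp add: v)
    qed
    then show "p (F r (j z)) = snd Z z" "q (G r (j z)) = snd Z z"
      using generated_equalizer[OF cW cA star_hom_compose[OF Xe(3) hF[OF r]] hP S _ jE(1)[OF z]]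
        generated_equalizer[OF cW cA star_hom_compose[OF Ye(3) hG[OF r]] hP S _ jE(1)[OF z]] Zj[OF z]
      by simp_all
  qed
  let ?J = "ext_ker A Z"
  have JZ: "?J \<subseteq> carrier (fst Z)" by (auto simp: ext_ker_def star_ker_def)
  have JX: "ext_ker A X \<subseteq> carrier C" "ext_ker A Y \<subseteq> carrier D" by (auto simp: ext_ker_def star_ker_def Xd Yd)
  have FJ: "F r (j z) \<in> ext_ker A X" and GJ: "G r (j z) \<in> ext_ker A Y" if "z \<in> ?J" "0 \<le> r" "r \<le> 1" for z r
    using that const[of z r] star_homD(1)[OF hF] star_homD(1)[OF hG] jE(2)[of z]
    by (auto simp: ext_ker_def star_ker_def Xd Yd)
  note hFj = star_hom_compose[OF hF j(1)] and hGj = star_hom_compose[OF hG j(1)]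
  have ag: "agreeing_pair C (ext_ker A X) B \<psi>" "agreeing_pair D (ext_ker A Y) B \<phi>"
    using \<psi> \<phi> by (simp_all add: Xd Yd)
  have e_agree: "agreeing_pair (fst Z) ?J (IB B) (?e \<circ> j, ?e' \<circ> j)"
  proof (rule BI.agreeing_pairI)
    show "asymptotic_hom (fst Z) (IB B) (fst (?e \<circ> j, ?e' \<circ> j))" "asymptotic_hom (fst Z) (IB B) (snd (?e \<circ> j, ?e' \<circ> j))"
      unfolding fst_conv snd_conv by (intro BI.star_hom_asymptotic Ze star_hom_compose[OF _ j(1)] he)+
    fix z assume z: "z \<in> ?J"
    obtain Q where Q: "cstar_subalgebra (prod_cstar A ?U) Q"
        "\<And>a. a \<in> carrier A \<Longrightarrow> (a, fst \<Theta> a, snd \<Theta> a) \<in> Q" "\<And>e e'. (czero A, e, e') \<in> Q \<Longrightarrow> BI.aeq e e'"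
      using BI.cycle_algebra[OF cA \<Theta>] by blast
    let ?k = "\<lambda>v. ((p \<circ> F 0) v, (snd \<circ> snd) v)"
    \<comment> \<open>On generators the point of \<open>A\<close> and the last two coordinates form
      a triple of the cycle \<open>\<Theta>\<close>, hence on all of the generated algebra they lie
      in its algebra of triples, where coordinates over 0 agree.\<close>
    have "cstar_generated ?W S \<subseteq> {v \<in> carrier ?W. ?k v \<in> Q}"
    proof (rule cstar_generated_minimal[OF cstar_subalgebra_preimage[OF cW cstar_prod[OF cA cU] _ Q(1)]])
      show "star_hom ?W (prod_cstar A ?U) ?k"
        by (intro star_hom_pair hP star_hom_compose[OF prod_homs(2) prod_homs(2)])
      show "S \<subseteq> {v \<in> carrier ?W. ?k v \<in> Q}"
      proof
        fix v assume "v \<in> S"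
        then obtain x y a where v: "v = w x y a" and xy: "x \<in> carrier C" "y \<in> carrier D" "a \<in> carrier A" "p x = a" "q y = a"
          using Scases by blast
        have "?k v = (a, fst \<Theta> a, snd \<Theta> a)" using F0w(1)[OF xy(1-3)] xy(4) by (simp add: v) (simp add: w_def)
        then show "v \<in> {v \<in> carrier ?W. ?k v \<in> Q}" using wW[OF xy(1-3)] Q(2)[OF xy(3)] v by simp
      qed
    qed
    then have "?k (j z) \<in> Q" using jE(1)[of z] z JZ by blast
    moreover have "p (F 0 (j z)) = czero A" using z Zj[of z] by (simp add: ext_ker_def star_ker_def)
    ultimately show "BI.aeq (fst (?e \<circ> j, ?e' \<circ> j) z) (snd (?e \<circ> j, ?e' \<circ> j) z)"
      using Q(3)[of "fst (snd (snd (j z)))" "snd (snd (snd (j z)))"] by simp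
  qed
  define \<eta> where "\<eta> = (\<lambda>r. map_pair (eval_at r) (?e \<circ> j, ?e' \<circ> j))"
  have ev: "codomain_hom (IB B) B (\<lambda>g. g r)" if "r \<in> {0, 1}" for r using eval_hom that by auto
  have \<eta>_agree: "agreeing_pair (fst Z) ?J B (\<eta> r)" if "r \<in> {0, 1}" for r
    using codomain_hom.agreeing_pair_push[OF ev[OF that] Ze(1) JZ e_agree] by (simp add: \<eta>_def eval_at_push)
  have comp_agree: "agreeing_pair (fst Z) ?J B (pair_comp \<psi> (F r \<circ> j))" "agreeing_pair (fst Z) ?J B (pair_comp \<phi> (G r \<circ> j))"
    if "0 \<le> r" "r \<le> 1" for r
    using agreeing_pair_comp[OF Xe(1) Ze(1) JX(1) ag(1) hFj[OF that]] agreeing_pair_comp[OF Ye(1) Ze(1) JX(2) ag(2) hGj[OF that]]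
      FJ GJ that by (simp_all add: o_def)
  have hom_eval: "asymptotic_hom ?W B (eval_at r \<circ> ?e)" "asymptotic_hom ?W B (eval_at r \<circ> ?e')" if "r \<in> {0, 1}" for r
    unfolding eval_at_push
    by (intro star_hom_asymptotic cW star_hom_compose[OF codomain_hom.push_star_hom[OF ev[OF that]]] he)+
  have asy: "asymptotic_hom C B (fst \<psi>)" "asymptotic_hom C B (snd \<psi>)" "asymptotic_hom D B (fst \<phi>)" "asymptotic_hom D B (snd \<phi>)"
    using ag by (simp_all add: agreeing_pair_def)
  \<comment> \<open>On a generator the section value goes to the end of the homotopy
    \<open>\<Theta>\<close> exactly. Elsewhere in the algebra the equality survives modulo
    \<open>C\<^sub>0\<close>, since both sides are asymptotic homomorphisms.\<close>
  have gen: "f (h v) \<simeq> eval_at r (k v)"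
    if "r \<in> {0, 1}" "asymptotic_hom K B f" "csa K" "star_hom ?W K h" "k \<in> {?e, ?e'}" "v \<in> cstar_generated ?W S"
      "\<And>x y a. \<lbrakk>x \<in> carrier C; y \<in> carrier D; a \<in> carrier A\<rbrakk> \<Longrightarrow> f (h (w x y a)) = eval_at r (k (w x y a))"
    for f h k r v and K :: "real cstar"
  proof -
    have "asymptotic_hom ?W B (eval_at r \<circ> k)" using hom_eval[OF that(1)] that(5) by blast
    then show ?thesis
      using generated_aeq[OF cW asymptotic_hom_comp[OF that(3) cW that(2,4)] _ S _ that(6)] Scases that(7)
        asymptotic_homD(1)[OF cW asymptotic_hom_comp[OF that(3) cW that(2,4)]] S
      by (smt (verit, best) aeq_refl comp_apply subsetD)
  qed
  have 1: "(pair_comp \<psi> (F 0 \<circ> j), pair_comp \<psi> (F 1 \<circ> j)) \<in> en_homotopy (fst Z) ?J B"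
    using en_homotopy_path[OF Xe(1) Ze(1) JX(1) ag(1) star_hom_compose[OF prod_homs(1) j(1)] _ JZ] FJ by (simp add: F_def o_def)
  have 2: "(pair_comp \<psi> (F 1 \<circ> j), \<eta> 0) \<in> en_homotopy (fst Z) ?J B"
  proof (rule en_homotopy_aeq[OF Ze(1) JZ comp_agree(1) \<eta>_agree])
    fix z assume "z \<in> carrier (fst Z)"
    note gen = gen[OF _ _ Xe(1) hF _ jE(1)[OF this], of 0 _ 1]
    show "fst (pair_comp \<psi> (F 1 \<circ> j)) z \<simeq> fst (\<eta> 0) z \<and> snd (pair_comp \<psi> (F 1 \<circ> j)) z \<simeq> snd (\<eta> 0) z"
      using gen[OF _ asy(1), of ?e] gen[OF _ asy(2), of ?e'] \<Theta>0 F0w(2) by (simp add: \<eta>_def) (simp add: w_def)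
  qed simp_all
  have 3: "(\<eta> 0, \<eta> 1) \<in> en_homotopy (fst Z) ?J B"
    by (rule en_homotopyI[OF \<eta>_agree \<eta>_agree e_agree]) (simp_all add: \<eta>_def evaluates_to_def)
  have 4: "(pair_comp \<phi> (G 0 \<circ> j), \<eta> 1) \<in> en_homotopy (fst Z) ?J B"
  proof (rule en_homotopy_aeq[OF Ze(1) JZ comp_agree(2) \<eta>_agree])
    fix z assume "z \<in> carrier (fst Z)"
    note gen = gen[OF _ _ Ye(1) hG _ jE(1)[OF this], of 1 _ 0]
    show "fst (pair_comp \<phi> (G 0 \<circ> j)) z \<simeq> fst (\<eta> 1) z \<and> snd (pair_comp \<phi> (G 0 \<circ> j)) z \<simeq> snd (\<eta> 1) z"
      using gen[OF _ asy(3), of ?e] gen[OF _ asy(4), of ?e'] \<Theta>1 F0w(3) by (simp add: \<eta>_def) (simp add: w_def)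
  qed simp_all
  have 5: "(pair_comp \<phi> (G 0 \<circ> j), pair_comp \<phi> (G 1 \<circ> j)) \<in> en_homotopy (fst Z) ?J B"
    using en_homotopy_path[OF Ye(1) Ze(1) JX(2) ag(2) star_hom_compose[OF star_hom_compose[OF prod_homs(1) prod_homs(2)] j(1)] _ JZ] GJ
    by (simp add: G_def o_def)
  have eq: "sym (en_homotopy (fst Z) ?J B)" "trans (en_homotopy (fst Z) ?J B)"
    using en_homotopy_equiv[OF Ze(1) JZ] unfolding equiv_def by blast+
  have "(pair_comp \<psi> (F 0 \<circ> j), pair_comp \<phi> (G 1 \<circ> j)) \<in> en_homotopy (fst Z) ?J B"
    by (intro transD[OF eq(2) transD[OF eq(2) transD[OF eq(2) transD[OF eq(2) 1 2] 3] symD[OF eq(1) 4]] 5])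
  moreover have jS: "S \<subseteq> j ` carrier (fst Z)"
    using j(2) cstar_generated_subalgebra(2)[OF cW S] unfolding bij_betw_def by blast
  have "over_map X Z (F 0 \<circ> j)"
    using hFj[of 0] star_homD(1)[OF hFj[of 0]] const(1)[of _ 0] surj1 jS
    by (force simp: over_map_def star_epi_def Xd)
  moreover have "over_map Y Z (G 1 \<circ> j)"
    using hGj[of 1] star_homD(1)[OF hGj[of 1]] const(2)[of _ 1] surj2 jS
    by (force simp: over_map_def star_epi_def Yd)
  ultimately show ?thesis using Z by blast
qed

end


section \<open>The isomorphism\<close>

lemma quotient_operation:
  assumes eq: "equiv E R" and f: "\<And>x x' y y'. \<lbrakk>(x, x') \<in> R; (y, y') \<in> R\<rbrakk> \<Longrightarrow> (f x y, f x' y') \<in> R"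
    and a: "a \<in> E" "b \<in> E"
  shows "(\<Union>x\<in>R `` {a}. \<Union>y\<in>R `` {b}. R `` {f x y}) = R `` {f a b}"
proof -
  have "R `` {f x y} = R `` {f a b}" if "x \<in> R `` {a}" "y \<in> R `` {b}" for x y
    using equiv_class_eq[OF eq f, of a x b y] that by simp
  moreover have "a \<in> R `` {a}" "b \<in> R `` {b}" using a equiv_class_self[OF eq] by blast+
  ultimately show ?thesis by blast
qed

section \<open>Classes in the direct limit\<close>

locale asymptotic_theories = codomain B for B :: "'b cstar" +
  fixes A :: "'a cstar" and s1 s2 :: "('b \<Rightarrow> 'b) \<times> ('b \<Rightarrow> 'b)"
  assumes cA: "csa A" and sepA: "separable A"
    and s1: "multiplier_isometry B s1" and s2: "multiplier_isometry B s2"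
    and s12: "(s1 *[multiplier_algebra B] adj (multiplier_algebra B) s1)
       +[multiplier_algebra B] (s2 *[multiplier_algebra B] adj (multiplier_algebra B) s2) = multiplier_one B"
begin

abbreviation H :: "(('a, 'b) fun_pair \<times> ('a, 'b) fun_pair) set"
  where "H \<equiv> kk_homotopy A B"

abbreviation en :: "'a extn \<Rightarrow> ((real, 'b) fun_pair \<times> (real, 'b) fun_pair) set"
  where "en X \<equiv> en_homotopy (fst X) (ext_ker A X) B"

abbreviation agreeing :: "'a extn \<Rightarrow> (real, 'b) fun_pair \<Rightarrow> bool"
  where "agreeing X \<equiv> agreeing_pair (fst X) (ext_ker A X) B"

abbreviation plus :: "('c, 'b) fun_pair \<Rightarrow> ('c, 'b) fun_pair \<Rightarrow> ('c, 'b) fun_pair"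
  where "plus \<equiv> pair_sum B s1 s2"

text \<open>The value of \<open>\<gamma>\<close> on a representative at a single index, before
  passing to the limit.\<close>

definition en_class :: "'a extn \<times> (real, 'b) fun_pair set \<Rightarrow> ('a, 'b) fun_pair set"
  where "en_class u = (\<Union>\<psi>\<in>snd u. \<Union>s\<in>sections A (fst u). H `` {pair_comp \<psi> s})"

lemma ext_ker_subset: "ext_ker A X \<subseteq> carrier (fst X)"
  by (auto simp: ext_ker_def star_ker_def)

lemmas H_equiv = kk_homotopy_equiv[OF cA]

lemma en_equiv: "X \<in> extensions A \<Longrightarrow> equiv {\<psi>. agreeing X \<psi>} (en X)"
  by (rule en_homotopy_equiv[OF extensionsD(1) ext_ker_subset])

lemma en_agreeing: "(\<phi>, \<psi>) \<in> en X \<Longrightarrow> agreeing X \<phi> \<and> agreeing X \<psi>"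
  by (auto simp: en_homotopy_def)

interpretation k: orthogonal_homs B B "conjugate B s1" "conjugate B s2"
  by (rule conjugate_orthogonal[OF s1 s2 s12])

lemma plus_eq: "plus \<Phi> \<Psi> = k.osum_pair \<Phi> \<Psi>"
  by (simp add: pair_sum_def k.osum_pair_def k.osum_def orth_sum_eq fun_eq_iff)

lemma pair_comp_plus: "pair_comp (plus \<Phi> \<Psi>) s = plus (pair_comp \<Phi> s) (pair_comp \<Psi> s)"
  by (simp add: pair_sum_def pair_comp_def orth_sum_def fun_eq_iff)

lemma plus_en: "\<lbrakk>X \<in> extensions A; (\<phi>, \<phi>') \<in> en X; (\<psi>, \<psi>') \<in> en X\<rbrakk> \<Longrightarrow> (plus \<phi> \<psi>, plus \<phi>' \<psi>') \<in> en X"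
  unfolding plus_eq by (rule k.osum_en_homotopy[OF extensionsD(1) ext_ker_subset])

lemma plus_agreeing: "\<lbrakk>X \<in> extensions A; agreeing X \<phi>; agreeing X \<psi>\<rbrakk> \<Longrightarrow> agreeing X (plus \<phi> \<psi>)"
  unfolding plus_eq by (rule k.osum_agreeing[OF extensionsD(1) ext_ker_subset])

lemma section_cycle:
  assumes X: "X \<in> extensions A" and \<psi>: "agreeing X \<psi>" and s: "s \<in> sections A X"
  shows "kk_cycle A B (pair_comp \<psi> s)"
  using kk_cycle_section[OF cA extensionsD(1,3)[OF X] \<psi>[unfolded ext_ker_def] _
      star_along_section[OF cA extensionsD(1)[OF X] \<psi>]] sectionsD[OF cA X s] by blast

lemma section_homotopy:
  assumes X: "X \<in> extensions A" and h: "(\<phi>, \<psi>) \<in> en X" and s: "s \<in> sections A X" and t: "t \<in> sections A X"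
  shows "(pair_comp \<phi> s, pair_comp \<psi> t) \<in> H"
proof -
  note e = extensionsD[OF X] and s = sectionsD[OF cA X s] and t = sectionsD[OF cA X t]
  have \<psi>: "agreeing X \<psi>" using en_agreeing[OF h] by simp
  note along = star_along_section[OF cA e(1) \<psi>]
  have "(pair_comp \<phi> s, pair_comp \<psi> s) \<in> H"
    using kk_homotopy_comp[OF cA e(1,3) h[unfolded ext_ker_def] s(1)] s(2) by blast
  moreover have "(pair_comp \<psi> s, pair_comp \<psi> t) \<in> H"
    using kk_homotopy_sections[OF cA e(1,3) \<psi>[unfolded ext_ker_def] s(1) along t(1) along] s(2,3) t(2,3) by blast
  ultimately show ?thesis using H_equiv unfolding equiv_def by (blast dest: transD)
qed

lemma obtain_section:
  assumes "X \<in> extensions A"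
  obtains s where "s \<in> sections A X"
  using sections_nonempty[OF cA assms] by blast

text \<open>All representatives and all sections give homotopic cycles by
  \<open>section_homotopy\<close>, so the union is a single class.\<close>

lemma en_class_eq:
  assumes X: "X \<in> extensions A" and \<psi>: "agreeing X \<psi>" and s: "s \<in> sections A X"
  shows "en_class (X, en X `` {\<psi>}) = H `` {pair_comp \<psi> s}"
proof -
  have "H `` {pair_comp \<phi> t} = H `` {pair_comp \<psi> s}" if "\<phi> \<in> en X `` {\<psi>}" "t \<in> sections A X" for \<phi> t
    using equiv_class_eq[OF H_equiv section_homotopy[OF X _ s that(2)]] that(1) by blast
  moreover have "\<psi> \<in> en X `` {\<psi>}" using equiv_class_self[OF en_equiv[OF X]] \<psi> by blast
  ultimately show ?thesis using s unfolding en_class_def fst_conv snd_conv by blast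
qed

lemma EN_preE:
  assumes "u \<in> EN_pre A B"
  obtains X \<psi> where "u = (X, en X `` {\<psi>})" "X \<in> extensions A" "agreeing X \<psi>"
  using assms by (auto simp: EN_pre_def quotient_def)

lemma EN_preI: "\<lbrakk>X \<in> extensions A; agreeing X \<psi>\<rbrakk> \<Longrightarrow> (X, en X `` {\<psi>}) \<in> EN_pre A B"
  unfolding EN_pre_def by (intro SigmaI quotientI) simp_all

text \<open>If \<open>t\<close> is a section of the larger extension, then
  \<open>l \<circ> t\<close> is one of the smaller, and both compositions give the same cycle. This
  is why pulling back does not change the class.\<close>

lemma pullback:
  assumes X: "X \<in> extensions A" and Z: "Z \<in> extensions A" and l: "over_map X Z l" and \<psi>: "agreeing X \<psi>"
  shows "agreeing Z (pair_comp \<psi> l)" "EN_pullback A B Z l (en X `` {\<psi>}) = en Z `` {pair_comp \<psi> l}"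
    "en_class (Z, en Z `` {pair_comp \<psi> l}) = en_class (X, en X `` {\<psi>})"
proof -
  note e = extensionsD[OF X] and e' = extensionsD[OF Z]
  have lh: "star_hom (fst Z) (fst X) l" using l by (simp add: over_map_def star_epi_def)
  have lJ: "l j \<in> ext_ker A X" if "j \<in> ext_ker A Z" for j
    using l that star_homD(1)[OF lh] by (auto simp: over_map_def ext_ker_def star_ker_def)
  show ag: "agreeing Z (pair_comp \<psi> l)"
    by (rule agreeing_pair_comp[OF e(1) e'(1) ext_ker_subset \<psi> lh lJ])
  have "en Z `` {pair_comp \<phi> l} = en Z `` {pair_comp \<psi> l}" if "\<phi> \<in> en X `` {\<psi>}" for \<phi>
    using equiv_class_eq[OF en_equiv[OF Z] en_homotopy_comp[OF e(1) e'(1) ext_ker_subset _ lh lJ]] that by blast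
  moreover have self: "(\<psi>, \<psi>) \<in> en X" using equiv_class_self[OF en_equiv[OF X]] \<psi> by blast
  ultimately show "EN_pullback A B Z l (en X `` {\<psi>}) = en Z `` {pair_comp \<psi> l}"
    unfolding EN_pullback_def by blast
  obtain t where t: "t \<in> sections A Z" using obtain_section[OF Z] .
  note t' = sectionsD[OF cA Z t]
  have "l \<circ> t \<in> sections A X"
    unfolding sections_def mem_Collect_eq
  proof (intro conjI ballI)
    show "continuous_map (ctop A) (ctop (fst X)) (l \<circ> t)"
      by (rule continuous_map_compose[OF t'(5) star_hom_continuous[OF e'(1) e(1) lh]])
    show "homogeneous A (fst X) (l \<circ> t)"
      using t t'(3) star_homD(3)[OF lh] by (simp add: homogeneous_def sections_def)
    show "(l \<circ> t) (adj A a) = adj (fst X) ((l \<circ> t) a)" "snd X ((l \<circ> t) a) = a" if "a \<in> carrier A" for a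
      using t'(2-4) that star_homD(5)[OF lh] l by (simp_all add: over_map_def)
  qed
  then show "en_class (Z, en Z `` {pair_comp \<psi> l}) = en_class (X, en X `` {\<psi>})"
    using en_class_eq[OF Z ag t] en_class_eq[OF X \<psi>] by (simp add: pair_comp_def o_assoc)
qed

lemma common_extension:
  assumes X: "X \<in> extensions A" and Y: "Y \<in> extensions A" and \<psi>: "agreeing X \<psi>" and \<phi>: "agreeing Y \<phi>"
    and eq: "en_class (X, en X `` {\<psi>}) = en_class (Y, en Y `` {\<phi>})"
  shows "\<exists>Z l m. Z \<in> extensions A \<and> over_map X Z l \<and> over_map Y Z m \<and> (pair_comp \<psi> l, pair_comp \<phi> m) \<in> en Z"
proof -
  obtain s where s: "s \<in> sections A X" using obtain_section[OF X] .
  obtain t where t: "t \<in> sections A Y" using obtain_section[OF Y] .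
  have "(pair_comp \<psi> s, pair_comp \<phi> t) \<in> H"
    using eq en_class_eq[OF X \<psi> s] en_class_eq[OF Y \<phi> t] eq_equiv_class[OF _ H_equiv] section_cycle[OF Y \<phi> t] by simp
  then show ?thesis by (rule homotopy_from_extension[OF cA X Y \<psi> \<phi> s t])
qed

text \<open>The limit relation is the kernel of \<open>en_class\<close>: one inclusion is invariance
  under pullback, the other is \<open>common_extension\<close>. Injectivity of
  \<open>\<gamma>\<close> is contained in this, and transitivity of the limit relation comes for
  free.\<close>

lemma EN_lim_eq: "EN_lim A B = {(u, v). u \<in> EN_pre A B \<and> v \<in> EN_pre A B \<and> en_class u = en_class v}"
proof -
  have "(u, v) \<in> EN_lim A B \<longleftrightarrow> en_class u = en_class v" if u: "u \<in> EN_pre A B" and v: "v \<in> EN_pre A B" for u v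
  proof -
    obtain X \<psi> where X: "u = (X, en X `` {\<psi>})" "X \<in> extensions A" "agreeing X \<psi>" using EN_preE[OF u] .
    obtain Y \<phi> where Y: "v = (Y, en Y `` {\<phi>})" "Y \<in> extensions A" "agreeing Y \<phi>" using EN_preE[OF v] .
    have "(u, v) \<in> EN_lim A B \<longleftrightarrow> (\<exists>Z\<in>extensions A. \<exists>l m. over_map X Z l \<and> over_map Y Z m \<and>
        EN_pullback A B Z l (en X `` {\<psi>}) = EN_pullback A B Z m (en Y `` {\<phi>}))"
      using u v by (simp add: EN_lim_def X(1) Y(1))
    also have "\<dots> \<longleftrightarrow> (\<exists>Z\<in>extensions A. \<exists>l m. over_map X Z l \<and> over_map Y Z m \<and>
        en Z `` {pair_comp \<psi> l} = en Z `` {pair_comp \<phi> m})"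
      by (intro bex_cong ex_cong1 conj_cong refl) (simp add: pullback(2)[OF X(2) _ _ X(3)] pullback(2)[OF Y(2) _ _ Y(3)])
    also have "\<dots> \<longleftrightarrow> en_class u = en_class v" (is "?L \<longleftrightarrow> ?R")
    proof
      assume ?L
      then obtain Z l m where Z: "Z \<in> extensions A" "over_map X Z l" "over_map Y Z m"
        "en Z `` {pair_comp \<psi> l} = en Z `` {pair_comp \<phi> m}" by blast
      then show ?R
        using pullback(3)[OF X(2) Z(1,2) X(3)] pullback(3)[OF Y(2) Z(1,3) Y(3)] by (simp add: X(1) Y(1))
    next
      assume ?R
      then obtain Z l m where Z: "Z \<in> extensions A" "over_map X Z l" "over_map Y Z m"
        "(pair_comp \<psi> l, pair_comp \<phi> m) \<in> en Z"
        using common_extension[OF X(2) Y(2) X(3) Y(3)] unfolding X(1) Y(1) by blast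
      then show ?L using equiv_class_eq[OF en_equiv[OF Z(1)] Z(4)] by blast
    qed
    finally show ?thesis .
  qed
  moreover have "u \<in> EN_pre A B \<and> v \<in> EN_pre A B" if "(u, v) \<in> EN_lim A B" for u v
    using that unfolding EN_lim_def by blast
  ultimately have "(u, v) \<in> EN_lim A B \<longleftrightarrow> u \<in> EN_pre A B \<and> v \<in> EN_pre A B \<and> en_class u = en_class v" for u v
    by blast
  then show ?thesis by (intro subset_antisym subrelI) (simp_all only: mem_Collect_eq case_prod_conv)
qed

lemma gamma_map_eq: "u \<in> EN_pre A B \<Longrightarrow> gamma_map A B (EN_lim A B `` {u}) = en_class u"
proof -
  assume u: "u \<in> EN_pre A B"
  have "gamma_map A B U = (\<Union>v\<in>U. en_class v)" for U
    by (simp add: gamma_map_def en_class_def case_prod_beta)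
  then show ?thesis using u by (auto simp: EN_lim_eq)
qed

lemma EN_lim_class: "u \<in> EN_pre A B \<Longrightarrow> EN_lim A B `` {u} = {v \<in> EN_pre A B. en_class v = en_class u}"
  by (auto simp: EN_lim_eq)

lemma pair_zero_agreeing: "X \<in> extensions A \<Longrightarrow> agreeing X (pair_zero B)"
  unfolding pair_zero_def
  by (rule agreeing_pairI) (auto intro!: star_hom_asymptotic extensionsD(1) simp: star_hom_def)

text \<open>A common refinement of two extensions arises from the homotopy between their zero pairs.\<close>

lemma EN_pre_common:
  assumes u: "u \<in> EN_pre A B" and v: "v \<in> EN_pre A B"
  shows "\<exists>Z \<psi> \<phi>. Z \<in> extensions A \<and> agreeing Z \<psi> \<and> agreeing Z \<phi> \<and>
    en_class (Z, en Z `` {\<psi>}) = en_class u \<and> en_class (Z, en Z `` {\<phi>}) = en_class v"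
proof -
  obtain X \<psi> where X: "u = (X, en X `` {\<psi>})" "X \<in> extensions A" "agreeing X \<psi>" using EN_preE[OF u] .
  obtain Y \<phi> where Y: "v = (Y, en Y `` {\<phi>})" "Y \<in> extensions A" "agreeing Y \<phi>" using EN_preE[OF v] .
  obtain s where s: "s \<in> sections A X" using obtain_section[OF X(2)] .
  obtain t where t: "t \<in> sections A Y" using obtain_section[OF Y(2)] .
  have "pair_comp (pair_zero B) s = pair_comp (pair_zero B) t"
    by (simp add: pair_zero_def pair_comp_def o_def)
  then have "en_class (X, en X `` {pair_zero B}) = en_class (Y, en Y `` {pair_zero B})"
    using en_class_eq[OF X(2) pair_zero_agreeing s] en_class_eq[OF Y(2) pair_zero_agreeing t] X(2) Y(2) by simp
  then obtain Z l m where Z: "Z \<in> extensions A" "over_map X Z l" "over_map Y Z m"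
    using common_extension[OF X(2) Y(2) pair_zero_agreeing[OF X(2)] pair_zero_agreeing[OF Y(2)]] by blast
  show ?thesis
    using Z(1) pullback(1,3)[OF X(2) Z(1,2) X(3)] pullback(1,3)[OF Y(2) Z(1,3) Y(3)]
    by (intro exI[of _ Z] exI[of _ "pair_comp \<psi> l"] exI[of _ "pair_comp \<phi> m"]) (simp add: X(1) Y(1))
qed

section \<open>Addition and the isomorphism\<close>

abbreviation EM_plus :: "('a, 'b) fun_pair set \<Rightarrow> ('a, 'b) fun_pair set \<Rightarrow> ('a, 'b) fun_pair set"
  where "EM_plus \<equiv> mult (EM A B s1 s2)"

lemma EM_plus_class: "\<lbrakk>kk_cycle A B \<Phi>; kk_cycle A B \<Psi>\<rbrakk> \<Longrightarrow> EM_plus (H `` {\<Phi>}) (H `` {\<Psi>}) = H `` {plus \<Phi> \<Psi>}"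
  using quotient_operation[OF H_equiv, of plus \<Phi> \<Psi>] k.osum_kk_homotopy[OF cA] by (simp add: EM_def plus_eq)

lemma en_class_plus:
  assumes X: "X \<in> extensions A" and ag: "agreeing X \<psi>" "agreeing X \<phi>"
  defines "\<zeta> \<equiv> mult (EN_rel (fst X) (ext_ker A X) B s1 s2) (en X `` {\<psi>}) (en X `` {\<phi>})"
  shows "(X, \<zeta>) \<in> EN_pre A B" "en_class (X, \<zeta>) = EM_plus (en_class (X, en X `` {\<psi>})) (en_class (X, en X `` {\<phi>}))"
proof -
  have \<zeta>: "\<zeta> = en X `` {plus \<psi> \<phi>}"
    using quotient_operation[OF en_equiv[OF X], of plus \<psi> \<phi>] plus_en[OF X] ag by (simp add: \<zeta>_def EN_rel_def)
  show "(X, \<zeta>) \<in> EN_pre A B" unfolding \<zeta> by (rule EN_preI[OF X plus_agreeing[OF X ag]])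
  obtain s where s: "s \<in> sections A X" using obtain_section[OF X] .
  show "en_class (X, \<zeta>) = EM_plus (en_class (X, en X `` {\<psi>})) (en_class (X, en X `` {\<phi>}))"
    unfolding \<zeta> en_class_eq[OF X plus_agreeing[OF X ag] s] en_class_eq[OF X ag(1) s] en_class_eq[OF X ag(2) s]
    using EM_plus_class[OF section_cycle[OF X ag(1) s] section_cycle[OF X ag(2) s]] by (simp add: pair_comp_plus)
qed

lemma EN_plus:
  assumes u: "u \<in> EN_pre A B" and v: "v \<in> EN_pre A B"
  shows "\<exists>w\<in>EN_pre A B. mult (EN A B s1 s2) (EN_lim A B `` {u}) (EN_lim A B `` {v}) = EN_lim A B `` {w} \<and>
    en_class w = EM_plus (en_class u) (en_class v)"
proof -
  let ?U = "EN_lim A B `` {u}" and ?V = "EN_lim A B `` {v}"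
  let ?m = "\<lambda>X. mult (EN_rel (fst X) (ext_ker A X) B s1 s2)"
  let ?w = "{w \<in> EN_pre A B. en_class w = EM_plus (en_class u) (en_class v)}"
  have *: "(X, ?m X \<xi> \<eta>) \<in> ?w" if "(X, \<xi>) \<in> ?U" "(X, \<eta>) \<in> ?V" for X \<xi> \<eta>
  proof -
    have pre: "(X, \<xi>) \<in> EN_pre A B" "(X, \<eta>) \<in> EN_pre A B" and eq: "en_class (X, \<xi>) = en_class u" "en_class (X, \<eta>) = en_class v"
      using that unfolding EN_lim_class[OF u] EN_lim_class[OF v] by simp_all
    obtain \<psi> where \<psi>: "\<xi> = en X `` {\<psi>}" "X \<in> extensions A" "agreeing X \<psi>" using EN_preE[OF pre(1)] by blast
    obtain \<phi> where \<phi>: "\<eta> = en X `` {\<phi>}" "agreeing X \<phi>" using EN_preE[OF pre(2)] by blast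
    show ?thesis using en_class_plus[OF \<psi>(2,3) \<phi>(2)] eq by (simp add: \<psi>(1) \<phi>(1))
  qed
  have w: "EN_lim A B `` {w} = ?w" if "w \<in> ?w" for w using that EN_lim_class[of w] by auto
  obtain Z \<psi> \<phi> where Z: "Z \<in> extensions A" "agreeing Z \<psi>" "agreeing Z \<phi>"
      "en_class (Z, en Z `` {\<psi>}) = en_class u" "en_class (Z, en Z `` {\<phi>}) = en_class v"
    using EN_pre_common[OF u v] by blast
  have UV: "(Z, en Z `` {\<psi>}) \<in> ?U" "(Z, en Z `` {\<phi>}) \<in> ?V"
    unfolding EN_lim_class[OF u] EN_lim_class[OF v] using EN_preI[OF Z(1)] Z by simp_all
  \<comment> \<open>The sum of two classes is a union over all common indices. Every member of the
    family equals \<open>?w\<close>, and a common refinement shows that there is at least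
    one.\<close>
  let ?F = "{EN_lim A B `` {(X, ?m X \<xi> \<eta>)} |X \<xi> \<eta>. (X, \<xi>) \<in> ?U \<and> (X, \<eta>) \<in> ?V}"
  have "Y = ?w" if "Y \<in> ?F" for Y using that w[OF *] by (elim CollectE exE conjE) simp
  moreover have "?F \<noteq> {}" using UV by blast
  ultimately have "\<Union>?F = ?w" by blast
  then have "mult (EN A B s1 s2) ?U ?V = ?w" by (simp add: EN_def)
  then show ?thesis using *[OF UV] w[OF *[OF UV]] by (intro bexI[of _ "(Z, ?m Z (en Z `` {\<psi>}) (en Z `` {\<phi>}))"]) simp_all
qed

theorem gamma_map_iso: "gamma_map A B \<in> iso (EN A B s1 s2) (EM A B s1 s2)"
proof -
  have carr: "carrier (EN A B s1 s2) = EN_pre A B // EN_lim A B" "carrier (EM A B s1 s2) = {\<Phi>. kk_cycle A B \<Phi>} // H"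
    by (simp_all add: EN_def EM_def)
  have cls: "en_class u \<in> {\<Phi>. kk_cycle A B \<Phi>} // H" if u: "u \<in> EN_pre A B" for u
  proof -
    obtain X \<psi> where X: "u = (X, en X `` {\<psi>})" "X \<in> extensions A" "agreeing X \<psi>" using EN_preE[OF u] .
    obtain s where s: "s \<in> sections A X" using obtain_section[OF X(2)] .
    show ?thesis unfolding X(1) en_class_eq[OF X(2,3) s] using section_cycle[OF X(2,3) s] by (auto intro: quotientI)
  qed
  have cl: "gamma_map A B U \<in> carrier (EM A B s1 s2)" if "U \<in> carrier (EN A B s1 s2)" for U
    using that cls gamma_map_eq unfolding carr by (elim quotientE) simp
  have "gamma_map A B \<in> hom (EN A B s1 s2) (EM A B s1 s2)"
  proof (rule homI[OF cl])
    show "gamma_map A B (mult (EN A B s1 s2) U V) = EM_plus (gamma_map A B U) (gamma_map A B V)"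
      if UV: "U \<in> carrier (EN A B s1 s2)" "V \<in> carrier (EN A B s1 s2)" for U V
    proof -
      obtain u where u: "u \<in> EN_pre A B" "U = EN_lim A B `` {u}" using UV(1) unfolding carr by (blast elim: quotientE)
      obtain v where v: "v \<in> EN_pre A B" "V = EN_lim A B `` {v}" using UV(2) unfolding carr by (blast elim: quotientE)
      obtain w where w: "w \<in> EN_pre A B" "mult (EN A B s1 s2) U V = EN_lim A B `` {w}"
          "en_class w = EM_plus (en_class u) (en_class v)"
        using EN_plus[OF u(1) v(1)] unfolding u(2) v(2) by blast
      show ?thesis unfolding w(2) unfolding u(2) v(2) gamma_map_eq[OF u(1)] gamma_map_eq[OF v(1)] gamma_map_eq[OF w(1)] w(3) ..
    qed
  qed
  moreover have "inj_on (gamma_map A B) (EN_pre A B // EN_lim A B)"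
  proof (rule inj_onI)
    fix U V assume UV: "U \<in> EN_pre A B // EN_lim A B" "V \<in> EN_pre A B // EN_lim A B" and eq: "gamma_map A B U = gamma_map A B V"
    obtain u v where uv: "u \<in> EN_pre A B" "U = EN_lim A B `` {u}" "v \<in> EN_pre A B" "V = EN_lim A B `` {v}"
      using UV by (blast elim: quotientE)
    then have "en_class u = en_class v" using eq gamma_map_eq[OF uv(1)] gamma_map_eq[OF uv(3)] by simp
    then show "U = V" unfolding uv(2,4) EN_lim_class[OF uv(1)] EN_lim_class[OF uv(3)] by simp
  qed
  moreover have "gamma_map A B ` carrier (EN A B s1 s2) = carrier (EM A B s1 s2)"
  proof -
    have "Y \<in> gamma_map A B ` (EN_pre A B // EN_lim A B)" if Y: "Y \<in> {\<Phi>. kk_cycle A B \<Phi>} // H" for Y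
  proof -
    obtain \<Phi> where \<Phi>: "kk_cycle A B \<Phi>" "Y = H `` {\<Phi>}" using Y by (auto elim: quotientE)
    obtain Z \<psi> where Z: "Z \<in> extensions A" "agreeing Z \<psi>" and h: "\<forall>s\<in>sections A Z. (pair_comp \<psi> s, \<Phi>) \<in> H"
      using cycle_from_extension[OF cA sepA \<Phi>(1)] by blast
    obtain s where s: "s \<in> sections A Z" using obtain_section[OF Z(1)] .
    have "Y = en_class (Z, en Z `` {\<psi>})"
      using equiv_class_eq[OF H_equiv, of "pair_comp \<psi> s" \<Phi>] h s en_class_eq[OF Z s] \<Phi>(2) by simp
    then show ?thesis by (intro image_eqI[OF _ quotientI[OF EN_preI[OF Z]]]) (simp only: gamma_map_eq[OF EN_preI[OF Z]])
  qed
    then show ?thesis using cl unfolding carr by blast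
  qed
  ultimately show ?thesis unfolding iso_def bij_betw_def carr by blast
qed

end

theorem theorem6p4:
  fixes A :: "'a cstar" and B :: "'b cstar"
    and s1 s2 :: "('b \<Rightarrow> 'b) \<times> ('b \<Rightarrow> 'b)"
  assumes "cstar_algebra A" and "separable A"
    and "cstar_algebra B" and "stable_cstar B" and "sigma_unital B"
    and "multiplier_isometry B s1" and "multiplier_isometry B s2"
    and "(s1 \<boxdot>\<^bsub>multiplier_algebra B\<^esub> adj (multiplier_algebra B) s1)
       \<boxplus>\<^bsub>multiplier_algebra B\<^esub> (s2 \<boxdot>\<^bsub>multiplier_algebra B\<^esub> adj (multiplier_algebra B) s2)
       = multiplier_one B"
  shows "gamma_map A B \<in> iso (EN A B s1 s2) (EM A B s1 s2)"
proof -
  interpret asymptotic_theories B A s1 s2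
    using assms by (simp add: asymptotic_theories_def asymptotic_theories_axioms_def codomain_def)
  show ?thesis by (rule gamma_map_iso)
qed

end
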